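(* Choose a matrix randomly from $CUE_n$ and let $Z_n$ be the closest spacing between any two eigenvalues. Fix $\beta>0$. Then as $n\to\infty$, $$\Pr\left( Z_n \left(\frac{n^4}{72\pi}\right)^{1/3} > \beta \right)\to e^{-\beta^3}.$$
   Context: $CUE_n$ (circular unitary ensemble) is the compact group $U(n)$ of $n\times n$ unitary matrices with normalized Haar measure. Its eigenvalues $e^{i t_1},\dots,e^{i t_n}$ are identified with their angles $t_1,\dots,t_n\in[0,2\pi)$, and $Z_n=\min_{i\neq j}|t_i-t_j|$. *)

theory Defs
  imports
    "HOL-Probability.Probability"
    "HOL-Computational_Algebra.Fundamental_Theorem_Algebra"
    "Jordan_Normal_Form.Char_Poly"
    "Jordan_Normal_Form.Schur_Decomposition"
begin

text \<open>The order of the matrices must be a term, since the limit is taken over it, so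
  matrices come from \<open>Jordan_Normal_Form\<close>, where the dimension is not part of the type.\<close>

definition unitary_group :: "nat \<Rightarrow> complex mat monoid" where
  "unitary_group n =
     \<lparr>carrier = {U \<in> carrier_mat n n. mat_adjoint U * U = 1\<^sub>m n},
      monoid.mult = (*),
      one = 1\<^sub>m n\<rparr>"

text \<open>The type of matrices carries no topology; the topology of the unitary group is the one
  induced by the \<open>n\<^sup>2\<close> matrix entries.\<close>

definition unitary_topology :: "nat \<Rightarrow> complex mat topology" where
  "unitary_topology n =
     pullback_topology (carrier (unitary_group n))
       (\<lambda>U. \<lambda>ij\<in>{..<n} \<times> {..<n}. U $$ ij)
       (product_topology (\<lambda>_. euclidean) ({..<n} \<times> {..<n}))"

text \<open>Left Haar probability measures. For a compact group such a measure exists and is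
  also right invariant; for a compact metrizable group every Borel probability measure is
  regular, so regularity is not demanded and the measure is unique.\<close>

definition normalized_haar_measure ::
    "('a, 'b) monoid_scheme \<Rightarrow> 'a topology \<Rightarrow> 'a measure \<Rightarrow> bool" where
  "normalized_haar_measure G T M \<longleftrightarrow>
     prob_space M \<and>
     space M = topspace T \<and>
     sets M = sigma_sets (topspace T) {V. openin T V} \<and>
     (\<forall>g\<in>carrier G. \<forall>S\<in>sets M. emeasure M ((\<lambda>x. g \<otimes>\<^bsub>G\<^esub> x) ` S) = emeasure M S)"

text \<open>The angles \<open>t\<^sub>1, \<dots>, t\<^sub>n \<in> [0, 2\<pi>)\<close> of the eigenvalues, with algebraic
  multiplicity and in increasing order.\<close>

definition eigenangles :: "complex mat \<Rightarrow> real list" where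
  "eigenangles A = sorted_list_of_multiset (image_mset Arg2pi (proots (char_poly A)))"

text \<open>The indices differ, not the angles: a repeated eigenvalue gives spacing \<open>0\<close>.
  Distances are taken between the angles in \<open>[0, 2\<pi>)\<close>, not around the circle.
  For matrices of order less than 2 the set is empty and the value is meaningless.\<close>

definition closest_spacing :: "complex mat \<Rightarrow> real" where
  "closest_spacing A =
     (let t = eigenangles A
      in Min {\<bar>t ! i - t ! j\<bar> | i j. i < length t \<and> j < length t \<and> i \<noteq> j})"

end

theory Submission
  imports Defs
begin

text \<open>The mean of a symmetric Laurent polynomial of the eigenvalues under the Haar measure is the
  mean under the Weyl density \<open>|vdm|\<^sup>2 / n!\<close>: by left invariance the Haar mean annihilates the radial
  part of the Laplacian of the unitary group, and multiplication by \<open>vdm\<close> turns this operator into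
  one that is diagonal on alternants, with \<open>vdm\<close> spanning the zero eigenspace. The gap event is a
  bounded limit of such polynomials.

  Under the Weyl density the sums over tuples of distinct eigenangles have determinantal means
  (Gaudin). For \<open>s\<close> pairs at distance of order \<open>n powr (-4/3)\<close> the determinant factors
  asymptotically into \<open>n\<^sup>4 (x - y)\<^sup>2 / 12\<close> for each pair, and close triples are negligible. Cut the
  circle into \<open>B\<close> blocks: the joint means of the numbers of close pairs in distinct blocks tend to
  \<open>(\<beta>\<^sup>3 / B) ^ s\<close>, so the probability that all blocks are free of close pairs is
  \<open>(1 - \<beta>\<^sup>3 / B) ^ B\<close> up to an error of order \<open>1 / B\<close>.\<close>

section \<open>Alternants and the radial Laplacian\<close>

text \<open>Of the Haar measure only left invariance is given, so the group is not parametrised by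
  eigenvalues and eigenvectors and no Jacobian is computed. Everything is tested on symmetric
  Laurent polynomials instead: power sums of eigenvalues are traces of powers, thus polynomials in
  the entries and their conjugates, along which invariance can be differentiated. The constant 72
  pi: relative to Lebesgue measure a pair has density n^4 (x - y)^2 / 12 divided by (2 pi)^2.
  Integrating the gap over (0, d] gives a factor d^3 / 3 and the position a factor 2 pi, in all n^4
  d^3 / (72 pi), which is \<beta>^3 for d = \<beta> (72 pi / n^4)^(1/3). The blocks avoid two
  obstacles. Pairs may share a point, so a product of pair counts is in general not a sum over
  distinct indices; pairs in different blocks share none, and the product of their counts is exactly
  such a sum. And for fixed B only finitely many joint means occur, so no series of moments has to
  converge uniformly in n; B tends to infinity after n.\<close>

definition nonzero_upto :: "nat \<Rightarrow> (nat \<Rightarrow> complex) \<Rightarrow> bool" where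
  "nonzero_upto n z \<longleftrightarrow> (\<forall>i<n. z i \<noteq> 0)"

definition laurent_mono :: "nat \<Rightarrow> (nat \<Rightarrow> int) \<Rightarrow> (nat \<Rightarrow> complex) \<Rightarrow> complex" where
  "laurent_mono n m z = (\<Prod>i<n. z i powi m i)"

text \<open>The numerators of the Weyl character formula, with arbitrary integer exponents.\<close>

definition alternant :: "nat \<Rightarrow> (nat \<Rightarrow> int) \<Rightarrow> (nat \<Rightarrow> complex) \<Rightarrow> complex" where
  "alternant n l z = det (mat n n (\<lambda>(i,j). z i powi l j))"

abbreviation vdm :: "nat \<Rightarrow> (nat \<Rightarrow> complex) \<Rightarrow> complex" where
  "vdm n \<equiv> alternant n int"

definition psum :: "nat \<Rightarrow> int \<Rightarrow> (nat \<Rightarrow> complex) \<Rightarrow> complex" where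
  "psum n m z = (\<Sum>j<n. z j powi m)"

text \<open>With E_j = z_j d/dz_j, a Laurent monomial is an eigenfunction of the sum over j of E_j^2
  - (n - 1) E_j; the eigenvalue for the exponents 0, ..., n - 1 of \<open>vdm\<close> is subtracted.
  For strictly decreasing l this is the Casimir eigenvalue of the representation whose character has
  this alternant as numerator.\<close>

definition laurent_energy :: "nat \<Rightarrow> (nat \<Rightarrow> int) \<Rightarrow> int" where
  "laurent_energy n l = (\<Sum>i<n. l i * (l i - (int n - 1))) - (\<Sum>i<n. int i * (int i - (int n - 1)))"

lemma alternant_expand:
  "alternant n l z = (\<Sum>p | p permutes {..<n}. signof p * laurent_mono n (l \<circ> p) z)"
proof -
  have "alternant n l z = (\<Sum>p | p permutes {0..<n}. signof p * (\<Prod>i = 0..<n. z i powi l (p i)))"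
    unfolding alternant_def by (subst det_def') (auto intro!: sum.cong prod.cong dest: permutes_in_image)
  then show ?thesis by (simp add: laurent_mono_def atLeast0LessThan)
qed

lemma laurent_mono_shift:
  assumes "nonzero_upto n z" "j < n"
  shows "z j powi k * laurent_mono n m z = laurent_mono n (m(j := m j + k)) z"
proof -
  have "laurent_mono n (m(j := m j + k)) z = z j powi (m j + k) * (\<Prod>i\<in>{..<n}-{j}. z i powi m i)"
    unfolding laurent_mono_def using assms(2) by (subst prod.remove[of _ j]) auto
  also have "\<dots> = z j powi k * (z j powi m j * (\<Prod>i\<in>{..<n}-{j}. z i powi m i))"
    using assms by (simp add: power_int_add nonzero_upto_def)
  also have "\<dots> = z j powi k * laurent_mono n m z"
    unfolding laurent_mono_def using assms(2) by (subst (2) prod.remove[of _ j]) auto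
  finally show ?thesis by simp
qed

text \<open>The power sum is symmetric, so in the term of the permutation p the sum over shifted
  positions j may be reindexed by p. The shift then acts on l itself, the same for all p, as in the
  Murnaghan-Nakayama rule before vanishing terms are dropped.\<close>

lemma psum_alternant:
  assumes "nonzero_upto n z"
  shows "psum n k z * alternant n l z = (\<Sum>j<n. alternant n (l(j := l j + k)) z)"
proof -
  have *: "psum n k z * laurent_mono n (l \<circ> p) z = (\<Sum>j<n. laurent_mono n (l(j := l j + k) \<circ> p) z)"
    if p: "p permutes {..<n}" for p
  proof -
    have "psum n k z * laurent_mono n (l \<circ> p) z = (\<Sum>j<n. laurent_mono n ((l \<circ> p)(j := l (p j) + k)) z)"
      unfolding psum_def sum_distrib_right using assms
      by (intro sum.cong) (auto simp: laurent_mono_shift)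
    also have "\<dots> = (\<Sum>j<n. laurent_mono n (l(p j := l (p j) + k) \<circ> p) z)"
      using permutes_inj[OF p]
      by (intro sum.cong refl arg_cong[of _ _ "\<lambda>m. laurent_mono n m z"]) (auto simp: fun_eq_iff inj_eq)
    also have "\<dots> = (\<Sum>j<n. laurent_mono n (l(j := l j + k) \<circ> p) z)"
      using sum.permute[OF p, of "\<lambda>j. laurent_mono n (l(j := l j + k) \<circ> p) z"] by (simp add: o_def)
    finally show ?thesis .
  qed
  have "psum n k z * alternant n l z
      = (\<Sum>p | p permutes {..<n}. signof p * (psum n k z * laurent_mono n (l \<circ> p) z))"
    by (simp add: alternant_expand sum_distrib_left mult_ac)
  also have "\<dots> = (\<Sum>p | p permutes {..<n}. \<Sum>j<n. signof p * laurent_mono n (l(j := l j + k) \<circ> p) z)"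
    by (intro sum.cong refl) (simp add: * sum_distrib_left)
  also have "\<dots> = (\<Sum>j<n. alternant n (l(j := l j + k)) z)"
    by (subst sum.swap) (simp add: alternant_expand)
  finally show ?thesis .
qed

section \<open>Symmetric Laurent polynomials as combinations of alternants\<close>

text \<open>Generated from power sums rather than characterised by symmetry: alternant expansions,
  Euler derivatives, traces of matrix powers and measurability are all established generator by
  generator.\<close>

inductive_set symL :: "nat \<Rightarrow> ((nat \<Rightarrow> complex) \<Rightarrow> complex) set" for n where
  const: "(\<lambda>z. c) \<in> symL n"
| psum: "psum n m \<in> symL n"
| add: "F \<in> symL n \<Longrightarrow> G \<in> symL n \<Longrightarrow> (\<lambda>z. F z + G z) \<in> symL n"
| mult: "F \<in> symL n \<Longrightarrow> G \<in> symL n \<Longrightarrow> (\<lambda>z. F z * G z) \<in> symL n"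

text \<open>A formal list, in which exponents may repeat, so that terms can be filtered and counted
  by their energy.\<close>

definition alt_comb :: "nat \<Rightarrow> (complex \<times> (nat \<Rightarrow> int)) list \<Rightarrow> (nat \<Rightarrow> complex) \<Rightarrow> complex" where
  "alt_comb n xs z = (\<Sum>(c,l)\<leftarrow>xs. c * alternant n l z)"

lemma alt_comb_simps [simp]:
  "alt_comb n [] z = 0"
  "alt_comb n ((c,l)#xs) z = c * alternant n l z + alt_comb n xs z"
  "alt_comb n (xs @ ys) z = alt_comb n xs z + alt_comb n ys z"
  by (simp_all add: alt_comb_def)

lemma alt_comb_scale: "alt_comb n (map (\<lambda>(c,l). (d * c, l)) xs) z = d * alt_comb n xs z"
  by (induction xs) (auto simp: algebra_simps)

text \<open>Meant for the single alternant \<open>vdm\<close>, where it expands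
  \<open>vdm * F\<close>. The general \<open>xs\<close> is what the product case needs, since it
  multiplies the result for G by F.\<close>

lemma symL_alt_comb:
  assumes "F \<in> symL n"
  shows "\<exists>ys. \<forall>z. nonzero_upto n z \<longrightarrow> F z * alt_comb n xs z = alt_comb n ys z"
  using assms
proof (induction arbitrary: xs)
  case (const c)
  show ?case by (rule exI[of _ "map (\<lambda>(d,l). (c * d, l)) xs"]) (simp add: alt_comb_scale)
next
  case (psum m)
  show ?case
  proof (induction xs)
    case Nil
    show ?case by (rule exI[of _ "[]"]) simp
  next
    case (Cons x xs)
    obtain c l where x: "x = (c,l)" by force
    from Cons obtain ys where ys: "\<And>z. nonzero_upto n z \<Longrightarrow> psum n m z * alt_comb n xs z = alt_comb n ys z"
      by auto
    define zs where "zs = map (\<lambda>j. (c, l(j := l j + m))) [0..<n]"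
    have zs: "alt_comb n zs z = c * (\<Sum>j<n. alternant n (l(j := l j + m)) z)" for z
      unfolding zs_def alt_comb_def
      by (simp add: o_def interv_sum_list_conv_sum_set_nat atLeast0LessThan sum_distrib_left)
    show ?case
      by (rule exI[of _ "zs @ ys"])
         (auto simp: x zs ys[symmetric] psum_alternant[symmetric] distrib_left)
  qed
next
  case (add F G)
  from add.IH(1)[of xs] obtain ys where ys: "\<And>z. nonzero_upto n z \<Longrightarrow> F z * alt_comb n xs z = alt_comb n ys z" by auto
  from add.IH(2)[of xs] obtain zs where zs: "\<And>z. nonzero_upto n z \<Longrightarrow> G z * alt_comb n xs z = alt_comb n zs z" by auto
  show ?case by (rule exI[of _ "ys @ zs"]) (simp add: ys[symmetric] zs[symmetric] algebra_simps)
next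
  case (mult F G)
  from mult.IH(2)[of xs] obtain ys where ys: "\<And>z. nonzero_upto n z \<Longrightarrow> G z * alt_comb n xs z = alt_comb n ys z" by auto
  from mult.IH(1)[of ys] obtain zs where zs: "\<And>z. nonzero_upto n z \<Longrightarrow> F z * alt_comb n ys z = alt_comb n zs z" by auto
  show ?case by (rule exI[of _ zs]) (simp add: ys[symmetric] zs[symmetric] algebra_simps)
qed

lemma alternant_not_inj:
  assumes "\<not> inj_on l {..<n}"
  shows "alternant n l z = 0"
proof -
  from assms obtain i j where ij: "i < n" "j < n" "i \<noteq> j" "l i = l j" by (auto simp: inj_on_def)
  show ?thesis unfolding alternant_def
    by (rule det_identical_columns[of _ n i j]) (use ij in \<open>auto simp: col_def\<close>)
qed

lemma vdm_repeat:
  assumes "i < n" "j < n" "i \<noteq> j" "z i = z j"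
  shows "alternant n l z = 0"
  unfolding alternant_def
  by (rule det_identical_rows[of _ n i j]) (use assms in \<open>auto simp: row_def\<close>)

text \<open>The quadratic x (x - (n - 1)) is at most 0 on 0, ..., n - 1 and positive at every other
  integer. Exchanging members of {0, ..., n - 1} for outside integers therefore raises the sum
  strictly.\<close>

lemma laurent_energy_pos:
  assumes inj: "inj_on l {..<n}" and ne: "l ` {..<n} \<noteq> int ` {..<n}"
  shows "laurent_energy n l > 0"
proof -
  define g :: "int \<Rightarrow> int" where "g x = x * (x - (int n - 1))" for x
  define S T where "S = l ` {..<n}" and "T = int ` {..<n}"
  have fin: "finite S" "finite T" by (auto simp: S_def T_def)
  have cS: "card S = n" "card T = n" by (auto simp: S_def T_def card_image inj)
  have T: "x \<in> T \<longleftrightarrow> 0 \<le> x \<and> x < int n" for x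
    unfolding T_def by (auto intro!: image_eqI[of _ _ "nat x"])
  have "laurent_energy n l = sum g S - sum g T"
    by (simp add: laurent_energy_def S_def T_def sum.reindex inj g_def)
  also have "sum g S = sum g (S \<inter> T) + sum g (S - T)" using fin by (metis sum.Int_Diff)
  also have "sum g T = sum g (S \<inter> T) + sum g (T - S)" using fin by (metis sum.Int_Diff inf_commute)
  finally have e: "laurent_energy n l = sum g (S - T) - sum g (T - S)" by simp
  have "\<not> S \<subseteq> T" using ne fin cS card_subset_eq[of T S] by (auto simp: S_def T_def)
  then have "S - T \<noteq> {}" by auto
  moreover have "g x > 0" if "x \<in> S - T" for x
  proof -
    have "n > 0" using that by (auto simp: S_def)
    then have "x < 0 \<and> x - (int n - 1) < 0 \<or> x > 0 \<and> x - (int n - 1) > 0" using that T[of x] by auto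
    then show ?thesis unfolding g_def by (auto intro: mult_pos_pos mult_neg_neg)
  qed
  ultimately have "sum g (S - T) > 0" using fin by (intro sum_pos) auto
  moreover have "sum g (T - S) \<le> 0"
    using T by (intro sum_nonpos) (auto simp: g_def mult_nonneg_nonpos)
  ultimately show ?thesis using e by simp
qed

text \<open>Distinct exponents of energy zero are 0, ..., n - 1 in some order, so the alternant is
  \<open>vdm\<close> up to sign; with a repeated exponent it vanishes.\<close>

lemma alternant_energy_zero:
  assumes "laurent_energy n l = 0"
  shows "\<exists>e. \<forall>z. alternant n l z = e * vdm n z"
proof (cases "inj_on l {..<n}")
  case False
  then show ?thesis by (auto intro!: exI[of _ 0] simp: alternant_not_inj)
next
  case True
  then have im: "l ` {..<n} = int ` {..<n}" using laurent_energy_pos assms by force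
  define p where "p i = (if i < n then nat (l i) else i)" for i
  have lp: "l i = int (p i) \<and> p i < n" if "i < n" for i
  proof -
    have "l i \<in> int ` {..<n}" using that im by blast
    then show ?thesis using that by (auto simp: p_def)
  qed
  have "inj_on p {..<n}" using True lp by (metis inj_on_def lessThan_iff)
  moreover have "p ` {..<n} \<subseteq> {..<n}" using lp by auto
  ultimately have "bij_betw p {..<n} {..<n}"
    by (simp add: bij_betw_def endo_inj_surj)
  then have p: "p permutes {0..<n}"
    by (intro bij_imp_permutes) (auto simp: p_def atLeast0LessThan)
  have "alternant n l z = signof p * vdm n z" for z
  proof -
    define A where "A = mat n n (\<lambda>(i,j). z j powi int i)"
    have "alternant n l z = det (transpose_mat (mat n n (\<lambda>(i,j). z i powi l j)))"
      unfolding alternant_def by (subst det_transpose) auto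
    also have "transpose_mat (mat n n (\<lambda>(i,j). z i powi l j)) = mat n n (\<lambda>(i,j). A $$ (p i, j))"
      by (rule eq_matI) (auto simp: A_def lp)
    also have "det \<dots> = signof p * det A" by (rule det_permute_rows) (auto simp: A_def p)
    also have "det A = det (transpose_mat A)" by (subst det_transpose) (auto simp: A_def)
    also have "transpose_mat A = mat n n (\<lambda>(i,j). z i powi int j)"
      by (rule eq_matI) (auto simp: A_def)
    finally show ?thesis by (simp add: alternant_def)
  qed
  then show ?thesis by blast
qed

text \<open>A kernel vector of the Vandermonde matrix is the coefficient vector of a polynomial of
  degree below n with n distinct roots.\<close>

lemma vdm_nonzero:
  assumes "inj_on z {..<n}"
  shows "vdm n z \<noteq> 0"
proof
  assume "vdm n z = 0"
  define A where "A = mat n n (\<lambda>(i,j). z i powi int j)"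
  have A: "A \<in> carrier_mat n n" by (simp add: A_def)
  from \<open>vdm n z = 0\<close> have "det A = 0" by (simp add: alternant_def A_def)
  then obtain v where v: "v \<in> carrier_vec n" "v \<noteq> 0\<^sub>v n" "A *\<^sub>v v = 0\<^sub>v n"
    using det_0_iff_vec_prod_zero[OF A] by auto
  define P where "P = (\<Sum>j<n. monom (v $ j) j)"
  have cP: "coeff P k = (if k < n then v $ k else 0)" for k
    by (simp add: P_def coeff_sum)
  have root: "poly P (z i) = 0" if "i < n" for i
  proof -
    have "0 = (A *\<^sub>v v) $ i" using v that by simp
    also have "\<dots> = (\<Sum>j<n. z i ^ j * v $ j)"
      using that v(1) by (simp add: A_def scalar_prod_def atLeast0LessThan mult_mat_vec_def)
    also have "\<dots> = poly P (z i)" by (simp add: P_def poly_sum poly_monom mult.commute)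
    finally show ?thesis by simp
  qed
  have "P = 0"
  proof (rule ccontr)
    assume "P \<noteq> 0"
    then have n0: "n > 0" by (auto simp: P_def intro!: gr0I)
    have "degree P < n" using n0 by (intro degree_lessI) (auto simp: cP)
    have "n = card (z ` {..<n})" using assms by (simp add: card_image)
    also have "\<dots> \<le> card {x. poly P x = 0}"
      using root by (intro card_mono poly_roots_finite \<open>P \<noteq> 0\<close>) auto
    also have "\<dots> \<le> degree P" by (rule card_poly_roots_bound) fact
    finally show False using \<open>degree P < n\<close> by simp
  qed
  then have "v $ j = 0" if "j < n" for j using cP[of j] that by simp
  then have "v = 0\<^sub>v n" using v(1) by (intro eq_vecI) auto
  then show False using v by simp
qed

section \<open>Euler operators and their Laplacian on alternants\<close>

text \<open>\<open>f'\<close> is E_j f with E_j = z_j d/dz_j, hence the division by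
  \<open>z j\<close>; Laurent monomials are eigenfunctions of E_j. Points are restricted to nonzero
  coordinates, where integer powers are differentiable.\<close>

definition euler_deriv :: "nat \<Rightarrow> ((nat \<Rightarrow> complex) \<Rightarrow> complex) \<Rightarrow> nat \<Rightarrow> ((nat \<Rightarrow> complex) \<Rightarrow> complex) \<Rightarrow> bool" where
  "euler_deriv n f j f' \<longleftrightarrow>
     (\<forall>z. nonzero_upto n z \<longrightarrow> ((\<lambda>w. f (z(j := w))) has_field_derivative f' z / z j) (at (z j)))"

lemma euler_derivD:
  "euler_deriv n f j f' \<Longrightarrow> nonzero_upto n z \<Longrightarrow>
    ((\<lambda>w. f (z(j := w))) has_field_derivative f' z / z j) (at (z j))"
  by (simp add: euler_deriv_def)

lemma euler_deriv_const: "euler_deriv n (\<lambda>z. c) j (\<lambda>z. 0)"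
  by (simp add: euler_deriv_def)

lemma euler_deriv_add:
  "euler_deriv n f j f' \<Longrightarrow> euler_deriv n g j g' \<Longrightarrow> euler_deriv n (\<lambda>z. f z + g z) j (\<lambda>z. f' z + g' z)"
  by (auto simp: euler_deriv_def add_divide_distrib intro!: DERIV_add)

lemma euler_deriv_mult:
  assumes "euler_deriv n f j f'" "euler_deriv n g j g'"
  shows "euler_deriv n (\<lambda>z. f z * g z) j (\<lambda>z. f' z * g z + f z * g' z)"
  unfolding euler_deriv_def
proof (intro allI impI)
  fix z assume z: "nonzero_upto n z"
  from DERIV_mult[OF euler_derivD[OF assms(1) z] euler_derivD[OF assms(2) z]]
  show "((\<lambda>w. f (z(j := w)) * g (z(j := w))) has_field_derivative (f' z * g z + f z * g' z) / z j) (at (z j))"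
    by (simp add: add_divide_distrib mult.commute)
qed

lemma euler_deriv_cmult: "euler_deriv n f j f' \<Longrightarrow> euler_deriv n (\<lambda>z. c * f z) j (\<lambda>z. c * f' z)"
  using euler_deriv_mult[OF euler_deriv_const[of n c j]] by fastforce

lemma euler_deriv_sum:
  "finite A \<Longrightarrow> (\<And>x. x \<in> A \<Longrightarrow> euler_deriv n (f x) j (f' x)) \<Longrightarrow>
   euler_deriv n (\<lambda>z. \<Sum>x\<in>A. f x z) j (\<lambda>z. \<Sum>x\<in>A. f' x z)"
proof (induction A rule: finite_induct)
  case empty
  then show ?case by (simp add: euler_deriv_const)
next
  case (insert x A)
  then show ?case using euler_deriv_add[of n "f x" j "f' x"] by simp
qed

lemma euler_deriv_powi:
  assumes "j < n"
  shows "euler_deriv n (\<lambda>z. z i powi m) j (\<lambda>z. if i = j then of_int m * z j powi m else 0)"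
proof (cases "i = j")
  case True
  then show ?thesis
    using assms unfolding euler_deriv_def
    by (auto intro!: derivative_eq_intros simp: nonzero_upto_def power_int_diff)
next
  case False
  then show ?thesis by (simp add: euler_deriv_def)
qed

lemma euler_deriv_mono:
  assumes j: "j < n"
  shows "euler_deriv n (laurent_mono n m) j (\<lambda>z. of_int (m j) * laurent_mono n m z)"
  unfolding euler_deriv_def
proof (intro allI impI)
  fix z assume z: "nonzero_upto n z"
  have *: "laurent_mono n m (z(j := w)) = (\<Prod>i\<in>{..<n}-{j}. z i powi m i) * w powi m j" for w
    unfolding laurent_mono_def using j by (subst prod.remove[of _ j]) (auto simp: mult.commute)
  have zj: "z j \<noteq> 0" using z j by (simp add: nonzero_upto_def)
  have **: "laurent_mono n m z = (\<Prod>i\<in>{..<n}-{j}. z i powi m i) * z j powi m j" using *[of "z j"] by simp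
  show "((\<lambda>w. laurent_mono n m (z(j := w))) has_field_derivative of_int (m j) * laurent_mono n m z / z j) (at (z j))"
    unfolding * ** using zj
    by (auto intro!: derivative_eq_intros simp: power_int_diff)
qed

definition ground_energy :: "nat \<Rightarrow> int" where
  "ground_energy n = (\<Sum>i<n. int i * (int i - (int n - 1)))"

text \<open>\<open>g\<close> is the image of f under the sum over j of E_j^2 - (n - 1) E_j, shifted
  by the ground energy so that \<open>vdm\<close> is annihilated; \<open>f1\<close> and
  \<open>f2\<close> are the iterated Euler derivatives.\<close>

definition euler_laplace :: "nat \<Rightarrow> ((nat \<Rightarrow> complex) \<Rightarrow> complex) \<Rightarrow> ((nat \<Rightarrow> complex) \<Rightarrow> complex) \<Rightarrow> bool" where
  "euler_laplace n f g \<longleftrightarrow> (\<exists>f1 f2. (\<forall>j<n. euler_deriv n f j (f1 j) \<and> euler_deriv n (f1 j) j (f2 j)) \<and>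
     (\<forall>z. nonzero_upto n z \<longrightarrow> g z = (\<Sum>j<n. f2 j z - of_int (int n - 1) * f1 j z)
         - of_int (ground_energy n) * f z))"

lemma euler_laplace_add:
  assumes "euler_laplace n f f'" "euler_laplace n g g'"
  shows "euler_laplace n (\<lambda>z. f z + g z) (\<lambda>z. f' z + g' z)"
proof -
  from assms obtain f1 f2 g1 g2 where
    *: "\<forall>j<n. euler_deriv n f j (f1 j) \<and> euler_deriv n (f1 j) j (f2 j)"
      "\<forall>j<n. euler_deriv n g j (g1 j) \<and> euler_deriv n (g1 j) j (g2 j)"
      "\<forall>z. nonzero_upto n z \<longrightarrow> f' z = (\<Sum>j<n. f2 j z - of_int (int n - 1) * f1 j z)
         - of_int (ground_energy n) * f z"
      "\<forall>z. nonzero_upto n z \<longrightarrow> g' z = (\<Sum>j<n. g2 j z - of_int (int n - 1) * g1 j z)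
         - of_int (ground_energy n) * g z"
    unfolding euler_laplace_def by blast
  show ?thesis unfolding euler_laplace_def
    by (rule exI[of _ "\<lambda>j z. f1 j z + g1 j z"], rule exI[of _ "\<lambda>j z. f2 j z + g2 j z"])
      (use * in \<open>auto intro!: euler_deriv_add simp: sum.distrib sum_subtractf ring_distribs simp flip: sum_distrib_left\<close>)
qed

lemma euler_laplace_cmult:
  assumes "euler_laplace n f f'"
  shows "euler_laplace n (\<lambda>z. c * f z) (\<lambda>z. c * f' z)"
proof -
  from assms obtain f1 f2 where
    *: "\<forall>j<n. euler_deriv n f j (f1 j) \<and> euler_deriv n (f1 j) j (f2 j)"
      "\<forall>z. nonzero_upto n z \<longrightarrow> f' z = (\<Sum>j<n. f2 j z - of_int (int n - 1) * f1 j z)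
         - of_int (ground_energy n) * f z"
    unfolding euler_laplace_def by blast
  show ?thesis unfolding euler_laplace_def
    by (rule exI[of _ "\<lambda>j z. c * f1 j z"], rule exI[of _ "\<lambda>j z. c * f2 j z"])
      (use * in \<open>auto intro!: euler_deriv_cmult simp: sum_subtractf right_diff_distrib sum_distrib_left mult_ac\<close>)
qed

lemma euler_laplace_zero: "euler_laplace n (\<lambda>z. 0) (\<lambda>z. 0)"
  unfolding euler_laplace_def
  by (rule exI[of _ "\<lambda>j z. 0"], rule exI[of _ "\<lambda>j z. 0"]) (auto intro!: euler_deriv_const)

lemma euler_laplace_sum:
  "finite A \<Longrightarrow> (\<And>x. x \<in> A \<Longrightarrow> euler_laplace n (f x) (f' x)) \<Longrightarrow>
   euler_laplace n (\<lambda>z. \<Sum>x\<in>A. f x z) (\<lambda>z. \<Sum>x\<in>A. f' x z)"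
proof (induction A rule: finite_induct)
  case empty
  then show ?case by (simp add: euler_laplace_zero)
next
  case (insert x A)
  then show ?case using euler_laplace_add[of n "f x" "f' x"] by simp
qed

lemma euler_laplace_mono:
  "euler_laplace n (laurent_mono n m) (\<lambda>z. of_int (laurent_energy n m) * laurent_mono n m z)"
  unfolding euler_laplace_def
  by (rule exI[of _ "\<lambda>j z. of_int (m j) * laurent_mono n m z"],
      rule exI[of _ "\<lambda>j z. of_int (m j) * (of_int (m j) * laurent_mono n m z)"])
    (auto intro!: euler_deriv_mono euler_deriv_cmult
      simp: laurent_energy_def ground_energy_def algebra_simps sum_distrib_left sum_distrib_right sum_subtractf sum.distrib)

lemma laurent_energy_permute:
  assumes "p permutes {..<n}"
  shows "laurent_energy n (l \<circ> p) = laurent_energy n l"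
  using sum.permute[OF assms, of "\<lambda>i. l i * (l i - (int n - 1))"]
  by (simp add: laurent_energy_def o_def)

lemma euler_laplace_alternant:
  "euler_laplace n (alternant n l) (\<lambda>z. of_int (laurent_energy n l) * alternant n l z)"
proof -
  have "euler_laplace n (\<lambda>z. \<Sum>p | p permutes {..<n}. signof p * laurent_mono n (l \<circ> p) z)
     (\<lambda>z. \<Sum>p | p permutes {..<n}. signof p * (of_int (laurent_energy n (l \<circ> p)) * laurent_mono n (l \<circ> p) z))"
    by (intro euler_laplace_sum euler_laplace_cmult euler_laplace_mono) (simp add: finite_permutations)
  also have "(\<lambda>z. \<Sum>p | p permutes {..<n}. signof p * (of_int (laurent_energy n (l \<circ> p)) * laurent_mono n (l \<circ> p) z))
      = (\<lambda>z. of_int (laurent_energy n l) * alternant n l z)"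
    by (auto simp: fun_eq_iff alternant_expand sum_distrib_left laurent_energy_permute intro!: sum.cong)
  finally show ?thesis unfolding alternant_expand[abs_def] .
qed

definition energy_scale :: "nat \<Rightarrow> (complex \<times> (nat \<Rightarrow> int)) list \<Rightarrow> (complex \<times> (nat \<Rightarrow> int)) list" where
  "energy_scale n xs = map (\<lambda>(c,l). (of_int (laurent_energy n l) * c, l)) xs"

lemma euler_laplace_alt_comb:
  "euler_laplace n (alt_comb n xs) (alt_comb n (energy_scale n xs))"
proof (induction xs)
  case Nil
  then show ?case by (simp add: alt_comb_def[abs_def] energy_scale_def euler_laplace_zero)
next
  case (Cons x xs)
  obtain c l where x: "x = (c,l)" by force
  from euler_laplace_add[OF euler_laplace_cmult[OF euler_laplace_alternant] Cons, of c l] show ?case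
    unfolding x by (simp add: alt_comb_def[abs_def] energy_scale_def mult_ac)
qed

lemma euler_deriv_unique:
  assumes f: "euler_deriv n f j f1" and g: "euler_deriv n g j g1"
    and eq: "\<And>z. nonzero_upto n z \<Longrightarrow> f z = g z" and j: "j < n" and z: "nonzero_upto n z"
  shows "f1 z = g1 z"
proof -
  have zj: "z j \<noteq> 0" using z j by (simp add: nonzero_upto_def)
  have "((\<lambda>w. g (z(j := w))) has_field_derivative f1 z / z j) (at (z j))"
  proof (rule has_field_derivative_transform_within_open[OF euler_derivD[OF f z], of "- {0}"])
    show "f (z(j := w)) = g (z(j := w))" if "w \<in> - {0}" for w
      using that z by (intro eq) (auto simp: nonzero_upto_def)
  qed (use zj in auto)
  then have "f1 z / z j = g1 z / z j" using euler_derivD[OF g z] by (rule DERIV_unique)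
  then show ?thesis using zj by simp
qed

text \<open>The nonzero points stay nonzero under small changes of one coordinate, so an identity on
  them may be differentiated. It lets both sides of \<open>vdm * F = alt_comb n xs\<close> be
  transformed separately, one by the product rule, the other alternant by alternant.\<close>

lemma euler_laplace_unique:
  assumes "euler_laplace n f f'" "euler_laplace n g g'"
    and eq: "\<And>z. nonzero_upto n z \<Longrightarrow> f z = g z" and z: "nonzero_upto n z"
  shows "f' z = g' z"
proof -
  from assms obtain f1 f2 g1 g2 where
    *: "\<And>j. j < n \<Longrightarrow> euler_deriv n f j (f1 j)" "\<And>j. j < n \<Longrightarrow> euler_deriv n (f1 j) j (f2 j)"
      "\<And>j. j < n \<Longrightarrow> euler_deriv n g j (g1 j)" "\<And>j. j < n \<Longrightarrow> euler_deriv n (g1 j) j (g2 j)"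
      "\<And>z. nonzero_upto n z \<Longrightarrow> f' z = (\<Sum>j<n. f2 j z - of_int (int n - 1) * f1 j z)
         - of_int (ground_energy n) * f z"
      "\<And>z. nonzero_upto n z \<Longrightarrow> g' z = (\<Sum>j<n. g2 j z - of_int (int n - 1) * g1 j z)
         - of_int (ground_energy n) * g z"
    unfolding euler_laplace_def by blast
  have 1: "f1 j z = g1 j z" if "j < n" "nonzero_upto n z" for j z
    by (rule euler_deriv_unique[OF *(1)[OF that(1)] *(3)[OF that(1)] eq that]) 
  have 2: "f2 j z = g2 j z" if "j < n" for j
    by (rule euler_deriv_unique[OF *(2)[OF that(1)] *(4)[OF that(1)] 1 that z]) (use that in auto)
  show ?thesis using z by (simp add: *(5,6) eq 1 2)
qed

text \<open>As a function of its j-th coordinate alone, \<open>vdm\<close> is a polynomial of degree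
  below n vanishing at the n - 1 other points. It is thus a constant multiple of the product of w -
  z_k, whose logarithmic derivative is the sum of 1 / (w - z_k).\<close>

lemma vdm_log_deriv:
  assumes inj: "inj_on z {..<n}" and j: "j < n"
  shows "((\<lambda>w. vdm n (z(j := w))) has_field_derivative
           vdm n z * (\<Sum>k\<in>{..<n}-{j}. 1 / (z j - z k))) (at (z j))"
proof -
  define P where "P = (\<Sum>p | p permutes {..<n}. Polynomial.smult (signof p * (\<Prod>i\<in>{..<n}-{j}. z i ^ p i)) (monom 1 (p j)))"
  define Q where "Q = (\<Prod>k\<in>{..<n}-{j}. [:- z k, 1:])"
  have P: "poly P w = vdm n (z(j := w))" for w
    unfolding P_def alternant_expand laurent_mono_def poly_sum using j
    by (intro sum.cong refl, subst (2) prod.remove[of _ j]) (auto simp: poly_monom mult_ac intro!: prod.cong)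
  have degP: "degree P < n"
    unfolding P_def
  proof (rule degree_sum_less)
    show "0 < n" using j by simp
    fix p assume "p \<in> {p. p permutes {..<n}}"
    then have "p j < n" using j permutes_in_image[of p "{..<n}" j] by simp
    then show "degree (Polynomial.smult (signof p * (\<Prod>i\<in>{..<n}-{j}. z i ^ p i)) (monom 1 (p j))) < n"
      by (intro le_less_trans[OF degree_smult_le]) (simp add: degree_monom_eq)
  qed
  have "degree Q = card ({..<n}-{j})"
    unfolding Q_def by (subst degree_prod_eq_sum_degree) auto
  then have degQ: "degree Q < n" using j by simp
  have Q: "poly Q w = (\<Prod>k\<in>{..<n}-{j}. w - z k)" for w
    by (simp add: Q_def poly_prod)
  have ne: "z j - z k \<noteq> 0" if "k \<in> {..<n}-{j}" for k
    using that inj j by (auto simp: inj_on_def)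
  have Qj: "poly Q (z j) \<noteq> 0" unfolding Q using ne by (simp add: prod_zero_iff)
  \<comment> \<open>Both sides have degree below n and agree at the n distinct points
    \<open>z k\<close>.\<close>
  have PQ: "P = Polynomial.smult (vdm n z / poly Q (z j)) Q"
  proof (rule poly_eqI_degree[of "z ` {..<n}"])
    show "poly P x = poly (Polynomial.smult (vdm n z / poly Q (z j)) Q) x" if "x \<in> z ` {..<n}" for x
    proof -
      from that obtain k where k: "k < n" "x = z k" by auto
      show ?thesis
      proof (cases "k = j")
        case True
        then show ?thesis using k Qj by (simp add: P)
      next
        case False
        then have "poly Q x = 0" unfolding Q using k by (auto simp: prod_zero_iff)
        moreover have "poly P x = 0" unfolding P using k j False
          by (intro vdm_repeat[of j n k]) auto
        ultimately show ?thesis by simp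
      qed
    qed
    have "card (z ` {..<n}) = n" using inj by (simp add: card_image)
    then show "card (z ` {..<n}) > degree P"
      "card (z ` {..<n}) > degree (Polynomial.smult (vdm n z / poly Q (z j)) Q)"
      using degP degQ le_less_trans[OF degree_smult_le] by auto
  qed
  have "((\<lambda>w. \<Prod>k\<in>{..<n}-{j}. w - z k) has_field_derivative
     (\<Sum>k\<in>{..<n}-{j}. 1 * (\<Prod>i\<in>({..<n}-{j})-{k}. z j - z i))) (at (z j))"
    by (rule has_field_derivative_prod) (auto intro!: derivative_eq_intros)
  also have "(\<Sum>k\<in>{..<n}-{j}. 1 * (\<Prod>i\<in>({..<n}-{j})-{k}. z j - z i))
     = poly Q (z j) * (\<Sum>k\<in>{..<n}-{j}. 1 / (z j - z k))"
    unfolding sum_distrib_left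
  proof (rule sum.cong[OF refl])
    fix k assume k: "k \<in> {..<n}-{j}"
    show "1 * (\<Prod>i\<in>({..<n}-{j})-{k}. z j - z i) = poly Q (z j) * (1 / (z j - z k))"
      unfolding Q using k ne[OF k] by (subst (2) prod.remove[of _ k]) auto
  qed
  finally have "((\<lambda>w. vdm n z / poly Q (z j) * (\<Prod>k\<in>{..<n}-{j}. w - z k)) has_field_derivative
     vdm n z / poly Q (z j) * (poly Q (z j) * (\<Sum>k\<in>{..<n}-{j}. 1 / (z j - z k)))) (at (z j))"
    by (rule DERIV_cmult)
  also have "(\<lambda>w. vdm n z / poly Q (z j) * (\<Prod>k\<in>{..<n}-{j}. w - z k)) = (\<lambda>w. vdm n (z(j := w)))"
    by (rule ext) (simp add: Q[symmetric] P[symmetric] PQ[THEN arg_cong[of _ _ "\<lambda>p. poly p x" for x]])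
  finally show ?thesis using Qj by simp
qed

section \<open>The radial Laplacian on symmetric Laurent polynomials\<close>

text \<open>An entry (m, K) stands for the term K(z) z_j^m of E_j F. One list serves all j because F
  is symmetric, and the derivative of F along the unitary group is later read off the same
  list.\<close>

inductive euler_grad :: "nat \<Rightarrow> ((nat \<Rightarrow> complex) \<Rightarrow> complex) \<Rightarrow> (int \<times> ((nat \<Rightarrow> complex) \<Rightarrow> complex)) list \<Rightarrow> bool" for n where
  const: "euler_grad n (\<lambda>z. c) []"
| psum: "euler_grad n (psum n m) [(m, \<lambda>z. of_int m)]"
| add: "euler_grad n F xs \<Longrightarrow> euler_grad n G ys \<Longrightarrow> euler_grad n (\<lambda>z. F z + G z) (xs @ ys)"
| mult: "euler_grad n F xs \<Longrightarrow> euler_grad n G ys \<Longrightarrow> euler_grad n (\<lambda>z. F z * G z)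
     (map (\<lambda>(m,K). (m, \<lambda>z. K z * G z)) xs @ map (\<lambda>(m,K). (m, \<lambda>z. K z * F z)) ys)"

lemma euler_grad_exists:
  "F \<in> symL n \<Longrightarrow> \<exists>xs. euler_grad n F xs \<and> (\<forall>(m,K)\<in>set xs. K \<in> symL n)"
proof (induction rule: symL.induct)
  case (add F G)
  then obtain xs ys where "euler_grad n F xs" "\<forall>(m,K)\<in>set xs. K \<in> symL n"
    "euler_grad n G ys" "\<forall>(m,K)\<in>set ys. K \<in> symL n" by blast
  then show ?case by (intro exI[of _ "xs @ ys"]) (auto intro: euler_grad.add)
next
  case (mult F G)
  then obtain xs ys where "euler_grad n F xs" "\<forall>(m,K)\<in>set xs. K \<in> symL n"
    "euler_grad n G ys" "\<forall>(m,K)\<in>set ys. K \<in> symL n" by blast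
  note g = this
  show ?case
    by (rule exI, rule conjI, rule euler_grad.mult[OF g(1) g(3)])
       (use g mult.hyps in \<open>auto intro!: symL.mult\<close>)
qed (force intro: euler_grad.intros symL.intros)+

text \<open>A fixed choice, since one function may have several expressions in power sums.\<close>

definition grad_list :: "nat \<Rightarrow> ((nat \<Rightarrow> complex) \<Rightarrow> complex) \<Rightarrow> (int \<times> ((nat \<Rightarrow> complex) \<Rightarrow> complex)) list" where
  "grad_list n F = (SOME xs. euler_grad n F xs \<and> (\<forall>(m,K)\<in>set xs. K \<in> symL n))"

lemma grad_list:
  assumes "F \<in> symL n"
  shows "euler_grad n F (grad_list n F)" "(m,K) \<in> set (grad_list n F) \<Longrightarrow> K \<in> symL n"
proof -
  have "euler_grad n F (grad_list n F) \<and> (\<forall>(m,K)\<in>set (grad_list n F). K \<in> symL n)"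
    unfolding grad_list_def by (rule someI_ex) (rule euler_grad_exists[OF assms])
  then show "euler_grad n F (grad_list n F)" "(m,K) \<in> set (grad_list n F) \<Longrightarrow> K \<in> symL n" by auto
qed

lemma euler_grad_deriv:
  assumes "euler_grad n F xs" "j < n"
  shows "euler_deriv n F j (\<lambda>z. \<Sum>(m,K)\<leftarrow>xs. K z * z j powi m)"
  using assms(1)
proof induction
  case (const c)
  then show ?case by (simp add: euler_deriv_const)
next
  case (psum m)
  have "euler_deriv n (\<lambda>z. \<Sum>i<n. z i powi m) j (\<lambda>z. \<Sum>i<n. if i = j then of_int m * z j powi m else 0)"
    by (intro euler_deriv_sum euler_deriv_powi assms) simp
  then show ?case using assms(2) by (simp add: psum_def[abs_def])
next
  case (add F xs G ys)
  then show ?case by (simp add: euler_deriv_add)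
next
  case (mult F xs G ys)
  have e: "(\<Sum>(m,K)\<leftarrow>map (\<lambda>(m,K). (m, \<lambda>z. K z * H z)) us. K z * z j powi m) = (\<Sum>(m,K)\<leftarrow>us. K z * z j powi m) * H z"
    for us :: "(int \<times> ((nat \<Rightarrow> complex) \<Rightarrow> complex)) list" and H z by (induction us) (auto simp: algebra_simps)
  have "euler_deriv n (\<lambda>z. F z * G z) j
      (\<lambda>z. (\<Sum>(m,K)\<leftarrow>xs. K z * z j powi m) * G z + F z * (\<Sum>(m,K)\<leftarrow>ys. K z * z j powi m))"
    by (rule euler_deriv_mult[OF mult.IH])
  then show ?case unfolding map_append sum_list_append e by (simp only: mult.commute[of "F z" for z])
qed

text \<open>The divergence of the matrix field U^m in terms of traces: differentiating U^m along all
  matrix units and contracting gives tr(U^l) tr(U^(m-l)) summed over l, with the opposite sign for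
  inverse powers.\<close>

definition loop_poly :: "nat \<Rightarrow> int \<Rightarrow> (nat \<Rightarrow> complex) \<Rightarrow> complex" where
  "loop_poly n m z = (if m > 0 then \<Sum>l<nat m. psum n (int l) z * psum n (m - int l) z
     else - (\<Sum>l<nat (-m). psum n (- int l) z * psum n (m + int l) z))"

text \<open>Adding the terms of (j,k) and (k,j) cancels the pole: (x_j^N - x_k^N) / (x_j - x_k) is a
  geometric sum. The double sum obtained lacks its diagonal j = k, which would contribute N x_j^N
  for each j.\<close>

lemma sum_off_diagonal_loop:
  fixes x :: "nat \<Rightarrow> complex"
  assumes inj: "inj_on x {..<n}"
  shows "(\<Sum>j<n. x j ^ N * (\<Sum>k\<in>{..<n}-{j}. (x j + x k) / (x j - x k)))
     = (\<Sum>l<N. (\<Sum>j<n. x j ^ l) * (\<Sum>k<n. x k ^ (N - l))) - of_nat N * (\<Sum>j<n. x j ^ N)"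
proof -
  define S where "S = (SIGMA j:{..<n}. {..<n}-{j})"
  have fin: "finite S" by (simp add: S_def)
  define f where "f = (\<lambda>(j,k). x j ^ N * ((x j + x k) / (x j - x k)))"
  define g where "g = (\<lambda>(j,k). \<Sum>l<N. x j ^ l * x k ^ (N - l))"
  have swap: "sum h S = sum (\<lambda>(j,k). h (k,j)) S" for h :: "nat \<times> nat \<Rightarrow> complex"
    by (rule sum.reindex_bij_witness[of _ "\<lambda>(j,k). (k,j)" "\<lambda>(j,k). (k,j)"]) (auto simp: S_def)
  have pair: "f (j,k) + f (k,j) = g (j,k) + g (k,j)" if "(j,k) \<in> S" for j k
  proof -
    from that inj have ne: "x j - x k \<noteq> 0" "x k - x j \<noteq> 0" by (auto simp: S_def inj_on_def)
    have "f (j,k) + f (k,j) = (x j ^ N - x k ^ N) / (x j - x k) * (x j + x k)"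
      using ne by (simp add: f_def divide_simps) (simp add: algebra_simps)
    also have "(x j ^ N - x k ^ N) / (x j - x k) = (\<Sum>l<N. x k ^ (N - Suc l) * x j ^ l)"
      using ne by (simp add: power_diff_sumr2)
    also have "\<dots> * (x j + x k) = (\<Sum>l<N. x k ^ (N - Suc l) * x j ^ Suc l) + (\<Sum>l<N. x k ^ (N - l) * x j ^ l)"
      unfolding distrib_left sum_distrib_right
    proof (intro arg_cong2[where f = "(+)"] sum.cong refl)
      fix l assume "l \<in> {..<N}"
      then have "N - l = Suc (N - Suc l)" by auto
      then show "x k ^ (N - Suc l) * x j ^ l * x k = x k ^ (N - l) * x j ^ l" by simp
    qed simp
    also have "(\<Sum>l<N. x k ^ (N - Suc l) * x j ^ Suc l) = (\<Sum>l<N. x k ^ l * x j ^ (N - l))"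
      by (rule sum.reindex_bij_witness[of _ "\<lambda>l. N - Suc l" "\<lambda>l. N - Suc l"]) (auto simp: Suc_diff_Suc)
    finally show ?thesis by (simp add: g_def mult_ac add_ac)
  qed
  have "2 * sum f S = sum f S + sum (\<lambda>(j,k). f (k,j)) S" using swap[of f] by simp
  also have "\<dots> = (\<Sum>(j,k)\<in>S. f (j,k) + f (k,j))" by (simp add: sum.distrib split_def)
  also have "\<dots> = (\<Sum>(j,k)\<in>S. g (j,k) + g (k,j))" by (rule sum.cong) (auto simp: pair)
  also have "\<dots> = 2 * sum g S" using swap[of g] by (simp add: sum.distrib split_def)
  finally have fg: "sum f S = sum g S" by simp
  have "(\<Sum>j<n. x j ^ N * (\<Sum>k\<in>{..<n}-{j}. (x j + x k) / (x j - x k))) = sum f S"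
    unfolding S_def f_def by (subst sum.Sigma[symmetric]) (auto simp: sum_distrib_left)
  also have "\<dots> = sum g S" by (rule fg)
  also have "\<dots> = (\<Sum>j<n. \<Sum>k\<in>{..<n}-{j}. g (j,k))"
    using sum.Sigma[of "{..<n}" "\<lambda>j. {..<n}-{j}" "\<lambda>j k. g (j,k)"] by (simp add: S_def)
  also have "\<dots> = (\<Sum>j<n. (\<Sum>k<n. g (j,k)) - g (j,j))"
    by (intro sum.cong refl) (simp add: sum_diff1)
  also have "\<dots> = (\<Sum>j<n. \<Sum>k<n. g (j,k)) - (\<Sum>j<n. g (j,j))" by (simp add: sum_subtractf)
  also have "(\<Sum>j<n. g (j,j)) = of_nat N * (\<Sum>j<n. x j ^ N)"
    by (simp add: g_def sum_distrib_left flip: power_add)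
  also have "(\<Sum>j<n. \<Sum>k<n. g (j,k)) = (\<Sum>l<N. (\<Sum>j<n. x j ^ l) * (\<Sum>k<n. x k ^ (N - l)))"
    unfolding g_def split_conv sum_product
    by (subst (2) sum.swap, subst sum.swap, rule refl)
  finally show ?thesis .
qed

text \<open>Negative m reduces to positive m by z \<mapsto> 1/z, under which (z_j + z_k) / (z_j -
  z_k) changes sign.\<close>

lemma loop_poly_eq:
  assumes inj: "inj_on z {..<n}" and nz: "nonzero_upto n z"
  shows "loop_poly n m z = (\<Sum>j<n. z j powi m * (\<Sum>k\<in>{..<n}-{j}. (z j + z k) / (z j - z k))) + of_int m * psum n m z"
proof (cases "m > 0")
  case True
  define N where "N = nat m"
  have m: "m = int N" using True by (simp add: N_def)
  have d: "psum n (int N - int l) z = (\<Sum>k<n. z k ^ (N - l))" if "l < N" for l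
    using that by (simp add: psum_def flip: of_nat_diff)
  have "loop_poly n m z = (\<Sum>l<N. (\<Sum>j<n. z j ^ l) * (\<Sum>k<n. z k ^ (N - l)))"
    using True by (simp add: loop_poly_def m d) (simp add: psum_def)
  then show ?thesis using sum_off_diagonal_loop[OF inj, of N] by (simp add: m psum_def)
next
  case False
  define N where "N = nat (-m)"
  have m: "m = - int N" using False by (simp add: N_def)
  define x where "x j = inverse (z j)" for j
  have injx: "inj_on x {..<n}" using inj by (simp add: x_def inj_on_def)
  have p: "z j powi (- int l) = x j ^ l" for j l
    by (simp add: x_def power_int_minus power_inverse)
  have d: "psum n (int l - int N) z = (\<Sum>k<n. x k ^ (N - l))" if "l < N" for l
  proof -
    have "int l - int N = - int (N - l)" using that by simp
    then show ?thesis by (simp only: psum_def p)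
  qed
  have *: "(x j + x k) / (x j - x k) = - ((z j + z k) / (z j - z k))" if "j < n" "k \<in> {..<n}-{j}" for j k
  proof -
    have "z j \<noteq> 0" "z k \<noteq> 0" "z j \<noteq> z k" using nz inj that by (auto simp: nonzero_upto_def inj_on_def)
    then show ?thesis unfolding x_def by (simp add: field_simps)
  qed
  have "loop_poly n m z = - (\<Sum>l<N. (\<Sum>j<n. x j ^ l) * (\<Sum>k<n. x k ^ (N - l)))"
    using False by (simp add: loop_poly_def m d) (simp add: psum_def p)
  also have "\<dots> = - (\<Sum>j<n. x j ^ N * (\<Sum>k\<in>{..<n}-{j}. (x j + x k) / (x j - x k))) - of_nat N * (\<Sum>j<n. x j ^ N)"
    unfolding sum_off_diagonal_loop[OF injx] by simp
  also have "(\<Sum>j<n. x j ^ N * (\<Sum>k\<in>{..<n}-{j}. (x j + x k) / (x j - x k)))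
      = - (\<Sum>j<n. x j ^ N * (\<Sum>k\<in>{..<n}-{j}. (z j + z k) / (z j - z k)))"
    by (simp add: * sum_negf)
  finally show ?thesis by (simp add: m psum_def p)
qed

lemma symL_sum: "finite A \<Longrightarrow> (\<And>x. x \<in> A \<Longrightarrow> f x \<in> symL n) \<Longrightarrow> (\<lambda>z. \<Sum>x\<in>A. f x z) \<in> symL n"
  by (induction A rule: finite_induct) (auto intro: symL.intros)

lemma symL_sum_list: "(\<And>x. x \<in> set xs \<Longrightarrow> f x \<in> symL n) \<Longrightarrow> (\<lambda>z. \<Sum>x\<leftarrow>xs. f x z) \<in> symL n"
  by (induction xs) (auto intro: symL.intros)

lemma symL_cmult: "F \<in> symL n \<Longrightarrow> (\<lambda>z. c * F z) \<in> symL n"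
  by (intro symL.mult symL.const)

lemma loop_poly_symL: "loop_poly n m \<in> symL n"
proof (cases "m > 0")
  case True
  then show ?thesis unfolding loop_poly_def[abs_def]
    by (simp add: symL_sum symL.mult symL.psum)
next
  case False
  have "(\<lambda>z. (-1) * (\<Sum>l<nat (-m). psum n (- int l) z * psum n (m + int l) z)) \<in> symL n"
    by (intro symL_cmult symL_sum symL.mult symL.psum) simp
  then show ?thesis using False unfolding loop_poly_def[abs_def] by simp
qed

text \<open>\<open>loop_div n m K\<close> corresponds to the divergence of the matrix field \<open>U \<mapsto> K(U) U\<^sup>m\<close> on the
  unitary group, expressed through the eigenvalues; \<open>radial_laplace\<close> is the divergence of a gradient.\<close>

definition loop_div :: "nat \<Rightarrow> int \<Rightarrow> ((nat \<Rightarrow> complex) \<Rightarrow> complex) \<Rightarrow> (nat \<Rightarrow> complex) \<Rightarrow> complex" where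
  "loop_div n m K z = (\<Sum>(l,J)\<leftarrow>grad_list n K. J z * psum n (m + l) z) + K z * loop_poly n m z"

definition radial_laplace :: "nat \<Rightarrow> ((nat \<Rightarrow> complex) \<Rightarrow> complex) \<Rightarrow> (nat \<Rightarrow> complex) \<Rightarrow> complex" where
  "radial_laplace n F z = (\<Sum>(m,K)\<leftarrow>grad_list n F. loop_div n m K z)"

lemma loop_div_symL: "K \<in> symL n \<Longrightarrow> loop_div n m K \<in> symL n"
  unfolding loop_div_def[abs_def] split_def
  by (intro symL.add symL.mult symL_sum_list loop_poly_symL symL.psum) (auto dest: grad_list(2))

lemma radial_laplace_symL: "F \<in> symL n \<Longrightarrow> radial_laplace n F \<in> symL n"
  unfolding radial_laplace_def[abs_def] split_def
  by (intro symL_sum_list loop_div_symL) (auto dest: grad_list(2))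

lemma euler_deriv_sum_list:
  "(\<And>x. x \<in> set xs \<Longrightarrow> euler_deriv n (f x) j (f' x)) \<Longrightarrow>
   euler_deriv n (\<lambda>z. \<Sum>x\<leftarrow>xs. f x z) j (\<lambda>z. \<Sum>x\<leftarrow>xs. f' x z)"
  by (induction xs) (auto intro: euler_deriv_const euler_deriv_add)

lemma sum_sum_list: "(\<Sum>j<(n::nat). \<Sum>x\<leftarrow>xs. f x j) = (\<Sum>x\<leftarrow>xs. \<Sum>j<n. (f x j :: complex))"
  by (induction xs) (auto simp: sum.distrib)

lemma sum_list_mult_left: "(\<Sum>x\<leftarrow>xs. f x) * (c::complex) = (\<Sum>x\<leftarrow>xs. f x * c)"
  by (induction xs) (auto simp: algebra_simps)

lemma sum_list_add: "(\<Sum>x\<leftarrow>xs. f x + g x) = (\<Sum>x\<leftarrow>xs. f x) + (\<Sum>x\<leftarrow>xs. (g x :: complex))"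
  by (induction xs) (auto simp: algebra_simps)

text \<open>Conjugation by \<open>vdm\<close> flattens the radial part. In the product rule for
  \<open>vdm * F\<close> the second-order terms of \<open>vdm\<close> drop out, as its energy is
  zero, and the cross terms 2 (E_j vdm)(E_j F) supply the drift (z_j + z_k) / (z_j - z_k) that
  \<open>loop_poly\<close> encodes. At coincident coordinates every alternant vanishes and both
  sides are zero.\<close>

lemma vdm_radial_laplace:
  assumes F: "F \<in> symL n" and eq: "\<And>z. nonzero_upto n z \<Longrightarrow> vdm n z * F z = alt_comb n xs z"
    and z: "nonzero_upto n z"
  shows "vdm n z * radial_laplace n F z = alt_comb n (energy_scale n xs) z"
proof (cases "inj_on z {..<n}")
  case False
  then obtain i j where "i < n" "j < n" "i \<noteq> j" "z i = z j" by (auto simp: inj_on_def)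
  then have 0: "alternant n l z = 0" for l by (rule vdm_repeat)
  have "alt_comb n ys z = 0" for ys by (induction ys) (auto simp: 0)
  then show ?thesis using 0 by simp
next
  case True
  define gF where "gF = grad_list n F"
  define F1 where "F1 j z = (\<Sum>(m,K)\<leftarrow>gF. K z * z j powi m)" for j :: nat and z :: "nat \<Rightarrow> complex"
  define K1 where "K1 K j z = (\<Sum>(l,J)\<leftarrow>grad_list n K. J z * z j powi l)" for K and j :: nat and z :: "nat \<Rightarrow> complex"
  define F2 where "F2 j z = (\<Sum>(m,K)\<leftarrow>gF. K1 K j z * z j powi m + K z * (of_int m * z j powi m))" for j :: nat and z :: "nat \<Rightarrow> complex"
  have dF1: "euler_deriv n F j (F1 j)" if "j < n" for j
    unfolding F1_def[abs_def] gF_def by (rule euler_grad_deriv[OF grad_list(1)[OF F] that])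
  have dF2: "euler_deriv n (F1 j) j (F2 j)" if j: "j < n" for j
    unfolding F1_def[abs_def] F2_def[abs_def] split_def
  proof (rule euler_deriv_sum_list)
    fix x assume x: "x \<in> set gF"
    obtain m K where mK: "x = (m,K)" by force
    have K: "K \<in> symL n" using grad_list(2)[OF F] x by (auto simp: mK gF_def)
    have "euler_deriv n K j (K1 K j)"
      unfolding K1_def[abs_def] by (rule euler_grad_deriv[OF grad_list(1)[OF K] j])
    from euler_deriv_mult[OF this euler_deriv_powi[OF j, of j m]]
    show "euler_deriv n (\<lambda>z. snd x z * z j powi fst x) j (\<lambda>z. K1 (snd x) j z * z j powi fst x + snd x z * (of_int (fst x) * z j powi fst x))"
      by (simp add: mK)
  qed
  have "laurent_energy n int = 0" by (simp add: laurent_energy_def)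
  with euler_laplace_alternant[of n int] have "euler_laplace n (vdm n) (\<lambda>z. 0)" by simp
  then obtain a1 a2 where a:
    "\<And>j. j < n \<Longrightarrow> euler_deriv n (vdm n) j (a1 j)" "\<And>j. j < n \<Longrightarrow> euler_deriv n (a1 j) j (a2 j)"
    "\<And>z. nonzero_upto n z \<Longrightarrow> 0 = (\<Sum>j<n. a2 j z - of_int (int n - 1) * a1 j z) - of_int (ground_energy n) * vdm n z"
    unfolding euler_laplace_def by blast
  define h1 where "h1 j z = a1 j z * F z + vdm n z * F1 j z" for j z
  define h2 where "h2 j z = (a2 j z * F z + a1 j z * F1 j z) + (a1 j z * F1 j z + vdm n z * F2 j z)" for j z
  define h where "h z = (\<Sum>j<n. h2 j z - of_int (int n - 1) * h1 j z) - of_int (ground_energy n) * (vdm n z * F z)" for z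
  have "euler_laplace n (\<lambda>z. vdm n z * F z) h"
    unfolding euler_laplace_def
  proof (rule exI[of _ h1], rule exI[of _ h2], intro conjI allI impI)
    fix j assume j: "j < n"
    show "euler_deriv n (\<lambda>z. vdm n z * F z) j (h1 j)"
      unfolding h1_def[abs_def] by (rule euler_deriv_mult[OF a(1)[OF j] dF1[OF j]])
    show "euler_deriv n (h1 j) j (h2 j)"
      unfolding h1_def[abs_def] h2_def[abs_def]
      by (rule euler_deriv_add[OF euler_deriv_mult[OF a(2)[OF j] dF1[OF j]] euler_deriv_mult[OF a(1)[OF j] dF2[OF j]]])
  qed (simp add: h_def)
  from euler_laplace_unique[OF this euler_laplace_alt_comb eq z]
  have hz: "h z = alt_comb n (energy_scale n xs) z" .
  have a1: "a1 j z = vdm n z * (z j * (\<Sum>k\<in>{..<n}-{j}. 1 / (z j - z k)))" if j: "j < n" for j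
  proof -
    have "a1 j z / z j = vdm n z * (\<Sum>k\<in>{..<n}-{j}. 1 / (z j - z k))"
      by (rule DERIV_unique[OF euler_derivD[OF a(1)[OF j] z] vdm_log_deriv[OF True j]])
    then show ?thesis using z j by (simp add: nonzero_upto_def field_simps)
  qed
  define s where "s j = (\<Sum>k\<in>{..<n}-{j}. (z j + z k) / (z j - z k))" for j
  \<comment> \<open>The n - 1 of the operator is spent as one unit for each k different from j,
    turning 2 z_j / (z_j - z_k) into (z_j + z_k) / (z_j - z_k).\<close>
  have s: "2 * (z j * (\<Sum>k\<in>{..<n}-{j}. 1 / (z j - z k))) - of_int (int n - 1) = s j" if j: "j < n" for j
  proof -
    have "(of_int (int n - 1) :: complex) = (\<Sum>k\<in>{..<n}-{j}. 1)" using j by (simp add: of_nat_diff)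
    then have "2 * (z j * (\<Sum>k\<in>{..<n}-{j}. 1 / (z j - z k))) - of_int (int n - 1)
       = (\<Sum>k\<in>{..<n}-{j}. 2 * z j / (z j - z k) - 1)"
      by (simp only: sum_subtractf sum_distrib_left) simp
    also have "\<dots> = s j" unfolding s_def
    proof (rule sum.cong[OF refl])
      fix k assume "k \<in> {..<n}-{j}"
      then have "z j - z k \<noteq> 0" using True j by (auto simp: inj_on_def)
      then show "2 * z j / (z j - z k) - 1 = (z j + z k) / (z j - z k)" by (simp add: field_simps)
    qed
    finally show ?thesis .
  qed
  have "h z = F z * ((\<Sum>j<n. a2 j z - of_int (int n - 1) * a1 j z) - of_int (ground_energy n) * vdm n z)
      + (\<Sum>j<n. 2 * a1 j z * F1 j z + vdm n z * F2 j z - of_int (int n - 1) * (vdm n z * F1 j z))"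
  proof -
    have "h2 j z - c * h1 j z = F z * (a2 j z - c * a1 j z) + (2 * a1 j z * F1 j z + vdm n z * F2 j z - c * (vdm n z * F1 j z))" for j c
      unfolding h1_def h2_def by (simp add: algebra_simps)
    then show ?thesis unfolding h_def by (simp only: sum.distrib sum_distrib_left[symmetric]) (simp only: right_diff_distrib mult_ac diff_add_eq)
  qed
  also have "\<dots> = (\<Sum>j<n. 2 * a1 j z * F1 j z + vdm n z * F2 j z - of_int (int n - 1) * (vdm n z * F1 j z))"
    using a(3)[OF z] by simp
  also have "\<dots> = (\<Sum>j<n. vdm n z * (F2 j z + F1 j z * s j))"
  proof (rule sum.cong[OF refl])
    fix j assume "j \<in> {..<n}"
    then have j: "j < n" by simp
    show "2 * a1 j z * F1 j z + vdm n z * F2 j z - of_int (int n - 1) * (vdm n z * F1 j z) = vdm n z * (F2 j z + F1 j z * s j)"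
      unfolding s[OF j, symmetric] a1[OF j] by (simp only: ring_distribs mult_ac) (simp only: add_ac add_diff_eq)
  qed
  also have "\<dots> = vdm n z * (\<Sum>j<n. F2 j z + F1 j z * s j)" by (simp only: sum_distrib_left)
  also have "(\<Sum>j<n. F2 j z + F1 j z * s j) = radial_laplace n F z"
  proof -
    have "(\<Sum>j<n. F2 j z + F1 j z * s j)
      = (\<Sum>x\<leftarrow>gF. \<Sum>j<n. (K1 (snd x) j z * z j powi fst x + snd x z * (of_int (fst x) * z j powi fst x)) + snd x z * z j powi fst x * s j)"
      unfolding F1_def F2_def split_def sum_list_mult_left sum_list_add[symmetric] sum_sum_list ..
    also have "\<dots> = (\<Sum>x\<leftarrow>gF. loop_div n (fst x) (snd x) z)"
    proof (intro arg_cong[of _ _ sum_list] map_cong refl)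
      fix x assume "x \<in> set gF"
      have 1: "(\<Sum>j<n. K1 (snd x) j z * z j powi fst x) = (\<Sum>(l,J)\<leftarrow>grad_list n (snd x). J z * psum n (fst x + l) z)"
        unfolding K1_def split_def sum_list_mult_left sum_sum_list psum_def sum_distrib_left using z
        by (intro arg_cong[of _ _ sum_list] map_cong refl sum.cong)
           (auto simp: power_int_add nonzero_upto_def mult_ac)
      show "(\<Sum>j<n. (K1 (snd x) j z * z j powi fst x + snd x z * (of_int (fst x) * z j powi fst x)) + snd x z * z j powi fst x * s j)
        = loop_div n (fst x) (snd x) z"
        unfolding sum.distrib 1 loop_div_def loop_poly_eq[OF True z] s_def psum_def
        by (simp add: ring_distribs sum_distrib_left mult_ac)
    qed
    finally show ?thesis by (simp add: radial_laplace_def gF_def split_def)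
  qed
  finally show ?thesis using hz by simp
qed

section \<open>Invariant means of symmetric Laurent polynomials\<close>

lemma symL_tendsto:
  assumes "F \<in> symL n" "\<And>i. i < n \<Longrightarrow> ((\<lambda>e. y e i) \<longlongrightarrow> z i) L" "nonzero_upto n z"
  shows "((\<lambda>e. F (y e)) \<longlongrightarrow> F z) L"
  using assms(1)
proof induction
  case (psum m)
  show ?case unfolding psum_def
    by (intro tendsto_sum tendsto_power_int) (use assms in \<open>auto simp: nonzero_upto_def\<close>)
qed (auto intro: tendsto_intros)

text \<open>Points that differ stay different by continuity. Equal points are turned by angles e i
  and e j, which differ by less than 1, hence not by a nonzero multiple of 2 pi.\<close>

lemma perturb_distinct:
  fixes z :: "nat \<Rightarrow> complex"
  assumes "nonzero_upto n z"
  shows "\<forall>\<^sub>F e in at_right (0::real). inj_on (\<lambda>i. z i * cis (e * real i)) {..<n}"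
proof -
  have "\<forall>\<^sub>F e in at_right (0::real). z i * cis (e * real i) \<noteq> z j * cis (e * real j)"
    if ij: "i < n" "j < n" "i \<noteq> j" for i j
  proof (cases "z i = z j")
    case False
    have "((\<lambda>e. z i * cis (e * real i) - z j * cis (e * real j)) \<longlongrightarrow> z i * cis (0 * real i) - z j * cis (0 * real j)) (at_right 0)"
      by (intro tendsto_intros)
    then have "((\<lambda>e. z i * cis (e * real i) - z j * cis (e * real j)) \<longlongrightarrow> z i - z j) (at_right 0)" by simp
    then have "\<forall>\<^sub>F e in at_right (0::real). z i * cis (e * real i) - z j * cis (e * real j) \<noteq> 0"
      using False by (intro tendsto_imp_eventually_ne) auto
    then show ?thesis by eventually_elim auto
  next
    case True
    have z0: "z j \<noteq> 0" using assms ij by (auto simp: nonzero_upto_def)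
    have "\<forall>\<^sub>F e in at_right (0::real). e \<in> {0<..<1 / (real i + real j + 1)}"
      by (intro eventually_at_right_real) (simp add: add_nonneg_pos)
    then show ?thesis
    proof eventually_elim
      case (elim e)
      show ?case
      proof
        assume "z i * cis (e * real i) = z j * cis (e * real j)"
        then have "cis (e * real i) = cis (e * real j)" using True z0 by simp
        then have "cis (e * real i - e * real j) = 1" by (simp flip: cis_divide)
        then have "cos (e * real i - e * real j) = 1" by (simp add: complex_eq_iff)
        then obtain k :: int where k: "e * real i - e * real j = of_int k * (2 * pi)"
          by (auto simp: cos_one_2pi_int)
        have lt: "e * (real i + real j) < 1"
        proof -
          have "e * (real i + real j + 1) < 1"
            using elim by (simp add: field_simps add_nonneg_pos)
          moreover have "e > 0" using elim by simp
          ultimately show ?thesis by (simp add: algebra_simps)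
        qed
        have "\<bar>e * real i - e * real j\<bar> \<le> e * (real i + real j)"
          using elim by (auto simp: abs_le_iff algebra_simps intro: add_increasing mult_nonneg_nonneg)
        with lt k have "\<bar>of_int k * (2 * pi)\<bar> < 1" by simp
        moreover have "k = 0 \<or> \<bar>of_int k * (2 * pi)\<bar> \<ge> 1 * 1"
        proof (cases "k = 0")
          case False
          then have "\<bar>real_of_int k\<bar> \<ge> 1" by linarith
          then show ?thesis unfolding abs_mult using pi_gt3 by (intro disjI2 mult_mono) auto
        qed simp
        ultimately have "k = 0" by linarith
        with k have "e * (real i - real j) = 0" by (simp add: algebra_simps)
        then show False using elim ij by simp
      qed
    qed
  qed
  then have "\<forall>\<^sub>F e in at_right (0::real). \<forall>i\<in>{..<n}. \<forall>j\<in>{..<n}. i \<noteq> j \<longrightarrow> z i * cis (e * real i) \<noteq> z j * cis (e * real j)"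
    by (intro eventually_ball_finite ballI) auto
  then show ?thesis by eventually_elim (auto simp: inj_on_def)
qed

text \<open>Where the coordinates are distinct, \<open>vdm\<close> can be divided out; continuity of
  F carries the value to the remaining points.\<close>

lemma symL_eq_constI:
  assumes F: "F \<in> symL n" and eq: "\<And>z. nonzero_upto n z \<Longrightarrow> vdm n z * F z = c * vdm n z"
    and z: "nonzero_upto n z"
  shows "F z = c"
proof -
  have lim: "((\<lambda>e. F (\<lambda>i. z i * cis (e * real i))) \<longlongrightarrow> F z) (at_right 0)"
  proof (rule symL_tendsto[OF F _ z])
    fix i
    have "((\<lambda>e. z i * cis (e * real i)) \<longlongrightarrow> z i * cis (0 * real i)) (at_right 0)" by (intro tendsto_intros)
    then show "((\<lambda>e. z i * cis (e * real i)) \<longlongrightarrow> z i) (at_right 0)" by simp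
  qed
  have "\<forall>\<^sub>F e in at_right (0::real). F (\<lambda>i. z i * cis (e * real i)) = c"
    using perturb_distinct[OF z]
  proof eventually_elim
    case (elim e)
    have "vdm n (\<lambda>i. z i * cis (e * real i)) \<noteq> 0" by (rule vdm_nonzero[OF elim])
    moreover have "nonzero_upto n (\<lambda>i. z i * cis (e * real i))" using z by (simp add: nonzero_upto_def)
    ultimately show ?case using eq[of "\<lambda>i. z i * cis (e * real i)"] by simp
  qed
  then have "((\<lambda>e. F (\<lambda>i. z i * cis (e * real i))) \<longlongrightarrow> c) (at_right 0)"
    by (rule tendsto_eventually)
  from tendsto_unique[OF _ lim this] show ?thesis by simp
qed

definition zero_part :: "nat \<Rightarrow> (complex \<times> (nat \<Rightarrow> int)) list \<Rightarrow> (complex \<times> (nat \<Rightarrow> int)) list" where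
  "zero_part n xs = filter (\<lambda>(c,l). laurent_energy n l = 0) xs"

lemma zero_part_multiple: "\<exists>d. \<forall>z. alt_comb n (zero_part n xs) z = d * vdm n z"
proof (induction xs)
  case Nil
  show ?case by (rule exI[of _ 0]) (simp add: zero_part_def)
next
  case (Cons x xs)
  obtain c l where x: "x = (c,l)" by force
  from Cons obtain d where d: "\<And>z. alt_comb n (zero_part n xs) z = d * vdm n z" by blast
  show ?case
  proof (cases "laurent_energy n l = 0")
    case True
    then obtain e where "\<And>z. alternant n l z = e * vdm n z" using alternant_energy_zero by blast
    with True d show ?thesis
      by (intro exI[of _ "c * e + d"]) (simp add: zero_part_def x algebra_simps)
  next
    case False
    with d show ?thesis by (intro exI[of _ d]) (simp add: zero_part_def x)
  qed
qed

text \<open>A mean that annihilates the radial Laplacian is determined on symmetric Laurent polynomials: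
  subtracting \<open>radial_laplace F / \<kappa>\<close> from \<open>F\<close> removes the alternants of energy \<open>\<kappa> \<noteq> 0\<close> from
  \<open>vdm * F\<close> without changing the mean of \<open>F\<close>, until only a multiple of \<open>vdm\<close> is left.\<close>

lemma invariant_mean_formula:
  fixes \<phi> :: "((nat \<Rightarrow> complex) \<Rightarrow> complex) \<Rightarrow> complex"
  assumes lin: "\<And>F G c. F \<in> symL n \<Longrightarrow> G \<in> symL n \<Longrightarrow> \<phi> (\<lambda>z. F z + c * G z) = \<phi> F + c * \<phi> G"
    and const: "\<And>F c. (\<And>z. nonzero_upto n z \<Longrightarrow> F z = c) \<Longrightarrow> F \<in> symL n \<Longrightarrow> \<phi> F = c"
    and lap: "\<And>F. F \<in> symL n \<Longrightarrow> \<phi> (radial_laplace n F) = 0"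
    and F: "F \<in> symL n" and eq: "\<And>z. nonzero_upto n z \<Longrightarrow> vdm n z * F z = alt_comb n xs z"
  shows "\<phi> F * vdm n z = alt_comb n (zero_part n xs) z"
  using F eq
proof (induction "length (filter (\<lambda>(c,l). laurent_energy n l \<noteq> 0) xs)" arbitrary: F xs rule: less_induct)
  case less
  show ?case
  proof (cases "\<exists>(c,l)\<in>set xs. laurent_energy n l \<noteq> 0")
    case False
    then have 0: "zero_part n xs = xs" by (auto simp: zero_part_def filter_id_conv)
    then obtain d where d: "\<And>z. alt_comb n xs z = d * vdm n z" using zero_part_multiple[of n xs] by auto
    have "F z = d" if "nonzero_upto n z" for z
      by (rule symL_eq_constI[OF less.prems(1) _ that]) (use less.prems(2) d in simp)
    then have "\<phi> F = d" by (rule const) (use less.prems in simp_all)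
    then show ?thesis by (simp add: 0 d)
  next
    case True
    then obtain c0 l0 where l0: "(c0,l0) \<in> set xs" "laurent_energy n l0 \<noteq> 0" by auto
    define k where "k = laurent_energy n l0"
    have k0: "k \<noteq> 0" using l0 by (simp add: k_def)
    define G where "G z = F z + (- 1 / of_int k) * radial_laplace n F z" for z
    have G: "G \<in> symL n" unfolding G_def[abs_def]
      by (intro symL.add symL_cmult radial_laplace_symL less.prems)
    have phiG: "\<phi> G = \<phi> F"
      unfolding G_def[abs_def] using less.prems(1) by (subst lin) (auto simp: lap radial_laplace_symL)
    \<comment> \<open>Terms of energy k acquire the coefficient 0 and are removed from the list, so
      that the number of terms of nonzero energy really drops.\<close>
    define ys where "ys = map (\<lambda>(c,l). ((1 - of_int (laurent_energy n l) / of_int k) * c, l)) (filter (\<lambda>(c,l). laurent_energy n l \<noteq> k) xs)"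
    have ys: "alt_comb n ys z = alt_comb n xs z - alt_comb n (energy_scale n xs) z / of_int k" for z
      unfolding ys_def energy_scale_def
    proof (induction xs)
      case (Cons x xs)
      then show ?case using k0 by (cases x) (auto simp: add_divide_distrib left_diff_distrib)
    qed simp
    have "vdm n z * G z = alt_comb n ys z" if z: "nonzero_upto n z" for z
    proof -
      have "vdm n z * G z = vdm n z * F z - (vdm n z * radial_laplace n F z) / of_int k"
        by (simp add: G_def algebra_simps)
      also have "\<dots> = alt_comb n ys z"
        using vdm_radial_laplace[OF less.prems(1) less.prems(2) z] less.prems(2)[OF z] by (simp only: ys)
      finally show ?thesis .
    qed
    moreover have "length (filter (\<lambda>(c,l). laurent_energy n l \<noteq> 0) ys) < length (filter (\<lambda>(c,l). laurent_energy n l \<noteq> 0) xs)"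
    proof -
      have "length (filter (\<lambda>(c,l). laurent_energy n l \<noteq> 0) ys) = length (filter (\<lambda>(c,l). laurent_energy n l \<noteq> k) (filter (\<lambda>(c,l). laurent_energy n l \<noteq> 0) xs))"
        unfolding ys_def by (induction xs) auto
      also have "\<dots> < length (filter (\<lambda>(c,l). laurent_energy n l \<noteq> 0) xs)"
        by (rule length_filter_less[of "(c0,l0)"]) (use l0 in \<open>auto simp: k_def\<close>)
      finally show ?thesis .
    qed
    ultimately have "\<phi> G * vdm n z = alt_comb n (zero_part n ys) z"
      using less.hyps[of ys G] G by blast
    also have "\<dots> = alt_comb n (zero_part n xs) z"
      unfolding ys_def zero_part_def using k0 by (induction xs) auto
    finally show ?thesis by (simp add: phiG)
  qed
qed

section \<open>Haar measure on the unitary group\<close>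

definition unitary_mat :: "nat \<Rightarrow> complex mat \<Rightarrow> bool" where
  "unitary_mat n U \<longleftrightarrow> U \<in> carrier_mat n n \<and> mat_adjoint U * U = 1\<^sub>m n"

definition mat_tr :: "nat \<Rightarrow> complex mat \<Rightarrow> complex" where
  "mat_tr n A = (\<Sum>i<n. A $$ (i,i))"

definition unitary_pow :: "complex mat \<Rightarrow> int \<Rightarrow> complex mat" where
  "unitary_pow U m = (if m \<ge> 0 then U ^\<^sub>m nat m else mat_adjoint U ^\<^sub>m nat (-m))"

definition eigen_points :: "complex mat \<Rightarrow> nat \<Rightarrow> complex" where
  "eigen_points U i = cis (eigenangles U ! i)"

section \<open>Unitary matrices, traces of powers and eigenvalues\<close>

lemma mat_adjoint_dim [simp]: "dim_row (mat_adjoint A) = dim_col A" "dim_col (mat_adjoint A) = dim_row A"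
  by (simp_all add: mat_adjoint_def)

lemma mat_adjoint_carrier [simp]: "A \<in> carrier_mat n m \<Longrightarrow> mat_adjoint A \<in> carrier_mat m n"
  by (intro carrier_matI) auto

lemma mat_adjoint_index [simp]:
  "i < dim_col A \<Longrightarrow> j < dim_row A \<Longrightarrow> mat_adjoint A $$ (i,j) = cnj (A $$ (j,i))"
  by (simp add: mat_adjoint_def mat_of_rows_index)

lemma mat_mult_index:
  assumes "A \<in> carrier_mat n n" "B \<in> carrier_mat n n" "i < n" "j < n"
  shows "(A * B) $$ (i,j) = (\<Sum>k<n. A $$ (i,k) * B $$ (k,j))"
proof -
  have "(A * B) $$ (i,j) = Matrix.row A i \<bullet> Matrix.col B j" using assms by simp
  also have "\<dots> = (\<Sum>k = 0..<n. A $$ (i,k) * B $$ (k,j))" using assms by (simp add: scalar_prod_def)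
  finally show ?thesis by (simp only: atLeast0LessThan)
qed

lemma unitary_matD:
  assumes "unitary_mat n U"
  shows "U \<in> carrier_mat n n" "mat_adjoint U \<in> carrier_mat n n" "mat_adjoint U * U = 1\<^sub>m n" "U * mat_adjoint U = 1\<^sub>m n"
proof -
  show U: "U \<in> carrier_mat n n" and WU: "mat_adjoint U * U = 1\<^sub>m n" using assms by (auto simp: unitary_mat_def)
  then show W: "mat_adjoint U \<in> carrier_mat n n" by simp
  show "U * mat_adjoint U = 1\<^sub>m n" by (rule mat_mult_left_right_inverse[OF W U WU])
qed

lemma mat_tr_mult_comm:
  assumes "A \<in> carrier_mat n n" "B \<in> carrier_mat n n"
  shows "mat_tr n (A * B) = mat_tr n (B * A)"
proof -
  have "mat_tr n (A * B) = (\<Sum>i<n. \<Sum>k<n. A $$ (i,k) * B $$ (k,i))"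
    unfolding mat_tr_def by (intro sum.cong refl mat_mult_index[OF assms]) auto
  also have "\<dots> = (\<Sum>k<n. \<Sum>i<n. B $$ (k,i) * A $$ (i,k))"
    by (subst sum.swap) (simp add: mult.commute)
  also have "\<dots> = mat_tr n (B * A)"
    unfolding mat_tr_def by (intro sum.cong refl mat_mult_index[OF assms(2,1), symmetric]) auto
  finally show ?thesis .
qed

lemma upper_triangular_pow:
  assumes B: "B \<in> carrier_mat n n" and ut: "upper_triangular (B :: complex mat)"
  shows "(\<forall>i<n. \<forall>j<i. (B ^\<^sub>m k) $$ (i,j) = 0) \<and> (\<forall>i<n. (B ^\<^sub>m k) $$ (i,i) = (B $$ (i,i)) ^ k)"
proof (induction k)
  case 0
  then show ?case using B by auto
next
  case (Suc k)
  have Bk: "B ^\<^sub>m k \<in> carrier_mat n n" using B by simp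
  have ut': "B $$ (i,j) = 0" if "j < i" "i < n" for i j
    using upper_triangularD[OF ut that(1)] that B by auto
  have S0: "(B ^\<^sub>m k) $$ (i,j) = 0" if "i < n" "j < i" for i j using Suc that by blast
  have S1: "(B ^\<^sub>m k) $$ (i,i) = (B $$ (i,i)) ^ k" if "i < n" for i using Suc that by blast
  show ?case
  proof (intro conjI allI impI)
    fix i j assume ij: "i < n" "j < i"
    have "(B ^\<^sub>m Suc k) $$ (i,j) = (\<Sum>l<n. (B ^\<^sub>m k) $$ (i,l) * B $$ (l,j))"
      using mat_mult_index[OF Bk B, of i j] ij by (simp only: pow_mat.simps)
    also have "\<dots> = 0"
    proof (rule sum.neutral, rule ballI)
      fix l assume "l \<in> {..<n}"
      then show "(B ^\<^sub>m k) $$ (i,l) * B $$ (l,j) = 0"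
        using S0[of i l] ut'[of j l] ij by (cases "l < i") simp_all
    qed
    finally show "(B ^\<^sub>m Suc k) $$ (i,j) = 0" .
  next
    fix i assume i: "i < n"
    have "(B ^\<^sub>m Suc k) $$ (i,i) = (\<Sum>l<n. (B ^\<^sub>m k) $$ (i,l) * B $$ (l,i))"
      using mat_mult_index[OF Bk B, of i i] i by (simp only: pow_mat.simps)
    also have "\<dots> = (\<Sum>l<n. if l = i then (B ^\<^sub>m k) $$ (i,i) * B $$ (i,i) else 0)"
    proof (rule sum.cong[OF refl])
      fix l assume "l \<in> {..<n}"
      then show "(B ^\<^sub>m k) $$ (i,l) * B $$ (l,i) = (if l = i then (B ^\<^sub>m k) $$ (i,i) * B $$ (i,i) else 0)"
        using S0[of i l] ut'[of i l] i by (cases l i rule: linorder_cases) simp_all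
    qed
    also have "\<dots> = B $$ (i,i) ^ Suc k" using i by (simp add: S1 mult.commute)
    finally show "(B ^\<^sub>m Suc k) $$ (i,i) = B $$ (i,i) ^ Suc k" .
  qed
qed

text \<open>Schur triangularisation: the trace is invariant under similarity, and the k-th power of
  a triangular matrix has the k-th powers of the diagonal entries on its diagonal.\<close>

lemma mat_tr_pow_eigenvalues:
  fixes A :: "complex mat"
  assumes A: "A \<in> carrier_mat n n"
  shows "mat_tr n (A ^\<^sub>m k) = (\<Sum>z\<in>#proots (char_poly A). z ^ k)" "size (proots (char_poly A)) = n"
proof -
  obtain es where es: "char_poly A = (\<Prod>a\<leftarrow>es. [:- a, 1:])" "length es = n"
    using char_poly_factorized[OF A] by blast
  obtain B P Q where BPQ: "schur_decomposition A es = (B,P,Q)" by (metis prod_cases3)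
  from schur_decomposition[OF A es(1) BPQ]
  have sim: "similar_mat_wit A B P Q" and ut: "upper_triangular B" and dg: "diag_mat B = es" by auto
  note w = similar_mat_witD2[OF A sim]
  have B: "B \<in> carrier_mat n n" and P: "P \<in> carrier_mat n n" and Q: "Q \<in> carrier_mat n n"
    and QP: "Q * P = 1\<^sub>m n" using w by auto
  have Bk: "B ^\<^sub>m k \<in> carrier_mat n n" using B by simp
  have "mat_tr n (A ^\<^sub>m k) = mat_tr n (P * B ^\<^sub>m k * Q)"
    by (simp add: similar_mat_wit_pow_id[OF sim])
  also have "\<dots> = mat_tr n (Q * (P * B ^\<^sub>m k))" using P Q Bk by (intro mat_tr_mult_comm) auto
  also have "Q * (P * B ^\<^sub>m k) = B ^\<^sub>m k" using P Q Bk QP by (simp add: left_mult_one_mat[OF Bk] flip: assoc_mult_mat)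
  also have "mat_tr n (B ^\<^sub>m k) = (\<Sum>i<n. (B $$ (i,i)) ^ k)"
    unfolding mat_tr_def using upper_triangular_pow[OF B ut] by simp
  also have "\<dots> = (\<Sum>z\<leftarrow>es. z ^ k)"
  proof -
    have "es = map (\<lambda>i. B $$ (i,i)) [0..<n]" using dg B by (auto simp: diag_mat_def)
    then show ?thesis by (simp add: o_def interv_sum_list_conv_sum_set_nat atLeast0LessThan)
  qed
  also have "\<dots> = (\<Sum>z\<in>#mset es. z ^ k)" by (simp add: sum_mset_sum_list flip: mset_map)
  also have pr: "mset es = proots (char_poly A)"
    unfolding es(1)
  proof (induction es)
    case (Cons a es)
    have "(\<Prod>a\<leftarrow>es. [:- a, 1:]) \<noteq> 0" by (auto simp: prod_list_zero_iff)
    then have "proots ([:- a, 1:] * (\<Prod>a\<leftarrow>es. [:- a, 1:])) = proots [:- a, 1:] + proots (\<Prod>a\<leftarrow>es. [:- a, 1:])"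
      by (intro proots_mult) auto
    then show ?case using Cons by (simp del: mult_pCons_left)
  qed simp
  finally show "mat_tr n (A ^\<^sub>m k) = (\<Sum>z\<in>#proots (char_poly A). z ^ k)" .
  show "size (proots (char_poly A)) = n" using es(2) by (simp flip: pr)
qed

text \<open>Compare the squared lengths of U v and v for an eigenvector v, written out in
  coordinates.\<close>

lemma unitary_eigenvalue_norm:
  assumes U: "unitary_mat n U" and z: "z \<in># proots (char_poly U)"
  shows "cmod z = 1"
proof -
  note Ud = unitary_matD[OF U]
  have "poly (char_poly U) z = 0"
  proof (cases "char_poly U = 0")
    case False
    then show ?thesis using z by simp
  qed simp
  then have "eigenvalue U z" using eigenvalue_root_char_poly[OF Ud(1)] by simp
  then obtain v where v: "v \<in> carrier_vec n" "v \<noteq> 0\<^sub>v n" "U *\<^sub>v v = z \<cdot>\<^sub>v v"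
    unfolding eigenvalue_def eigenvector_def using Ud(1) by auto
  have Uv: "(\<Sum>j<n. U $$ (i,j) * vec_index v j) = z * vec_index v i" if "i < n" for i
  proof -
    have "vec_index (U *\<^sub>v v) i = (\<Sum>j<n. U $$ (i,j) * vec_index v j)"
      using that Ud(1) v(1) by (simp add: scalar_prod_def atLeast0LessThan)
    then show ?thesis using v that by simp
  qed
  have WU: "(\<Sum>i<n. cnj (U $$ (i,k)) * U $$ (i,j)) = (if k = j then 1 else 0)" if "k < n" "j < n" for j k
    using mat_mult_index[OF Ud(2,1) that] Ud that by simp
  have "(\<Sum>i<n. cnj (z * vec_index v i) * (z * vec_index v i))
     = (\<Sum>i<n. cnj (\<Sum>k<n. U $$ (i,k) * vec_index v k) * (\<Sum>j<n. U $$ (i,j) * vec_index v j))"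
    by (simp add: Uv)
  also have "\<dots> = (\<Sum>i<n. \<Sum>k<n. \<Sum>j<n. (cnj (vec_index v k) * vec_index v j) * (cnj (U $$ (i,k)) * U $$ (i,j)))"
    by (simp only: cnj_sum complex_cnj_mult sum_product) (simp only: mult_ac)
  also have "\<dots> = (\<Sum>k<n. \<Sum>j<n. \<Sum>i<n. (cnj (vec_index v k) * vec_index v j) * (cnj (U $$ (i,k)) * U $$ (i,j)))"
    by (subst sum.swap, rule sum.cong[OF refl], subst sum.swap, rule refl)
  also have "\<dots> = (\<Sum>k<n. \<Sum>j<n. (cnj (vec_index v k) * vec_index v j) * (if k = j then 1 else 0))"
    by (intro sum.cong refl) (simp add: WU flip: sum_distrib_left)
  also have "\<dots> = (\<Sum>k<n. cnj (vec_index v k) * vec_index v k)"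
    by (intro sum.cong refl) (simp add: if_distrib cong: if_cong)
  finally have "cnj z * z * (\<Sum>k<n. cnj (vec_index v k) * vec_index v k) = (\<Sum>k<n. cnj (vec_index v k) * vec_index v k)"
    by (simp add: sum_distrib_left mult_ac)
  moreover have "(\<Sum>k<n. cnj (vec_index v k) * vec_index v k) \<noteq> 0"
  proof
    have "(\<Sum>k<n. cnj (vec_index v k) * vec_index v k) = of_real (\<Sum>k<n. (cmod (vec_index v k))\<^sup>2)"
      by (simp add: complex_norm_square mult.commute del: of_real_power)
    moreover assume "(\<Sum>k<n. cnj (vec_index v k) * vec_index v k) = 0"
    ultimately have "complex_of_real (\<Sum>k<n. (cmod (vec_index v k))\<^sup>2) = 0" by simp
    then have "(\<Sum>k<n. (cmod (vec_index v k))\<^sup>2) = 0" by (simp only: of_real_eq_0_iff)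
    then have "vec_index v k = 0" if "k < n" for k using that by (simp add: sum_nonneg_eq_0_iff)
    then have "v = 0\<^sub>v n" using v(1) by (intro eq_vecI) auto
    then show False using v by simp
  qed
  ultimately have "cnj z * z = 1" by simp
  then have "complex_of_real ((cmod z)\<^sup>2) = 1" by (simp only: complex_norm_square mult.commute)
  then have "(cmod z)\<^sup>2 = 1" by (simp only: of_real_eq_1_iff)
  then have "cmod z = 1 \<or> cmod z = - 1" by (simp add: power2_eq_1_iff)
  then show ?thesis using norm_ge_zero[of z] by linarith
qed

text \<open>The last claim links eigenvalues to the matrix: power sums are traces of powers,
  polynomial in the entries of U and their conjugates. All measurability and differentiation goes
  through them and not through the sorted angles. Negative powers come from conjugation, as the
  eigenvalues lie on the circle.\<close>

lemma eigenangles_props: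
  assumes U: "unitary_mat n U"
  shows "length (eigenangles U) = n"
    "i < n \<Longrightarrow> 0 \<le> eigenangles U ! i \<and> eigenangles U ! i < 2 * pi"
    "psum n m (eigen_points U) = mat_tr n (unitary_pow U m)"
proof -
  note Ud = unitary_matD[OF U]
  have ms: "mset (eigenangles U) = image_mset Arg2pi (proots (char_poly U))"
    by (simp add: eigenangles_def)
  show len: "length (eigenangles U) = n"
    using arg_cong[OF ms, of size] mat_tr_pow_eigenvalues(2)[OF Ud(1)] by simp
  show "0 \<le> eigenangles U ! i \<and> eigenangles U ! i < 2 * pi" if "i < n"
  proof -
    have "eigenangles U ! i \<in># mset (eigenangles U)" using that len by simp
    then show ?thesis unfolding ms using Arg2pi by auto
  qed
  have pos: "(\<Sum>j<n. eigen_points U j ^ k) = mat_tr n (U ^\<^sub>m k)" for k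
  proof -
    have "(\<Sum>j<n. eigen_points U j ^ k) = (\<Sum>t\<leftarrow>eigenangles U. cis t ^ k)"
      by (simp add: eigen_points_def len interv_sum_list_conv_sum_set_nat sum_list_sum_nth atLeast0LessThan)
    also have "\<dots> = (\<Sum>t\<in>#mset (eigenangles U). cis t ^ k)" by (simp add: sum_mset_sum_list flip: mset_map)
    also have "\<dots> = (\<Sum>z\<in>#proots (char_poly U). cis (Arg2pi z) ^ k)"
      unfolding ms by (simp add: image_mset.compositionality o_def)
    also have "\<dots> = (\<Sum>z\<in>#proots (char_poly U). z ^ k)"
    proof (intro arg_cong[of _ _ sum_mset] image_mset_cong)
      fix z assume "z \<in># proots (char_poly U)"
      then have "cmod z = 1" by (rule unitary_eigenvalue_norm[OF U])
      then have "cis (Arg2pi z) = z" using Arg2pi_eq[of z] by (simp add: cis_conv_exp)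
      then show "cis (Arg2pi z) ^ k = z ^ k" by simp
    qed
    also have "\<dots> = mat_tr n (U ^\<^sub>m k)" by (simp add: mat_tr_pow_eigenvalues(1)[OF Ud(1)])
    finally show ?thesis .
  qed
  have adj_pow: "\<forall>i<n. \<forall>j<n. (mat_adjoint U ^\<^sub>m k) $$ (i,j) = cnj ((U ^\<^sub>m k) $$ (j,i))" for k
  proof (induction k)
    case 0
    then show ?case using Ud by auto
  next
    case (Suc k)
    show ?case
    proof (intro allI impI)
      fix i j assume ij: "i < n" "j < n"
      have Uk: "U ^\<^sub>m k \<in> carrier_mat n n" "mat_adjoint U ^\<^sub>m k \<in> carrier_mat n n" using Ud by auto
      have comm: "U ^\<^sub>m Suc k = U * U ^\<^sub>m k"
      proof (induction k)
        case (Suc k)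
        then show ?case using assoc_mult_mat[OF Ud(1) pow_carrier_mat[OF Ud(1)] Ud(1), of k] by simp
      qed (use Ud(1) in simp)
      have "(mat_adjoint U ^\<^sub>m Suc k) $$ (i,j) = (\<Sum>l<n. cnj ((U ^\<^sub>m k) $$ (l,i)) * cnj (U $$ (j,l)))"
        using mat_mult_index[OF Uk(2) Ud(2) ij] Suc Ud(1) ij by simp
      also have "\<dots> = cnj ((U * U ^\<^sub>m k) $$ (j,i))"
        using mat_mult_index[OF Ud(1) Uk(1) ij(2,1)] by (simp add: mult.commute)
      finally show "(mat_adjoint U ^\<^sub>m Suc k) $$ (i,j) = cnj ((U ^\<^sub>m Suc k) $$ (j,i))" by (simp only: comm)
    qed
  qed
  show "psum n m (eigen_points U) = mat_tr n (unitary_pow U m)"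
  proof (cases "m \<ge> 0")
    case True
    then show ?thesis using pos[of "nat m"] by (simp add: psum_def unitary_pow_def power_int_def)
  next
    case False
    have "psum n m (eigen_points U) = (\<Sum>j<n. cnj (eigen_points U j ^ nat (-m)))"
      using False by (simp add: psum_def power_int_def eigen_points_def cis_cnj cis_inverse)
    also have "\<dots> = cnj (mat_tr n (U ^\<^sub>m nat (-m)))" by (simp add: pos[symmetric])
    also have "\<dots> = mat_tr n (unitary_pow U m)"
      using False adj_pow by (simp add: unitary_pow_def mat_tr_def)
    finally show ?thesis .
  qed
qed

lemma unitary_pow_carrier [simp]: "unitary_mat n U \<Longrightarrow> unitary_pow U m \<in> carrier_mat n n"
  using unitary_matD[of n U] by (auto simp: unitary_pow_def)

lemma unitary_pow_succ:
  assumes "unitary_mat n U"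
  shows "unitary_pow U m * U = unitary_pow U (m + 1)" "unitary_pow U m * mat_adjoint U = unitary_pow U (m - 1)"
proof -
  note Ud = unitary_matD[OF assms]
  have cancel: "A ^\<^sub>m Suc k * B = A ^\<^sub>m k"
    if "A \<in> carrier_mat n n" "B \<in> carrier_mat n n" "A * B = 1\<^sub>m n" for A B :: "complex mat" and k
  proof -
    have "A ^\<^sub>m Suc k * B = A ^\<^sub>m k * (A * B)"
      using assoc_mult_mat[OF pow_carrier_mat[OF that(1)] that(1,2), of k] by simp
    then show ?thesis by (simp only: that(3) right_mult_one_mat[OF pow_carrier_mat[OF that(1)]])
  qed
  have zero: "mat_adjoint U ^\<^sub>m 0 = U ^\<^sub>m 0" using Ud(1) by simp
  show "unitary_pow U m * U = unitary_pow U (m + 1)"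
  proof (cases "m \<ge> 0")
    case True
    then have "nat (m + 1) = Suc (nat m)" by simp
    then show ?thesis using True by (simp add: unitary_pow_def)
  next
    case False
    define k where "k = nat (- (m + 1))"
    have e: "nat (-m) = Suc k" using False by (simp add: k_def)
    have "unitary_pow U m * U = mat_adjoint U ^\<^sub>m k"
      using False by (simp only: unitary_pow_def e cancel[OF Ud(2,1,3)] if_False)
    also have "\<dots> = unitary_pow U (m + 1)"
    proof (cases "m = -1")
      case True
      then show ?thesis by (simp only: k_def unitary_pow_def) (use zero in simp)
    next
      case m: False
      then show ?thesis using False by (simp add: k_def unitary_pow_def)
    qed
    finally show ?thesis .
  qed
  show "unitary_pow U m * mat_adjoint U = unitary_pow U (m - 1)"
  proof (cases "m > 0")
    case False
    have "nat (-(m - 1)) = Suc (nat (-m))" using False by simp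
    moreover have "unitary_pow U m = mat_adjoint U ^\<^sub>m nat (-m)"
      using False zero by (cases "m = 0") (simp_all add: unitary_pow_def)
    ultimately show ?thesis using False by (simp add: unitary_pow_def)
  next
    case True
    define k where "k = nat (m - 1)"
    have e: "nat m = Suc k" using True by (simp add: k_def)
    show ?thesis
      using True cancel[OF Ud(1,2,4), of k] by (simp add: unitary_pow_def e k_def)
  qed
qed

lemma unitary_pow_add:
  assumes U: "unitary_mat n U"
  shows "unitary_pow U l * unitary_pow U m = unitary_pow U (l + m)"
proof (induction m rule: int_induct[where k = 0])
  case base
  have "unitary_pow U 0 = 1\<^sub>m n" using unitary_matD(1)[OF U] by (simp add: unitary_pow_def)
  then show ?case by (simp add: right_mult_one_mat[OF unitary_pow_carrier[OF U]])
next
  case (step1 m)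
  note assoc = assoc_mult_mat[OF unitary_pow_carrier[OF U] unitary_pow_carrier[OF U] unitary_matD(1)[OF U], of l m]
  have "unitary_pow U l * unitary_pow U (m + 1) = unitary_pow U l * unitary_pow U m * U"
    by (simp only: assoc unitary_pow_succ(1)[OF U])
  also have "\<dots> = unitary_pow U (l + (m + 1))"
    by (simp only: step1 unitary_pow_succ(1)[OF U] add.assoc)
  finally show ?case .
next
  case (step2 m)
  note assoc = assoc_mult_mat[OF unitary_pow_carrier[OF U] unitary_pow_carrier[OF U] unitary_matD(2)[OF U], of l m]
  have "unitary_pow U l * unitary_pow U (m - 1) = unitary_pow U l * unitary_pow U m * mat_adjoint U"
    by (simp only: assoc unitary_pow_succ(2)[OF U])
  also have "\<dots> = unitary_pow U (l + (m - 1))"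
    by (simp only: step2 unitary_pow_succ(2)[OF U] add_diff_eq)
  finally show ?case .
qed

section \<open>Measurability and translation for the Haar measure\<close>

definition haar_unitary :: "nat \<Rightarrow> complex mat measure \<Rightarrow> bool" where
  "haar_unitary n M \<longleftrightarrow> normalized_haar_measure (unitary_group n) (unitary_topology n) M"

lemma haar_space: "haar_unitary n M \<Longrightarrow> space M = {U. unitary_mat n U}"
  by (auto simp: haar_unitary_def normalized_haar_measure_def unitary_topology_def topspace_pullback_topology
      unitary_group_def unitary_mat_def)

lemma haar_prob: "haar_unitary n M \<Longrightarrow> prob_space M"
  by (simp add: haar_unitary_def normalized_haar_measure_def)

lemma haar_entry_measurable:
  assumes H: "haar_unitary n M" and ij: "i < n" "j < n"
  shows "(\<lambda>U. U $$ (i,j)) \<in> borel_measurable M"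
proof (rule borel_measurableI)
  fix S :: "complex set" assume S: "open S"
  define X where "X = product_topology (\<lambda>_. euclidean :: complex topology) ({..<n} \<times> {..<n})"
  have "continuous_map (unitary_topology n) X (id \<circ> (\<lambda>U. \<lambda>ij\<in>{..<n} \<times> {..<n}. U $$ ij))"
    unfolding unitary_topology_def X_def by (rule continuous_map_pullback) (rule continuous_map_id)
  then have "continuous_map (unitary_topology n) X (\<lambda>U. \<lambda>ij\<in>{..<n} \<times> {..<n}. U $$ ij)"
    by (simp only: id_comp)
  moreover have "continuous_map X euclidean (\<lambda>f. f (i,j))"
    unfolding X_def using ij by (intro continuous_map_product_projection) auto
  ultimately have "continuous_map (unitary_topology n) euclidean ((\<lambda>f. f (i,j)) \<circ> (\<lambda>U. \<lambda>ij\<in>{..<n} \<times> {..<n}. U $$ ij))"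
    by (rule continuous_map_compose)
  then have "continuous_map (unitary_topology n) euclidean (\<lambda>U. U $$ (i,j))"
    using ij by (simp add: o_def)
  then have "openin (unitary_topology n) {U \<in> topspace (unitary_topology n). U $$ (i,j) \<in> S}"
    using S by (intro openin_continuous_map_preimage) auto
  moreover have "{U \<in> topspace (unitary_topology n). U $$ (i,j) \<in> S} = (\<lambda>U. U $$ (i,j)) -` S \<inter> space M"
    using H by (auto simp: haar_unitary_def normalized_haar_measure_def)
  ultimately show "(\<lambda>U. U $$ (i,j)) -` S \<inter> space M \<in> sets M"
    using H unfolding haar_unitary_def normalized_haar_measure_def by (auto intro: sigma_sets.Basic)
qed

lemma unitary_entry_bound:
  assumes U: "unitary_mat n U" and ij: "i < n" "j < n"
  shows "cmod (U $$ (i,j)) \<le> 1"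
proof -
  note Ud = unitary_matD[OF U]
  have "(mat_adjoint U * U) $$ (j,j) = (\<Sum>k<n. cnj (U $$ (k,j)) * U $$ (k,j))"
    using mat_mult_index[OF Ud(2,1) ij(2,2)] Ud(1) ij by simp
  also have "\<dots> = of_real (\<Sum>k<n. (cmod (U $$ (k,j)))\<^sup>2)"
    by (simp add: complex_norm_square mult.commute del: of_real_power)
  finally have "complex_of_real (\<Sum>k<n. (cmod (U $$ (k,j)))\<^sup>2) = 1" using Ud(3) ij by simp
  then have "(\<Sum>k<n. (cmod (U $$ (k,j)))\<^sup>2) = 1" by (simp only: of_real_eq_1_iff)
  moreover have "(cmod (U $$ (i,j)))\<^sup>2 \<le> (\<Sum>k<n. (cmod (U $$ (k,j)))\<^sup>2)"
    using ij by (intro member_le_sum) auto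
  ultimately show ?thesis by (simp add: power2_le_imp_le abs_square_le_1)
qed

lemma unitary_mat_mult:
  assumes g: "unitary_mat n g" and U: "unitary_mat n U"
  shows "unitary_mat n (g * U)"
proof -
  note gd = unitary_matD[OF g] and Ud = unitary_matD[OF U]
  have adj: "mat_adjoint (g * U) = mat_adjoint U * mat_adjoint g"
    by (rule eq_matI) (use gd Ud in \<open>auto simp: scalar_prod_def mult.commute\<close>)
  have "mat_adjoint U * mat_adjoint g * (g * U) = mat_adjoint U * (mat_adjoint g * (g * U))"
    using gd Ud by (intro assoc_mult_mat[of _ n n _ n _ n]) auto
  also have "mat_adjoint g * (g * U) = (mat_adjoint g * g) * U"
    using gd Ud by (intro assoc_mult_mat[symmetric, of _ n n _ n _ n]) auto
  also have "\<dots> = U" using gd Ud by simp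
  finally show ?thesis using gd Ud by (simp add: unitary_mat_def adj)
qed

lemma unitary_mat_adjoint:
  assumes "unitary_mat n g"
  shows "unitary_mat n (mat_adjoint g)"
proof -
  note gd = unitary_matD[OF assms]
  have "mat_adjoint (mat_adjoint g) = g" by (rule eq_matI) auto
  then show ?thesis using gd by (simp add: unitary_mat_def)
qed

text \<open>Invariance speaks of images of measurable sets, so it is applied to level sets:
  translation by g maps the set where f(g U) lies in B onto the set where f lies in B. Hence f and
  its translate have the same distribution.\<close>

lemma haar_invariant_integral:
  fixes f :: "complex mat \<Rightarrow> complex"
  assumes H: "haar_unitary n M" and g: "unitary_mat n g"
    and f: "f \<in> borel_measurable M" and fg: "(\<lambda>U. f (g * U)) \<in> borel_measurable M"
  shows "(\<integral>U. f (g * U) \<partial>M) = (\<integral>U. f U \<partial>M)"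
proof -
  note gd = unitary_matD[OF g] and sp = haar_space[OF H]
  note gU = unitary_mat_mult[OF g] and adjU = unitary_mat_mult[OF unitary_mat_adjoint[OF g]]
  have gi: "mat_adjoint g * (g * U) = U" "g * (mat_adjoint g * U) = U" if "unitary_mat n U" for U
  proof -
    note Ud = unitary_matD[OF that]
    have "mat_adjoint g * (g * U) = (mat_adjoint g * g) * U"
      using gd Ud by (intro assoc_mult_mat[symmetric, of _ n n _ n _ n]) auto
    then show "mat_adjoint g * (g * U) = U" using gd Ud by simp
    have "g * (mat_adjoint g * U) = (g * mat_adjoint g) * U"
      using gd Ud by (intro assoc_mult_mat[symmetric, of _ n n _ n _ n]) auto
    then show "g * (mat_adjoint g * U) = U" using gd Ud by simp
  qed
  have "distr M borel (\<lambda>U. f (g * U)) = distr M borel f"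
  proof (rule measure_eqI)
    fix B assume "B \<in> sets (distr M borel (\<lambda>U. f (g * U)))"
    then have B: "B \<in> sets borel" by simp
    define S where "S = (\<lambda>U. f (g * U)) -` B \<inter> space M"
    have S: "S \<in> sets M" unfolding S_def using fg B by (rule measurable_sets)
    have "(\<lambda>x. g * x) ` S = f -` B \<inter> space M"
    proof (intro equalityI subsetI)
      fix V assume "V \<in> f -` B \<inter> space M"
      then show "V \<in> (\<lambda>x. g * x) ` S"
        using gi(2)[of V] adjU[of V] unfolding S_def sp by (intro image_eqI[of _ _ "mat_adjoint g * V"]) auto
    qed (use gU in \<open>auto simp: S_def sp\<close>)
    moreover have "emeasure M ((\<lambda>x. g * x) ` S) = emeasure M S"
      using H g S unfolding haar_unitary_def normalized_haar_measure_def unitary_mat_def unitary_group_def by auto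
    ultimately show "emeasure (distr M borel (\<lambda>U. f (g * U))) B = emeasure (distr M borel f) B"
      using f fg B by (simp add: emeasure_distr S_def)
  qed simp
  then have "(\<integral>x. x \<partial>distr M borel (\<lambda>U. f (g * U))) = (\<integral>x. x \<partial>distr M borel f)" by simp
  then show ?thesis using f fg by (simp add: integral_distr)
qed

section \<open>Differentiation of trigonometric families under the integral\<close>

text \<open>Finite sums of c_k(x) e^(i k \<theta>) with bounded measurable coefficients. Translates
  of entries along one-parameter phase rotations are of this kind, and the parameter separates from
  the integration variable.\<close>

inductive trig_family :: "'a measure \<Rightarrow> (real \<Rightarrow> 'a \<Rightarrow> complex) \<Rightarrow> bool" for M where
  base: "c \<in> borel_measurable M \<Longrightarrow> (\<And>x. x \<in> space M \<Longrightarrow> cmod (c x) \<le> B) \<Longrightarrow>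
      (\<And>x \<theta>. x \<in> space M \<Longrightarrow> f \<theta> x = c x * cis (of_int k * \<theta>)) \<Longrightarrow> trig_family M f"
| add: "trig_family M f \<Longrightarrow> trig_family M g \<Longrightarrow>
      (\<And>x \<theta>. x \<in> space M \<Longrightarrow> h \<theta> x = f \<theta> x + g \<theta> x) \<Longrightarrow> trig_family M h"

lemma trig_family_mult:
  assumes "trig_family M f" "trig_family M g"
  shows "trig_family M (\<lambda>\<theta> x. f \<theta> x * g \<theta> x)"
  using assms
proof (induction arbitrary: g)
  case (base c B f k)
  note b = base(1-3)
  from base(4) show ?case
  proof induction
    case (base d C g l)
    show ?case
    proof (rule trig_family.base[of "\<lambda>x. c x * d x" M "B * C" _ "k + l"])
      show "(\<lambda>x. c x * d x) \<in> borel_measurable M" using b base by measurable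
      show "cmod (c x * d x) \<le> B * C" if "x \<in> space M" for x
        unfolding norm_mult using b(2)[OF that] base(2)[OF that]
        by (intro mult_mono) (auto intro: order_trans[OF norm_ge_zero])
    qed (use b base in \<open>auto simp: ring_distribs mult_ac simp flip: cis_mult\<close>)
  next
    case (add g1 g2 h)
    show ?case by (rule trig_family.add[OF add.IH]) (simp add: add.hyps algebra_simps)
  qed
next
  case (add f1 f2 h)
  show ?case by (rule trig_family.add[OF add.IH(1)[OF add.prems] add.IH(2)[OF add.prems]]) (simp add: add.hyps algebra_simps)
qed

lemma trig_family_cong: "trig_family M f \<Longrightarrow> (\<And>x \<theta>. x \<in> space M \<Longrightarrow> g \<theta> x = f \<theta> x) \<Longrightarrow> trig_family M g"
proof (induction arbitrary: g rule: trig_family.induct)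
  case (base c B f k)
  show ?case by (rule trig_family.base[of c M B _ k]) (use base in auto)
next
  case (add f1 f2 h)
  show ?case by (rule trig_family.add[OF add.hyps(1,2)]) (use add in auto)
qed

lemma trig_family_const: "trig_family M (\<lambda>\<theta> x. c)"
  by (rule trig_family.base[of "\<lambda>x. c" M "cmod c" _ 0]) auto

lemma trig_family_add: "trig_family M f \<Longrightarrow> trig_family M g \<Longrightarrow> trig_family M (\<lambda>\<theta> x. f \<theta> x + g \<theta> x)"
  by (erule (1) trig_family.add) simp

lemma trig_family_sum:
  "finite A \<Longrightarrow> (\<And>i. i \<in> A \<Longrightarrow> trig_family M (f i)) \<Longrightarrow> trig_family M (\<lambda>\<theta> x. \<Sum>i\<in>A. f i \<theta> x)"
  by (induction A rule: finite_induct) (auto intro: trig_family_const trig_family_add)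

lemma trig_family_bounded_measurable:
  assumes "trig_family M f"
  shows "f \<theta> \<in> borel_measurable M \<and> (\<exists>B. \<forall>x\<in>space M. cmod (f \<theta> x) \<le> B)"
  using assms
proof induction
  case (base c B f k)
  have "f \<theta> \<in> borel_measurable M \<longleftrightarrow> (\<lambda>x. c x * cis (of_int k * \<theta>)) \<in> borel_measurable M"
    by (rule measurable_cong) (use base in auto)
  then show ?case using base by (auto intro!: exI[of _ B] simp: norm_mult)
next
  case (add f g h)
  from add.IH obtain B C where BC: "\<forall>x\<in>space M. cmod (f \<theta> x) \<le> B" "\<forall>x\<in>space M. cmod (g \<theta> x) \<le> C" by auto
  have "h \<theta> \<in> borel_measurable M \<longleftrightarrow> (\<lambda>x. f \<theta> x + g \<theta> x) \<in> borel_measurable M"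
    by (rule measurable_cong) (use add in auto)
  moreover have "cmod (h \<theta> x) \<le> B + C" if "x \<in> space M" for x
    using BC that add.hyps(3)[OF that, of \<theta>] by (auto intro: order_trans[OF norm_triangle_ineq] add_mono)
  ultimately show ?case using add.IH by auto
qed

lemma cis_deriv: "((\<lambda>\<theta>. cis (a * \<theta>)) has_vector_derivative \<i> * of_real a) (at 0)"
proof -
  have "((\<lambda>z. exp (\<i> * (of_real a * z))) has_field_derivative \<i> * of_real a) (at (of_real 0))"
    by (auto intro!: derivative_eq_intros)
  from has_vector_derivative_real_field[OF this] show ?thesis
    by (simp add: cis_conv_exp)
qed

text \<open>Each term integrates to a constant times e^(i k \<theta>), so differentiation under the
  integral is linearity.\<close>

lemma trig_family_integral_deriv:
  assumes "prob_space M" and "trig_family M f"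
    and "\<And>x. x \<in> space M \<Longrightarrow> ((\<lambda>\<theta>. f \<theta> x) has_vector_derivative d x) (at 0)"
  shows "((\<lambda>\<theta>. \<integral>x. f \<theta> x \<partial>M) has_vector_derivative (\<integral>x. d x \<partial>M)) (at 0)"
proof -
  interpret prob_space M by fact
  \<comment> \<open>The induction carries a derivative of its own, because a derivative given for a
    sum need not split into derivatives of the summands; uniqueness identifies the two
    afterwards.\<close>
  have "\<exists>d. integrable M d \<and> (\<forall>\<theta>. integrable M (f \<theta>)) \<and> (\<forall>x\<in>space M. ((\<lambda>\<theta>. f \<theta> x) has_vector_derivative d x) (at 0)) \<and>
     ((\<lambda>\<theta>. \<integral>x. f \<theta> x \<partial>M) has_vector_derivative (\<integral>x. d x \<partial>M)) (at 0)"
    using assms(2)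
  proof induction
    case (base c B f k)
    have c: "integrable M c" using base by (intro integrable_const_bound[of _ B]) auto
    have i: "integrable M (f \<theta>)" for \<theta>
    proof -
      have "integrable M (f \<theta>) \<longleftrightarrow> integrable M (\<lambda>x. c x * cis (of_int k * \<theta>))"
        by (rule Bochner_Integration.integrable_cong) (auto simp: base)
      then show ?thesis using c by simp
    qed
    have e: "(\<integral>x. f \<theta> x \<partial>M) = (\<integral>x. c x \<partial>M) * cis (of_int k * \<theta>)" for \<theta>
    proof -
      have "(\<integral>x. f \<theta> x \<partial>M) = (\<integral>x. c x * cis (of_int k * \<theta>) \<partial>M)"
        by (rule Bochner_Integration.integral_cong) (auto simp: base)
      then show ?thesis using c by simp
    qed
    show ?case
    proof (rule exI[of _ "\<lambda>x. c x * (\<i> * of_real (of_int k))"], intro conjI ballI allI i)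
      show "integrable M (\<lambda>x. c x * (\<i> * of_real (of_int k)))" using c by simp
      show "((\<lambda>\<theta>. f \<theta> x) has_vector_derivative c x * (\<i> * of_real (of_int k))) (at 0)" if "x \<in> space M" for x
        unfolding base(3)[OF that] by (rule has_vector_derivative_mult_right[OF cis_deriv])
      show "((\<lambda>\<theta>. \<integral>x. f \<theta> x \<partial>M) has_vector_derivative (\<integral>x. c x * (\<i> * of_real (of_int k)) \<partial>M)) (at 0)"
              proof -
        have "((\<lambda>\<theta>. (\<integral>x. c x \<partial>M) * cis (real_of_int k * \<theta>)) has_vector_derivative (\<integral>x. c x \<partial>M) * (\<i> * of_real (of_int k))) (at 0)"
          by (rule has_vector_derivative_mult_right[OF cis_deriv])
        then show ?thesis unfolding e using c by simp
      qed
    qed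
  next
    case (add f g h)
    then obtain d1 d2 where d: "integrable M d1" "\<And>\<theta>. integrable M (f \<theta>)" "\<And>x. x \<in> space M \<Longrightarrow> ((\<lambda>\<theta>. f \<theta> x) has_vector_derivative d1 x) (at 0)"
       "((\<lambda>\<theta>. \<integral>x. f \<theta> x \<partial>M) has_vector_derivative (\<integral>x. d1 x \<partial>M)) (at 0)"
       "integrable M d2" "\<And>\<theta>. integrable M (g \<theta>)" "\<And>x. x \<in> space M \<Longrightarrow> ((\<lambda>\<theta>. g \<theta> x) has_vector_derivative d2 x) (at 0)"
       "((\<lambda>\<theta>. \<integral>x. g \<theta> x \<partial>M) has_vector_derivative (\<integral>x. d2 x \<partial>M)) (at 0)" by blast
    have i: "integrable M (h \<theta>)" for \<theta>
    proof -
      have "integrable M (h \<theta>) \<longleftrightarrow> integrable M (\<lambda>x. f \<theta> x + g \<theta> x)"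
        by (rule Bochner_Integration.integrable_cong) (auto simp: add)
      then show ?thesis using d by simp
    qed
    have e: "(\<integral>x. h \<theta> x \<partial>M) = (\<integral>x. f \<theta> x \<partial>M) + (\<integral>x. g \<theta> x \<partial>M)" for \<theta>
    proof -
      have "(\<integral>x. h \<theta> x \<partial>M) = (\<integral>x. f \<theta> x + g \<theta> x \<partial>M)"
        by (rule Bochner_Integration.integral_cong) (auto simp: add)
      then show ?thesis using d by simp
    qed
    show ?case
    proof (rule exI[of _ "\<lambda>x. d1 x + d2 x"], intro conjI ballI allI i)
      show "((\<lambda>\<theta>. h \<theta> x) has_vector_derivative d1 x + d2 x) (at 0)" if "x \<in> space M" for x
        unfolding add.hyps(3)[OF that] by (intro has_vector_derivative_add d that)
      show "((\<lambda>\<theta>. \<integral>x. h \<theta> x \<partial>M) has_vector_derivative (\<integral>x. d1 x + d2 x \<partial>M)) (at 0)"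
        unfolding e using has_vector_derivative_add[OF d(4,8)] d by simp
    qed (use d in auto)
  qed
  then obtain d' where d': "\<And>x. x \<in> space M \<Longrightarrow> ((\<lambda>\<theta>. f \<theta> x) has_vector_derivative d' x) (at 0)"
     "((\<lambda>\<theta>. \<integral>x. f \<theta> x \<partial>M) has_vector_derivative (\<integral>x. d' x \<partial>M)) (at 0)" by blast
  have "(\<integral>x. d' x \<partial>M) = (\<integral>x. d x \<partial>M)"
    by (rule Bochner_Integration.integral_cong[OF refl])
       (use vector_derivative_unique_at[OF d'(1) assms(3)] in auto)
  with d'(2) show ?thesis by simp
qed

section \<open>Phase rotations and derivatives of matrix powers\<close>

text \<open>For a unit vector v this is the exponential of i \<theta> v v^*, in closed form because
  v v^* is a projection; its entries are trigonometric polynomials in \<theta>. For v = 0 it is the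
  identity.\<close>

definition phase_rotation :: "nat \<Rightarrow> (nat \<Rightarrow> complex) \<Rightarrow> real \<Rightarrow> complex mat" where
  "phase_rotation n v \<theta> = mat n n (\<lambda>(i,j). (if i = j then 1 else 0) + (cis \<theta> - 1) * (v i * cnj (v j)))"

lemma phase_rotation_carrier [simp]: "phase_rotation n v \<theta> \<in> carrier_mat n n"
  by (simp add: phase_rotation_def)

lemma phase_rotation_unitary:
  assumes v: "(\<Sum>i<n. v i * cnj (v i)) = 1"
  shows "unitary_mat n (phase_rotation n v \<theta>)"
  unfolding unitary_mat_def
proof (intro conjI)
  define c where "c = cis \<theta> - 1"
  \<comment> \<open>This says that 1 + c has modulus 1.\<close>
  have c: "c + cnj c + cnj c * c = 0" by (simp add: c_def algebra_simps cis_cnj cis_mult)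
  show "mat_adjoint (phase_rotation n v \<theta>) * phase_rotation n v \<theta> = 1\<^sub>m n"
  proof (rule eq_matI)
    fix i j assume ij: "i < dim_row (1\<^sub>m n)" "j < dim_col (1\<^sub>m n)"
    then have i: "i < n" and j: "j < n" by auto
    have "(mat_adjoint (phase_rotation n v \<theta>) * phase_rotation n v \<theta>) $$ (i,j)
       = (\<Sum>k<n. cnj (phase_rotation n v \<theta> $$ (k,i)) * phase_rotation n v \<theta> $$ (k,j))"
      using mat_mult_index[OF mat_adjoint_carrier phase_rotation_carrier i j, OF phase_rotation_carrier] i by (simp add: phase_rotation_def)
    also have "\<dots> = (\<Sum>k<n. (if k = i then (if i = j then 1 else 0) else 0)
         + (if k = i then c * (v i * cnj (v j)) else 0) + (if k = j then cnj c * (v i * cnj (v j)) else 0)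
         + cnj c * c * (v i * cnj (v j)) * (v k * cnj (v k)))"
      using i j by (intro sum.cong refl) (auto simp: phase_rotation_def c_def[symmetric] algebra_simps)
    also have "\<dots> = (if i = j then 1 else 0) + (c + cnj c + cnj c * c) * (v i * cnj (v j))"
    proof -
      have "(\<Sum>k<n. cnj c * c * (v i * cnj (v j)) * (v k * cnj (v k))) = cnj c * c * (v i * cnj (v j))"
        using v by (simp flip: sum_distrib_left)
      then show ?thesis unfolding sum.distrib using i j by (simp add: algebra_simps)
    qed
    finally show "(mat_adjoint (phase_rotation n v \<theta>) * phase_rotation n v \<theta>) $$ (i,j) = 1\<^sub>m n $$ (i,j)"
      using i j by (simp add: c)
  qed (auto simp: phase_rotation_def)
qed simp

lemma phase_rotation_zero [simp]: "phase_rotation n v 0 = 1\<^sub>m n" "phase_rotation n (\<lambda>_. 0) \<theta> = 1\<^sub>m n"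
  by (auto simp: phase_rotation_def intro!: eq_matI)

lemma phase_rotation_mult_index:
  assumes "U \<in> carrier_mat n n" "i < n" "j < n"
  shows "(phase_rotation n v \<theta> * U) $$ (i,j) = U $$ (i,j) + (cis \<theta> - 1) * (\<Sum>k<n. v i * cnj (v k) * U $$ (k,j))"
proof -
  have "(phase_rotation n v \<theta> * U) $$ (i,j)
     = (\<Sum>k<n. (if k = i then U $$ (i,j) else 0) + (cis \<theta> - 1) * (v i * cnj (v k) * U $$ (k,j)))"
    unfolding mat_mult_index[OF phase_rotation_carrier assms]
    using assms by (intro sum.cong refl) (auto simp: phase_rotation_def algebra_simps)
  then show ?thesis using assms by (simp add: sum.distrib sum_distrib_left)
qed

text \<open>\<open>pow_deriv U m a b c d\<close> is the \<open>(a,b)\<close> entry of the derivative of \<open>U \<mapsto> U\<^sup>m\<close> in the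
  direction \<open>E\<^sub>c\<^sub>d U\<close>, where \<open>E\<^sub>c\<^sub>d\<close> is a matrix unit.\<close>

definition pow_deriv :: "complex mat \<Rightarrow> int \<Rightarrow> nat \<Rightarrow> nat \<Rightarrow> nat \<Rightarrow> nat \<Rightarrow> complex" where
  "pow_deriv U m a b c d = (if m > 0
     then \<Sum>l<nat m. unitary_pow U (int l) $$ (a,c) * unitary_pow U (m - int l) $$ (d,b)
     else - (\<Sum>l<nat (-m). unitary_pow U (- (int l + 1)) $$ (a,c) * unitary_pow U (m + int l + 1) $$ (d,b)))"

lemma unitary_pow_add_index:
  assumes "unitary_mat n U" "i < n" "j < n"
  shows "(\<Sum>k<n. unitary_pow U l $$ (i,k) * unitary_pow U m $$ (k,j)) = unitary_pow U (l + m) $$ (i,j)"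
  using mat_mult_index[of "unitary_pow U l" n "unitary_pow U m" i j] assms
  by (simp add: unitary_pow_add)

lemma pow_deriv_trace:
  assumes U: "unitary_mat n U" and cd: "c < n" "d < n"
  shows "(\<Sum>a<n. pow_deriv U m a a c d) = of_int m * unitary_pow U m $$ (d,c)"
proof -
  have s: "(\<Sum>a<n. unitary_pow U l $$ (a,c) * unitary_pow U k $$ (d,a)) = unitary_pow U (k + l) $$ (d,c)" for l k
    using unitary_pow_add_index[OF U cd(2,1), of k l] by (simp add: mult.commute)
  show ?thesis
  proof (cases "m > 0")
    case True
    have "(\<Sum>a<n. pow_deriv U m a a c d) = (\<Sum>l<nat m. unitary_pow U (m - int l + int l) $$ (d,c))"
      using True unfolding pow_deriv_def s[symmetric] by simp (subst sum.swap, rule refl)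
    then show ?thesis using True by simp
  next
    case False
    have "(\<Sum>a<n. pow_deriv U m a a c d) = - (\<Sum>l<nat (-m). unitary_pow U ((m + int l + 1) + (- (int l + 1))) $$ (d,c))"
      using False unfolding pow_deriv_def s[symmetric] by (simp add: sum_negf) (subst sum.swap, rule refl)
    then show ?thesis using False by simp
  qed
qed

text \<open>Contracting entry indices with direction indices separates the two factors U^l and
  U^(m-l) into a product of traces.\<close>

lemma pow_deriv_diag:
  assumes U: "unitary_mat n U"
  shows "(\<Sum>a<n. \<Sum>b<n. pow_deriv U m a b a b) = loop_poly n m (eigen_points U)"
proof -
  have s: "(\<Sum>a<n. \<Sum>b<n. unitary_pow U l $$ (a,a) * unitary_pow U k $$ (b,b))
      = psum n l (eigen_points U) * psum n k (eigen_points U)" for l k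
    by (simp add: eigenangles_props(3)[OF U] mat_tr_def sum_product)
  have sw: "(\<Sum>a<n. \<Sum>b<n. \<Sum>l<N. f a b l) = (\<Sum>l<N. \<Sum>a<n. \<Sum>b<n. (f a b l :: complex))" for f and N :: nat
  proof -
    have "(\<Sum>a<n. \<Sum>b<n. \<Sum>l<N. f a b l) = (\<Sum>a<n. \<Sum>l<N. \<Sum>b<n. f a b l)"
      by (intro sum.cong refl sum.swap)
    also have "\<dots> = (\<Sum>l<N. \<Sum>a<n. \<Sum>b<n. f a b l)" by (rule sum.swap)
    finally show ?thesis .
  qed
  show ?thesis
  proof (cases "m > 0")
    case True
    then show ?thesis unfolding pow_deriv_def loop_poly_def by (simp add: sw s)
  next
    case False
    have "(\<Sum>a<n. \<Sum>b<n. pow_deriv U m a b a b)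
       = - (\<Sum>l<nat (-m). psum n (- (int l + 1)) (eigen_points U) * psum n (m + int l + 1) (eigen_points U))"
      using False unfolding pow_deriv_def by (simp add: sum_negf sw s)
    also have "(\<Sum>l<nat (-m). psum n (- (int l + 1)) (eigen_points U) * psum n (m + int l + 1) (eigen_points U))
       = (\<Sum>l<nat (-m). psum n (- int l) (eigen_points U) * psum n (m + int l) (eigen_points U))"
    \<comment> \<open>The summation index is reversed, l to -m - 1 - l; this exchanges the two
      exponents.\<close>
    proof (rule sum.reindex_bij_witness[of _ "\<lambda>l. nat (-m) - Suc l" "\<lambda>l. nat (-m) - Suc l"])
      fix l assume "l \<in> {..<nat (-m)}"
      then have "- int (nat (-m) - Suc l) = m + int l + 1" "m + int (nat (-m) - Suc l) = - (int l + 1)" by auto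
      then show "psum n (- int (nat (-m) - Suc l)) (eigen_points U) * psum n (m + int (nat (-m) - Suc l)) (eigen_points U)
        = psum n (- (int l + 1)) (eigen_points U) * psum n (m + int l + 1) (eigen_points U)"
        by (simp only: mult.commute)
    qed auto
    finally show ?thesis using False by (simp add: loop_poly_def)
  qed
qed

text \<open>\<open>P\<close> is any family obeying the recursion that the product rule yields from
  A^(k+1) = A^k A. It is used for the powers of a rotated matrix and for those of its
  adjoint.\<close>

lemma mat_pow_entry_deriv:
  fixes A :: "real \<Rightarrow> complex mat"
  assumes A: "\<And>\<theta>. A \<theta> \<in> carrier_mat n n"
    and dA: "\<And>i j. i < n \<Longrightarrow> j < n \<Longrightarrow> ((\<lambda>\<theta>. A \<theta> $$ (i,j)) has_vector_derivative A' i j) (at 0)"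
    and P0: "\<And>a b. a < n \<Longrightarrow> b < n \<Longrightarrow> P 0 a b = 0"
    and PS: "\<And>k a b. a < n \<Longrightarrow> b < n \<Longrightarrow> P (Suc k) a b = (\<Sum>e<n. (A 0 ^\<^sub>m k) $$ (a,e) * A' e b + P k a e * A 0 $$ (e,b))"
    and ab: "a < n" "b < n"
  shows "((\<lambda>\<theta>. (A \<theta> ^\<^sub>m k) $$ (a,b)) has_vector_derivative P k a b) (at 0)"
  using ab
proof (induction k arbitrary: a b)
  case 0
  have "(\<lambda>\<theta>. (A \<theta> ^\<^sub>m 0) $$ (a,b)) = (\<lambda>\<theta>. 1\<^sub>m n $$ (a,b))" using carrier_matD(1)[OF A] by (simp add: fun_eq_iff)
  then show ?case using P0 0 by simp
next
  case (Suc k)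
  have e: "(A \<theta> ^\<^sub>m Suc k) $$ (a,b) = (\<Sum>e<n. (A \<theta> ^\<^sub>m k) $$ (a,e) * A \<theta> $$ (e,b))" for \<theta>
    using mat_mult_index[OF pow_carrier_mat[OF A] A, of a b] Suc.prems by (simp only: pow_mat.simps)
  show ?case unfolding e PS[OF Suc.prems]
    by (intro has_vector_derivative_sum has_vector_derivative_mult Suc.IH dA) (use Suc.prems in auto)
qed

text \<open>The rotation has derivative i v v^* at 0, whose (c,d) entry is i v_c times the conjugate
  of v_d; the direction is thus the corresponding combination of the E_cd U. For m \<le> 0 the
  adjoint is differentiated, which brings the sign of \<open>pow_deriv\<close>.\<close>

lemma unitary_pow_deriv:
  assumes U: "unitary_mat n U" and ab: "a < n" "b < n"
  shows "((\<lambda>\<theta>. unitary_pow (phase_rotation n v \<theta> * U) m $$ (a,b)) has_vector_derivative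
     \<i> * (\<Sum>c<n. \<Sum>d<n. v c * cnj (v d) * pow_deriv U m a b c d)) (at 0)"
proof -
  note Ud = unitary_matD[OF U]
  define V where "V \<theta> = phase_rotation n v \<theta> * U" for \<theta>
  have V: "V \<theta> \<in> carrier_mat n n" for \<theta> unfolding V_def using Ud by (intro mult_carrier_mat[of _ n n]) auto
  have V0: "V 0 = U" using Ud by (simp add: V_def)
  have dV: "((\<lambda>\<theta>. V \<theta> $$ (i,j)) has_vector_derivative \<i> * (\<Sum>k<n. v i * cnj (v k) * U $$ (k,j))) (at 0)"
    if "i < n" "j < n" for i j
  proof -
    have "((\<lambda>\<theta>. U $$ (i,j) + (cis (1 * \<theta>) - 1) * (\<Sum>k<n. v i * cnj (v k) * U $$ (k,j))) has_vector_derivative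
       0 + (\<i> * of_real 1 - 0) * (\<Sum>k<n. v i * cnj (v k) * U $$ (k,j))) (at 0)"
      by (intro has_vector_derivative_add has_vector_derivative_const has_vector_derivative_mult_left
          has_vector_derivative_diff cis_deriv)
    then show ?thesis unfolding V_def phase_rotation_mult_index[OF Ud(1) that] by simp
  qed
  have up: "unitary_pow U (int k) = U ^\<^sub>m k" "unitary_pow U (- int k) = mat_adjoint U ^\<^sub>m k" for k
  proof -
    show "unitary_pow U (int k) = U ^\<^sub>m k" by (simp add: unitary_pow_def)
    show "unitary_pow U (- int k) = mat_adjoint U ^\<^sub>m k"
      using carrier_matD[OF Ud(1)] by (cases k) (simp_all add: unitary_pow_def del: of_nat_Suc)
  qed
  show ?thesis
  proof (cases "m > 0")
    case True
    define P where "P k a b = \<i> * (\<Sum>c<n. \<Sum>d<n. v c * cnj (v d) *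
       (\<Sum>l<k. unitary_pow U (int l) $$ (a,c) * unitary_pow U (int k - int l) $$ (d,b)))" for k a b
    have "((\<lambda>\<theta>. (V \<theta> ^\<^sub>m nat m) $$ (a,b)) has_vector_derivative P (nat m) a b) (at 0)"
    proof (rule mat_pow_entry_deriv[OF V dV _ _ ab])
      show "P 0 a b = 0" for a b by (simp add: P_def)
      fix k a b assume ab: "a < n" "b < n"
      have 1: "(\<Sum>e<n. P k a e * V 0 $$ (e,b)) = \<i> * (\<Sum>c<n. \<Sum>d<n. v c * cnj (v d) *
         (\<Sum>l<k. unitary_pow U (int l) $$ (a,c) * unitary_pow U (int (Suc k) - int l) $$ (d,b)))"
      proof -
        have "(\<Sum>e<n. P k a e * V 0 $$ (e,b)) = \<i> * (\<Sum>e<n. \<Sum>c<n. \<Sum>d<n. \<Sum>l<k. v c * cnj (v d) *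
           (unitary_pow U (int l) $$ (a,c) * (unitary_pow U (int k - int l) $$ (d,e) * unitary_pow U 1 $$ (e,b))))"
          using up(1)[of 1] Ud by (simp add: P_def V0 sum_distrib_left sum_distrib_right mult_ac)
        also have "(\<Sum>e<n. \<Sum>c<n. \<Sum>d<n. \<Sum>l<k. v c * cnj (v d) *
           (unitary_pow U (int l) $$ (a,c) * (unitary_pow U (int k - int l) $$ (d,e) * unitary_pow U 1 $$ (e,b))))
          = (\<Sum>c<n. \<Sum>d<n. \<Sum>l<k. v c * cnj (v d) *
           (unitary_pow U (int l) $$ (a,c) * (\<Sum>e<n. unitary_pow U (int k - int l) $$ (d,e) * unitary_pow U 1 $$ (e,b))))"
          unfolding sum_distrib_left
          by (subst sum.swap, rule sum.cong[OF refl], subst sum.swap, rule sum.cong[OF refl], subst sum.swap, rule refl)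
        also have "\<dots> = (\<Sum>c<n. \<Sum>d<n. \<Sum>l<k. v c * cnj (v d) *
           (unitary_pow U (int l) $$ (a,c) * unitary_pow U (int (Suc k) - int l) $$ (d,b)))"
        proof (intro sum.cong refl)
          fix c d l assume "d \<in> {..<n}"
          then have d: "d < n" by simp
          have eq: "int k - int l + 1 = int (Suc k) - int l" by simp
          have "(\<Sum>e<n. unitary_pow U (int k - int l) $$ (d,e) * unitary_pow U 1 $$ (e,b)) = unitary_pow U (int (Suc k) - int l) $$ (d,b)"
            using unitary_pow_add_index[OF U d ab(2), of "int k - int l" "1"] unfolding eq .
          then show "v c * cnj (v d) * (unitary_pow U (int l) $$ (a,c) * (\<Sum>e<n. unitary_pow U (int k - int l) $$ (d,e) * unitary_pow U 1 $$ (e,b)))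
             = v c * cnj (v d) * (unitary_pow U (int l) $$ (a,c) * unitary_pow U (int (Suc k) - int l) $$ (d,b))" by (simp only:)
        qed
        finally show ?thesis by (simp add: sum_distrib_left)
      qed
      have 2: "(\<Sum>e<n. (V 0 ^\<^sub>m k) $$ (a,e) * (\<i> * (\<Sum>d<n. v e * cnj (v d) * U $$ (d,b))))
         = \<i> * (\<Sum>c<n. \<Sum>d<n. v c * cnj (v d) * (unitary_pow U (int k) $$ (a,c) * unitary_pow U (int (Suc k) - int k) $$ (d,b)))"
        using up(1)[of k] up(1)[of 1] Ud by (simp add: V0 sum_distrib_left mult_ac)
      show "P (Suc k) a b = (\<Sum>e<n. (V 0 ^\<^sub>m k) $$ (a,e) * (\<i> * (\<Sum>d<n. v e * cnj (v d) * U $$ (d,b))) + P k a e * V 0 $$ (e,b))"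
        unfolding sum.distrib 1 2 by (simp add: P_def ring_distribs sum.distrib)
    qed
    then show ?thesis using True by (simp add: unitary_pow_def V_def P_def pow_deriv_def)
  next
    case False
    define W where "W \<theta> = mat_adjoint (V \<theta>)" for \<theta>
    have W: "W \<theta> \<in> carrier_mat n n" for \<theta> using V by (simp add: W_def)
    have W0: "W 0 = mat_adjoint U" by (simp add: W_def V0)
    have dW: "((\<lambda>\<theta>. W \<theta> $$ (i,j)) has_vector_derivative - \<i> * (\<Sum>c<n. v c * cnj (v j) * mat_adjoint U $$ (i,c))) (at 0)"
      if ij: "i < n" "j < n" for i j
    proof -
      have "((\<lambda>\<theta>. cnj (V \<theta> $$ (j,i))) has_vector_derivative cnj (\<i> * (\<Sum>k<n. v j * cnj (v k) * U $$ (k,i)))) (at 0)"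
        by (rule bounded_linear.has_vector_derivative[OF bounded_linear_cnj dV[OF ij(2,1)]])
      moreover have "(\<lambda>\<theta>. cnj (V \<theta> $$ (j,i))) = (\<lambda>\<theta>. W \<theta> $$ (i,j))"
        using V ij unfolding W_def by (auto simp: fun_eq_iff carrier_matD[OF V])
      ultimately show ?thesis using Ud(1) ij by (simp add: mult_ac)
    qed
    define P where "P k a b = - \<i> * (\<Sum>c<n. \<Sum>d<n. v c * cnj (v d) *
       (\<Sum>l<k. unitary_pow U (- (int l + 1)) $$ (a,c) * unitary_pow U (- int k + int l + 1) $$ (d,b)))" for k a b
    have "((\<lambda>\<theta>. (W \<theta> ^\<^sub>m nat (-m)) $$ (a,b)) has_vector_derivative P (nat (-m)) a b) (at 0)"
    proof (rule mat_pow_entry_deriv[OF W dW _ _ ab])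
      show "P 0 a b = 0" for a b by (simp add: P_def)
      fix k a b assume ab: "a < n" "b < n"
      have 1: "(\<Sum>e<n. P k a e * W 0 $$ (e,b)) = - \<i> * (\<Sum>c<n. \<Sum>d<n. v c * cnj (v d) *
         (\<Sum>l<k. unitary_pow U (- (int l + 1)) $$ (a,c) * unitary_pow U (- int (Suc k) + int l + 1) $$ (d,b)))"
      proof -
        have "(\<Sum>e<n. P k a e * W 0 $$ (e,b)) = - \<i> * (\<Sum>e<n. \<Sum>c<n. \<Sum>d<n. \<Sum>l<k. v c * cnj (v d) *
           (unitary_pow U (- (int l + 1)) $$ (a,c) * (unitary_pow U (- int k + int l + 1) $$ (d,e) * unitary_pow U (-1) $$ (e,b))))"
          using up(2)[of 1] Ud by (simp add: P_def W0 sum_distrib_left sum_distrib_right sum_negf mult_ac)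
        also have "(\<Sum>e<n. \<Sum>c<n. \<Sum>d<n. \<Sum>l<k. v c * cnj (v d) *
           (unitary_pow U (- (int l + 1)) $$ (a,c) * (unitary_pow U (- int k + int l + 1) $$ (d,e) * unitary_pow U (-1) $$ (e,b))))
          = (\<Sum>c<n. \<Sum>d<n. \<Sum>l<k. v c * cnj (v d) *
           (unitary_pow U (- (int l + 1)) $$ (a,c) * (\<Sum>e<n. unitary_pow U (- int k + int l + 1) $$ (d,e) * unitary_pow U (-1) $$ (e,b))))"
          unfolding sum_distrib_left
          by (subst sum.swap, rule sum.cong[OF refl], subst sum.swap, rule sum.cong[OF refl], subst sum.swap, rule refl)
        also have "\<dots> = (\<Sum>c<n. \<Sum>d<n. \<Sum>l<k. v c * cnj (v d) *
           (unitary_pow U (- (int l + 1)) $$ (a,c) * unitary_pow U (- int (Suc k) + int l + 1) $$ (d,b)))"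
        proof (intro sum.cong refl)
          fix c d l assume "d \<in> {..<n}"
          then have d: "d < n" by simp
          have eq: "- int k + int l + 1 + -1 = - int (Suc k) + int l + 1" by simp
          have "(\<Sum>e<n. unitary_pow U (- int k + int l + 1) $$ (d,e) * unitary_pow U (-1) $$ (e,b)) = unitary_pow U (- int (Suc k) + int l + 1) $$ (d,b)"
            using unitary_pow_add_index[OF U d ab(2), of "- int k + int l + 1" "-1"] unfolding eq .
          then show "v c * cnj (v d) * (unitary_pow U (- (int l + 1)) $$ (a,c) * (\<Sum>e<n. unitary_pow U (- int k + int l + 1) $$ (d,e) * unitary_pow U (-1) $$ (e,b)))
             = v c * cnj (v d) * (unitary_pow U (- (int l + 1)) $$ (a,c) * unitary_pow U (- int (Suc k) + int l + 1) $$ (d,b))" by (simp only:)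
        qed
        finally show ?thesis by (simp add: sum_distrib_left)
      qed
      have 2: "(\<Sum>e<n. (W 0 ^\<^sub>m k) $$ (a,e) * (- \<i> * (\<Sum>c<n. v c * cnj (v b) * mat_adjoint U $$ (e,c))))
         = - \<i> * (\<Sum>c<n. \<Sum>d<n. v c * cnj (v d) * (unitary_pow U (- (int k + 1)) $$ (a,c) * unitary_pow U (- int (Suc k) + int k + 1) $$ (d,b)))"
      proof -
        have "(\<Sum>d<n. v c * cnj (v d) * (x * unitary_pow U (- int (Suc k) + int k + 1) $$ (d,b))) = v c * cnj (v b) * x" for c x
        proof -
          have "(\<Sum>d<n. v c * cnj (v d) * (x * unitary_pow U (- int (Suc k) + int k + 1) $$ (d,b)))
             = (\<Sum>d<n. if d = b then v c * cnj (v b) * x else 0)"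
            using up(1)[of 0] Ud ab by (intro sum.cong refl) auto
          then show ?thesis using ab by simp
        qed
        then have "- \<i> * (\<Sum>c<n. \<Sum>d<n. v c * cnj (v d) * (unitary_pow U (- (int k + 1)) $$ (a,c) * unitary_pow U (- int (Suc k) + int k + 1) $$ (d,b)))
          = - \<i> * (\<Sum>c<n. v c * cnj (v b) * unitary_pow U (- (int k + 1)) $$ (a,c))" by simp
        also have "(\<Sum>c<n. v c * cnj (v b) * unitary_pow U (- (int k + 1)) $$ (a,c))
          = (\<Sum>c<n. v c * cnj (v b) * (\<Sum>e<n. unitary_pow U (- int k) $$ (a,e) * unitary_pow U (-1) $$ (e,c)))"
          by (intro sum.cong refl) (use ab in \<open>simp add: unitary_pow_add_index[OF U]\<close>)
        also have "\<dots> = (\<Sum>e<n. \<Sum>c<n. v c * cnj (v b) * (unitary_pow U (- int k) $$ (a,e) * unitary_pow U (-1) $$ (e,c)))"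
          unfolding sum_distrib_left by (rule sum.swap)
        finally show ?thesis
          using up(2)[of k] up(2)[of 1] Ud by (simp add: W0 sum_distrib_left mult_ac sum_negf)
      qed
      show "P (Suc k) a b = (\<Sum>e<n. (W 0 ^\<^sub>m k) $$ (a,e) * (- \<i> * (\<Sum>c<n. v c * cnj (v b) * mat_adjoint U $$ (e,c))) + P k a e * W 0 $$ (e,b))"
        unfolding sum.distrib 1 2 by (simp add: P_def ring_distribs sum.distrib)
    qed
    moreover have "unitary_pow (V \<theta>) m = W \<theta> ^\<^sub>m nat (-m)" for \<theta>
      using False carrier_matD[OF V] by (cases "m = 0") (auto simp: unitary_pow_def W_def)
    ultimately show ?thesis using False by (simp add: V_def P_def pow_deriv_def sum_negf)
  qed
qed

text \<open>Only power sums need matrix calculus, through the trace of the derivative of a power.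
  Sums and products then obey the very rules by which \<open>euler_grad\<close> builds its
  lists.\<close>

lemma eigen_points_deriv:
  assumes U: "unitary_mat n U" and v: "(\<Sum>i<n. v i * cnj (v i)) = 1" and F: "euler_grad n F xs"
  shows "((\<lambda>\<theta>. F (eigen_points (phase_rotation n v \<theta> * U))) has_vector_derivative
     (\<Sum>(l,J)\<leftarrow>xs. J (eigen_points U) * (\<i> * (\<Sum>c<n. \<Sum>d<n. v c * cnj (v d) * unitary_pow U l $$ (d,c))))) (at 0)"
  using F
proof induction
  case (const c)
  then show ?case by simp
next
  case (psum m)
  have uV: "unitary_mat n (phase_rotation n v \<theta> * U)" for \<theta>
    by (rule unitary_mat_mult[OF phase_rotation_unitary[OF v] U])
  have "((\<lambda>\<theta>. \<Sum>a<n. unitary_pow (phase_rotation n v \<theta> * U) m $$ (a,a)) has_vector_derivative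
     (\<Sum>a<n. \<i> * (\<Sum>c<n. \<Sum>d<n. v c * cnj (v d) * pow_deriv U m a a c d))) (at 0)"
    by (intro has_vector_derivative_sum unitary_pow_deriv U) auto
  also have "(\<lambda>\<theta>. \<Sum>a<n. unitary_pow (phase_rotation n v \<theta> * U) m $$ (a,a)) = (\<lambda>\<theta>. psum n m (eigen_points (phase_rotation n v \<theta> * U)))"
    by (simp add: eigenangles_props(3)[OF uV] mat_tr_def)
  also have "(\<Sum>a<n. \<i> * (\<Sum>c<n. \<Sum>d<n. v c * cnj (v d) * pow_deriv U m a a c d))
     = \<i> * (\<Sum>c<n. \<Sum>d<n. v c * cnj (v d) * (\<Sum>a<n. pow_deriv U m a a c d))"
    unfolding sum_distrib_left by (subst sum.swap, rule sum.cong[OF refl], subst sum.swap, rule refl)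
  also have "\<dots> = \<i> * (\<Sum>c<n. \<Sum>d<n. v c * cnj (v d) * (of_int m * unitary_pow U m $$ (d,c)))"
    by (intro arg_cong[where f = "\<lambda>x. \<i> * x"] sum.cong refl) (simp add: pow_deriv_trace[OF U])
  finally show ?case by (simp add: sum_distrib_left mult_ac)
next
  case (add F xs G ys)
  then show ?case by (simp add: has_vector_derivative_add)
next
  case (mult F xs G ys)
  have z: "phase_rotation n v 0 * U = U" using unitary_matD(1)[OF U] by simp
  have e: "(\<Sum>(m,K)\<leftarrow>map (\<lambda>(m,K). (m, \<lambda>z. K z * H z)) us. K (eigen_points U) * (\<i> * (\<Sum>c<n. \<Sum>d<n. v c * cnj (v d) * unitary_pow U m $$ (d,c))))
     = (\<Sum>(m,K)\<leftarrow>us. K (eigen_points U) * (\<i> * (\<Sum>c<n. \<Sum>d<n. v c * cnj (v d) * unitary_pow U m $$ (d,c)))) * H (eigen_points U)"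
    for us :: "(int \<times> ((nat \<Rightarrow> complex) \<Rightarrow> complex)) list" and H
    by (induction us) (auto simp: ring_distribs mult_ac)
  from has_vector_derivative_mult[OF mult.IH] show ?case
    unfolding map_append sum_list_append e z by (simp only: add.commute mult.commute)
qed

section \<open>Loop equations for the Haar measure\<close>

lemma trig_family_entries:
  assumes H: "haar_unitary n M" and rot: "\<And>\<theta>. unitary_mat n (phase_rotation n v \<theta>)" and ab: "a < n" "b < n"
  shows "trig_family M (\<lambda>\<theta> U. unitary_pow (phase_rotation n v \<theta> * U) m $$ (a,b))"
proof -
  note sp = haar_space[OF H]
  have entry: "trig_family M (\<lambda>\<theta> U. U $$ (i,j))" if "i < n" "j < n" for i j
    by (rule trig_family.base[of "\<lambda>U. U $$ (i,j)" M 1 _ 0])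
       (use haar_entry_measurable[OF H that] unitary_entry_bound that in \<open>auto simp: sp\<close>)
  have entry': "trig_family M (\<lambda>\<theta> U. cnj (U $$ (i,j)))" if "i < n" "j < n" for i j
  proof (rule trig_family.base[of "\<lambda>U. cnj (U $$ (i,j))" M 1 _ 0])
    show "(\<lambda>U. cnj (U $$ (i,j))) \<in> borel_measurable M"
      by (rule measurable_compose[OF haar_entry_measurable[OF H that] borel_measurable_continuous_onI[OF continuous_on_cnj[OF continuous_on_id]]])
  qed (use unitary_entry_bound that in \<open>auto simp: sp\<close>)
  have ph: "trig_family M (\<lambda>\<theta> U. cis (of_int k * \<theta>))" for k
    by (rule trig_family.base[of "\<lambda>U. 1" M 1 _ k]) auto
  have V: "trig_family M (\<lambda>\<theta> U. (phase_rotation n v \<theta> * U) $$ (i,j))" if ij: "i < n" "j < n" for i j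
  proof (rule trig_family_cong)
    show "trig_family M (\<lambda>\<theta> U. U $$ (i,j) + (cis (of_int 1 * \<theta>) + -1) * (\<Sum>k<n. v i * cnj (v k) * U $$ (k,j)))"
      by (intro trig_family_add trig_family_mult trig_family_sum trig_family_const entry ph that) (use that in auto)
    show "(phase_rotation n v \<theta> * U) $$ (i,j) = U $$ (i,j) + (cis (of_int 1 * \<theta>) + -1) * (\<Sum>k<n. v i * cnj (v k) * U $$ (k,j))"
      if "U \<in> space M" for U \<theta>
      using that phase_rotation_mult_index[of U n i j v \<theta>] ij unitary_matD(1) by (auto simp: sp)
  qed
  have W: "trig_family M (\<lambda>\<theta> U. mat_adjoint (phase_rotation n v \<theta> * U) $$ (i,j))" if ij: "i < n" "j < n" for i j
  proof (rule trig_family_cong)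
    show "trig_family M (\<lambda>\<theta> U. cnj (U $$ (j,i)) + (cis (of_int (-1) * \<theta>) + -1) * (\<Sum>k<n. cnj (v j) * v k * cnj (U $$ (k,i))))"
      by (intro trig_family_add trig_family_mult trig_family_sum trig_family_const entry' ph that) (use that in auto)
    show "mat_adjoint (phase_rotation n v \<theta> * U) $$ (i,j) = cnj (U $$ (j,i)) + (cis (of_int (-1) * \<theta>) + -1) * (\<Sum>k<n. cnj (v j) * v k * cnj (U $$ (k,i)))"
      if "U \<in> space M" for U \<theta>
    proof -
      have Uc: "U \<in> carrier_mat n n" using that unitary_matD(1) by (auto simp: sp)
      have "mat_adjoint (phase_rotation n v \<theta> * U) $$ (i,j) = cnj ((phase_rotation n v \<theta> * U) $$ (j,i))"
        using Uc ij carrier_matD[OF phase_rotation_carrier, of n v \<theta>] by (intro mat_adjoint_index) auto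
      then show ?thesis unfolding phase_rotation_mult_index[OF Uc ij(2,1)] by (simp add: cis_cnj)
    qed
  qed
  have powtrig: "trig_family M (\<lambda>\<theta> U. (A \<theta> U ^\<^sub>m k) $$ (a,b))"
    if A: "\<And>\<theta> U. U \<in> space M \<Longrightarrow> A \<theta> U \<in> carrier_mat n n"
      and tA: "\<And>i j. i < n \<Longrightarrow> j < n \<Longrightarrow> trig_family M (\<lambda>\<theta> U. A \<theta> U $$ (i,j))"
      and ab: "a < n" "b < n" for A k a b
    using ab
  proof (induction k arbitrary: a b)
    case 0
    show ?case by (rule trig_family_cong[OF trig_family_const[of M "1\<^sub>m n $$ (a,b)"]]) (use carrier_matD(1)[OF A] in simp)
  next
    case (Suc k)
    show ?case
    proof (rule trig_family_cong)
      show "trig_family M (\<lambda>\<theta> U. \<Sum>e<n. (A \<theta> U ^\<^sub>m k) $$ (a,e) * A \<theta> U $$ (e,b))"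
        by (intro trig_family_sum trig_family_mult Suc.IH tA) (use Suc.prems in auto)
      show "(A \<theta> U ^\<^sub>m Suc k) $$ (a,b) = (\<Sum>e<n. (A \<theta> U ^\<^sub>m k) $$ (a,e) * A \<theta> U $$ (e,b))" if "U \<in> space M" for U \<theta>
        using mat_mult_index[OF pow_carrier_mat[OF A[OF that, of \<theta>]] A[OF that, of \<theta>] Suc.prems] by (simp only: pow_mat.simps)
    qed
  qed
  have uV: "unitary_mat n (phase_rotation n v \<theta> * U)" if "U \<in> space M" for U \<theta>
    using unitary_mat_mult[OF rot] that by (auto simp: sp)
  show ?thesis
  proof (cases "m \<ge> 0")
    case True
    then show ?thesis unfolding unitary_pow_def
      by simp (intro powtrig V ab, use unitary_matD(1)[OF uV] in auto)
  next
    case False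
    then show ?thesis unfolding unitary_pow_def
      by simp (intro powtrig W ab, use unitary_matD(2)[OF uV] in auto)
  qed
qed

lemma trig_family_symL:
  assumes H: "haar_unitary n M" and rot: "\<And>\<theta>. unitary_mat n (phase_rotation n v \<theta>)" and F: "F \<in> symL n"
  shows "trig_family M (\<lambda>\<theta> U. F (eigen_points (phase_rotation n v \<theta> * U)))"
  using F
proof induction
  case (psum m)
  show ?case
  proof (rule trig_family_cong)
    show "trig_family M (\<lambda>\<theta> U. \<Sum>a<n. unitary_pow (phase_rotation n v \<theta> * U) m $$ (a,a))"
      by (intro trig_family_sum trig_family_entries[OF H rot]) auto
    show "psum n m (eigen_points (phase_rotation n v \<theta> * U)) = (\<Sum>a<n. unitary_pow (phase_rotation n v \<theta> * U) m $$ (a,a))"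
      if "U \<in> space M" for U \<theta>
      using unitary_mat_mult[OF rot, of U \<theta>] that haar_space[OF H] by (simp add: eigenangles_props(3) mat_tr_def)
  qed
qed (auto intro: trig_family_const trig_family_add trig_family_mult)

lemma unitary_one: "unitary_mat n (1\<^sub>m n)"
proof -
  have "mat_adjoint (1\<^sub>m n) = (1\<^sub>m n :: complex mat)" by (rule eq_matI) auto
  then show ?thesis by (simp add: unitary_mat_def)
qed

lemma haar_bounded_entry:
  assumes H: "haar_unitary n M" and ab: "a < n" "b < n"
  shows "trig_family M (\<lambda>\<theta> U. unitary_pow U m $$ (a,b))"
proof -
  \<comment> \<open>With v = 0 the rotation is the identity, so plain entries appear as a family
    constant in \<theta>, and boundedness and measurability come with it.\<close>
  have "trig_family M (\<lambda>\<theta> U. unitary_pow (phase_rotation n (\<lambda>_. 0) \<theta> * U) m $$ (a,b))"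
    by (rule trig_family_entries[OF H _ ab]) (simp add: unitary_one)
  then show ?thesis
    by (rule trig_family_cong) (use haar_space[OF H] in \<open>auto simp: left_mult_one_mat[OF unitary_matD(1)]\<close>)
qed

lemma haar_bounded_symL:
  assumes H: "haar_unitary n M" and F: "F \<in> symL n"
  shows "trig_family M (\<lambda>\<theta> U. F (eigen_points U))"
proof -
  have "trig_family M (\<lambda>\<theta> U. F (eigen_points (phase_rotation n (\<lambda>_. 0) \<theta> * U)))"
    by (rule trig_family_symL[OF H _ F]) (simp add: unitary_one)
  then show ?thesis
    by (rule trig_family_cong) (use haar_space[OF H] in \<open>auto simp: left_mult_one_mat[OF unitary_matD(1)]\<close>)
qed

lemma trig_family_integrable:
  assumes "haar_unitary n M" "trig_family M f"
  shows "integrable M (f \<theta>)"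
proof -
  interpret prob_space M by (rule haar_prob) fact
  from trig_family_bounded_measurable[OF assms(2), of \<theta>] obtain B where
    "f \<theta> \<in> borel_measurable M" "\<forall>x\<in>space M. cmod (f \<theta> x) \<le> B" by auto
  then show ?thesis by (intro integrable_const_bound[of _ B]) auto
qed

lemma integral_double_sum:
  fixes f :: "nat \<Rightarrow> nat \<Rightarrow> 'a \<Rightarrow> complex"
  assumes f: "\<And>c d. c < n \<Longrightarrow> d < n \<Longrightarrow> integrable M (f c d)"
  shows "(\<integral>x. (\<Sum>c<n. \<Sum>d<n. k c d * f c d x) \<partial>M) = (\<Sum>c<n. \<Sum>d<n. k c d * (\<integral>x. f c d x \<partial>M))"
proof -
  have "(\<integral>x. (\<Sum>c<n. \<Sum>d<n. k c d * f c d x) \<partial>M) = (\<Sum>c<n. \<integral>x. (\<Sum>d<n. k c d * f c d x) \<partial>M)"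
    by (intro Bochner_Integration.integral_sum Bochner_Integration.integrable_sum integrable_mult_right f) auto
  also have "\<dots> = (\<Sum>c<n. \<Sum>d<n. \<integral>x. k c d * f c d x \<partial>M)"
    by (intro sum.cong refl Bochner_Integration.integral_sum integrable_mult_right f) auto
  finally show ?thesis by simp
qed

text \<open>Polarisation: unit vectors e_c give the diagonal, and (e_c + e_d) / sqrt 2 together with
  (e_c + i e_d) / sqrt 2 give the sum and the difference of the two off-diagonal entries.\<close>

lemma quadratic_form_zero:
  fixes M :: "nat \<Rightarrow> nat \<Rightarrow> complex"
  assumes q: "\<And>v. (\<Sum>i<n. v i * cnj (v i)) = 1 \<Longrightarrow> (\<Sum>c<n. \<Sum>d<n. v c * cnj (v d) * M c d) = 0"
    and cd: "c < n" "d < n"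
  shows "M c d = 0"
proof -
  have diag: "M c c = 0" if c: "c < n" for c
  proof -
    have d: "(\<Sum>i<n. (if i = c then 1 else 0) * g i) = (g c :: complex)" for g
      using c by (simp add: if_distrib[of "\<lambda>x. x * y" for y] cong: if_cong)
    have d': "(\<Sum>i<n. cnj (if i = c then 1 else 0) * g i) = (g c :: complex)" for g
      using d[of g] by (simp add: if_distrib cong: if_cong)
    have "(\<Sum>a<n. \<Sum>b<n. (if a = c then 1 else 0) * cnj (if b = c then 1 else 0) * M a b) = M c c"
      by (simp only: mult.assoc sum_distrib_left[symmetric] d d')
    moreover have "(\<Sum>i<n. (if i = c then 1 else 0) * cnj (if i = c then 1 else 0)) = (1::complex)"
      by (simp only: d) simp
    ultimately show ?thesis using q[of "\<lambda>i. if i = c then 1 else 0"] by simp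
  qed
  show ?thesis
  proof (cases "c = d")
    case True
    then show ?thesis using diag cd by simp
  next
    case False
    define u where "u x y i = (if i = c then x else if i = d then y else 0)" for x y :: complex and i
    have two: "(\<Sum>i<n. u x y i * g i) = x * g c + y * g d" for x y g
    proof -
      have "(\<Sum>i<n. u x y i * g i) = (\<Sum>i\<in>{c,d}. u x y i * g i)"
        using cd by (intro sum.mono_neutral_right) (auto simp: u_def)
      then show ?thesis using False by (simp add: u_def)
    qed
    have cu: "cnj (u x y i) = u (cnj x) (cnj y) i" for x y i by (simp add: u_def)
    have eq: "cnj y * M c d * x + y * cnj x * M d c = 0" if n: "x * cnj x + y * cnj y = 1" for x y
    proof -
      have "(\<Sum>i<n. u x y i * cnj (u x y i)) = 1" unfolding two using n False by (simp add: u_def)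
      from q[OF this] have "(\<Sum>a<n. u x y a * (\<Sum>b<n. u (cnj x) (cnj y) b * M a b)) = 0"
        by (simp add: cu sum_distrib_left mult.assoc)
      then show ?thesis unfolding two using diag cd by (simp add: algebra_simps)
    qed
    define s where "s = complex_of_real (1 / sqrt 2)"
    have ss: "s * s = 1 / 2" unfolding s_def of_real_mult[symmetric] by simp
    have s0: "s \<noteq> 0" and cs: "cnj s = s" by (simp_all add: s_def)
    have "s * cnj s + s * cnj s = 1" by (simp add: cs ss)
    from eq[OF this] have "s * M c d * s + s * s * M d c = 0" by (simp only: cs)
    then have "(s * s) * (M c d + M d c) = 0" by (simp add: algebra_simps)
    then have 1: "M c d + M d c = 0" by (simp add: ss)
    have "cnj (\<i> * s) * M c d * s + \<i> * s * cnj s * M d c = 0"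
      by (rule eq) (simp add: cs ss mult_ac flip: mult.assoc[of s s])
    then have "\<i> * (s * s) * (M d c - M c d) = 0" by (simp add: cs algebra_simps)
    then have "M d c = M c d" by (simp add: ss)
    with 1 show ?thesis by simp
  qed
qed

text \<open>Invariance of the Haar measure under the phase rotations \<open>1 + (e\<^sup>i\<^sup>\<theta> - 1) v v\<^sup>*\<close>, differentiated
  at \<open>\<theta> = 0\<close>; since the projections \<open>v v\<^sup>*\<close> span all matrices, the derivative in the direction of every
  matrix unit has mean zero, and the loop equation is the sum over the matrix units.\<close>

lemma haar_loop_equation:
  assumes H: "haar_unitary n M" and K: "K \<in> symL n"
  shows "(\<integral>U. loop_div n m K (eigen_points U) \<partial>M) = 0"
proof -
  note sp = haar_space[OF H]
  \<comment> \<open>The (a,b) entry of the derivative of K(U) U^m in the direction E_cd U.\<close>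
  define \<tau> where "\<tau> a b c d U = (\<Sum>(l,J)\<leftarrow>grad_list n K. J (eigen_points U) * unitary_pow U l $$ (d,c)) * unitary_pow U m $$ (a,b)
     + K (eigen_points U) * pow_deriv U m a b c d" for a b c d U
  have trig_list: "trig_family M (\<lambda>\<theta> U. \<Sum>(l,J)\<leftarrow>xs. J (eigen_points U) * unitary_pow U l $$ (d,c))"
    if "\<And>m J. (m,J) \<in> set xs \<Longrightarrow> J \<in> symL n" "c < n" "d < n" for xs c d
    using that(1)
  proof (induction xs)
    case Nil
    show ?case by (simp add: trig_family_const)
  next
    case (Cons x xs)
    obtain l J where x: "x = (l,J)" by force
    have "J \<in> symL n" using Cons.prems[of l J] x by simp
    moreover have "trig_family M (\<lambda>\<theta> U. \<Sum>(l,J)\<leftarrow>xs. J (eigen_points U) * unitary_pow U l $$ (d,c))"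
      using Cons by auto
    ultimately show ?case unfolding x using that
      by (simp add: trig_family_add trig_family_mult haar_bounded_symL[OF H] haar_bounded_entry[OF H])
  qed
  have tpd: "trig_family M (\<lambda>\<theta> U. pow_deriv U m a b c d)" if "a < n" "b < n" "c < n" "d < n" for a b c d
  proof (cases "m > 0")
    case True
    then show ?thesis unfolding pow_deriv_def
      by simp (intro trig_family_sum trig_family_mult haar_bounded_entry[OF H] that finite_lessThan)
  next
    case False
    have "trig_family M (\<lambda>\<theta> U. (-1) * (\<Sum>l<nat (-m). unitary_pow U (- (int l + 1)) $$ (a,c) * unitary_pow U (m + int l + 1) $$ (d,b)))"
      by (intro trig_family_sum trig_family_mult trig_family_const haar_bounded_entry[OF H] that finite_lessThan)
    then show ?thesis unfolding pow_deriv_def using False by simp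
  qed
  have t\<tau>: "trig_family M (\<lambda>\<theta>. \<tau> a b c d)" if "a < n" "b < n" "c < n" "d < n" for a b c d
    unfolding \<tau>_def
    by (intro trig_family_add trig_family_mult trig_list haar_bounded_entry[OF H] haar_bounded_symL[OF H] K tpd grad_list(2)[OF K] that)
  have int\<tau>: "integrable M (\<tau> a b c d)" if "a < n" "b < n" "c < n" "d < n" for a b c d
    by (rule trig_family_integrable[OF H t\<tau>[OF that]])
  have zero: "(\<integral>U. \<tau> a b c d U \<partial>M) = 0" if ab: "a < n" "b < n" and cd: "c < n" "d < n" for a b c d
  proof (rule quadratic_form_zero[OF _ cd])
    fix v :: "nat \<Rightarrow> complex" assume v: "(\<Sum>i<n. v i * cnj (v i)) = 1"
    define f where "f U = K (eigen_points U) * unitary_pow U m $$ (a,b)" for U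
    have rot: "unitary_mat n (phase_rotation n v \<theta>)" for \<theta> by (rule phase_rotation_unitary[OF v])
    have tf: "trig_family M (\<lambda>\<theta> U. f (phase_rotation n v \<theta> * U))"
      unfolding f_def by (intro trig_family_mult trig_family_symL[OF H rot K] trig_family_entries[OF H rot ab])
    have tf0: "trig_family M (\<lambda>\<theta> U. f U)"
      unfolding f_def by (intro trig_family_mult haar_bounded_symL[OF H K] haar_bounded_entry[OF H ab])
    have const: "(\<integral>U. f (phase_rotation n v \<theta> * U) \<partial>M) = (\<integral>U. f U \<partial>M)" for \<theta>
      by (rule haar_invariant_integral[OF H rot])
         (use trig_family_bounded_measurable[OF tf, of \<theta>] trig_family_bounded_measurable[OF tf0] in auto)
    have "((\<lambda>\<theta>. \<integral>U. f (phase_rotation n v \<theta> * U) \<partial>M) has_vector_derivative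
       (\<integral>U. \<i> * (\<Sum>c<n. \<Sum>d<n. v c * cnj (v d) * \<tau> a b c d U) \<partial>M)) (at 0)"
    proof (rule trig_family_integral_deriv[OF haar_prob[OF H] tf])
      fix U assume "U \<in> space M"
      then have U: "unitary_mat n U" by (simp add: sp)
      have z: "phase_rotation n v 0 * U = U" using unitary_matD(1)[OF U] by simp
      define S where "S l = (\<Sum>c<n. \<Sum>d<n. v c * cnj (v d) * unitary_pow U l $$ (d,c))" for l
      have lists: "(\<Sum>(l,J)\<leftarrow>ys. J (eigen_points U) * (\<i> * S l))
        = \<i> * (\<Sum>c<n. \<Sum>d<n. v c * cnj (v d) * (\<Sum>(l,J)\<leftarrow>ys. J (eigen_points U) * unitary_pow U l $$ (d,c)))" for ys
      proof (induction ys)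
        case (Cons y ys)
        obtain l J where y: "y = (l,J)" by force
        have "(\<Sum>(l,J)\<leftarrow>y#ys. J (eigen_points U) * (\<i> * S l)) = \<i> * (J (eigen_points U) * S l) + (\<Sum>(l,J)\<leftarrow>ys. J (eigen_points U) * (\<i> * S l))"
          by (simp add: y)
        then show ?case unfolding Cons
          by (simp add: y S_def sum_distrib_left distrib_left sum.distrib mult_ac)
      qed simp
      have "((\<lambda>\<theta>. f (phase_rotation n v \<theta> * U)) has_vector_derivative
         K (eigen_points U) * (\<i> * (\<Sum>c<n. \<Sum>d<n. v c * cnj (v d) * pow_deriv U m a b c d))
         + (\<Sum>(l,J)\<leftarrow>grad_list n K. J (eigen_points U) * (\<i> * S l)) * unitary_pow U m $$ (a,b)) (at 0)"
        using has_vector_derivative_mult[OF eigen_points_deriv[OF U v grad_list(1)[OF K]] unitary_pow_deriv[OF U ab, of v m]]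
        unfolding f_def S_def z .
      also have "(\<Sum>(l,J)\<leftarrow>grad_list n K. J (eigen_points U) * (\<i> * S l))
        = \<i> * (\<Sum>c<n. \<Sum>d<n. v c * cnj (v d) * (\<Sum>(l,J)\<leftarrow>grad_list n K. J (eigen_points U) * unitary_pow U l $$ (d,c)))"
        by (rule lists)
      finally show "((\<lambda>\<theta>. f (phase_rotation n v \<theta> * U)) has_vector_derivative \<i> * (\<Sum>c<n. \<Sum>d<n. v c * cnj (v d) * \<tau> a b c d U)) (at 0)"
        by (simp add: \<tau>_def sum_distrib_left sum_distrib_right distrib_left sum.distrib mult_ac add_ac)
    qed
    moreover have "((\<lambda>\<theta>. \<integral>U. f (phase_rotation n v \<theta> * U) \<partial>M) has_vector_derivative 0) (at 0)"
      unfolding const by simp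
    ultimately have "(\<integral>U. \<i> * (\<Sum>c<n. \<Sum>d<n. v c * cnj (v d) * \<tau> a b c d U) \<partial>M) = 0"
      by (rule vector_derivative_unique_at)
    moreover have "(\<integral>U. \<i> * (\<Sum>c<n. \<Sum>d<n. v c * cnj (v d) * \<tau> a b c d U) \<partial>M)
       = \<i> * (\<Sum>c<n. \<Sum>d<n. v c * cnj (v d) * (\<integral>U. \<tau> a b c d U \<partial>M))"
      by (simp only: integral_mult_right_zero integral_double_sum[OF int\<tau>[OF ab]])
    ultimately show "(\<Sum>c<n. \<Sum>d<n. v c * cnj (v d) * (\<integral>U. \<tau> a b c d U \<partial>M)) = 0" by simp
  qed
  \<comment> \<open>Setting c = a and d = b and summing turns the derivatives into the divergence of
    K(U) U^m.\<close>
  have div: "loop_div n m K (eigen_points U) = (\<Sum>a<n. \<Sum>b<n. \<tau> a b a b U)" if "U \<in> space M" for U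
  proof -
    have U: "unitary_mat n U" using that by (simp add: sp)
    have p: "(\<Sum>a<n. \<Sum>b<n. unitary_pow U l $$ (b,a) * unitary_pow U m $$ (a,b)) = psum n (m + l) (eigen_points U)" for l
    proof -
      have "(\<Sum>a<n. \<Sum>b<n. unitary_pow U l $$ (b,a) * unitary_pow U m $$ (a,b)) = (\<Sum>a<n. unitary_pow U (m + l) $$ (a,a))"
        by (intro sum.cong refl) (simp add: unitary_pow_add_index[OF U, symmetric] mult.commute)
      then show ?thesis by (simp add: eigenangles_props(3)[OF U] mat_tr_def)
    qed
    have "(\<Sum>a<n. \<Sum>b<n. (\<Sum>(l,J)\<leftarrow>xs. J (eigen_points U) * unitary_pow U l $$ (b,a)) * unitary_pow U m $$ (a,b))
       = (\<Sum>(l,J)\<leftarrow>xs. J (eigen_points U) * psum n (m + l) (eigen_points U))" for xs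
    proof (induction xs)
      case (Cons x xs)
      obtain l J where x: "x = (l,J)" by force
      have "(\<Sum>a<n. \<Sum>b<n. (\<Sum>(l,J)\<leftarrow>x#xs. J (eigen_points U) * unitary_pow U l $$ (b,a)) * unitary_pow U m $$ (a,b))
        = J (eigen_points U) * (\<Sum>a<n. \<Sum>b<n. unitary_pow U l $$ (b,a) * unitary_pow U m $$ (a,b))
         + (\<Sum>a<n. \<Sum>b<n. (\<Sum>(l,J)\<leftarrow>xs. J (eigen_points U) * unitary_pow U l $$ (b,a)) * unitary_pow U m $$ (a,b))"
        by (simp add: x ring_distribs sum.distrib sum_distrib_left mult_ac)
      then show ?case unfolding p Cons by (simp add: x)
    qed simp
    then show ?thesis
      by (simp add: \<tau>_def loop_div_def sum.distrib pow_deriv_diag[OF U, symmetric] sum_distrib_left)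
  qed
  have "(\<integral>U. loop_div n m K (eigen_points U) \<partial>M) = (\<integral>U. (\<Sum>a<n. \<Sum>b<n. \<tau> a b a b U) \<partial>M)"
    by (rule Bochner_Integration.integral_cong) (auto simp: div)
  also have "\<dots> = (\<Sum>a<n. \<Sum>b<n. \<integral>U. \<tau> a b a b U \<partial>M)"
    using integral_double_sum[of n M "\<lambda>a b. \<tau> a b a b" "\<lambda>_ _. 1"] int\<tau> by simp
  also have "\<dots> = 0" by (simp add: zero)
  finally show ?thesis .
qed

lemma haar_symL_mean:
  assumes H: "haar_unitary n M"
    and F: "F \<in> symL n" and eq: "\<And>z. nonzero_upto n z \<Longrightarrow> vdm n z * F z = alt_comb n xs z"
  shows "(\<integral>U. F (eigen_points U) \<partial>M) * vdm n z = alt_comb n (zero_part n xs) z"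
proof (rule invariant_mean_formula[of n "\<lambda>F. \<integral>U. F (eigen_points U) \<partial>M", OF _ _ _ F eq])
  interpret prob_space M by (rule haar_prob[OF H])
  have int: "integrable M (\<lambda>U. F (eigen_points U))" if "F \<in> symL n" for F
    by (rule trig_family_integrable[OF H haar_bounded_symL[OF H that]])
  show "(\<integral>U. F (eigen_points U) + c * G (eigen_points U) \<partial>M)
      = (\<integral>U. F (eigen_points U) \<partial>M) + c * (\<integral>U. G (eigen_points U) \<partial>M)"
    if "F \<in> symL n" "G \<in> symL n" for F G c
    using int[OF that(1)] int[OF that(2)] by simp
  show "(\<integral>U. F (eigen_points U) \<partial>M) = c" if "\<And>z. nonzero_upto n z \<Longrightarrow> F z = c" for F :: "(nat \<Rightarrow> complex) \<Rightarrow> complex" and c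
  proof -
    have "F (eigen_points U) = c" for U
      by (rule that) (simp add: nonzero_upto_def eigen_points_def)
    moreover have "(\<integral>U. c \<partial>M) = measure M (space M) *\<^sub>R c" by (rule lebesgue_integral_const)
    ultimately show ?thesis by (simp only: prob_space) simp
  qed
  show "(\<integral>U. radial_laplace n F (eigen_points U) \<partial>M) = 0" if F: "F \<in> symL n" for F
  proof -
    have "integrable M (\<lambda>U. \<Sum>(m,K)\<leftarrow>xs. loop_div n m K (eigen_points U)) \<and>
       (\<integral>U. (\<Sum>(m,K)\<leftarrow>xs. loop_div n m K (eigen_points U)) \<partial>M) = 0"
      if "\<And>m K. (m,K) \<in> set xs \<Longrightarrow> K \<in> symL n" for xs
      using that
    proof (induction xs)
      case (Cons x xs)
      obtain m K where x: "x = (m,K)" by force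
      have "K \<in> symL n" using Cons.prems[of m K] x by simp
      moreover have "integrable M (\<lambda>U. \<Sum>(m,K)\<leftarrow>xs. loop_div n m K (eigen_points U)) \<and>
       (\<integral>U. (\<Sum>(m,K)\<leftarrow>xs. loop_div n m K (eigen_points U)) \<partial>M) = 0" using Cons by auto
      ultimately show ?case using int[OF loop_div_symL, of K m] haar_loop_equation[OF H, of K m]
        by (simp add: x)
    qed simp
    from this[of "grad_list n F"] grad_list(2)[OF F] show ?thesis
      unfolding radial_laplace_def by blast
  qed
qed

section \<open>The Weyl integration formula\<close>

definition circle_unif :: "real measure" where
  "circle_unif = density lborel (\<lambda>x. ennreal (indicator {0..<2*pi} x / (2*pi)))"

definition torus_unif :: "nat \<Rightarrow> (nat \<Rightarrow> real) measure" where
  "torus_unif n = PiM {..<n} (\<lambda>_. circle_unif)"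

definition circle_pts :: "(nat \<Rightarrow> real) \<Rightarrow> nat \<Rightarrow> complex" where
  "circle_pts t i = cis (t i)"

definition weyl :: "nat \<Rightarrow> (nat \<Rightarrow> real) measure" where
  "weyl n = density (torus_unif n) (\<lambda>t. ennreal ((cmod (vdm n (circle_pts t)))\<^sup>2 / fact n))"

lemma sets_circle_unif [measurable_cong, simp]: "sets circle_unif = sets borel"
  by (simp add: circle_unif_def)

lemma space_circle_unif [simp]: "space circle_unif = UNIV"
  by (simp add: circle_unif_def)

lemma prob_space_circle_unif: "prob_space circle_unif"
proof
  have *: "ennreal (indicator {0..<2*pi} x / (2*pi)) = ennreal (1 / (2*pi)) * indicator {0..<2*pi} x" for x :: real
    by (cases "x \<in> {0..<2*pi}") simp_all
  have "emeasure circle_unif (space circle_unif) = (\<integral>\<^sup>+x. ennreal (1 / (2*pi)) * indicator {0..<2*pi} x * indicator UNIV x \<partial>lborel)"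
    unfolding circle_unif_def * by (subst emeasure_density) simp_all
  also have "\<dots> = (\<integral>\<^sup>+x. ennreal (1 / (2*pi)) * indicator {0..<2*pi} x \<partial>lborel)"
    by (simp only: indicator_UNIV mult_1_right)
  also have "\<dots> = ennreal (1 / (2*pi)) * ennreal (2 * pi)"
    by (subst nn_integral_cmult_indicator) auto
  also have "\<dots> = 1" by (subst ennreal_mult[symmetric]) auto
  finally show "emeasure circle_unif (space circle_unif) = 1" .
qed

interpretation circle_unif: prob_space circle_unif
  by (rule prob_space_circle_unif)

interpretation torus: product_sigma_finite "\<lambda>_::nat. circle_unif"
  by unfold_locales

lemma prob_space_torus_unif: "prob_space (torus_unif n)"
  unfolding torus_unif_def by (rule prob_space_PiM) (rule prob_space_circle_unif)

lemma measurable_cis [measurable]: "cis \<in> borel_measurable borel"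
  by (rule borel_measurable_continuous_onI) (intro continuous_intros)

lemma circle_integral_cis: "(\<integral>t. cis (of_int k * t) \<partial>circle_unif) = (if k = 0 then 1 else 0)"
proof (cases "k = 0")
  case True
  then show ?thesis using circle_unif.prob_space by simp
next
  case False
  define F where "F t = cis (of_int k * t) / (\<i> * of_int k)" for t :: real
  have "has_bochner_integral lborel (\<lambda>x. indicator {0..2*pi} x *\<^sub>R cis (of_int k * x)) (F (2*pi) - F 0)"
  proof (rule has_bochner_integral_FTC_Icc)
    show "(F has_vector_derivative cis (of_int k * x)) (at x within {0..2*pi})" for x
    proof -
      have "((\<lambda>z. exp (\<i> * (of_int k * z)) / (\<i> * of_int k)) has_field_derivative exp (\<i> * (of_int k * of_real x))) (at (of_real x))"
        using False
      proof -
        have "\<i> * (e * \<i>) = - e" for e by (simp add: mult.commute[of e] flip: mult.assoc)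
        then show ?thesis using False by (auto intro!: derivative_eq_intros)
      qed
      from has_vector_derivative_real_field[OF this]
      have "(F has_vector_derivative cis (of_int k * x)) (at x)"
        by (simp add: F_def[abs_def] cis_conv_exp)
      then show ?thesis by (rule has_vector_derivative_at_within)
    qed
    show "continuous_on {0..2*pi} (\<lambda>x. cis (of_int k * x))" by (intro continuous_intros)
  qed simp
  then have "(\<integral>x. indicator {0..2*pi} x *\<^sub>R cis (of_int k * x) \<partial>lborel) = F (2*pi) - F 0"
    by (rule has_bochner_integral_integral_eq)
  also have "F (2*pi) = F 0"
    using cis_multiple_2pi[of "of_int k"] by (simp add: F_def mult_ac)
  finally have 0: "(\<integral>x. indicator {0..2*pi} x *\<^sub>R cis (of_int k * x) \<partial>lborel) = 0" by simp
  have "(\<integral>t. cis (of_int k * t) \<partial>circle_unif) = (\<integral>x. (indicator {0..<2*pi} x / (2*pi)) *\<^sub>R cis (of_int k * x) \<partial>lborel)"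
    unfolding circle_unif_def by (rule integral_density) auto
  also have "\<dots> = (\<integral>x. (1 / (2*pi)) *\<^sub>R (indicator {0..2*pi} x *\<^sub>R cis (of_int k * x)) \<partial>lborel)"
  proof (rule integral_cong_AE)
    have "AE x in lborel. x \<noteq> 2 * pi" by (rule AE_lborel_singleton)
    then show "AE x in lborel. (indicator {0..<2*pi} x / (2*pi)) *\<^sub>R cis (of_int k * x) = (1 / (2*pi)) *\<^sub>R (indicator {0..2*pi} x *\<^sub>R cis (of_int k * x))"
      by eventually_elim (auto split: split_indicator)
  qed auto
  also have "\<dots> = (1 / (2*pi)) *\<^sub>R (\<integral>x. indicator {0..2*pi} x *\<^sub>R cis (of_int k * x) \<partial>lborel)"
    by (rule integral_scaleR_right)
  also have "\<dots> = 0" by (simp only: 0 scaleR_zero_right)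
  finally show ?thesis using False by simp
qed

lemma cis_powi: "cis x powi k = cis (of_int k * x)"
  by (cases "k \<ge> 0") (simp_all add: power_int_def Complex.DeMoivre cis_inverse power_inverse)

lemma circle_pts_nonzero [simp]: "nonzero_upto n (circle_pts t)"
  by (simp add: nonzero_upto_def circle_pts_def)

lemma laurent_mono_circle: "laurent_mono n l (circle_pts t) = (\<Prod>i<n. cis (of_int (l i) * t i))"
  by (simp add: laurent_mono_def circle_pts_def cis_powi)

lemma laurent_mono_orthogonal:
  "(\<integral>t. laurent_mono n l (circle_pts t) * cnj (laurent_mono n m (circle_pts t)) \<partial>torus_unif n)
     = (if \<forall>i<n. l i = m i then 1 else 0)"
proof -
  have "(\<integral>t. laurent_mono n l (circle_pts t) * cnj (laurent_mono n m (circle_pts t)) \<partial>torus_unif n)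
     = (\<integral>t. (\<Prod>i<n. cis (of_int (l i - m i) * t i)) \<partial>torus_unif n)"
    unfolding laurent_mono_circle cnj_prod prod.distrib[symmetric]
    by (intro Bochner_Integration.integral_cong prod.cong refl) (simp add: cis_cnj cis_mult left_diff_distrib)
  also have "\<dots> = (\<Prod>i<n. \<integral>x. cis (of_int (l i - m i) * x) \<partial>circle_unif)"
    unfolding torus_unif_def
    by (rule torus.product_integral_prod) (auto intro!: circle_unif.integrable_const_bound[of _ 1])
  also have "\<dots> = (\<Prod>i<n. if l i = m i then 1 else 0)" by (simp add: circle_integral_cis del: of_int_diff)
  also have "\<dots> = (if \<forall>i<n. l i = m i then 1 else 0)" by (auto intro: prod_zero)
  finally show ?thesis .
qed

lemma torus_component_measurable [measurable]: "i < n \<Longrightarrow> (\<lambda>t. t i) \<in> borel_measurable (torus_unif n)"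
  unfolding torus_unif_def by (simp add: measurable_component_singleton cong: measurable_cong_sets[OF refl sets_circle_unif])

lemma laurent_mono_measurable [measurable]: "(\<lambda>t. laurent_mono n l (circle_pts t)) \<in> borel_measurable (torus_unif n)"
  unfolding laurent_mono_circle by (intro borel_measurable_prod) simp

lemma alternant_measurable [measurable]: "(\<lambda>t. alternant n l (circle_pts t)) \<in> borel_measurable (torus_unif n)"
  unfolding alternant_expand by (intro borel_measurable_sum borel_measurable_times laurent_mono_measurable) auto

lemma norm_laurent_mono_circle: "cmod (laurent_mono n l (circle_pts t)) = 1"
  by (simp add: laurent_mono_circle prod_norm[symmetric])

lemma norm_alternant_circle: "cmod (alternant n l (circle_pts t)) \<le> fact n"
proof -
  have "cmod (alternant n l (circle_pts t)) \<le> (\<Sum>p | p permutes {..<n}. cmod (signof p * laurent_mono n (l \<circ> p) (circle_pts t)))"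
    unfolding alternant_expand by (rule norm_sum)
  also have "\<dots> = (\<Sum>p | p permutes {..<n}. 1)"
    by (intro sum.cong refl) (simp add: norm_mult norm_laurent_mono_circle sign_def)
  also have "\<dots> = fact n" by (simp add: card_permutations[of _ n])
  finally show ?thesis .
qed

lemma alternant_vdm_integral:
  "(\<integral>t. alternant n l (circle_pts t) * cnj (vdm n (circle_pts t)) \<partial>torus_unif n) =
    (\<Sum>p | p permutes {..<n}. \<Sum>q | q permutes {..<n}. signof p * signof q * (if \<forall>i<n. l (p i) = int (q i) then 1 else 0))"
proof -
  interpret prob_space "torus_unif n" by (rule prob_space_torus_unif)
  have int: "integrable (torus_unif n) (\<lambda>t. laurent_mono n l (circle_pts t) * cnj (laurent_mono n m (circle_pts t)))" for l m
  proof (rule integrable_const_bound[of _ 1])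
    show "(\<lambda>t. laurent_mono n l (circle_pts t) * cnj (laurent_mono n m (circle_pts t))) \<in> borel_measurable (torus_unif n)"
      by (intro borel_measurable_times laurent_mono_measurable
          measurable_compose[OF laurent_mono_measurable borel_measurable_continuous_onI[OF continuous_on_cnj[OF continuous_on_id]]])
  qed (simp add: norm_mult norm_laurent_mono_circle)
  have "(\<integral>t. alternant n l (circle_pts t) * cnj (vdm n (circle_pts t)) \<partial>torus_unif n)
     = (\<integral>t. (\<Sum>p | p permutes {..<n}. \<Sum>q | q permutes {..<n}. signof p * signof q *
          (laurent_mono n (l \<circ> p) (circle_pts t) * cnj (laurent_mono n (int \<circ> q) (circle_pts t)))) \<partial>torus_unif n)"
    by (intro Bochner_Integration.integral_cong refl) (simp add: alternant_expand sum_product mult_ac)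
  also have "\<dots> = (\<Sum>p | p permutes {..<n}. \<integral>t. (\<Sum>q | q permutes {..<n}. signof p * signof q *
          (laurent_mono n (l \<circ> p) (circle_pts t) * cnj (laurent_mono n (int \<circ> q) (circle_pts t)))) \<partial>torus_unif n)"
    by (intro Bochner_Integration.integral_sum Bochner_Integration.integrable_sum integrable_mult_right int)
  also have "\<dots> = (\<Sum>p | p permutes {..<n}. \<Sum>q | q permutes {..<n}. \<integral>t. signof p * signof q *
          (laurent_mono n (l \<circ> p) (circle_pts t) * cnj (laurent_mono n (int \<circ> q) (circle_pts t))) \<partial>torus_unif n)"
    by (intro sum.cong refl Bochner_Integration.integral_sum integrable_mult_right int)
  finally show ?thesis by (simp add: laurent_mono_orthogonal)
qed

text \<open>Two monomials are orthogonal unless their exponents agree; agreement would make l a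
  rearrangement of 0, ..., n - 1, which has energy zero.\<close>

lemma alternant_vdm_integral_zero:
  assumes "laurent_energy n l \<noteq> 0"
  shows "(\<integral>t. alternant n l (circle_pts t) * cnj (vdm n (circle_pts t)) \<partial>torus_unif n) = 0"
  unfolding alternant_vdm_integral
proof (intro sum.neutral ballI)
  fix p q assume "p \<in> {p. p permutes {..<n}}" "q \<in> {q. q permutes {..<n}}"
  then have pq: "p permutes {..<n}" "q permutes {..<n}" by auto
  have "\<not> (\<forall>i<n. l (p i) = int (q i))"
  proof
    assume *: "\<forall>i<n. l (p i) = int (q i)"
    have "laurent_energy n l = laurent_energy n (l \<circ> p)" using laurent_energy_permute[OF pq(1)] by simp
    also have "\<dots> = laurent_energy n (int \<circ> q)" using * by (simp add: laurent_energy_def)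
    also have "\<dots> = 0" using laurent_energy_permute[OF pq(2), of int] by (simp add: laurent_energy_def)
    finally show False using assms by simp
  qed
  then show "signof p * signof q * (if \<forall>i<n. l (p i) = int (q i) then 1 else 0) = (0::complex)" by simp
qed

text \<open>Of all pairs of permutations only the n! equal ones survive; this is the normalising
  constant of \<open>weyl\<close>.\<close>

lemma vdm_vdm_integral:
  "(\<integral>t. vdm n (circle_pts t) * cnj (vdm n (circle_pts t)) \<partial>torus_unif n) = fact n"
proof -
  have "(\<Sum>p | p permutes {..<n}. \<Sum>q | q permutes {..<n}. signof p * signof q * (if \<forall>i<n. int (p i) = int (q i) then 1 else 0))
     = (\<Sum>p | p permutes {..<n}. \<Sum>q | q permutes {..<n}. if q = p then 1 else (0::complex))"
  proof (intro sum.cong refl)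
    fix p q assume "p \<in> {p. p permutes {..<n}}" "q \<in> {q. q permutes {..<n}}"
    then have pq: "p permutes {..<n}" "q permutes {..<n}" by auto
    have "(\<forall>i<n. int (p i) = int (q i)) \<longleftrightarrow> q = p"
    proof
      assume *: "\<forall>i<n. int (p i) = int (q i)"
      show "q = p"
      proof
        fix i show "q i = p i" using * pq[THEN permutes_not_in, of i] by (cases "i < n") auto
      qed
    qed auto
    moreover have "(signof p * signof p :: complex) = 1" by (simp add: sign_def)
    ultimately show "signof p * signof q * (if \<forall>i<n. int (p i) = int (q i) then 1 else 0) = (if q = p then 1 else (0::complex))"
      by auto
  qed
  also have "\<dots> = (\<Sum>p | p permutes {..<n}. 1)"
    by (intro sum.cong refl) (simp add: finite_permutations)
  also have "\<dots> = fact n" by (simp add: card_permutations[of _ n])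
  finally show ?thesis unfolding alternant_vdm_integral .
qed

lemma integrable_alternant_vdm:
  "integrable (torus_unif n) (\<lambda>t. alternant n l (circle_pts t) * cnj (vdm n (circle_pts t)))"
proof -
  interpret prob_space "torus_unif n" by (rule prob_space_torus_unif)
  show ?thesis
  proof (rule integrable_const_bound[of _ "fact n * fact n"])
    show "AE t in torus_unif n. cmod (alternant n l (circle_pts t) * cnj (vdm n (circle_pts t))) \<le> fact n * fact n"
      by (simp add: norm_mult mult_mono norm_alternant_circle)
    show "(\<lambda>t. alternant n l (circle_pts t) * cnj (vdm n (circle_pts t))) \<in> borel_measurable (torus_unif n)"
      by (intro borel_measurable_times alternant_measurable
          measurable_compose[OF alternant_measurable borel_measurable_continuous_onI[OF continuous_on_cnj[OF continuous_on_id]]])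
  qed
qed

text \<open>The counterpart, on the side of the Weyl density, of discarding nonzero energies: here
  orthogonality does it, for the Haar mean it was the Laplacian.\<close>

lemma alt_comb_vdm_integral:
  "(\<integral>t. alt_comb n xs (circle_pts t) * cnj (vdm n (circle_pts t)) \<partial>torus_unif n)
    = (\<integral>t. alt_comb n (zero_part n xs) (circle_pts t) * cnj (vdm n (circle_pts t)) \<partial>torus_unif n)"
proof -
  have int: "integrable (torus_unif n) (\<lambda>t. alt_comb n ys (circle_pts t) * cnj (vdm n (circle_pts t)))" for ys
  proof (induction ys)
    case (Cons y ys)
    then show ?case using integrable_alternant_vdm[of n "snd y"]
      by (cases y) (simp add: distrib_right mult.assoc)
  qed simp
  show ?thesis
  proof (induction xs)
    case Nil
    show ?case by (simp add: zero_part_def)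
  next
    case (Cons x xs)
    obtain c l where x: "x = (c,l)" by force
    have s: "(\<integral>t. alt_comb n ((c,l)#ys) (circle_pts t) * cnj (vdm n (circle_pts t)) \<partial>torus_unif n)
       = c * (\<integral>t. alternant n l (circle_pts t) * cnj (vdm n (circle_pts t)) \<partial>torus_unif n)
         + (\<integral>t. alt_comb n ys (circle_pts t) * cnj (vdm n (circle_pts t)) \<partial>torus_unif n)" for ys
      using int[of ys] integrable_alternant_vdm[of n l] by (simp add: distrib_right mult.assoc)
    show ?case
    proof (cases "laurent_energy n l = 0")
      case True
      then have "zero_part n ((c,l)#xs) = (c,l) # zero_part n xs" by (simp add: zero_part_def)
      then show ?thesis unfolding x by (simp only: s Cons)
    next
      case False
      then show ?thesis unfolding x s Cons by (simp add: zero_part_def alternant_vdm_integral_zero)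
    qed
  qed
qed

lemma vdm_norm_square: "vdm n z * cnj (vdm n z) = complex_of_real ((cmod (vdm n z))\<^sup>2)"
  by (rule complex_norm_square[symmetric])

lemma weyl_integral:
  fixes f :: "(nat \<Rightarrow> real) \<Rightarrow> complex"
  assumes "f \<in> borel_measurable (torus_unif n)"
  shows "(\<integral>t. f t \<partial>weyl n) = (\<integral>t. f t * (vdm n (circle_pts t) * cnj (vdm n (circle_pts t))) \<partial>torus_unif n) / fact n"
proof -
  have "(\<integral>t. f t \<partial>weyl n) = (\<integral>t. ((cmod (vdm n (circle_pts t)))\<^sup>2 / fact n) *\<^sub>R f t \<partial>torus_unif n)"
    unfolding weyl_def by (rule integral_density) (use assms in auto)
  also have "\<dots> = (\<integral>t. f t * (vdm n (circle_pts t) * cnj (vdm n (circle_pts t))) / fact n \<partial>torus_unif n)"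
    unfolding vdm_norm_square
    by (intro Bochner_Integration.integral_cong refl) (simp add: scaleR_conv_of_real)
  finally show ?thesis by simp
qed

lemma symL_circle_measurable:
  "F \<in> symL n \<Longrightarrow> (\<lambda>t. F (circle_pts t)) \<in> borel_measurable (torus_unif n)"
proof (induction rule: symL.induct)
  case (psum m)
  show ?case unfolding psum_def circle_pts_def cis_powi by (intro borel_measurable_sum) simp
qed auto

text \<open>Expand \<open>vdm * F\<close> into alternants. Both means depend only on the part of
  energy zero, which equals E times \<open>vdm\<close> with E the Haar mean; integrating this
  against the conjugate of \<open>vdm\<close> returns E n!.\<close>

lemma haar_weyl_symL:
  assumes H: "haar_unitary n M" and F: "F \<in> symL n"
  shows "(\<integral>U. F (eigen_points U) \<partial>M) = (\<integral>t. F (circle_pts t) \<partial>weyl n)"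
proof -
  obtain xs where xs: "\<And>z. nonzero_upto n z \<Longrightarrow> F z * alt_comb n [(1,int)] z = alt_comb n xs z"
    using symL_alt_comb[OF F, of "[(1,int)]"] by blast
  then have eq: "vdm n z * F z = alt_comb n xs z" if "nonzero_upto n z" for z
    using xs[OF that] by (simp add: mult.commute)
  define E where "E = (\<integral>U. F (eigen_points U) \<partial>M)"
  have E: "E * vdm n z = alt_comb n (zero_part n xs) z" for z
    unfolding E_def by (rule haar_symL_mean[OF H F eq])
  have "(\<integral>t. F (circle_pts t) \<partial>weyl n)
      = (\<integral>t. F (circle_pts t) * (vdm n (circle_pts t) * cnj (vdm n (circle_pts t))) \<partial>torus_unif n) / fact n"
    by (rule weyl_integral[OF symL_circle_measurable[OF F]])
  also have "(\<integral>t. F (circle_pts t) * (vdm n (circle_pts t) * cnj (vdm n (circle_pts t))) \<partial>torus_unif n)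
      = (\<integral>t. alt_comb n xs (circle_pts t) * cnj (vdm n (circle_pts t)) \<partial>torus_unif n)"
    by (intro Bochner_Integration.integral_cong refl) (simp add: eq[symmetric])
  also have "\<dots> = (\<integral>t. E * (vdm n (circle_pts t) * cnj (vdm n (circle_pts t))) \<partial>torus_unif n)"
    by (subst alt_comb_vdm_integral) (simp add: E[symmetric] mult.assoc)
  also have "\<dots> = E * fact n"
    using vdm_vdm_integral[of n] integrable_alternant_vdm[of n int] by simp
  finally show ?thesis by (simp add: E_def)
qed

lemma prob_space_weyl: "prob_space (weyl n)"
proof
  have "emeasure (weyl n) (space (weyl n)) = (\<integral>\<^sup>+t. ennreal ((cmod (vdm n (circle_pts t)))\<^sup>2 / fact n) \<partial>torus_unif n)"
    unfolding weyl_def by (simp add: emeasure_density)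
  also have "\<dots> = ennreal (\<integral>t. (cmod (vdm n (circle_pts t)))\<^sup>2 / fact n \<partial>torus_unif n)"
  proof (rule nn_integral_eq_integral)
    interpret prob_space "torus_unif n" by (rule prob_space_torus_unif)
    show "integrable (torus_unif n) (\<lambda>t. (cmod (vdm n (circle_pts t)))\<^sup>2 / fact n)"
      by (rule integrable_const_bound[of _ "(fact n)\<^sup>2 / fact n"])
         (auto intro!: divide_right_mono power_mono norm_alternant_circle)
  qed simp
  also have "(\<integral>t. (cmod (vdm n (circle_pts t)))\<^sup>2 / fact n \<partial>torus_unif n) = 1"
  proof -
    have "complex_of_real (\<integral>t. (cmod (vdm n (circle_pts t)))\<^sup>2 / fact n \<partial>torus_unif n)
       = (\<integral>t. vdm n (circle_pts t) * cnj (vdm n (circle_pts t)) / fact n \<partial>torus_unif n)"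
      unfolding integral_complex_of_real[symmetric]
      unfolding vdm_norm_square by simp
    also have "\<dots> = 1" using vdm_vdm_integral[of n] by simp
    finally show ?thesis by (simp only: of_real_eq_1_iff)
  qed
  finally show "emeasure (weyl n) (space (weyl n)) = 1" by simp
qed

section \<open>Approximation of the gap event by symmetric Laurent polynomials\<close>

text \<open>On the circle the real and imaginary parts of w are (w + 1/w) / 2 and (w - 1/w) / (2 i).
  This converts the output of the Stone-Weierstrass theorem into Laurent monomials.\<close>

lemma polynomial_circle_laurent:
  fixes P :: "complex \<times> complex \<Rightarrow> real"
  assumes "real_polynomial_function P"
  shows "\<exists>xs. \<forall>s t. complex_of_real (P (cis s, cis t)) = (\<Sum>(c,a,b)\<leftarrow>xs. c * (cis s powi a * cis t powi (b::int)))"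
  using assms
proof (induction rule: real_polynomial_function.induct)
  case (linear f)
  then interpret bounded_linear f .
  have split: "f (z,w) = Re z * f (1,0) + Im z * f (\<i>,0) + Re w * f (0,1) + Im w * f (0,\<i>)" for z w
  proof -
    have "(z,w) = Re z *\<^sub>R (1,0) + Im z *\<^sub>R (\<i>,0) + Re w *\<^sub>R (0,1) + Im w *\<^sub>R (0,\<i>)"
      by (simp add: complex_eq_iff)
    then show ?thesis by (simp only: add scaleR real_scaleR_def)
  qed
  have re: "complex_of_real (cos s) = (cis s powi 1 + cis s powi (-1)) / 2"
    and im: "complex_of_real (sin s) = (cis s powi 1 - cis s powi (-1)) / (2 * \<i>)" for s
    by (simp_all only: cis_powi) (simp_all add: complex_eq_iff)
  have cx: "complex_of_real (cos s * A + sin s * B) = (of_real A / 2 + of_real B / (2 * \<i>)) * cis s powi 1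
      + (of_real A / 2 - of_real B / (2 * \<i>)) * cis s powi (-1)" for s A B
    unfolding of_real_add of_real_mult re im
    by (simp add: algebra_simps add_divide_distrib diff_divide_distrib)
  show ?case
  proof (rule exI[of _ "[(of_real (f (1,0)) / 2 + of_real (f (\<i>,0)) / (2 * \<i>), 1, 0),
        (of_real (f (1,0)) / 2 - of_real (f (\<i>,0)) / (2 * \<i>), -1, 0),
        (of_real (f (0,1)) / 2 + of_real (f (0,\<i>)) / (2 * \<i>), 0, 1),
        (of_real (f (0,1)) / 2 - of_real (f (0,\<i>)) / (2 * \<i>), 0, -1)]"], intro allI)
    fix s t
    have "complex_of_real (f (cis s, cis t)) = complex_of_real (cos s * f (1,0) + sin s * f (\<i>,0))
        + complex_of_real (cos t * f (0,1) + sin t * f (0,\<i>))"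
      unfolding of_real_add[symmetric] by (subst split) simp
    then show "complex_of_real (f (cis s, cis t)) = (\<Sum>(c,a,b)\<leftarrow>[(of_real (f (1,0)) / 2 + of_real (f (\<i>,0)) / (2 * \<i>), 1, 0),
        (of_real (f (1,0)) / 2 - of_real (f (\<i>,0)) / (2 * \<i>), -1, 0),
        (of_real (f (0,1)) / 2 + of_real (f (0,\<i>)) / (2 * \<i>), 0, 1),
        (of_real (f (0,1)) / 2 - of_real (f (0,\<i>)) / (2 * \<i>), 0, -1)]. c * (cis s powi a * cis t powi b))"
      unfolding cx by (simp add: add.assoc)
  qed
next
  case (const c)
  show ?case by (rule exI[of _ "[(of_real c,0,0)]"]) simp
next
  case (add f g)
  then obtain xs ys where "\<forall>s t. complex_of_real (f (cis s, cis t)) = (\<Sum>(c,a,b)\<leftarrow>xs. c * (cis s powi a * cis t powi b))"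
    "\<forall>s t. complex_of_real (g (cis s, cis t)) = (\<Sum>(c,a,b)\<leftarrow>ys. c * (cis s powi a * cis t powi b))" by blast
  then show ?case by (intro exI[of _ "xs @ ys"]) simp
next
  case (mult f g)
  then obtain xs ys where xs: "\<And>s t. complex_of_real (f (cis s, cis t)) = (\<Sum>(c,a,b)\<leftarrow>xs. c * (cis s powi a * cis t powi b))"
    and ys: "\<And>s t. complex_of_real (g (cis s, cis t)) = (\<Sum>(c,a,b)\<leftarrow>ys. c * (cis s powi a * cis t powi b))" by blast
  define zs where "zs = concat (map (\<lambda>(c,a,b). map (\<lambda>(d,a',b'). (c * d, a + a', b + b')) ys) xs)"
  have 1: "(\<Sum>(d,a',b')\<leftarrow>map (\<lambda>(d,a',b'). (c * d, a + a', b + b')) ys. d * (cis s powi a' * cis t powi b'))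
     = c * (cis s powi a * cis t powi b) * (\<Sum>(c,a,b)\<leftarrow>ys. c * (cis s powi a * cis t powi b))" for c a b s t
    by (induction ys) (auto simp: power_int_add ring_distribs mult_ac)
  have "(\<Sum>(c,a,b)\<leftarrow>zs. c * (cis s powi a * cis t powi b))
     = (\<Sum>(c,a,b)\<leftarrow>xs. c * (cis s powi a * cis t powi b)) * (\<Sum>(c,a,b)\<leftarrow>ys. c * (cis s powi a * cis t powi b))" for s t
    unfolding zs_def
  proof (induction xs)
    case (Cons x xs)
    obtain c a b where x: "x = (c,a,b)" by (metis prod_cases3)
    show ?case using Cons 1[of s t c a b] by (simp add: x distrib_right)
  qed simp
  then show ?case by (intro exI[of _ zs]) (simp add: xs ys)
qed

lemma Arg2pi_cis: "0 \<le> s \<Longrightarrow> s < 2 * pi \<Longrightarrow> Arg2pi (cis s) = s"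
  by (rule Arg2pi_unique[of 1]) (auto simp: cis_conv_exp)

text \<open>A function on the circle that is continuous also at \<open>1\<close>, where the angle \<open>Arg2pi\<close> jumps,
  and that agrees with the angle except on a short arc below \<open>1\<close>.\<close>

definition trimmed_angle :: "nat \<Rightarrow> complex \<Rightarrow> real" where
  "trimmed_angle l z = min (Arg2pi z) (real l * arccos (Re z))"

text \<open>Away from 1 the angle itself is continuous on the circle. At 1 the function is squeezed
  between 0 and l arccos(Re z), which tends to 0 from both sides.\<close>

lemma continuous_trimmed_angle: "continuous_on (sphere 0 1) (trimmed_angle l)"
  unfolding continuous_on_eq_continuous_within
proof
  fix z :: complex assume z: "z \<in> sphere 0 1"
  have carc: "continuous_on (sphere 0 1) (\<lambda>z. real l * arccos (Re z))"
  proof (intro continuous_intros ballI)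
    fix w :: complex assume "w \<in> sphere 0 1"
    then show "- 1 \<le> Re w \<and> Re w \<le> 1" using abs_Re_le_cmod[of w] by (simp add: abs_le_iff)
  qed
  have arc0: "0 \<le> arccos (Re w)" if "w \<in> sphere 0 1" for w
    using that abs_Re_le_cmod[of w] by (intro arccos_lbound) (auto simp: abs_le_iff)
  show "continuous (at z within sphere 0 1) (trimmed_angle l)"
  proof (cases "z = 1")
    case False
    have "z \<notin> \<real>\<^sub>\<ge>\<^sub>0"
    proof
      assume "z \<in> \<real>\<^sub>\<ge>\<^sub>0"
      then obtain r where "r \<ge> 0" "z = of_real r" by (auto simp: nonneg_Reals_def)
      with z False show False by auto
    qed
    then have "continuous (at z within sphere 0 1) Arg2pi"
      by (rule continuous_at_imp_continuous_within[OF continuous_at_Arg2pi])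
    moreover have "continuous (at z within sphere 0 1) (\<lambda>z. real l * arccos (Re z))"
      using carc z by (simp add: continuous_on_eq_continuous_within)
    ultimately show ?thesis unfolding trimmed_angle_def[abs_def] by (intro continuous_min)
  next
    case True
    have up: "((\<lambda>w. real l * arccos (Re w)) \<longlongrightarrow> 0) (at 1 within sphere 0 1)"
      using carc[unfolded continuous_on_def, rule_format, of 1] by simp
    have "(trimmed_angle l \<longlongrightarrow> 0) (at 1 within sphere 0 1)"
    proof (rule tendsto_sandwich[OF _ _ tendsto_const up])
      show "\<forall>\<^sub>F w in at 1 within sphere 0 1. 0 \<le> trimmed_angle l w"
        using arc0 Arg2pi_ge_0 unfolding eventually_at_filter trimmed_angle_def by (intro always_eventually) auto
      show "\<forall>\<^sub>F w in at 1 within sphere 0 1. trimmed_angle l w \<le> real l * arccos (Re w)"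
        by (intro always_eventually) (simp add: trimmed_angle_def)
    qed
    moreover have "trimmed_angle l 1 = 0" using Arg2pi_cis[of 0] by (simp add: trimmed_angle_def)
    ultimately show ?thesis using True by (simp add: continuous_within)
  qed
qed

text \<open>For 0 < s < 2 pi the number arccos(cos s) is positive, so l times it exceeds s for large
  l and the minimum is the angle.\<close>

lemma trimmed_angle_eventually:
  assumes "0 \<le> s" "s < 2 * pi"
  shows "\<forall>\<^sub>F l in sequentially. trimmed_angle l (cis s) = s"
proof (cases "s = 0")
  case True
  then show ?thesis using Arg2pi_cis[of 0] by (simp add: trimmed_angle_def)
next
  case False
  have "cos s < 1"
  proof (rule ccontr)
    assume "\<not> cos s < 1"
    then have "cos s = 1" using cos_le_one[of s] by simp
    then obtain k :: int where k: "s = of_int k * (2 * pi)" by (auto simp: cos_one_2pi_int)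
    have "0 < s" using assms False by simp
    then have "0 < real_of_int k" unfolding k by (rule zero_less_mult_pos2) simp
    moreover have "real_of_int k * (2 * pi) < 1 * (2 * pi)" using assms k by simp
    then have "real_of_int k < 1" by (rule mult_right_less_imp_less) simp
    ultimately have "0 < k" "k < 1" by auto
    then show False by simp
  qed
  then have "arccos 1 < arccos (cos s)" by (intro arccos_less_arccos) auto
  then have pos: "arccos (cos s) > 0" by simp
  obtain N where N: "s / arccos (cos s) \<le> real N" using real_arch_simple by blast
  have "\<forall>\<^sub>F l in sequentially. l \<ge> N" by (rule eventually_ge_at_top)
  then show ?thesis
  proof eventually_elim
    case (elim l)
    have "s \<le> real N * arccos (cos s)" using N pos by (simp add: field_simps)
    also have "\<dots> \<le> real l * arccos (cos s)" using elim pos by (intro mult_right_mono) auto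
    finally show ?case using Arg2pi_cis[OF assms] by (simp add: trimmed_angle_def)
  qed
qed

text \<open>In terms of the distance of the trimmed angles: 1 up to \<delta>, 0 from \<delta> + 1/l
  on, linear between. Falling off only beyond \<delta> makes the limit the indicator of the closed
  condition, whose complement is the strict inequality of the gap event.\<close>

definition soft_close :: "real \<Rightarrow> nat \<Rightarrow> complex \<times> complex \<Rightarrow> real" where
  "soft_close \<delta> l = (\<lambda>(z,w). max 0 (1 - real l * max 0 (\<bar>trimmed_angle l z - trimmed_angle l w\<bar> - \<delta>)))"

lemma soft_close_bounds: "0 \<le> soft_close \<delta> l p" "soft_close \<delta> l p \<le> 1"
  by (auto simp: soft_close_def split_def max_def)

lemma continuous_soft_close: "continuous_on (sphere 0 1 \<times> sphere 0 1) (soft_close \<delta> l)"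
proof -
  have 1: "continuous_on (sphere 0 1 \<times> sphere 0 1) (\<lambda>p. trimmed_angle l (fst p))"
    "continuous_on (sphere 0 1 \<times> sphere 0 1) (\<lambda>p. trimmed_angle l (snd p))"
    by (auto intro!: continuous_on_compose2[OF continuous_trimmed_angle] continuous_intros)
  show ?thesis unfolding soft_close_def split_def
    by (intro continuous_intros 1)
qed

lemma soft_close_tendsto:
  assumes "0 \<le> s" "s < 2 * pi" "0 \<le> t" "t < 2 * pi"
  shows "(\<lambda>l. soft_close \<delta> l (cis s, cis t)) \<longlonglongrightarrow> (if \<bar>s - t\<bar> \<le> \<delta> then 1 else 0)"
proof -
  define d where "d = \<bar>s - t\<bar> - \<delta>"
  have ev: "\<forall>\<^sub>F l in sequentially. soft_close \<delta> l (cis s, cis t) = max 0 (1 - real l * max 0 d)"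
    using trimmed_angle_eventually[OF assms(1,2)] trimmed_angle_eventually[OF assms(3,4)]
    by eventually_elim (simp add: soft_close_def d_def)
  have "\<forall>\<^sub>F l in sequentially. soft_close \<delta> l (cis s, cis t) = (if \<bar>s - t\<bar> \<le> \<delta> then 1 else 0)"
  proof (cases "d \<le> 0")
    case True
    show ?thesis using ev by eventually_elim (use True in \<open>auto simp: d_def max_def\<close>)
  next
    case False
    obtain N where N: "1 / d \<le> real N" using real_arch_simple by blast
    have "\<forall>\<^sub>F l in sequentially. l \<ge> N" by (rule eventually_ge_at_top)
    with ev show ?thesis
    proof eventually_elim
      case (elim l)
      have "1 / d \<le> real l" using N elim by simp
      then have "1 \<le> real l * d" using False by (simp add: field_simps)
      then show ?case using elim False by (auto simp: d_def max_def)
    qed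
  qed
  then show ?thesis by (rule tendsto_eventually)
qed

definition gap_exceeds :: "nat \<Rightarrow> real \<Rightarrow> (nat \<Rightarrow> real) \<Rightarrow> bool" where
  "gap_exceeds n \<delta> t \<longleftrightarrow> (\<forall>i<n. \<forall>j<n. i \<noteq> j \<longrightarrow> \<bar>t i - t j\<bar> > \<delta>)"

text \<open>The diagonal is included, so that the count is a full double sum and can be approximated
  by products of two power sums. The gap event is then the smallest possible value n.\<close>

definition close_count :: "nat \<Rightarrow> real \<Rightarrow> (nat \<Rightarrow> real) \<Rightarrow> nat" where
  "close_count n \<delta> t = card {p \<in> {..<n} \<times> {..<n}. \<bar>t (fst p) - t (snd p)\<bar> \<le> \<delta>}"

lemma close_count_bounds:
  assumes "\<delta> \<ge> 0"
  shows "n \<le> close_count n \<delta> t" "close_count n \<delta> t \<le> n * n" "close_count n \<delta> t = n \<longleftrightarrow> gap_exceeds n \<delta> t"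
proof -
  define D where "D = (\<lambda>i. (i,i)) ` {..<n}"
  define S where "S = {p \<in> {..<n} \<times> {..<n}. \<bar>t (fst p) - t (snd p)\<bar> \<le> \<delta>}"
  have D: "card D = n" "D \<subseteq> S" using assms by (auto simp: D_def S_def card_image inj_on_def)
  have fin: "finite S" by (simp add: S_def)
  have cc: "close_count n \<delta> t = card S" by (simp add: close_count_def S_def)
  show "n \<le> close_count n \<delta> t" unfolding cc using card_mono[OF fin D(2)] D(1) by simp
  have "card S \<le> card ({..<n} \<times> {..<n})" by (intro card_mono) (auto simp: S_def)
  then show "close_count n \<delta> t \<le> n * n" by (simp add: cc)
  have "close_count n \<delta> t = n \<longleftrightarrow> D = S"
    unfolding cc using card_subset_eq[OF fin D(2)] D(1) by metis
  also have "\<dots> \<longleftrightarrow> S \<subseteq> D" using D(2) by auto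
  also have "\<dots> \<longleftrightarrow> (\<forall>i<n. \<forall>j<n. \<bar>t i - t j\<bar> \<le> \<delta> \<longrightarrow> i = j)" unfolding D_def S_def by fastforce
  also have "\<dots> \<longleftrightarrow> gap_exceeds n \<delta> t" unfolding gap_exceeds_def not_le[symmetric] by blast
  finally show "close_count n \<delta> t = n \<longleftrightarrow> gap_exceeds n \<delta> t" .
qed

text \<open>The indicator of the gap event is a polynomial in the number of close ordered pairs, which in
  turn is a bounded limit of symmetric Laurent polynomials by the Stone-Weierstrass theorem.\<close>

lemma gap_indicator_approx:
  assumes "\<delta> \<ge> 0"
  shows "\<exists>G B. (\<forall>l. G l \<in> symL n) \<and> (\<forall>l t. cmod (G l (circle_pts t)) \<le> B) \<and>
     (\<forall>t. (\<forall>i<n. 0 \<le> t i \<and> t i < 2 * pi) \<longrightarrow>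
        (\<lambda>l. G l (circle_pts t)) \<longlonglongrightarrow> (if gap_exceeds n \<delta> t then 1 else 0))"
proof -
  have "\<forall>l. \<exists>P. real_polynomial_function P \<and> (\<forall>p\<in>sphere 0 1 \<times> sphere 0 1. \<bar>soft_close \<delta> l p - P p\<bar> < 1 / real (Suc l))"
  proof
    fix l
    have "compact (sphere 0 1 \<times> sphere 0 1 :: (complex \<times> complex) set)" by (intro compact_Times compact_sphere)
    moreover have "0 < 1 / real (Suc l)" by simp
    ultimately obtain P where "real_polynomial_function P" "\<And>p. p \<in> sphere 0 1 \<times> sphere 0 1 \<Longrightarrow> \<bar>soft_close \<delta> l p - P p\<bar> < 1 / real (Suc l)"
      using Stone_Weierstrass_real_polynomial_function[OF _ continuous_soft_close] by blast
    then show "\<exists>P. real_polynomial_function P \<and> (\<forall>p\<in>sphere 0 1 \<times> sphere 0 1. \<bar>soft_close \<delta> l p - P p\<bar> < 1 / real (Suc l))"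
      by blast
  qed
  from choice[OF this] obtain P where P: "\<And>l. real_polynomial_function (P l)"
    "\<And>l p. p \<in> sphere 0 1 \<times> sphere 0 1 \<Longrightarrow> \<bar>soft_close \<delta> l p - P l p\<bar> < 1 / real (Suc l)" by blast
  have "\<forall>l. \<exists>xs. \<forall>s t. complex_of_real (P l (cis s, cis t)) = (\<Sum>(c,a,b)\<leftarrow>xs. c * (cis s powi a * cis t powi b))"
    using polynomial_circle_laurent[OF P(1)] by blast
  then obtain xs where xs: "\<And>l s t. complex_of_real (P l (cis s, cis t)) = (\<Sum>(c,a,b)\<leftarrow>xs l. c * (cis s powi a * cis t powi b))"
    unfolding choice_iff by blast
  \<comment> \<open>Summed over all i and j, the monomial z_i^a z_j^b factors into two power
    sums.\<close>
  define Q where "Q l z = (\<Sum>(c,a,b)\<leftarrow>xs l. c * (psum n a z * psum n b z))" for l z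
  have Q: "Q l (circle_pts t) = (\<Sum>i<n. \<Sum>j<n. complex_of_real (P l (cis (t i), cis (t j))))" for l t
  proof -
    have "(\<Sum>i<n. \<Sum>j<n. (\<Sum>(c,a,b)\<leftarrow>ys. c * (cis (t i) powi a * cis (t j) powi b)))
       = (\<Sum>(c,a,b)\<leftarrow>ys. c * (psum n a (circle_pts t) * psum n b (circle_pts t)))" for ys :: "(complex \<times> int \<times> int) list"
    proof (induction ys)
      case (Cons y ys)
      obtain c a b where y: "y = (c,a,b)" by (metis prod_cases3)
      have "(\<Sum>i<n. \<Sum>j<n. c * (cis (t i) powi a * cis (t j) powi b)) = c * (psum n a (circle_pts t) * psum n b (circle_pts t))"
      proof -
        have "(\<Sum>i<n. \<Sum>j<n. cis (t i) powi a * cis (t j) powi b) = psum n a (circle_pts t) * psum n b (circle_pts t)"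
          by (simp only: psum_def circle_pts_def sum_product)
        then show ?thesis by (simp only: sum_distrib_left[symmetric])
      qed
      then show ?case using Cons by (simp add: y sum.distrib)
    qed simp
    then show ?thesis by (simp add: Q_def xs)
  qed
  have QsymL: "Q l \<in> symL n" for l
    unfolding Q_def[abs_def] split_def by (intro symL_sum_list symL_cmult symL.mult symL.psum)
  \<comment> \<open>Lagrange interpolation on the possible counts n, ..., n^2: the value is 1 at n
    and 0 at all others.\<close>
  define G where "G l z = (\<Prod>k\<in>{n+1..n*n}. (Q l z + (- of_nat k)) * (1 / (of_nat n - of_nat k)))" for l z
  have prodsym: "finite A \<Longrightarrow> (\<And>k. k \<in> A \<Longrightarrow> f k \<in> symL n) \<Longrightarrow> (\<lambda>z. \<Prod>k\<in>A. f k z) \<in> symL n" for A and f :: "nat \<Rightarrow> _"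
    by (induction A rule: finite_induct) (auto intro: symL.intros)
  have GsymL: "G l \<in> symL n" for l
    unfolding G_def[abs_def] by (intro prodsym symL.mult symL.add symL.const QsymL) simp
  have mem: "(cis s, cis t) \<in> sphere 0 1 \<times> sphere 0 1" for s t by simp
  have Pb: "\<bar>P l (cis s, cis t)\<bar> \<le> 2" for l s t
  proof -
    have "1 / real (Suc l) \<le> 1" by simp
    then show ?thesis using P(2)[OF mem, of l s t] soft_close_bounds[of \<delta> l "(cis s, cis t)"] by linarith
  qed
  define B where "B = (\<Prod>k\<in>{n+1..n*n}. (2 * real (n * n) + real k) * cmod (1 / (of_nat n - of_nat k)))"
  have bound: "cmod (G l (circle_pts t)) \<le> B" for l t
    unfolding G_def B_def prod_norm[symmetric]
  proof (intro prod_mono conjI norm_ge_zero)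
    fix k
    have "cmod (Q l (circle_pts t)) \<le> (\<Sum>i<n. \<Sum>j<n. cmod (complex_of_real (P l (cis (t i), cis (t j)))))"
      unfolding Q by (intro order_trans[OF norm_sum] sum_mono norm_sum)
    also have "\<dots> \<le> (\<Sum>i<n. \<Sum>j<n. 2)" using Pb by (intro sum_mono) auto
    finally have "cmod (Q l (circle_pts t)) \<le> 2 * real (n * n)" by simp
    then have "cmod (Q l (circle_pts t) + (- of_nat k)) \<le> 2 * real (n * n) + real k"
      by (intro order_trans[OF norm_triangle_ineq]) simp
    then show "cmod ((Q l (circle_pts t) + (- of_nat k)) * (1 / (of_nat n - of_nat k))) \<le> (2 * real (n * n) + real k) * cmod (1 / (of_nat n - of_nat k))"
      unfolding norm_mult by (intro mult_right_mono) auto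
  qed
  have lim: "(\<lambda>l. G l (circle_pts t)) \<longlonglongrightarrow> (if gap_exceeds n \<delta> t then 1 else 0)"
    if t: "\<forall>i<n. 0 \<le> t i \<and> t i < 2 * pi" for t
  proof -
    define N where "N = close_count n \<delta> t"
    have Pl: "(\<lambda>l. P l (cis (t i), cis (t j))) \<longlonglongrightarrow> (if \<bar>t i - t j\<bar> \<le> \<delta> then 1 else 0)" if "i < n" "j < n" for i j
    proof -
      have "(\<lambda>l. soft_close \<delta> l (cis (t i), cis (t j)) - P l (cis (t i), cis (t j))) \<longlonglongrightarrow> 0"
      proof (rule Lim_null_comparison[OF _ LIMSEQ_inverse_real_of_nat])
        show "\<forall>\<^sub>F l in sequentially. norm (soft_close \<delta> l (cis (t i), cis (t j)) - P l (cis (t i), cis (t j))) \<le> inverse (real (Suc l))"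
          using P(2)[OF mem] by (intro always_eventually allI) (simp add: inverse_eq_divide less_imp_le del: of_nat_Suc)
      qed
      from tendsto_diff[OF soft_close_tendsto[of "t i" "t j" \<delta>] this] show ?thesis using t that by simp
    qed
    have "(\<lambda>l. Q l (circle_pts t)) \<longlonglongrightarrow> (\<Sum>i<n. \<Sum>j<n. complex_of_real (if \<bar>t i - t j\<bar> \<le> \<delta> then 1 else 0))"
      unfolding Q by (intro tendsto_sum tendsto_of_real Pl) auto
    also have "(\<Sum>i<n. \<Sum>j<n. complex_of_real (if \<bar>t i - t j\<bar> \<le> \<delta> then 1 else 0)) = of_nat N"
    proof -
      have "(\<Sum>i<n. \<Sum>j<n. complex_of_real (if \<bar>t i - t j\<bar> \<le> \<delta> then 1 else 0))
        = (\<Sum>p\<in>{..<n}\<times>{..<n}. if \<bar>t (fst p) - t (snd p)\<bar> \<le> \<delta> then 1 else 0)"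
        by (simp add: sum.cartesian_product split_def if_distrib cong: if_cong)
      also have "\<dots> = of_nat N" unfolding N_def close_count_def
        by (subst sum.inter_filter[symmetric]) auto
      finally show ?thesis .
    qed
    finally have "(\<lambda>l. Q l (circle_pts t)) \<longlonglongrightarrow> of_nat N" .
    then have "(\<lambda>l. G l (circle_pts t)) \<longlonglongrightarrow> (\<Prod>k\<in>{n+1..n*n}. (of_nat N + (- of_nat k)) * (1 / (of_nat n - of_nat k)))"
      unfolding G_def by (intro tendsto_intros)
    also have "(\<Prod>k\<in>{n+1..n*n}. (of_nat N + (- of_nat k)) * (1 / (of_nat n - of_nat k))) = (if gap_exceeds n \<delta> t then 1 else (0::complex))"
    proof (cases "N = n")
      case True
      then show ?thesis using close_count_bounds(3)[OF assms, of n t]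
        by (auto simp: N_def[symmetric] intro!: prod.neutral)
    next
      case False
      then have "N \<in> {n+1..n*n}" using close_count_bounds(1,2)[OF assms, of n t] by (auto simp: N_def)
      then have "(\<Prod>k\<in>{n+1..n*n}. (of_nat N + (- of_nat k)) * (1 / (of_nat n - of_nat k))) = (0::complex)"
        by (intro prod_zero) (auto intro!: bexI[of _ N])
      then show ?thesis using False close_count_bounds(3)[OF assms, of n t] by (auto simp: N_def[symmetric])
    qed
    finally show ?thesis .
  qed
  show ?thesis using GsymL bound lim by blast
qed

section \<open>Transfer of the gap event to the Weyl density\<close>

lemma weyl_AE_range: "AE t in weyl n. \<forall>i<n. 0 \<le> t i \<and> t i < 2 * pi"
proof -
  have c: "AE x in circle_unif. 0 \<le> x \<and> x < 2 * pi"
    unfolding circle_unif_def by (subst AE_density) (auto intro!: AE_I2 split: split_indicator split_indicator_asm)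
  have "AE t in torus_unif n. 0 \<le> t i \<and> t i < 2 * pi" if "i < n" for i
    unfolding torus_unif_def
    by (rule AE_PiM_component[where P = "\<lambda>x. 0 \<le> x \<and> x < 2 * pi" and M = "\<lambda>_. circle_unif", OF _ _ c]) (use that prob_space_circle_unif in auto)
  then have "AE t in torus_unif n. \<forall>i\<in>{..<n}. 0 \<le> t i \<and> t i < 2 * pi"
    by (intro AE_finite_allI) auto
  then show ?thesis unfolding weyl_def
    by (subst AE_density) (auto elim!: eventually_mono)
qed

text \<open>Dominated convergence along the same approximants under both measures, whose means agree
  term by term. The gap event of the matrices is measurable as a level set of a pointwise limit of
  functions of traces.\<close>

lemma haar_weyl_gap:
  assumes H: "haar_unitary n M" and \<delta>: "\<delta> \<ge> 0"
  shows "measure M {U \<in> space M. gap_exceeds n \<delta> (\<lambda>i. eigenangles U ! i)} = measure (weyl n) {t \<in> space (weyl n). gap_exceeds n \<delta> t}"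
    and "{U \<in> space M. gap_exceeds n \<delta> (\<lambda>i. eigenangles U ! i)} \<in> sets M"
proof -
  interpret M: prob_space M by (rule haar_prob[OF H])
  interpret W: prob_space "weyl n" by (rule prob_space_weyl)
  obtain G B where G: "\<And>l. G l \<in> symL n" and B: "\<And>l t. cmod (G l (circle_pts t)) \<le> B"
    and lim: "\<And>t. \<forall>i<n. 0 \<le> t i \<and> t i < 2 * pi \<Longrightarrow> (\<lambda>l. G l (circle_pts t)) \<longlonglongrightarrow> (if gap_exceeds n \<delta> t then 1 else 0)"
    using gap_indicator_approx[OF \<delta>, of n] by blast
  define g where "g t = (if gap_exceeds n \<delta> t then 1 else (0::complex))" for t
  have ep: "eigen_points U = circle_pts (\<lambda>i. eigenangles U ! i)" for U
    by (auto simp: eigen_points_def circle_pts_def)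
  have mG: "(\<lambda>U. G l (eigen_points U)) \<in> borel_measurable M" for l
    using trig_family_integrable[OF H haar_bounded_symL[OF H G]] by auto
  have limU: "(\<lambda>l. G l (eigen_points U)) \<longlonglongrightarrow> g (\<lambda>i. eigenangles U ! i)" if "U \<in> space M" for U
    unfolding ep g_def using that haar_space[OF H] eigenangles_props(2) by (intro lim) auto
  have mg: "(\<lambda>U. g (\<lambda>i. eigenangles U ! i)) \<in> borel_measurable M"
    by (rule borel_measurable_LIMSEQ_metric[OF mG limU])
  have "{U \<in> space M. gap_exceeds n \<delta> (\<lambda>i. eigenangles U ! i)} = (\<lambda>U. g (\<lambda>i. eigenangles U ! i)) -` {1} \<inter> space M"
    by (auto simp: g_def split: if_splits)
  also have "\<dots> \<in> sets M" using mg by (rule measurable_sets) auto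
  finally show S: "{U \<in> space M. gap_exceeds n \<delta> (\<lambda>i. eigenangles U ! i)} \<in> sets M" .
  have comp: "(\<lambda>t. t i) \<in> borel_measurable (weyl n)" if "i < n" for i
    using torus_component_measurable[OF that] by (simp add: weyl_def)
  have SW: "{t \<in> space (weyl n). gap_exceeds n \<delta> t} \<in> sets (weyl n)"
  proof -
    have "{t \<in> space (weyl n). gap_exceeds n \<delta> t} = {t \<in> space (weyl n). \<forall>i\<in>{..<n}. \<forall>j\<in>{..<n}. i \<noteq> j \<longrightarrow> \<delta> < \<bar>t i - t j\<bar>}"
      by (auto simp: gap_exceeds_def)
    also have "\<dots> \<in> sets (weyl n)"
    proof (intro sets.sets_Collect_finite_All)
      fix i j assume "i \<in> {..<n}" "j \<in> {..<n}"
      then have [measurable]: "(\<lambda>t. t i) \<in> borel_measurable (weyl n)" "(\<lambda>t. t j) \<in> borel_measurable (weyl n)"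
        using comp by auto
      show "{t \<in> space (weyl n). i \<noteq> j \<longrightarrow> \<delta> < \<bar>t i - t j\<bar>} \<in> sets (weyl n)" by measurable
    qed auto
    finally show ?thesis .
  qed
  have "(\<lambda>l. \<integral>U. G l (eigen_points U) \<partial>M) \<longlonglongrightarrow> (\<integral>U. g (\<lambda>i. eigenangles U ! i) \<partial>M)"
    by (rule integral_dominated_convergence[where w = "\<lambda>_. B"]) (use mG mg limU B in \<open>auto simp: ep\<close>)
  moreover have "(\<lambda>l. \<integral>t. G l (circle_pts t) \<partial>weyl n) \<longlonglongrightarrow> (\<integral>t. g t \<partial>weyl n)"
  proof (rule integral_dominated_convergence[where w = "\<lambda>_. B"])
    show "g \<in> borel_measurable (weyl n)"
      unfolding g_def[abs_def] by (rule measurable_If) (use SW in auto)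
    show "(\<lambda>t. G l (circle_pts t)) \<in> borel_measurable (weyl n)" for l
      using symL_circle_measurable[OF G] by (simp add: weyl_def)
    show "AE t in weyl n. (\<lambda>l. G l (circle_pts t)) \<longlonglongrightarrow> g t"
      using weyl_AE_range by (rule eventually_mono) (auto simp: g_def dest: lim)
  qed (use B in auto)
  ultimately have "(\<integral>U. g (\<lambda>i. eigenangles U ! i) \<partial>M) = (\<integral>t. g t \<partial>weyl n)"
    unfolding haar_weyl_symL[OF H G] by (rule LIMSEQ_unique)
  moreover have "(\<integral>U. g (\<lambda>i. eigenangles U ! i) \<partial>M) = of_real (measure M {U \<in> space M. gap_exceeds n \<delta> (\<lambda>i. eigenangles U ! i)})"
  proof -
    have "(\<integral>U. g (\<lambda>i. eigenangles U ! i) \<partial>M) = (\<integral>U. complex_of_real (indicator {U \<in> space M. gap_exceeds n \<delta> (\<lambda>i. eigenangles U ! i)} U) \<partial>M)"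
      by (rule Bochner_Integration.integral_cong) (auto simp: g_def)
    then show ?thesis using S by simp
  qed
  moreover have "(\<integral>t. g t \<partial>weyl n) = of_real (measure (weyl n) {t \<in> space (weyl n). gap_exceeds n \<delta> t})"
  proof -
    have "(\<integral>t. g t \<partial>weyl n) = (\<integral>t. complex_of_real (indicator {t \<in> space (weyl n). gap_exceeds n \<delta> t} t) \<partial>weyl n)"
      by (rule Bochner_Integration.integral_cong) (auto simp: g_def)
    then show ?thesis using SW by simp
  qed
  ultimately show "measure M {U \<in> space M. gap_exceeds n \<delta> (\<lambda>i. eigenangles U ! i)} = measure (weyl n) {t \<in> space (weyl n). gap_exceeds n \<delta> t}"
    by (simp only: of_real_eq_iff)
qed

text \<open>From order 2 on the set under \<open>Min\<close> is nonempty, so its minimum exceeds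
  \<delta> exactly when all its members do.\<close>

lemma closest_spacing_gap:
  assumes U: "unitary_mat n U" and n: "n \<ge> 2"
  shows "closest_spacing U > \<delta> \<longleftrightarrow> gap_exceeds n \<delta> (\<lambda>i. eigenangles U ! i)"
proof -
  define t where "t = eigenangles U"
  define S where "S = {\<bar>t ! i - t ! j\<bar> | i j. i < length t \<and> j < length t \<and> i \<noteq> j}"
  have len: "length t = n" unfolding t_def by (rule eigenangles_props(1)[OF U])
  have "S \<subseteq> (\<lambda>(i,j). \<bar>t ! i - t ! j\<bar>) ` ({..<n} \<times> {..<n})" by (auto simp: S_def len)
  then have fin: "finite S" by (rule finite_subset) auto
  have "\<bar>t ! 0 - t ! 1\<bar> \<in> S" unfolding S_def len using n by force
  then have ne: "S \<noteq> {}" by auto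
  have "closest_spacing U = Min S" by (simp add: closest_spacing_def t_def S_def Let_def)
  then have "closest_spacing U > \<delta> \<longleftrightarrow> (\<forall>x\<in>S. \<delta> < x)" using Min_gr_iff[OF fin ne] by simp
  also have "\<dots> \<longleftrightarrow> gap_exceeds n \<delta> (\<lambda>i. eigenangles U ! i)"
    unfolding gap_exceeds_def S_def len t_def[symmetric] by blast
  finally show ?thesis .
qed

section \<open>Determinantal sums over tuples of eigenangles\<close>

text \<open>The kernel, relative to \<open>circle_unif\<close>, of the orthogonal projection onto
  the span of the exponentials of frequency 0, ..., n - 1.\<close>

definition dirichlet :: "nat \<Rightarrow> real \<Rightarrow> real \<Rightarrow> complex" where
  "dirichlet n s t = (\<Sum>l<n. cis (real l * (s - t)))"

text \<open>For m \<le> n this is the m-point correlation function of \<open>weyl n\<close> relative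
  to \<open>circle_unif\<close>. The permutation expansion is taken as the definition because
  Gaudin's lemma sorts by permutations.\<close>

definition kernel_det :: "nat \<Rightarrow> nat \<Rightarrow> (nat \<Rightarrow> real) \<Rightarrow> complex" where
  "kernel_det n m t = (\<Sum>p | p permutes {..<m}. signof p * (\<Prod>i<m. dirichlet n (t i) (t (p i))))"

lemma kernel_det_cong:
  assumes "\<And>i. i < m \<Longrightarrow> t i = u i"
  shows "kernel_det n m t = kernel_det n m u"
proof -
  have "(\<Prod>i<m. dirichlet n (t i) (t (p i))) = (\<Prod>i<m. dirichlet n (u i) (u (p i)))" if "p permutes {..<m}" for p
    using assms permutes_in_image[OF that] by (intro prod.cong refl) simp
  then show ?thesis unfolding kernel_det_def by (intro sum.cong refl) simp
qed

lemma kernel_det_det: "kernel_det n m t = det (mat m m (\<lambda>(i,j). dirichlet n (t i) (t j)))"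
proof -
  have "det (mat m m (\<lambda>(i,j). dirichlet n (t i) (t j)))
     = (\<Sum>p | p permutes {0..<m}. signof p * (\<Prod>i = 0..<m. dirichlet n (t i) (t (p i))))"
    by (subst det_def') (auto intro!: sum.cong prod.cong dest: permutes_in_image)
  then show ?thesis by (simp only: kernel_det_def atLeast0LessThan)
qed

text \<open>The kernel matrix is the Vandermonde matrix times its adjoint.\<close>

lemma kernel_det_full: "kernel_det n n t = of_real ((cmod (vdm n (circle_pts t)))\<^sup>2)"
proof -
  define A where "A = mat n n (\<lambda>(i,j). circle_pts t i powi int j)"
  have A: "A \<in> carrier_mat n n" by (simp add: A_def)
  interpret cnj: comm_ring_hom cnj by unfold_locales auto
  have adj: "mat_adjoint A = map_mat cnj (transpose_mat A)"
    by (rule eq_matI) (auto simp: A_def)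
  have "mat n n (\<lambda>(i,j). dirichlet n (t i) (t j)) = A * mat_adjoint A"
  proof (rule eq_matI)
    fix i j assume "i < dim_row (A * mat_adjoint A)" "j < dim_col (A * mat_adjoint A)"
    then have ij: "i < n" "j < n" using A by auto
    have "(A * mat_adjoint A) $$ (i,j) = (\<Sum>l<n. A $$ (i,l) * mat_adjoint A $$ (l,j))"
      by (rule mat_mult_index[OF A mat_adjoint_carrier[OF A] ij])
    also have "\<dots> = (\<Sum>l<n. cis (real l * (t i - t j)))"
    proof (rule sum.cong[OF refl])
      fix l assume "l \<in> {..<n}"
      then have l: "l < n" by simp
      have Al: "A $$ (i,l) = cis (real l * t i)" if "i < n" for i
        using that l cis_powi[of "t i" "int l"] by (simp add: A_def circle_pts_def)
      moreover have "mat_adjoint A $$ (l,j) = cnj (A $$ (j,l))" using A l ij by (intro mat_adjoint_index) auto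
      ultimately have "A $$ (i,l) = cis (real l * t i)" "mat_adjoint A $$ (l,j) = cis (- (real l * t j))"
        using ij by (simp_all add: cis_cnj)
      then show "A $$ (i,l) * mat_adjoint A $$ (l,j) = cis (real l * (t i - t j))"
        by (simp add: cis_mult right_diff_distrib)
    qed
    finally show "mat n n (\<lambda>(i,j). dirichlet n (t i) (t j)) $$ (i,j) = (A * mat_adjoint A) $$ (i,j)"
      using ij by (simp add: dirichlet_def)
  qed (use A in auto)
  then have "kernel_det n n t = det A * det (mat_adjoint A)"
    unfolding kernel_det_det using A by (simp add: det_mult[of _ n])
  also have "det (mat_adjoint A) = cnj (det A)"
    unfolding adj cnj.hom_det det_transpose[OF A] ..
  also have "det A = vdm n (circle_pts t)" by (simp add: A_def alternant_def)
  finally show ?thesis by (simp only: vdm_norm_square)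
qed

lemma circle_integrable_bounded:
  fixes f :: "real \<Rightarrow> complex"
  assumes "continuous_on UNIV f" "\<And>x. cmod (f x) \<le> B"
  shows "integrable circle_unif f"
  by (rule circle_unif.integrable_const_bound[of _ B])
     (use assms borel_measurable_continuous_onI[OF assms(1)] in \<open>auto simp: measurable_cong_sets[OF sets_circle_unif refl]\<close>)

lemma norm_dirichlet: "cmod (dirichlet n s t) \<le> real n"
proof -
  have "cmod (dirichlet n s t) \<le> (\<Sum>l<n. cmod (cis (real l * (s - t))))" unfolding dirichlet_def by (rule norm_sum)
  then show ?thesis by simp
qed

lemma continuous_dirichlet [continuous_intros]:
  "continuous_on S f \<Longrightarrow> continuous_on S g \<Longrightarrow> continuous_on S (\<lambda>x. dirichlet n (f x) (g x))"
  unfolding dirichlet_def by (intro continuous_intros)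

lemma dirichlet_integrable: "integrable circle_unif (\<lambda>y. dirichlet n s y * dirichlet n y t)"
  by (rule circle_integrable_bounded[of _ "real n * real n"])
     (auto intro!: continuous_intros mult_mono norm_dirichlet simp: norm_mult)

text \<open>Idempotence of the projection: in the double sum of exponentials only equal frequencies
  survive the integration.\<close>

lemma dirichlet_reproducing: "(\<integral>y. dirichlet n s y * dirichlet n y t \<partial>circle_unif) = dirichlet n s t"
proof -
  have int: "integrable circle_unif (\<lambda>y. cis (of_int k * y))" for k
    by (rule circle_integrable_bounded[of _ 1]) (auto intro!: continuous_intros)
  have "dirichlet n s y * dirichlet n y t = (\<Sum>l<n. \<Sum>k<n. (cis (real l * s) * cis (- (real k * t))) * cis (of_int (int k - int l) * y))" for y
    unfolding dirichlet_def sum_product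
  proof (intro sum.cong refl)
    fix l k
    have "real l * (s - y) + real k * (y - t) = (real l * s + - (real k * t)) + of_int (int k - int l) * y"
      by (simp add: algebra_simps)
    then show "cis (real l * (s - y)) * cis (real k * (y - t)) = (cis (real l * s) * cis (- (real k * t))) * cis (of_int (int k - int l) * y)"
      by (simp only: cis_mult)
  qed
  then have "(\<integral>y. dirichlet n s y * dirichlet n y t \<partial>circle_unif)
     = (\<Sum>l<n. \<Sum>k<n. (cis (real l * s) * cis (- (real k * t))) * (\<integral>y. cis (of_int (int k - int l) * y) \<partial>circle_unif))"
    by (simp only: integral_double_sum[OF int])
  also have "\<dots> = (\<Sum>l<n. \<Sum>k<n. if k = l then cis (real l * s) * cis (- (real k * t)) else 0)"
    unfolding circle_integral_cis by (intro sum.cong refl) simp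
  also have "\<dots> = dirichlet n s t"
    unfolding dirichlet_def by (intro sum.cong refl) (simp add: cis_mult right_diff_distrib)
  finally show ?thesis .
qed

text \<open>Gaudin's lemma: in the expansion over the permutations of \<open>{..m}\<close>, those fixing \<open>m\<close> contribute
  \<open>n\<close> times the smaller determinant, while each of the others is contracted by the reproducing
  property of the kernel, with a change of sign.\<close>

lemma kernel_det_integral:
  "integrable circle_unif (\<lambda>y. kernel_det n (Suc m) (t(m := y)))"
  "(\<integral>y. kernel_det n (Suc m) (t(m := y)) \<partial>circle_unif) = (of_nat n - of_nat m) * kernel_det n m t"
proof -
  define f where "f y p = signof p * (\<Prod>i<Suc m. dirichlet n ((t(m := y)) i) ((t(m := y)) (p i)))" for y p
  define g where "g q = signof q * (\<Prod>i<m. dirichlet n (t i) (t (q i)))" for q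
  have K: "kernel_det n (Suc m) (t(m := y)) = (\<Sum>b\<in>insert m {..<m}. \<Sum>q | q permutes {..<m}. f y (Transposition.transpose m b \<circ> q))" for y
    unfolding kernel_det_def f_def lessThan_Suc by (rule sum_over_permutations_insert) auto
  have fm: "f y (Transposition.transpose m m \<circ> q) = of_nat n * g q" if q: "q permutes {..<m}" for q y
  proof -
    have "q m = m" using q by (auto intro: permutes_not_in)
    moreover have "(\<Prod>i<m. dirichlet n ((t(m := y)) i) ((t(m := y)) (q i))) = (\<Prod>i<m. dirichlet n (t i) (t (q i)))"
    proof (rule prod.cong[OF refl])
      fix i assume "i \<in> {..<m}"
      then have "i < m" "q i < m" using permutes_in_image[OF q, of i] by auto
      then show "dirichlet n ((t(m := y)) i) ((t(m := y)) (q i)) = dirichlet n (t i) (t (q i))" by simp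
    qed
    moreover have "dirichlet n y y = of_nat n" by (simp add: dirichlet_def)
    ultimately show ?thesis by (simp add: f_def g_def)
  qed
  have fb: "integrable circle_unif (\<lambda>y. f y (Transposition.transpose m b \<circ> q))"
    "(\<integral>y. f y (Transposition.transpose m b \<circ> q) \<partial>circle_unif) = - g q"
    if q: "q permutes {..<m}" and b: "b < m" for q b
  proof -
    \<comment> \<open>\<open>i0\<close> is the index that q sends to b. After the transposition
      \<open>i0\<close> goes to m and m goes to b, so y occurs in just two factors, which the
      reproducing property contracts to the factor of \<open>i0\<close> in q.\<close>
    obtain i0 where i0: "q i0 = b" "i0 < m"
      using b permutes_image[OF q] by (metis imageE lessThan_iff)
    have qm: "q m = m" using q by (auto intro: permutes_not_in)
    have perm: "permutation q" using q by (rule permutation_permutes[THEN iffD2, OF exI, OF conjI, rotated]) simp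
    have sg: "signof (Transposition.transpose m b \<circ> q) = - (signof q :: complex)"
      using sign_compose[OF permutation_swap_id perm, of m b] b by (simp add: sign_swap_id)
    define c where "c = (\<Prod>i\<in>{..<m}-{i0}. dirichlet n (t i) (t (q i)))"
    have e: "f y (Transposition.transpose m b \<circ> q) = - signof q * c * (dirichlet n (t i0) y * dirichlet n y (t b))" for y
    proof -
      have "(\<Prod>i<m. dirichlet n ((t(m := y)) i) ((t(m := y)) ((Transposition.transpose m b \<circ> q) i)))
         = dirichlet n (t i0) y * (\<Prod>i\<in>{..<m}-{i0}. dirichlet n ((t(m := y)) i) ((t(m := y)) ((Transposition.transpose m b \<circ> q) i)))"
        using i0 by (subst prod.remove[of _ i0]) auto
      also have "(\<Prod>i\<in>{..<m}-{i0}. dirichlet n ((t(m := y)) i) ((t(m := y)) ((Transposition.transpose m b \<circ> q) i))) = c"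
        unfolding c_def
      proof (rule prod.cong[OF refl])
        fix i assume i: "i \<in> {..<m}-{i0}"
        then have "q i < m" using permutes_in_image[OF q, of i] by auto
        moreover have "q i \<noteq> b" using i i0(1) permutes_inj[OF q] by (auto simp: inj_eq)
        ultimately show "dirichlet n ((t(m := y)) i) ((t(m := y)) ((Transposition.transpose m b \<circ> q) i)) = dirichlet n (t i) (t (q i))"
          using i by (simp add: transpose_apply_other)
      qed
      finally show ?thesis using b qm by (simp add: f_def sg mult_ac)
    qed
    show "integrable circle_unif (\<lambda>y. f y (Transposition.transpose m b \<circ> q))"
      unfolding e by (intro integrable_mult_right dirichlet_integrable)
    have "(\<integral>y. f y (Transposition.transpose m b \<circ> q) \<partial>circle_unif) = - signof q * c * dirichlet n (t i0) (t b)"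
      unfolding e by (simp only: integral_mult_right_zero dirichlet_reproducing)
    also have "\<dots> = - g q"
      unfolding g_def c_def using i0 by (subst (2) prod.remove[of _ i0]) (auto simp: mult_ac)
    finally show "(\<integral>y. f y (Transposition.transpose m b \<circ> q) \<partial>circle_unif) = - g q" .
  qed
  have int: "integrable circle_unif (\<lambda>y. f y (Transposition.transpose m b \<circ> q))" if "q permutes {..<m}" "b \<in> insert m {..<m}" for q b
    using that fb(1)[of q b] by (cases "b = m") (auto simp del: transpose_same comp_apply simp: fm)
  show "integrable circle_unif (\<lambda>y. kernel_det n (Suc m) (t(m := y)))"
    unfolding K by (intro Bochner_Integration.integrable_sum int) auto
  have "(\<integral>y. kernel_det n (Suc m) (t(m := y)) \<partial>circle_unif)
     = (\<Sum>b\<in>insert m {..<m}. \<Sum>q | q permutes {..<m}. \<integral>y. f y (Transposition.transpose m b \<circ> q) \<partial>circle_unif)"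
    unfolding K
    by (subst Bochner_Integration.integral_sum, intro Bochner_Integration.integrable_sum int, simp, simp)
       (intro sum.cong refl Bochner_Integration.integral_sum int, auto)
  also have "\<dots> = (\<Sum>q | q permutes {..<m}. of_nat n * g q) + (\<Sum>b<m. \<Sum>q | q permutes {..<m}. - g q)"
  proof -
    have "(\<Sum>q | q permutes {..<m}. \<integral>y. f y (Transposition.transpose m m \<circ> q) \<partial>circle_unif) = (\<Sum>q | q permutes {..<m}. of_nat n * g q)"
    proof (rule sum.cong[OF refl])
      fix q assume "q \<in> {q. q permutes {..<m}}"
      then have "(\<lambda>y. f y (Transposition.transpose m m \<circ> q)) = (\<lambda>y. of_nat n * g q)" by (intro ext fm) simp
      moreover have "(\<integral>y. of_nat n * g q \<partial>circle_unif) = of_nat n * g q"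
        using circle_unif.prob_space by simp
      ultimately show "(\<integral>y. f y (Transposition.transpose m m \<circ> q) \<partial>circle_unif) = of_nat n * g q" by (simp only:)
    qed
    moreover have "(\<Sum>b<m. \<Sum>q | q permutes {..<m}. \<integral>y. f y (Transposition.transpose m b \<circ> q) \<partial>circle_unif) = (\<Sum>b<m. \<Sum>q | q permutes {..<m}. - g q)"
      by (intro sum.cong refl fb(2)) auto
    ultimately show ?thesis by (subst sum.insert) (simp_all only: finite_lessThan lessThan_iff less_irrefl not_False_eq_True)
  qed
  also have "\<dots> = (of_nat n - of_nat m) * kernel_det n m t"
    unfolding kernel_det_def g_def[symmetric] by (simp add: sum_negf sum_distrib_left left_diff_distrib sum_subtractf)
  finally show "(\<integral>y. kernel_det n (Suc m) (t(m := y)) \<partial>circle_unif) = (of_nat n - of_nat m) * kernel_det n m t" .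
qed

text \<open>Downwards from m = n, where the determinant is the square of the modulus of
  \<open>vdm\<close>: each smaller one is a positive multiple of an integral of the next larger
  one.\<close>

lemma kernel_det_nonneg:
  assumes "m \<le> n"
  shows "Re (kernel_det n m t) \<ge> 0"
  using assms
proof (induction m arbitrary: t rule: inc_induct)
  case base
  show ?case unfolding kernel_det_full by simp
next
  case (step m)
  have "0 \<le> (\<integral>y. Re (kernel_det n (Suc m) (t(m := y))) \<partial>circle_unif)"
    by (intro integral_nonneg_AE AE_I2 step.IH)
  also have "\<dots> = Re ((of_nat n - of_nat m) * kernel_det n m t)"
    using kernel_det_integral[of n m t] by simp
  also have "\<dots> = (real n - real m) * Re (kernel_det n m t)"
    by simp
  finally show ?case using step.hyps by (simp add: zero_le_mult_iff)
qed

section \<open>Marginals of the Weyl density\<close>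

lemma kernel_det_nn_integral:
  assumes "m < n"
  shows "(\<integral>\<^sup>+y. ennreal (Re (kernel_det n (Suc m) (t(m := y)))) \<partial>circle_unif) = ennreal (real (n - m) * Re (kernel_det n m t))"
proof -
  have "(\<integral>\<^sup>+y. ennreal (Re (kernel_det n (Suc m) (t(m := y)))) \<partial>circle_unif) = ennreal (\<integral>y. Re (kernel_det n (Suc m) (t(m := y))) \<partial>circle_unif)"
    using kernel_det_integral[of n m t] assms by (intro nn_integral_eq_integral AE_I2 kernel_det_nonneg) auto
  also have "(\<integral>y. Re (kernel_det n (Suc m) (t(m := y))) \<partial>circle_unif) = Re ((of_nat n - of_nat m) * kernel_det n m t)"
    using kernel_det_integral[of n m t] by simp
  also have "\<dots> = real (n - m) * Re (kernel_det n m t)" using assms by (simp add: of_nat_diff)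
  finally show ?thesis .
qed

lemma kernel_det_measurable:
  assumes "m \<le> k"
  shows "(\<lambda>t. kernel_det n m t) \<in> borel_measurable (torus_unif k)"
  unfolding kernel_det_def dirichlet_def
proof (intro borel_measurable_sum borel_measurable_times borel_measurable_prod borel_measurable_const)
  fix p i l assume "p \<in> {p. p permutes {..<m}}" "i \<in> {..<m}"
  then have "i < k" "p i < k" using assms permutes_in_image[of p "{..<m}" i] by auto
  then show "(\<lambda>t. cis (real l * (t i - t (p i)))) \<in> borel_measurable (torus_unif k)" by simp
qed

lemma restrict_measurable_torus:
  "m \<le> k \<Longrightarrow> (\<lambda>t. restrict t {..<m}) \<in> measurable (torus_unif k) (torus_unif m)"
  unfolding torus_unif_def by (rule measurable_restrict_subset) auto

text \<open>Integrating out the coordinate k, from size k + 1 to size k, contributes n - k. The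
  factors are collected as factorials on both sides, which keeps division out of
  \<open>ennreal\<close>.\<close>

lemma torus_integrate_out:
  assumes H: "H \<in> borel_measurable (torus_unif m)" and d: "d \<le> n - m" and m: "m \<le> n"
  shows "(\<integral>\<^sup>+t. H (restrict t {..<m}) * ennreal (Re (kernel_det n (m + d) t)) \<partial>torus_unif (m + d)) * fact (n - m - d)
     = fact (n - m) * (\<integral>\<^sup>+t. H t * ennreal (Re (kernel_det n m t)) \<partial>torus_unif m)"
  using d
proof (induction d)
  case 0
  have "(\<integral>\<^sup>+t. H (restrict t {..<m}) * ennreal (Re (kernel_det n m t)) \<partial>torus_unif m)
     = (\<integral>\<^sup>+t. H t * ennreal (Re (kernel_det n m t)) \<partial>torus_unif m)"
    by (rule nn_integral_cong) (auto simp: torus_unif_def space_PiM PiE_def extensional_restrict)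
  then show ?case by (simp only: add_0_right diff_zero mult.commute)
next
  case (Suc d)
  define k where "k = m + d"
  have k: "k < n" using Suc.prems m by (simp add: k_def)
  have meas: "(\<lambda>t. H (restrict t {..<m}) * ennreal (Re (kernel_det n (Suc k) t))) \<in> borel_measurable (torus_unif (Suc k))"
    using measurable_compose[OF restrict_measurable_torus[of m "Suc k"] H] kernel_det_measurable[of "Suc k" "Suc k" n]
    by (auto simp: k_def)
  have "(\<integral>\<^sup>+t. H (restrict t {..<m}) * ennreal (Re (kernel_det n (Suc k) t)) \<partial>torus_unif (Suc k))
     = (\<integral>\<^sup>+x. (\<integral>\<^sup>+y. H (restrict (x(k := y)) {..<m}) * ennreal (Re (kernel_det n (Suc k) (x(k := y)))) \<partial>circle_unif) \<partial>torus_unif k)"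
    using meas unfolding torus_unif_def lessThan_Suc by (intro torus.product_nn_integral_insert) auto
  also have "\<dots> = (\<integral>\<^sup>+x. H (restrict x {..<m}) * ennreal (real (n - k) * Re (kernel_det n k x)) \<partial>torus_unif k)"
  proof (rule nn_integral_cong)
    fix x
    have "(\<integral>\<^sup>+y. H (restrict (x(k := y)) {..<m}) * ennreal (Re (kernel_det n (Suc k) (x(k := y)))) \<partial>circle_unif)
       = (\<integral>\<^sup>+y. H (restrict x {..<m}) * ennreal (Re (kernel_det n (Suc k) (x(k := y)))) \<partial>circle_unif)"
    proof -
      have "restrict (x(k := y)) {..<m} = restrict x {..<m}" for y by (auto simp: k_def)
      then show ?thesis by (simp only:)
    qed
    also have "\<dots> = H (restrict x {..<m}) * (\<integral>\<^sup>+y. ennreal (Re (kernel_det n (Suc k) (x(k := y)))) \<partial>circle_unif)"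
      by (rule nn_integral_cmult) (use kernel_det_integral(1)[of n k x] in auto)
    finally show "(\<integral>\<^sup>+y. H (restrict (x(k := y)) {..<m}) * ennreal (Re (kernel_det n (Suc k) (x(k := y)))) \<partial>circle_unif)
       = H (restrict x {..<m}) * ennreal (real (n - k) * Re (kernel_det n k x))"
      by (simp only: kernel_det_nn_integral[OF k])
  qed
  also have "\<dots> = (\<integral>\<^sup>+x. of_nat (n - k) * (H (restrict x {..<m}) * ennreal (Re (kernel_det n k x))) \<partial>torus_unif k)"
    using k by (intro nn_integral_cong) (simp add: ennreal_mult kernel_det_nonneg ennreal_of_nat_eq_real_of_nat mult_ac)
  also have "\<dots> = of_nat (n - k) * (\<integral>\<^sup>+x. H (restrict x {..<m}) * ennreal (Re (kernel_det n k x)) \<partial>torus_unif k)"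
    using measurable_compose[OF restrict_measurable_torus[of m k] H] kernel_det_measurable[of k k n]
    by (intro nn_integral_cmult) (auto simp: k_def)
  finally have "(\<integral>\<^sup>+t. H (restrict t {..<m}) * ennreal (Re (kernel_det n (Suc k) t)) \<partial>torus_unif (Suc k)) * fact (n - m - Suc d)
     = (\<integral>\<^sup>+x. H (restrict x {..<m}) * ennreal (Re (kernel_det n k x)) \<partial>torus_unif k) * (of_nat (n - k) * fact (n - m - Suc d))"
    by (simp add: mult_ac)
  also have "of_nat (n - k) * fact (n - m - Suc d) = (fact (n - m - d) :: ennreal)"
  proof -
    have "n - m - d = Suc (n - m - Suc d)" using Suc.prems by simp
    moreover have "n - k = Suc (n - m - Suc d)" using Suc.prems by (simp add: k_def)
    ultimately show ?thesis by (simp del: of_nat_Suc)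
  qed
  finally show ?case using Suc by (simp add: k_def)
qed

lemma weyl_nn_integral:
  assumes [measurable]: "f \<in> borel_measurable (torus_unif n)"
  shows "(\<integral>\<^sup>+t. f t \<partial>weyl n) * fact n = (\<integral>\<^sup>+t. f t * ennreal (Re (kernel_det n n t)) \<partial>torus_unif n)"
proof -
  have "(\<integral>\<^sup>+t. f t \<partial>weyl n) * fact n = (\<integral>\<^sup>+t. ennreal ((cmod (vdm n (circle_pts t)))\<^sup>2 / fact n) * f t \<partial>torus_unif n) * fact n"
    unfolding weyl_def by (subst nn_integral_density) auto
  also have "\<dots> = (\<integral>\<^sup>+t. ennreal ((cmod (vdm n (circle_pts t)))\<^sup>2 / fact n) * f t * fact n \<partial>torus_unif n)"
    by (rule nn_integral_multc[symmetric]) auto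
  also have "\<dots> = (\<integral>\<^sup>+t. f t * ennreal (Re (kernel_det n n t)) \<partial>torus_unif n)"
  proof (rule nn_integral_cong)
    fix t
    have "ennreal ((cmod (vdm n (circle_pts t)))\<^sup>2 / fact n) * fact n = ennreal ((cmod (vdm n (circle_pts t)))\<^sup>2 / fact n * fact n)"
      using ennreal_of_nat_eq_real_of_nat[of "fact n"] by (subst ennreal_mult) auto
    then have X: "ennreal ((cmod (vdm n (circle_pts t)))\<^sup>2 / fact n) * fact n = ennreal (Re (kernel_det n n t))"
      by (simp add: kernel_det_full)
    have "ennreal ((cmod (vdm n (circle_pts t)))\<^sup>2 / fact n) * f t * fact n
       = f t * (ennreal ((cmod (vdm n (circle_pts t)))\<^sup>2 / fact n) * fact n)" by (simp only: mult_ac)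
    then show "ennreal ((cmod (vdm n (circle_pts t)))\<^sup>2 / fact n) * f t * fact n = f t * ennreal (Re (kernel_det n n t))"
      by (simp only: X)
  qed
  finally show ?thesis .
qed

lemma weyl_marginal:
  assumes H: "H \<in> borel_measurable (torus_unif m)" and m: "m \<le> n"
  shows "(\<integral>\<^sup>+t. H (restrict t {..<m}) \<partial>weyl n) * fact n = fact (n - m) * (\<integral>\<^sup>+t. H t * ennreal (Re (kernel_det n m t)) \<partial>torus_unif m)"
  using torus_integrate_out[OF H order_refl m] weyl_nn_integral[OF measurable_compose[OF restrict_measurable_torus[OF m] H]] m
  by simp

section \<open>Permutation symmetry and sums over distinct indices\<close>

lemma vdm_permute:
  assumes p: "p permutes {..<n}"
  shows "cmod (vdm n (\<lambda>i. z (p i))) = cmod (vdm n z)"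
proof -
  define A where "A = mat n n (\<lambda>(i,j). z i powi int j)"
  have p': "p permutes {0..<n}" using p by (simp add: atLeast0LessThan)
  have "mat n n (\<lambda>(i,j). z (p i) powi int j) = mat n n (\<lambda>(i,j). A $$ (p i, j))"
    by (rule eq_matI) (use permutes_in_image[OF p] in \<open>auto simp: A_def\<close>)
  then have "vdm n (\<lambda>i. z (p i)) = signof p * det A"
    unfolding alternant_def using det_permute_rows[OF _ p', of A] by (simp add: A_def)
  then show ?thesis by (simp add: norm_mult sign_def alternant_def A_def)
qed

lemma torus_permute:
  assumes p: "p permutes {..<n}" and g: "g \<in> borel_measurable (torus_unif n)"
  shows "(\<integral>\<^sup>+t. g (\<lambda>i\<in>{..<n}. t (p i)) \<partial>torus_unif n) = (\<integral>\<^sup>+t. g t \<partial>torus_unif n)"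
proof -
  have "distr (torus_unif n) (torus_unif n) (\<lambda>t. \<lambda>i\<in>{..<n}. t (p i)) = torus_unif n"
    unfolding torus_unif_def
    by (rule distr_PiM_reindex) (use prob_space_circle_unif permutes_inj_on[OF p] permutes_in_image[OF p] in auto)
  then have "(\<integral>\<^sup>+t. g t \<partial>torus_unif n) = (\<integral>\<^sup>+t. g t \<partial>distr (torus_unif n) (torus_unif n) (\<lambda>t. \<lambda>i\<in>{..<n}. t (p i)))" by simp
  also have "\<dots> = (\<integral>\<^sup>+t. g (\<lambda>i\<in>{..<n}. t (p i)) \<partial>torus_unif n)"
  proof (rule nn_integral_distr)
    show "g \<in> borel_measurable (distr (torus_unif n) (torus_unif n) (\<lambda>t. \<lambda>i\<in>{..<n}. t (p i)))" using g by simp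
    show "(\<lambda>t. \<lambda>i\<in>{..<n}. t (p i)) \<in> measurable (torus_unif n) (torus_unif n)"
      unfolding torus_unif_def using permutes_in_image[OF p]
      by (intro measurable_restrict measurable_component_singleton) auto
  qed
  finally show ?thesis by simp
qed

lemma inj_on_extends_permutes:
  fixes f :: "nat \<Rightarrow> nat"
  assumes f: "f \<in> {..<m} \<rightarrow> {..<n}" "inj_on f {..<m}" and m: "m \<le> n"
  shows "\<exists>p. p permutes {..<n} \<and> (\<forall>i<m. p i = f i)"
proof -
  have "card ({..<n} - {..<m}) = card ({..<n} - f ` {..<m})"
    using f m by (subst (1 2) card_Diff_subset) (auto simp: card_image)
  then obtain h where h: "bij_betw h ({..<n} - {..<m}) ({..<n} - f ` {..<m})"
    using finite_same_card_bij[of "{..<n} - {..<m}" "{..<n} - f ` {..<m}"] by auto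
  define p where "p i = (if i < m then f i else if i < n then h i else i)" for i
  have "bij_betw p ({..<m} \<union> ({..<n} - {..<m})) (f ` {..<m} \<union> ({..<n} - f ` {..<m}))"
  proof (rule bij_betw_combine)
    show "bij_betw p {..<m} (f ` {..<m})"
      using f(2) by (auto simp: bij_betw_def p_def inj_on_def)
    show "bij_betw p ({..<n} - {..<m}) ({..<n} - f ` {..<m})"
      using h by (rule bij_betw_cong[THEN iffD1, rotated]) (auto simp: p_def)
  qed auto
  moreover have "{..<m} \<union> ({..<n} - {..<m}) = {..<n}" "f ` {..<m} \<union> ({..<n} - f ` {..<m}) = {..<n}"
    using f m by auto
  ultimately have "bij_betw p {..<n} {..<n}" by simp
  then have "p permutes {..<n}" by (rule bij_imp_permutes) (use m in \<open>auto simp: p_def\<close>)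
  then show ?thesis by (intro exI[of _ p]) (simp add: p_def)
qed

definition inj_tuples :: "nat \<Rightarrow> nat \<Rightarrow> (nat \<Rightarrow> nat) set" where
  "inj_tuples m n = {f \<in> {..<m} \<rightarrow>\<^sub>E {..<n}. inj_on f {..<m}}"

definition tuple_sum :: "nat \<Rightarrow> nat \<Rightarrow> ((nat \<Rightarrow> real) \<Rightarrow> real) \<Rightarrow> (nat \<Rightarrow> real) \<Rightarrow> real" where
  "tuple_sum n m h t = (\<Sum>f\<in>inj_tuples m n. h (\<lambda>i\<in>{..<m}. t (f i)))"

lemma finite_inj_tuples [simp]: "finite (inj_tuples m n)"
proof -
  have "finite ({..<m} \<rightarrow>\<^sub>E {..<n})" by (rule finite_PiE) auto
  then show ?thesis by (rule finite_subset[rotated]) (auto simp: inj_tuples_def)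
qed

lemma card_inj_tuples:
  assumes "m \<le> n"
  shows "card (inj_tuples m n) * fact (n - m) = fact n"
proof -
  have "card (inj_tuples m n) = (\<Prod>i\<in>{0..<m}. n - i)"
    using card_inj_on_subset_funcset[of "{..<m}" "{..<n}" "{..<m}"] by (simp add: inj_tuples_def)
  moreover have "(\<Prod>i\<in>{0..<m}. n - i) * fact (n - m) = fact n"
    using assms
  proof (induction m)
    case (Suc m)
    have "n - m = Suc (n - Suc m)" using Suc.prems by simp
    then have "(n - m) * fact (n - Suc m) = fact (n - m)" by (metis fact_Suc of_nat_id)
    then have "(\<Prod>i\<in>{0..<Suc m}. n - i) * fact (n - Suc m) = (\<Prod>i\<in>{0..<m}. n - i) * fact (n - m)"
      by (simp add: mult.assoc)
    then show ?case using Suc by simp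
  qed simp
  ultimately show ?thesis by simp
qed

text \<open>The density is symmetric. An injective tuple of indices extends to a permutation of all
  of them, which moves the tuple to the first m coordinates, where \<open>weyl_marginal\<close>
  applies.\<close>

lemma weyl_tuple:
  assumes H: "H \<in> borel_measurable (torus_unif m)" and m: "m \<le> n" and f: "f \<in> inj_tuples m n"
  shows "(\<integral>\<^sup>+t. H (\<lambda>i\<in>{..<m}. t (f i)) \<partial>weyl n) * fact n = fact (n - m) * (\<integral>\<^sup>+t. H t * ennreal (Re (kernel_det n m t)) \<partial>torus_unif m)"
proof -
  obtain p where p: "p permutes {..<n}" "\<And>i. i < m \<Longrightarrow> p i = f i"
    using inj_on_extends_permutes[of f m n] f m by (auto simp: inj_tuples_def PiE_def)
  have fm: "(\<lambda>t. \<lambda>i\<in>{..<m}. t (f i)) \<in> measurable (torus_unif n) (torus_unif m)"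
    unfolding torus_unif_def using f by (intro measurable_restrict measurable_component_singleton) (auto simp: inj_tuples_def)
  define g where "g t = H (restrict t {..<m}) * ennreal (Re (kernel_det n n t))" for t
  have g: "g \<in> borel_measurable (torus_unif n)"
    unfolding g_def[abs_def] using measurable_compose[OF restrict_measurable_torus[OF m] H] kernel_det_measurable[of n n n] by auto
  have "(\<integral>\<^sup>+t. H (\<lambda>i\<in>{..<m}. t (f i)) \<partial>weyl n) * fact n = (\<integral>\<^sup>+t. H (\<lambda>i\<in>{..<m}. t (f i)) * ennreal (Re (kernel_det n n t)) \<partial>torus_unif n)"
    by (rule weyl_nn_integral[OF measurable_compose[OF fm H]])
  also have "\<dots> = (\<integral>\<^sup>+t. g (\<lambda>i\<in>{..<n}. t (p i)) \<partial>torus_unif n)"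
  proof (rule nn_integral_cong)
    fix t :: "nat \<Rightarrow> real"
    have "restrict (\<lambda>i\<in>{..<n}. t (p i)) {..<m} = (\<lambda>i\<in>{..<m}. t (f i))" using p(2) m by (auto simp: restrict_def fun_eq_iff)
    moreover have "kernel_det n n (\<lambda>i\<in>{..<n}. t (p i)) = kernel_det n n (\<lambda>i. t (p i))" by (rule kernel_det_cong) simp
    moreover have "kernel_det n n (\<lambda>i. t (p i)) = kernel_det n n t"
      unfolding kernel_det_full using vdm_permute[OF p(1), of "circle_pts t"] by (simp add: circle_pts_def[abs_def])
    ultimately show "H (\<lambda>i\<in>{..<m}. t (f i)) * ennreal (Re (kernel_det n n t)) = g (\<lambda>i\<in>{..<n}. t (p i))" by (simp add: g_def)
  qed
  also have "\<dots> = (\<integral>\<^sup>+t. g t \<partial>torus_unif n)" by (rule torus_permute[OF p(1) g])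
  also have "\<dots> = (\<integral>\<^sup>+t. H (restrict t {..<m}) \<partial>weyl n) * fact n"
    unfolding g_def by (rule weyl_nn_integral[symmetric, OF measurable_compose[OF restrict_measurable_torus[OF m] H]])
  finally show ?thesis by (simp only: weyl_marginal[OF H m])
qed

text \<open>All tuples have the same mean, and their number n! / (n - m)! cancels the factorials of
  the marginal.\<close>

lemma weyl_tuple_sum:
  assumes h: "h \<in> borel_measurable (torus_unif m)" and h0: "\<And>t. h t \<ge> 0" and m: "m \<le> n"
  shows "(\<integral>\<^sup>+t. ennreal (tuple_sum n m h t) \<partial>weyl n) = (\<integral>\<^sup>+t. ennreal (h t) * ennreal (Re (kernel_det n m t)) \<partial>torus_unif m)"
proof -
  have fm: "(\<lambda>t. h (\<lambda>i\<in>{..<m}. t (f i))) \<in> borel_measurable (weyl n)" if "f \<in> inj_tuples m n" for f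
  proof -
    have "(\<lambda>t. \<lambda>i\<in>{..<m}. t (f i)) \<in> measurable (torus_unif n) (torus_unif m)"
      unfolding torus_unif_def using that by (intro measurable_restrict measurable_component_singleton) (auto simp: inj_tuples_def)
    from measurable_compose[OF this h] show ?thesis by (simp add: weyl_def)
  qed
  define I where "I = (\<integral>\<^sup>+t. ennreal (h t) * ennreal (Re (kernel_det n m t)) \<partial>torus_unif m)"
  have "(\<integral>\<^sup>+t. ennreal (tuple_sum n m h t) \<partial>weyl n) = (\<integral>\<^sup>+t. (\<Sum>f\<in>inj_tuples m n. ennreal (h (\<lambda>i\<in>{..<m}. t (f i)))) \<partial>weyl n)"
    unfolding tuple_sum_def using h0 by (simp add: sum_ennreal)
  also have "\<dots> = (\<Sum>f\<in>inj_tuples m n. \<integral>\<^sup>+t. ennreal (h (\<lambda>i\<in>{..<m}. t (f i))) \<partial>weyl n)"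
    using fm by (intro nn_integral_sum) auto
  finally have "(\<integral>\<^sup>+t. ennreal (tuple_sum n m h t) \<partial>weyl n) * fact n = (\<Sum>f\<in>inj_tuples m n. (\<integral>\<^sup>+t. ennreal (h (\<lambda>i\<in>{..<m}. t (f i))) \<partial>weyl n) * fact n)"
    by (simp add: sum_distrib_right)
  also have "\<dots> = (\<Sum>f\<in>inj_tuples m n. fact (n - m) * I)"
    unfolding I_def by (intro sum.cong refl weyl_tuple[OF _ m]) (use h in auto)
  also have "\<dots> = (of_nat (card (inj_tuples m n)) * fact (n - m)) * I" by (simp add: mult.assoc)
  also have "of_nat (card (inj_tuples m n)) * fact (n - m) = (fact n :: ennreal)"
    using arg_cong[OF card_inj_tuples[OF m], of "of_nat :: nat \<Rightarrow> ennreal"] by simp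
  finally have "(\<integral>\<^sup>+t. ennreal (tuple_sum n m h t) \<partial>weyl n) * of_nat (fact n) = I * of_nat (fact n)"
    by (simp only: of_nat_fact mult.commute)
  then have "of_nat (fact n) * (\<integral>\<^sup>+t. ennreal (tuple_sum n m h t) \<partial>weyl n) = of_nat (fact n) * I"
    by (simp only: mult.commute)
  then show ?thesis unfolding I_def[symmetric] by (auto simp: ennreal_mult_cancel_left)
qed

section \<open>Close pairs\<close>

text \<open>Coordinates 2 r and 2 r + 1 with r < s form the r-th pair, of which the odd one is the
  second point. Coordinates from 2 s on are single points, such as the third point of a
  triple.\<close>

definition pair_odd :: "nat \<Rightarrow> nat \<Rightarrow> bool" where
  "pair_odd s i \<longleftrightarrow> odd i \<and> i < 2 * s"

text \<open>The order of the Euclidean length of the modified row: sqrt n for a row of n numbers of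
  modulus 1, and the gap times n sqrt n for a difference row, since frequencies go up to n. Rows
  divided by it have a bounded Gram matrix with a limit.\<close>

definition pair_scale :: "nat \<Rightarrow> nat \<Rightarrow> (nat \<Rightarrow> real) \<Rightarrow> nat \<Rightarrow> real" where
  "pair_scale n s t i = (if pair_odd s i then (t i - t (i - 1)) * (real n * sqrt n) else sqrt n)"

definition pair_row :: "nat \<Rightarrow> nat \<Rightarrow> (nat \<Rightarrow> real) \<Rightarrow> nat \<Rightarrow> nat \<Rightarrow> complex" where
  "pair_row n s t i l = (if pair_odd s i then cis (real l * t i) - cis (real l * t (i - 1)) else cis (real l * t i))
      / of_real (pair_scale n s t i)"

definition pair_gram :: "nat \<Rightarrow> nat \<Rightarrow> (nat \<Rightarrow> real) \<Rightarrow> nat \<Rightarrow> nat \<Rightarrow> complex" where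
  "pair_gram n s t i j = (\<Sum>l<n. pair_row n s t i l * cnj (pair_row n s t j l))"

text \<open>Replacing the row of the second point of each close pair by the difference quotient of the two
  rows of the pair extracts the squared gaps from the determinant.\<close>

lemma kernel_det_pairs:
  assumes n: "n \<ge> 1" and ne: "\<And>i. i < m \<Longrightarrow> pair_odd s i \<Longrightarrow> t i \<noteq> t (i - 1)"
  shows "kernel_det n m t = of_real (\<Prod>i<m. (pair_scale n s t i)\<^sup>2) * det (mat m m (\<lambda>(i,j). pair_gram n s t i j))"
proof -
  \<comment> \<open>The row operations as a matrix: subtract the row i - 1 from the second row of a
    pair and divide by the scale. It is lower triangular, so its determinant is the product of the
    reciprocal scales.\<close>
  define e where "e i j = (if j = i then 1 / complex_of_real (pair_scale n s t i)
      else if pair_odd s i \<and> j = i - 1 then - 1 / complex_of_real (pair_scale n s t i) else 0)" for i j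
  define E where "E = mat m m (\<lambda>(i,j). e i j)"
  define K where "K = mat m m (\<lambda>(i,j). dirichlet n (t i) (t j))"
  have C: "E \<in> carrier_mat m m" "transpose_mat E \<in> carrier_mat m m" "K \<in> carrier_mat m m" "E * K \<in> carrier_mat m m"
    by (auto simp: E_def K_def intro!: mult_carrier_mat)
  have row: "(\<Sum>a<m. e i a * f a) = (if pair_odd s i then f i - f (i - 1) else f i) / of_real (pair_scale n s t i)"
    if i: "i < m" for i and f :: "nat \<Rightarrow> complex"
  proof (cases "pair_odd s i")
    case False
    then have "(\<Sum>a<m. e i a * f a) = (\<Sum>a<m. if a = i then f i / of_real (pair_scale n s t i) else 0)"
      by (intro sum.cong refl) (auto simp: e_def)
    then show ?thesis using i False by simp
  next
    case True
    then have "i \<noteq> 0" using odd_pos[of i] by (auto simp: pair_odd_def)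
    then have i1: "i - 1 < m" "i - 1 \<noteq> i" using i by auto
    have "(\<Sum>a<m. e i a * f a) = (\<Sum>a<m. (if a = i then f i / of_real (pair_scale n s t i) else 0)
        + (if a = i - 1 then - f (i - 1) / of_real (pair_scale n s t i) else 0))"
      using True i1 by (intro sum.cong refl) (auto simp: e_def)
    also have "\<dots> = f i / of_real (pair_scale n s t i) + - f (i - 1) / of_real (pair_scale n s t i)"
      unfolding sum.distrib using i i1 by simp
    finally show ?thesis using True by (simp add: diff_divide_distrib)
  qed
  have cnje: "cnj (e i j) = e i j" for i j by (simp add: e_def)
  have prow: "(\<Sum>a<m. e i a * cis (real l * t a)) = pair_row n s t i l" if "i < m" for i l
    unfolding row[OF that] pair_row_def by (simp only:)
  have prow': "(\<Sum>b<m. e j b * cis (- (real l * t b))) = cnj (pair_row n s t j l)" if "j < m" for j l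
    unfolding prow[OF that, symmetric] by (simp add: cnje cis_cnj)
  have G: "mat m m (\<lambda>(i,j). pair_gram n s t i j) = (E * K) * transpose_mat E"
  proof (rule eq_matI)
    fix i j assume "i < dim_row ((E * K) * transpose_mat E)" "j < dim_col ((E * K) * transpose_mat E)"
    then have ij: "i < m" "j < m" using C by (auto simp: E_def)
    have "((E * K) * transpose_mat E) $$ (i,j) = (\<Sum>b<m. (E * K) $$ (i,b) * transpose_mat E $$ (b,j))"
      by (rule mat_mult_index[OF C(4,2) ij])
    also have "\<dots> = (\<Sum>b<m. (\<Sum>a<m. e i a * dirichlet n (t a) (t b)) * e j b)"
    proof (rule sum.cong[OF refl])
      fix b assume "b \<in> {..<m}"
      then have b: "b < m" by simp
      have "(E * K) $$ (i,b) = (\<Sum>a<m. E $$ (i,a) * K $$ (a,b))" by (rule mat_mult_index[OF C(1,3) ij(1) b])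
      also have "\<dots> = (\<Sum>a<m. e i a * dirichlet n (t a) (t b))"
        by (intro sum.cong refl) (use ij b in \<open>simp add: E_def K_def\<close>)
      finally show "(E * K) $$ (i,b) * transpose_mat E $$ (b,j) = (\<Sum>a<m. e i a * dirichlet n (t a) (t b)) * e j b"
        using ij b by (simp add: E_def)
    qed
    also have "\<dots> = (\<Sum>b<m. \<Sum>l<n. (\<Sum>a<m. e i a * cis (real l * t a)) * (e j b * cis (- (real l * t b))))"
    proof (rule sum.cong[OF refl])
      fix b
      have "(\<Sum>a<m. e i a * dirichlet n (t a) (t b)) = (\<Sum>a<m. \<Sum>l<n. e i a * cis (real l * t a) * cis (- (real l * t b)))"
        unfolding dirichlet_def sum_distrib_left
        by (intro sum.cong refl) (simp add: mult.assoc cis_mult right_diff_distrib)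
      also have "\<dots> = (\<Sum>l<n. (\<Sum>a<m. e i a * cis (real l * t a)) * cis (- (real l * t b)))"
        by (subst sum.swap) (simp only: sum_distrib_right)
      finally show "(\<Sum>a<m. e i a * dirichlet n (t a) (t b)) * e j b
        = (\<Sum>l<n. (\<Sum>a<m. e i a * cis (real l * t a)) * (e j b * cis (- (real l * t b))))"
        by (simp only: sum_distrib_right[of _ _ "e j b"]) (intro sum.cong refl, simp only: mult_ac)
    qed
    also have "\<dots> = (\<Sum>l<n. (\<Sum>a<m. e i a * cis (real l * t a)) * (\<Sum>b<m. e j b * cis (- (real l * t b))))"
      by (subst sum.swap) (simp only: sum_distrib_left)
    also have "\<dots> = pair_gram n s t i j" unfolding prow[OF ij(1)] prow'[OF ij(2)] pair_gram_def ..
    finally show "mat m m (\<lambda>(i,j). pair_gram n s t i j) $$ (i,j) = ((E * K) * transpose_mat E) $$ (i,j)"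
      using ij by simp
  qed (use C in auto)
  have "det (mat m m (\<lambda>(i,j). pair_gram n s t i j)) = det E * det K * det E"
    unfolding G det_mult[OF C(4,2)] det_mult[OF C(1,3)] det_transpose[OF C(1)] ..
  moreover have "det E = (\<Prod>i<m. 1 / complex_of_real (pair_scale n s t i))"
  proof -
    have "det E = prod_list (diag_mat E)"
      by (rule det_lower_triangular[OF _ C(1)]) (auto simp: E_def e_def)
    also have "diag_mat E = map (\<lambda>i. 1 / complex_of_real (pair_scale n s t i)) [0..<m]"
      by (auto simp: diag_mat_def E_def e_def)
    also have "prod_list \<dots> = (\<Prod>i\<in>set [0..<m]. 1 / complex_of_real (pair_scale n s t i))"
      by (rule prod.distinct_set_conv_list[symmetric]) simp
    also have "set [0..<m] = {..<m}" by auto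
    finally show ?thesis .
  qed
  moreover have "(\<Prod>i<m. 1 / complex_of_real (pair_scale n s t i)) * (\<Prod>i<m. complex_of_real (pair_scale n s t i)) = 1"
  proof -
    have "pair_scale n s t i \<noteq> 0" if "i < m" for i
      using ne[OF that] n by (auto simp: pair_scale_def)
    then show ?thesis unfolding prod.distrib[symmetric] by (intro prod.neutral) auto
  qed
  moreover have "det K = kernel_det n m t" unfolding K_def kernel_det_det ..
  ultimately have "of_real (\<Prod>i<m. pair_scale n s t i) * of_real (\<Prod>i<m. pair_scale n s t i) * det (mat m m (\<lambda>(i,j). pair_gram n s t i j)) = kernel_det n m t"
    by (simp add: mult_ac)
  then show ?thesis by (simp add: prod_power_distrib power2_eq_square)
qed

lemma norm_cis_diff: "cmod (cis x - cis y) \<le> \<bar>x - y\<bar>"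
proof -
  have "cis x - cis y = cis y * (cis (x - y) - 1)" by (simp add: right_diff_distrib cis_mult)
  then have "cmod (cis x - cis y) = cmod (cis (x - y) - 1)" by (simp add: norm_mult)
  also have "\<dots> \<le> \<bar>x - y\<bar>"
  proof -
    have "cmod (exp (\<i> * of_real (x - y)) - 1) = 2 * \<bar>sin ((x - y) / 2)\<bar>" by (rule dist_exp_i_1)
    moreover have "\<bar>sin ((x - y) / 2)\<bar> \<le> \<bar>(x - y) / 2\<bar>" by (rule abs_sin_x_le_abs_x)
    ultimately show ?thesis by (simp add: cis_conv_exp)
  qed
  finally show ?thesis .
qed

text \<open>A chord is at most its arc, so an entry of a difference row is at most l times the gap,
  and l < n.\<close>

lemma norm_pair_row:
  assumes n: "n \<ge> 1" and l: "l < n" and ne: "pair_odd s i \<Longrightarrow> t i \<noteq> t (i - 1)"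
  shows "cmod (pair_row n s t i l) \<le> 1 / sqrt n"
proof (cases "pair_odd s i")
  case False
  then show ?thesis by (simp add: pair_row_def pair_scale_def norm_divide)
next
  case True
  have "cmod (cis (real l * t i) - cis (real l * t (i - 1))) \<le> real l * \<bar>t i - t (i - 1)\<bar>"
    using norm_cis_diff[of "real l * t i" "real l * t (i - 1)"] by (simp add: abs_mult flip: right_diff_distrib)
  also have "\<dots> \<le> real n * \<bar>t i - t (i - 1)\<bar>" using l by (intro mult_right_mono) auto
  finally have num: "cmod (cis (real l * t i) - cis (real l * t (i - 1))) \<le> real n * \<bar>t i - t (i - 1)\<bar>" .
  have "cmod (pair_row n s t i l) \<le> (real n * \<bar>t i - t (i - 1)\<bar>) / (\<bar>t i - t (i - 1)\<bar> * (real n * sqrt n))"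
  proof -
    have "cmod (pair_row n s t i l) = cmod (cis (real l * t i) - cis (real l * t (i - 1))) / \<bar>pair_scale n s t i\<bar>"
      using True by (simp add: pair_row_def norm_divide)
    moreover have "\<bar>pair_scale n s t i\<bar> = \<bar>t i - t (i - 1)\<bar> * (real n * sqrt n)"
      using True by (simp add: pair_scale_def abs_mult)
    ultimately show ?thesis using num by (simp only:) (rule divide_right_mono, auto)
  qed
  also have "\<dots> = 1 / sqrt n" using ne[OF True] n by simp
  finally show ?thesis .
qed

lemma norm_pair_gram:
  assumes n: "n \<ge> 1" and ne: "pair_odd s i \<Longrightarrow> t i \<noteq> t (i - 1)" "pair_odd s j \<Longrightarrow> t j \<noteq> t (j - 1)"
  shows "cmod (pair_gram n s t i j) \<le> 1"
proof -
  have "cmod (pair_gram n s t i j) \<le> (\<Sum>l<n. (1 / sqrt n) * (1 / sqrt n))"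
    unfolding pair_gram_def
  proof (rule order_trans[OF norm_sum], rule sum_mono)
    fix l assume "l \<in> {..<n}"
    then show "cmod (pair_row n s t i l * cnj (pair_row n s t j l)) \<le> (1 / sqrt n) * (1 / sqrt n)"
      unfolding norm_mult complex_mod_cnj using n ne by (intro mult_mono norm_pair_row) auto
  qed
  also have "\<dots> = 1" using n by simp
  finally show ?thesis .
qed

lemma norm_det_le_fact:
  assumes "\<And>i j. i < m \<Longrightarrow> j < m \<Longrightarrow> cmod (g i j) \<le> 1"
  shows "cmod (det (mat m m (\<lambda>(i,j). g i j))) \<le> fact m"
proof -
  have e: "det (mat m m (\<lambda>(i,j). g i j)) = (\<Sum>p | p permutes {0..<m}. signof p * (\<Prod>i = 0..<m. g i (p i)))"
    by (subst det_def') (auto intro!: sum.cong prod.cong dest: permutes_in_image)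
  have "cmod (det (mat m m (\<lambda>(i,j). g i j))) \<le> (\<Sum>p | p permutes {0..<m}. 1)"
    unfolding e
  proof (rule order_trans[OF norm_sum], rule sum_mono)
    fix p assume "p \<in> {p. p permutes {0..<m}}"
    then have p: "p permutes {0..<m}" by simp
    have "cmod (\<Prod>i = 0..<m. g i (p i)) \<le> 1"
      unfolding prod_norm[symmetric]
      by (rule prod_le_1) (use assms permutes_in_image[OF p] in auto)
    then show "cmod (signof p * (\<Prod>i = 0..<m. g i (p i))) \<le> 1" by (simp add: norm_mult sign_def)
  qed
  also have "\<dots> = fact m" by (simp add: card_permutations[of _ m])
  finally show ?thesis .
qed

text \<open>Normalised rows have length at most 1, so the Gram entries are at most 1 and the
  permutation expansion of the determinant has m! terms of modulus at most 1.\<close>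

lemma kernel_det_pair_bound:
  assumes n: "n \<ge> 1" and ne: "\<And>i. i < m \<Longrightarrow> pair_odd s i \<Longrightarrow> t i \<noteq> t (i - 1)"
  shows "Re (kernel_det n m t) \<le> fact m * (\<Prod>i<m. (pair_scale n s t i)\<^sup>2)"
proof -
  have "Re (kernel_det n m t) \<le> cmod (kernel_det n m t)" by (rule complex_Re_le_cmod)
  also have "\<dots> = (\<Prod>i<m. (pair_scale n s t i)\<^sup>2) * cmod (det (mat m m (\<lambda>(i,j). pair_gram n s t i j)))"
  proof -
    have "kernel_det n m t = of_real (\<Prod>i<m. (pair_scale n s t i)\<^sup>2) * det (mat m m (\<lambda>(i,j). pair_gram n s t i j))"
      by (rule kernel_det_pairs[OF n]) (rule ne)
    then show ?thesis by (simp only: norm_mult norm_of_real) (simp add: prod_nonneg)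
  qed
  also have "\<dots> \<le> (\<Prod>i<m. (pair_scale n s t i)\<^sup>2) * fact m"
    by (intro mult_left_mono norm_det_le_fact norm_pair_gram n ne prod_nonneg) auto
  finally show ?thesis by (simp add: mult.commute)
qed

lemma prod_pairs: "(\<Prod>i<2 * s. f i) = (\<Prod>r<s. f (2*r) * f (2*r+1))" for f :: "nat \<Rightarrow> 'a::comm_monoid_mult"
  by (induction s) (simp_all add: mult_ac)

lemma prod_pair_scale:
  "(\<Prod>i<2 * s. (pair_scale n s t i)\<^sup>2) = (\<Prod>r<s. real n ^ 4 * (t (2*r+1) - t (2*r))\<^sup>2)"
  unfolding prod_pairs
  by (intro prod.cong refl) (simp add: pair_scale_def pair_odd_def power_mult_distrib power4_eq_xxxx power2_eq_square)

lemma prod_pair_scale_Suc: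
  "(\<Prod>i<Suc (2 * s). (pair_scale n s t i)\<^sup>2) = real n * (\<Prod>r<s. real n ^ 4 * (t (2*r+1) - t (2*r))\<^sup>2)"
  by (simp add: prod_pair_scale) (simp add: pair_scale_def pair_odd_def)

section \<open>Limit of the normalised Gram determinant\<close>

text \<open>Summation by parts: multiplying by w - 1 leaves boundary terms of size at most 2 n^p and
  the increments of l^p, whose total is at most n^p.\<close>

lemma power_cis_sum_bound:
  assumes "w \<noteq> 1" "cmod w = 1"
  shows "cmod (\<Sum>l<n. of_nat l ^ p * w ^ l) * cmod (w - 1) \<le> 3 * real n ^ p"
proof -
  have "(\<Sum>l<n. of_nat (Suc l) ^ p * w ^ Suc l - of_nat l ^ p * w ^ l) = of_nat n ^ p * w ^ n - of_nat 0 ^ p * w ^ 0"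
    by (rule sum_lessThan_telescope)
  moreover have "of_nat (Suc l) ^ p * w ^ Suc l - of_nat l ^ p * w ^ l
     = of_nat l ^ p * w ^ l * (w - 1) + (of_nat (Suc l) ^ p - of_nat l ^ p) * w ^ Suc l" for l
    by (simp add: algebra_simps)
  ultimately have "(\<Sum>l<n. of_nat l ^ p * w ^ l * (w - 1)) + (\<Sum>l<n. (of_nat (Suc l) ^ p - of_nat l ^ p) * w ^ Suc l)
     = of_nat n ^ p * w ^ n - of_nat 0 ^ p * w ^ 0"
    by (simp only: sum.distrib)
  then have e: "(\<Sum>l<n. of_nat l ^ p * w ^ l) * (w - 1)
     = of_nat n ^ p * w ^ n - of_nat 0 ^ p - (\<Sum>l<n. (of_nat (Suc l) ^ p - of_nat l ^ p) * w ^ Suc l)"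
    by (simp only: sum_distrib_right eq_diff_eq power_0 mult_1_right)
  have "cmod (\<Sum>l<n. (of_nat (Suc l) ^ p - of_nat l ^ p) * w ^ Suc l) \<le> (\<Sum>l<n. real (Suc l) ^ p - real l ^ p)"
  proof (rule order_trans[OF norm_sum], rule sum_mono)
    fix l
    have "(of_nat (Suc l) ^ p - of_nat l ^ p :: complex) = of_real (real (Suc l) ^ p - real l ^ p)" by simp
    then have "cmod (of_nat (Suc l) ^ p - of_nat l ^ p) = \<bar>real (Suc l) ^ p - real l ^ p\<bar>" by (simp only: norm_of_real)
    also have "\<dots> = real (Suc l) ^ p - real l ^ p" by (simp add: power_mono)
    finally show "cmod ((of_nat (Suc l) ^ p - of_nat l ^ p) * w ^ Suc l) \<le> real (Suc l) ^ p - real l ^ p"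
      by (simp only: norm_mult norm_power assms(2) power_one mult_1_right order_refl)
  qed
  also have "\<dots> = real n ^ p - real 0 ^ p" by (rule sum_lessThan_telescope)
  also have "\<dots> \<le> real n ^ p" by simp
  finally have 1: "cmod (\<Sum>l<n. (of_nat (Suc l) ^ p - of_nat l ^ p) * w ^ Suc l) \<le> real n ^ p" .
  \<comment> \<open>The lower boundary term does not vanish for p = 0, where 0^0 = 1.\<close>
  have z: "cmod (of_nat 0 ^ p) \<le> real n ^ p \<or> n = 0" by (cases p) auto
  have 2: "cmod (of_nat n ^ p * w ^ n - of_nat 0 ^ p) \<le> 2 * real n ^ p"
  proof (cases "n = 0")
    case True
    then show ?thesis by simp
  next
    case False
    then have "cmod (of_nat 0 ^ p) \<le> real n ^ p" using z by simp
    moreover have "cmod (of_nat n ^ p * w ^ n) = real n ^ p" by (simp add: norm_mult norm_power assms(2))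
    ultimately show ?thesis using norm_triangle_ineq4[of "of_nat n ^ p * w ^ n" "of_nat 0 ^ p"] by linarith
  qed
  show ?thesis unfolding norm_mult[symmetric] e
    using norm_triangle_ineq4[of "of_nat n ^ p * w ^ n - of_nat 0 ^ p" "\<Sum>l<n. (of_nat (Suc l) ^ p - of_nat l ^ p) * w ^ Suc l"] 1 2
    by linarith
qed

lemma power_cis_mean_tendsto:
  assumes "w \<noteq> 1" "cmod w = 1"
  shows "(\<lambda>n. (\<Sum>l<n. of_nat l ^ p * w ^ l) / of_nat n ^ Suc p) \<longlonglongrightarrow> 0"
proof (rule Lim_null_comparison)
  have c: "cmod (w - 1) > 0" using assms by simp
  have "(\<lambda>n. (3 / cmod (w - 1)) * (1 / real n)) \<longlonglongrightarrow> (3 / cmod (w - 1)) * 0"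
    by (intro tendsto_intros lim_1_over_n)
  then show "(\<lambda>n. (3 / cmod (w - 1)) * (1 / real n)) \<longlonglongrightarrow> 0" by simp
  show "\<forall>\<^sub>F n in sequentially. norm ((\<Sum>l<n. of_nat l ^ p * w ^ l) / of_nat n ^ Suc p) \<le> (3 / cmod (w - 1)) * (1 / real n)"
    using eventually_gt_at_top[of 0]
  proof eventually_elim
    case (elim n)
    have "cmod (\<Sum>l<n. of_nat l ^ p * w ^ l) \<le> 3 * real n ^ p / cmod (w - 1)"
      using power_cis_sum_bound[OF assms, where n = n and p = p] c by (simp add: pos_le_divide_eq)
    then have "norm ((\<Sum>l<n. of_nat l ^ p * w ^ l) / of_nat n ^ Suc p) \<le> (3 * real n ^ p / cmod (w - 1)) / real n ^ Suc p"
      unfolding norm_divide norm_power norm_of_nat by (rule divide_right_mono) simp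
    also have "\<dots> = (3 / cmod (w - 1)) * (1 / real n)" using elim by simp
    finally show ?case .
  qed
qed

lemma power_mean_tendsto:
  assumes "p \<le> 2"
  shows "(\<lambda>n. (\<Sum>l<n. real l ^ p) / real n ^ Suc p) \<longlonglongrightarrow> 1 / real (Suc p)"
proof -
  have s1: "(\<Sum>l<n. real l) = real n * (real n - 1) / 2" for n
    by (induction n) (auto simp: field_simps)
  have s2: "(\<Sum>l<n. (real l)\<^sup>2) = real n * (real n - 1) * (2 * real n - 1) / 6" for n
    by (induction n) (auto simp: field_simps power2_eq_square)
  consider "p = 0" | "p = 1" | "p = 2" using assms by linarith
  then show ?thesis
  proof cases
    case 1
    have "(\<lambda>n. (\<Sum>l<n. real l ^ p) / real n ^ Suc p) \<longlonglongrightarrow> 1"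
      by (rule Lim_transform_eventually[OF tendsto_const]) (use 1 in \<open>auto intro!: eventually_mono[OF eventually_gt_at_top[of 0]]\<close>)
    then show ?thesis using 1 by simp
  next
    case 2
    have "(\<lambda>n. 1 / 2 - (1 / 2) * (1 / real n)) \<longlonglongrightarrow> 1 / 2 - (1 / 2) * 0" by (intro tendsto_intros lim_1_over_n)
    then have "(\<lambda>n. (\<Sum>l<n. real l ^ p) / real n ^ Suc p) \<longlonglongrightarrow> 1 / 2 - (1 / 2) * 0"
      by (rule Lim_transform_eventually) (use 2 in \<open>auto simp: s1 field_simps intro!: eventually_mono[OF eventually_gt_at_top[of 0]]\<close>)
    then show ?thesis using 2 by simp
  next
    case 3
    have "(\<lambda>n. (1 - 1 / real n) * (2 - 1 / real n) / 6) \<longlonglongrightarrow> (1 - 0) * (2 - 0) / 6" by (intro tendsto_intros lim_1_over_n) simp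
    then have "(\<lambda>n. (\<Sum>l<n. real l ^ p) / real n ^ Suc p) \<longlonglongrightarrow> (1 - 0) * (2 - 0) / 6"
      by (rule Lim_transform_eventually) (use 3 in \<open>auto simp: s2[unfolded power2_eq_square] field_simps power2_eq_square eval_nat_numeral intro!: eventually_mono[OF eventually_gt_at_top[of 0]]\<close>)
    then show ?thesis using 3 by simp
  qed
qed

text \<open>New coordinates for pairs: an even coordinate is the position of the first point, the
  odd one after it the gap measured in units of d.\<close>

definition pair_shift :: "real \<Rightarrow> (nat \<Rightarrow> real) \<Rightarrow> nat \<Rightarrow> real" where
  "pair_shift d x i = (if odd i then x (i - 1) + d * x i else x i)"

definition pair_base :: "(nat \<Rightarrow> real) \<Rightarrow> nat \<Rightarrow> real" where
  "pair_base x i = x (2 * (i div 2))"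

text \<open>For odd i the difference quotient of e^(i l x) in x is replaced by its derivative, with
  l rescaled to l / n.\<close>

definition limit_row :: "nat \<Rightarrow> (nat \<Rightarrow> real) \<Rightarrow> nat \<Rightarrow> nat \<Rightarrow> complex" where
  "limit_row n x i l = (\<i> * of_real (real l / real n)) ^ (i mod 2) * cis (real l * pair_base x i) / of_real (sqrt n)"

text \<open>For each pair the Gram matrix of the functions 1 and i u in L^2[0,1], where u is the
  limit of l / n. The exponents \<open>i mod 2\<close> and \<open>j mod 2\<close> tell values from
  derivatives, and different pairs are orthogonal.\<close>

definition limit_gram :: "nat \<Rightarrow> nat \<Rightarrow> complex" where
  "limit_gram i j = (if i div 2 = j div 2 then \<i> ^ (i mod 2) * (- \<i>) ^ (j mod 2) / of_nat (Suc (i mod 2 + j mod 2)) else 0)"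

lemma norm_limit_row: "l < n \<Longrightarrow> cmod (limit_row n x i l) \<le> 1 / sqrt n"
proof -
  assume l: "l < n"
  have "cmod (limit_row n x i l) = (real l / real n) ^ (i mod 2) / sqrt n"
    by (simp add: limit_row_def norm_mult norm_divide norm_power)
  also have "\<dots> \<le> 1 / sqrt n" using l by (intro divide_right_mono power_le_one) auto
  finally show ?thesis .
qed

text \<open>With u = l d x_i the second-order Taylor remainder of e^(i u) is at most u^2. Divided by
  the scale d x_i n sqrt n of the row it is at most n d / sqrt n, small since n d tends to
  0.\<close>

lemma pair_row_approx:
  assumes n: "n \<ge> 1" and l: "l < n" and d: "d > 0" and i: "i < 2 * s" and x: "odd i \<Longrightarrow> 0 < x i \<and> x i \<le> 1"
  shows "cmod (pair_row n s (pair_shift d x) i l - limit_row n x i l) \<le> real n * d / sqrt n"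
proof (cases "even i")
  case True
  then have "pair_row n s (pair_shift d x) i l = limit_row n x i l"
    by (simp add: pair_row_def limit_row_def pair_shift_def pair_scale_def pair_odd_def pair_base_def even_iff_mod_2_eq_zero)
  then show ?thesis using d by simp
next
  case False
  define b where "b = x (i - 1)"
  define u where "u = real l * (d * x i)"
  define N where "N = real n * sqrt n"
  have xi: "0 < x i" "x i \<le> 1" using x False by auto
  have N: "N > 0" using n by (simp add: N_def)
  have base: "pair_base x i = b" using False by (simp add: pair_base_def b_def)
  have im: "i mod 2 = 1" using False by (simp add: odd_iff_mod_2_eq_one)
  have even1: "even (i - 1)" using False by simp
  have 1: "pair_row n s (pair_shift d x) i l = cis (real l * b) * (cis u - 1) / of_real (d * x i * N)"
    using False i even1 unfolding pair_row_def pair_scale_def pair_odd_def pair_shift_def b_def[symmetric] u_def N_def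
    by (simp add: right_diff_distrib cis_mult distrib_left)
  have 2: "limit_row n x i l = cis (real l * b) * (\<i> * of_real u) / of_real (d * x i * N)"
    using xi d n unfolding limit_row_def base im u_def N_def by simp
  have "cmod (pair_row n s (pair_shift d x) i l - limit_row n x i l) = cmod (cis u - 1 - \<i> * of_real u) / (d * x i * N)"
    unfolding 1 2 diff_divide_distrib[symmetric] right_diff_distrib[symmetric] norm_divide norm_mult norm_cis norm_of_real
    using xi d N by simp
  also have "cmod (cis u - 1 - \<i> * of_real u) \<le> u\<^sup>2"
  proof -
    have "cmod (iexp u - (\<Sum>k\<le>1. (\<i> * of_real u) ^ k / fact k)) \<le> \<bar>u\<bar> ^ Suc 1 / fact (Suc 1)" by (rule iexp_approx1)
    then have "cmod (cis u - 1 - \<i> * of_real u) \<le> u\<^sup>2 / 2"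
      by (simp add: cis_conv_exp diff_diff_eq numeral_2_eq_2[symmetric])
    also have "\<dots> \<le> u\<^sup>2" by simp
    finally show ?thesis .
  qed
  also have "u\<^sup>2 / (d * x i * N) = (real l)\<^sup>2 * (d * x i) / N"
    using xi d N by (simp add: u_def power2_eq_square)
  also have "\<dots> \<le> (real n)\<^sup>2 * (d * 1) / N"
    using xi d N l by (intro divide_right_mono mult_mono power_mono) auto
  also have "\<dots> = real n * d / sqrt n" using n by (simp add: N_def power2_eq_square)
  finally show ?thesis using xi d N by (simp add: divide_right_mono)
qed

lemma pair_gram_approx:
  assumes n: "n \<ge> 1" and d: "d > 0" and i: "i < 2 * s" and j: "j < 2 * s" and x: "\<And>k. k < 2 * s \<Longrightarrow> odd k \<Longrightarrow> 0 < x k \<and> x k \<le> 1"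
  shows "cmod (pair_gram n s (pair_shift d x) i j - (\<Sum>l<n. limit_row n x i l * cnj (limit_row n x j l))) \<le> 2 * (real n * d)"
proof -
  define B where "B i l = pair_row n s (pair_shift d x) i l" for i l
  define L where "L i l = limit_row n x i l" for i l
  have ne: "pair_odd s k \<Longrightarrow> pair_shift d x k \<noteq> pair_shift d x (k - 1)" if "k < 2 * s" for k
    using x[OF that] d by (auto simp: pair_shift_def pair_odd_def)
  have "cmod (pair_gram n s (pair_shift d x) i j - (\<Sum>l<n. L i l * cnj (L j l))) \<le> (\<Sum>l<n. 2 * (real n * d) * (1 / real n))"
    unfolding pair_gram_def B_def[symmetric] sum_subtractf[symmetric]
  proof (rule order_trans[OF norm_sum], rule sum_mono)
    fix l assume "l \<in> {..<n}"
    then have l: "l < n" by simp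
    have "B i l * cnj (B j l) - L i l * cnj (L j l) = B i l * cnj (B j l - L j l) + (B i l - L i l) * cnj (L j l)"
      by (simp add: algebra_simps)
    then have "cmod (B i l * cnj (B j l) - L i l * cnj (L j l)) \<le> cmod (B i l) * cmod (B j l - L j l) + cmod (B i l - L i l) * cmod (L j l)"
      by (simp only: norm_mult[symmetric] complex_mod_cnj[symmetric, of "B j l - L j l"] complex_mod_cnj[symmetric, of "L j l"]) (rule norm_triangle_ineq)
    also have "\<dots> \<le> (1 / sqrt n) * (real n * d / sqrt n) + (real n * d / sqrt n) * (1 / sqrt n)"
      unfolding B_def L_def
      by (intro add_mono mult_mono norm_pair_row pair_row_approx norm_limit_row n l d i j ne) (use x i j d in auto)
    also have "\<dots> = 2 * (real n * d) * (1 / real n)" using n by (simp add: field_simps)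
    finally show "cmod (B i l * cnj (B j l) - L i l * cnj (L j l)) \<le> 2 * (real n * d) * (1 / real n)" .
  qed
  also have "\<dots> = 2 * (real n * d)" using n by simp
  finally show ?thesis by (simp add: L_def)
qed

text \<open>Within a pair the frequencies cancel and means of powers of l / n tend to 1 / (p + 1).
  Between pairs the ratio w of the base points differs from 1, as these are distinct in [0, 2 pi),
  and the oscillating sums average out.\<close>

lemma limit_row_gram_tendsto:
  assumes x: "\<And>k. k < 2 * s \<Longrightarrow> even k \<Longrightarrow> 0 \<le> x k \<and> x k < 2 * pi"
    and ne: "\<And>k l. k < 2 * s \<Longrightarrow> l < 2 * s \<Longrightarrow> even k \<Longrightarrow> even l \<Longrightarrow> k \<noteq> l \<Longrightarrow> x k \<noteq> x l"
    and i: "i < 2 * s" and j: "j < 2 * s"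
  shows "(\<lambda>n. \<Sum>l<n. limit_row n x i l * cnj (limit_row n x j l)) \<longlonglongrightarrow> limit_gram i j"
proof -
  define w where "w = cis (pair_base x i - pair_base x j)"
  define p where "p = i mod 2 + j mod 2"
  define c where "c = \<i> ^ (i mod 2) * (- \<i>) ^ (j mod 2)"
  have eq: "(\<Sum>l<n. limit_row n x i l * cnj (limit_row n x j l)) = c * ((\<Sum>l<n. of_nat l ^ p * w ^ l) / of_nat n ^ Suc p)" for n
  proof (cases "n = 0")
    case False
    have sq: "complex_of_real (sqrt n) * complex_of_real (sqrt n) = of_nat n"
      by (simp only: of_real_mult[symmetric] real_sqrt_mult_self) simp
    have "limit_row n x i l * cnj (limit_row n x j l) = c * (of_nat l ^ p * w ^ l / of_nat n ^ Suc p)" for l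
    proof -
      have "w ^ l = cis (real l * pair_base x i) * cis (- (real l * pair_base x j))"
        by (simp add: w_def Complex.DeMoivre cis_mult right_diff_distrib)
      moreover have "limit_row n x i l * cnj (limit_row n x j l)
        = (\<i> * of_real (real l / real n)) ^ (i mod 2) * (- \<i> * of_real (real l / real n)) ^ (j mod 2)
          * (cis (real l * pair_base x i) * cis (- (real l * pair_base x j))) / (complex_of_real (sqrt n) * complex_of_real (sqrt n))"
        by (simp add: limit_row_def cis_cnj mult_ac)
      ultimately show ?thesis unfolding sq
        unfolding c_def p_def power_mult_distrib by (simp add: power_add power_divide mult_ac)
    qed
    then show ?thesis by (simp only: sum_distrib_left sum_divide_distrib)
  qed simp
  show ?thesis
  proof (cases "i div 2 = j div 2")
    case True
    have "w = 1" using True by (simp add: w_def pair_base_def)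
    have "i mod 2 < 2" "j mod 2 < 2" by simp_all
    then have "p \<le> 2" unfolding p_def by linarith
    then have "(\<lambda>n. complex_of_real ((\<Sum>l<n. real l ^ p) / real n ^ Suc p)) \<longlonglongrightarrow> complex_of_real (1 / real (Suc p))"
      by (intro tendsto_of_real power_mean_tendsto)
    also have "(\<lambda>n. complex_of_real ((\<Sum>l<n. real l ^ p) / real n ^ Suc p)) = (\<lambda>n. (\<Sum>l<n. of_nat l ^ p * w ^ l) / of_nat n ^ Suc p)"
      by (simp add: \<open>w = 1\<close> fun_eq_iff)
    finally have "(\<lambda>n. c * ((\<Sum>l<n. of_nat l ^ p * w ^ l) / of_nat n ^ Suc p)) \<longlonglongrightarrow> c * of_real (1 / real (Suc p))"
      by (intro tendsto_mult tendsto_const)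
    then show ?thesis unfolding eq using True by (simp add: limit_gram_def c_def p_def)
  next
    case False
    have "w \<noteq> 1"
    proof
      assume "w = 1"
      then have "cos (pair_base x i - pair_base x j) = 1" by (simp add: w_def complex_eq_iff)
      then obtain k :: int where k: "pair_base x i - pair_base x j = of_int k * (2 * pi)" by (auto simp: cos_one_2pi_int)
      have b: "0 \<le> pair_base x i \<and> pair_base x i < 2 * pi" "0 \<le> pair_base x j \<and> pair_base x j < 2 * pi"
        unfolding pair_base_def using i j by (auto intro!: x)
      then have "\<bar>pair_base x i - pair_base x j\<bar> < 2 * pi" by linarith
      then have "\<bar>real_of_int k\<bar> * (2 * pi) < 1 * (2 * pi)" unfolding k by (simp add: abs_mult)
      then have "\<bar>real_of_int k\<bar> < 1" by (rule mult_right_less_imp_less) simp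
      then have "k = 0" by linarith
      then have "pair_base x i = pair_base x j" using k by simp
      moreover have "x (2 * (i div 2)) \<noteq> x (2 * (j div 2))" using False i j by (intro ne) auto
      ultimately show False by (simp add: pair_base_def)
    qed
    moreover have "cmod w = 1" by (simp add: w_def)
    ultimately have "(\<lambda>n. c * ((\<Sum>l<n. of_nat l ^ p * w ^ l) / of_nat n ^ Suc p)) \<longlonglongrightarrow> c * 0"
      by (intro tendsto_mult tendsto_const power_cis_mean_tendsto)
    then show ?thesis unfolding eq using False by (simp add: limit_gram_def)
  qed
qed

lemma pair_gram_tendsto:
  assumes x: "\<And>k. k < 2 * s \<Longrightarrow> even k \<Longrightarrow> 0 \<le> x k \<and> x k < 2 * pi"
    and v: "\<And>k. k < 2 * s \<Longrightarrow> odd k \<Longrightarrow> 0 < x k \<and> x k \<le> 1"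
    and ne: "\<And>k l. k < 2 * s \<Longrightarrow> l < 2 * s \<Longrightarrow> even k \<Longrightarrow> even l \<Longrightarrow> k \<noteq> l \<Longrightarrow> x k \<noteq> x l"
    and i: "i < 2 * s" and j: "j < 2 * s"
    and d: "\<And>n. n \<ge> 1 \<Longrightarrow> d n > 0" "(\<lambda>n. real n * d n) \<longlonglongrightarrow> 0"
  shows "(\<lambda>n. pair_gram n s (pair_shift (d n) x) i j) \<longlonglongrightarrow> limit_gram i j"
proof -
  have "(\<lambda>n. pair_gram n s (pair_shift (d n) x) i j - (\<Sum>l<n. limit_row n x i l * cnj (limit_row n x j l))) \<longlonglongrightarrow> 0"
  proof (rule Lim_null_comparison)
    show "\<forall>\<^sub>F n in sequentially. norm (pair_gram n s (pair_shift (d n) x) i j - (\<Sum>l<n. limit_row n x i l * cnj (limit_row n x j l))) \<le> 2 * (real n * d n)"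
      using eventually_ge_at_top[of 1] by eventually_elim (intro pair_gram_approx d i j v)
    show "(\<lambda>n. 2 * (real n * d n)) \<longlonglongrightarrow> 0" using tendsto_mult_left[OF d(2), of 2] by simp
  qed
  moreover have "(\<lambda>n. \<Sum>l<n. limit_row n x i l * cnj (limit_row n x j l)) \<longlonglongrightarrow> limit_gram i j"
    by (rule limit_row_gram_tendsto[where s = s]) (fact x, fact ne, fact i, fact j)
  ultimately have "(\<lambda>n. (pair_gram n s (pair_shift (d n) x) i j - (\<Sum>l<n. limit_row n x i l * cnj (limit_row n x j l)))
      + (\<Sum>l<n. limit_row n x i l * cnj (limit_row n x j l))) \<longlonglongrightarrow> 0 + limit_gram i j" by (rule tendsto_add)
  then show ?thesis by simp
qed

lemma det_tendsto:
  fixes g :: "nat \<Rightarrow> nat \<Rightarrow> nat \<Rightarrow> complex"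
  assumes "\<And>i j. i < m \<Longrightarrow> j < m \<Longrightarrow> (\<lambda>n. g n i j) \<longlonglongrightarrow> h i j"
  shows "(\<lambda>n. det (mat m m (\<lambda>(i,j). g n i j))) \<longlonglongrightarrow> det (mat m m (\<lambda>(i,j). h i j))"
proof -
  have e: "det (mat m m (\<lambda>(i,j). f i j)) = (\<Sum>p | p permutes {0..<m}. signof p * (\<Prod>i = 0..<m. f i (p i)))"
    for f :: "nat \<Rightarrow> nat \<Rightarrow> complex"
    by (subst det_def') (auto intro!: sum.cong prod.cong dest: permutes_in_image)
  show ?thesis unfolding e
  proof (intro tendsto_sum tendsto_mult tendsto_const tendsto_prod assms)
    fix p i assume "p \<in> {p. p permutes {0..<m}}" "i \<in> {0..<m}"
    then show "i < m" "p i < m" using permutes_in_image[of p "{0..<m}" i] by auto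
  qed
qed

lemma limit_gram_shift: "limit_gram (2 * s + i) (2 * s + j) = limit_gram i j"
  by (simp add: limit_gram_def)

text \<open>The matrix is block diagonal, with a block of determinant 1/3 - 1/4 = 1/12 for each
  pair.\<close>

lemma det_limit_gram: "det (mat (2 * s) (2 * s) (\<lambda>(i,j). limit_gram i j)) = (1 / 12) ^ s"
proof (induction s)
  case 0
  show ?case by (simp add: det_dim_zero)
next
  case (Suc s)
  define A where "A = mat (2 * s) (2 * s) (\<lambda>(i,j). limit_gram i j)"
  define D where "D = mat 2 2 (\<lambda>(i,j). limit_gram i j)"
  have "mat (2 * Suc s) (2 * Suc s) (\<lambda>(i,j). limit_gram i j) = four_block_mat A (0\<^sub>m (2 * s) 2) (0\<^sub>m 2 (2 * s)) D"
  proof (rule eq_matI)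
    fix i j assume "i < dim_row (four_block_mat A (0\<^sub>m (2 * s) 2) (0\<^sub>m 2 (2 * s)) D)"
      "j < dim_col (four_block_mat A (0\<^sub>m (2 * s) 2) (0\<^sub>m 2 (2 * s)) D)"
    then have ij: "i < 2 * s + 2" "j < 2 * s + 2" by (auto simp: A_def D_def)
    have dv: "k div 2 = s" if "k \<ge> 2 * s" "k < 2 * s + 2" for k using that by linarith
    have dv': "k div 2 < s" if "k < 2 * s" for k using that by linarith
    show "mat (2 * Suc s) (2 * Suc s) (\<lambda>(i,j). limit_gram i j) $$ (i,j) = four_block_mat A (0\<^sub>m (2 * s) 2) (0\<^sub>m 2 (2 * s)) D $$ (i,j)"
    proof (cases "i < 2 * s")
      case i: True
      show ?thesis
      proof (cases "j < 2 * s")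
        case True
        then show ?thesis using i by (simp add: A_def D_def)
      next
        case False
        then have "limit_gram i j = 0" using dv[of j] dv'[OF i] ij(2) by (simp only: limit_gram_def not_less) simp
        then show ?thesis using i ij False by (simp add: A_def D_def)
      qed
    next
      case i: False
      show ?thesis
      proof (cases "j < 2 * s")
        case True
        then have "limit_gram i j = 0" using dv[OF _ ij(1)] dv'[OF True] i by (simp only: limit_gram_def not_less) simp
        then show ?thesis using i ij True by (simp add: A_def D_def)
      next
        case False
        then obtain p q where pq: "i = 2 * s + p" "j = 2 * s + q" using i le_Suc_ex not_less by metis
        show ?thesis using ij unfolding pq by (simp add: A_def D_def limit_gram_shift)
      qed
    qed
  qed (auto simp: A_def D_def)
  moreover have "det (four_block_mat A (0\<^sub>m (2 * s) 2) (0\<^sub>m 2 (2 * s)) D) = det A * det D"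
    by (rule det_four_block_mat_upper_right_zero[of _ "2 * s" _ 2]) (simp_all add: A_def D_def)
  ultimately have "det (mat (2 * Suc s) (2 * Suc s) (\<lambda>(i,j). limit_gram i j)) = det A * det D" by (simp only:)
  also have "det D = 1 / 12"
  proof -
    \<comment> \<open>One step of Gaussian elimination on the block with rows (1, -i/2) and (i/2,
      1/3).\<close>
    define L where "L = mat 2 2 (\<lambda>(i,j). if i = 0 then (if j = 0 then 1 else 0) else (if j = 0 then \<i> / 2 else 1 / 12 :: complex))"
    define R where "R = mat 2 2 (\<lambda>(i,j). if i = 0 then (if j = 0 then 1 else - \<i> / 2) else (if j = 0 then 0 else 1 :: complex))"
    have LR: "L \<in> carrier_mat 2 2" "R \<in> carrier_mat 2 2" by (auto simp: L_def R_def)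
    have "D = L * R"
    proof (rule eq_matI)
      fix i j assume "i < dim_row (L * R)" "j < dim_col (L * R)"
      then have ij: "i < 2" "j < 2" using LR by auto
      have "(L * R) $$ (i,j) = L $$ (i,0) * R $$ (0,j) + L $$ (i,1) * R $$ (1,j)"
        using mat_mult_index[OF LR ij] by (simp add: numeral_2_eq_2)
      moreover have "i = 0 \<or> i = 1" "j = 0 \<or> j = 1" using ij by auto
      ultimately show "D $$ (i,j) = (L * R) $$ (i,j)"
        by (elim disjE) (simp_all add: D_def L_def R_def limit_gram_def)
    qed (auto simp: D_def L_def R_def)
    then have "det D = det L * det R" using det_mult[OF LR] by simp
    also have "det L = prod_list (diag_mat L)" by (rule det_lower_triangular[OF _ LR(1)]) (simp add: L_def)
    also have "diag_mat L = [1, 1 / 12]" by (simp add: diag_mat_def L_def numeral_2_eq_2)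
    also have "det R = prod_list (diag_mat R)" by (rule det_upper_triangular[OF _ LR(2)]) (auto simp: R_def)
    also have "diag_mat R = [1, 1]" by (simp add: diag_mat_def R_def numeral_2_eq_2)
    finally show ?thesis by simp
  qed
  finally show ?case using Suc by (simp add: A_def)
qed

section \<open>Substitution in product Lebesgue measure\<close>

interpretation lborel_fun: product_sigma_finite "\<lambda>_::nat. lborel :: real measure"
  by unfold_locales

text \<open>A translation of the gaps leaves Lebesgue measure invariant but not
  \<open>circle_unif\<close>, so the pair integrals are moved to the product of Lebesgue
  measures.\<close>

lemma torus_unif_density:
  "torus_unif m = density (PiM {..<m} (\<lambda>_. lborel)) (\<lambda>t. \<Prod>i<m. ennreal (indicator {0..<2*pi} (t i) / (2*pi)))"
proof -
  define w where "w x = ennreal (indicator {0..<2*pi} x / (2*pi))" for x :: real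
  have [measurable]: "w \<in> borel_measurable borel" unfolding w_def[abs_def] by measurable
  have "density (PiM {..<m} (\<lambda>_. lborel)) (\<lambda>t. \<Prod>i<m. w (t i)) = PiM {..<m} (\<lambda>_. circle_unif)"
  proof (rule torus.PiM_eqI)
    show "sets (density (PiM {..<m} (\<lambda>_. lborel)) (\<lambda>t. \<Prod>i<m. w (t i))) = sets (PiM {..<m} (\<lambda>_. circle_unif))"
      by (simp add: sets_PiM_cong[OF refl, of _ "\<lambda>_. lborel" "\<lambda>_. circle_unif"])
    fix A :: "nat \<Rightarrow> real set" assume A: "\<And>i. i \<in> {..<m} \<Longrightarrow> A i \<in> sets circle_unif"
    have box: "Pi\<^sub>E {..<m} A \<in> sets (PiM {..<m} (\<lambda>_. lborel))" using A by (intro sets_PiM_I_finite) auto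
    have mw: "(\<lambda>t. \<Prod>i<m. w (t i)) \<in> borel_measurable (PiM {..<m} (\<lambda>_. lborel))"
      by (intro borel_measurable_prod_ennreal measurable_compose[OF measurable_component_singleton]) auto
    have "emeasure (density (PiM {..<m} (\<lambda>_. lborel)) (\<lambda>t. \<Prod>i<m. w (t i))) (Pi\<^sub>E {..<m} A)
       = (\<integral>\<^sup>+t. (\<Prod>i<m. w (t i)) * indicator (Pi\<^sub>E {..<m} A) t \<partial>PiM {..<m} (\<lambda>_. lborel))"
      by (rule emeasure_density[OF mw box])
    also have "\<dots> = (\<integral>\<^sup>+t. (\<Prod>i<m. w (t i) * indicator (A i) (t i)) \<partial>PiM {..<m} (\<lambda>_. lborel))"
    proof (rule nn_integral_cong)
      fix t assume t: "t \<in> space (PiM {..<m} (\<lambda>_. lborel :: real measure))"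
      have "indicator (Pi\<^sub>E {..<m} A) t = (\<Prod>i<m. indicator (A i) (t i) :: ennreal)"
      proof (cases "t \<in> Pi\<^sub>E {..<m} A")
        case True
        then show ?thesis by (simp add: PiE_mem)
      next
        case False
        then obtain i where "i < m" "t i \<notin> A i" using t by (auto simp: space_PiM PiE_def Pi_def)
        then have "(\<Prod>i<m. indicator (A i) (t i) :: ennreal) = 0" by (intro prod_zero bexI[of _ i]) auto
        then show ?thesis using False by simp
      qed
      then show "(\<Prod>i<m. w (t i)) * indicator (Pi\<^sub>E {..<m} A) t = (\<Prod>i<m. w (t i) * indicator (A i) (t i))"
        by (simp add: prod.distrib)
    qed
    also have "\<dots> = (\<Prod>i<m. \<integral>\<^sup>+x. w x * indicator (A i) x \<partial>lborel)"
      by (rule lborel_fun.product_nn_integral_prod) (use A in auto)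
    also have "\<dots> = (\<Prod>i<m. emeasure circle_unif (A i))"
      using A by (intro prod.cong refl) (simp add: circle_unif_def emeasure_density w_def)
    finally show "emeasure (density (PiM {..<m} (\<lambda>_. lborel)) (\<lambda>t. \<Prod>i<m. w (t i))) (Pi\<^sub>E {..<m} A) = (\<Prod>i\<in>{..<m}. emeasure circle_unif (A i))" .
  qed simp
  then show ?thesis by (simp add: torus_unif_def w_def)
qed

text \<open>A product measure is determined by its boxes, and on a box the claim reduces to the
  affine substitution in each coordinate. The shift \<open>c j\<close> may later depend on
  coordinates outside J that are held fixed.\<close>

lemma nn_integral_PiM_affine:
  fixes c :: "nat \<Rightarrow> real"
  assumes J: "finite J" and d: "d > 0" and f: "f \<in> borel_measurable (PiM J (\<lambda>_. lborel))"
  shows "(\<integral>\<^sup>+y. f y \<partial>PiM J (\<lambda>_. lborel)) = ennreal (d ^ card J) * (\<integral>\<^sup>+y. f (\<lambda>j\<in>J. c j + d * y j) \<partial>PiM J (\<lambda>_. lborel))"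
proof -
  define N where "N = PiM J (\<lambda>_. lborel :: real measure)"
  define T where "T y = (\<lambda>j\<in>J. c j + d * y j)" for y :: "nat \<Rightarrow> real"
  have T: "T \<in> measurable N N"
    unfolding T_def[abs_def] N_def
  proof (rule measurable_restrict)
    fix j assume "j \<in> J"
    then have "(\<lambda>y. y j) \<in> borel_measurable (PiM J (\<lambda>_. lborel :: real measure))"
      using measurable_component_singleton[of j J "\<lambda>_. lborel :: real measure"] by simp
    then show "(\<lambda>y. c j + d * y j) \<in> measurable (PiM J (\<lambda>_. lborel)) lborel" by simp
  qed
  have "scale_measure (ennreal (d ^ card J)) (distr N N T) = PiM J (\<lambda>_. lborel)"
  proof (rule lborel_fun.PiM_eqI[OF J])
    show "sets (scale_measure (ennreal (d ^ card J)) (distr N N T)) = sets (PiM J (\<lambda>_. lborel))" by (simp add: N_def)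
    fix A :: "nat \<Rightarrow> real set" assume A: "\<And>i. i \<in> J \<Longrightarrow> A i \<in> sets lborel"
    have box: "Pi\<^sub>E J A \<in> sets N" unfolding N_def using A J by (intro sets_PiM_I_finite) auto
    have pre: "T -` Pi\<^sub>E J A \<inter> space N = Pi\<^sub>E J (\<lambda>j. (\<lambda>x. c j + d * x) -` A j)"
      by (auto simp: T_def N_def space_PiM PiE_def Pi_def extensional_def)
    have one: "emeasure lborel (A j) = ennreal d * emeasure lborel ((\<lambda>x. c j + d * x) -` A j)" if j: "j \<in> J" for j
    proof -
      have [measurable]: "A j \<in> sets borel" using A[OF j] by simp
      have m: "(\<lambda>x. c j + d * x) -` A j \<in> sets borel" using measurable_sets[of "\<lambda>x. c j + d * x" borel borel "A j"] by simp
      have "emeasure lborel (A j) = (\<integral>\<^sup>+x. indicator (A j) x \<partial>lborel)" by simp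
      also have "\<dots> = ennreal \<bar>d\<bar> * (\<integral>\<^sup>+x. indicator (A j) (c j + d * x) \<partial>lborel)"
        using d by (intro nn_integral_real_affine) auto
      also have "(\<lambda>x. indicator (A j) (c j + d * x)) = (indicator ((\<lambda>x. c j + d * x) -` A j) :: real \<Rightarrow> ennreal)"
        by (auto simp: fun_eq_iff indicator_def)
      finally show ?thesis using d m by simp
    qed
    have "emeasure (scale_measure (ennreal (d ^ card J)) (distr N N T)) (Pi\<^sub>E J A)
       = ennreal (d ^ card J) * emeasure N (Pi\<^sub>E J (\<lambda>j. (\<lambda>x. c j + d * x) -` A j))"
      using T box by (simp add: emeasure_distr pre)
    also have "emeasure N (Pi\<^sub>E J (\<lambda>j. (\<lambda>x. c j + d * x) -` A j)) = (\<Prod>j\<in>J. emeasure lborel ((\<lambda>x. c j + d * x) -` A j))"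
      unfolding N_def
    proof (rule lborel_fun.emeasure_PiM[OF J])
      fix j assume "j \<in> J"
      then show "(\<lambda>x. c j + d * x) -` A j \<in> sets lborel"
        using measurable_sets[of "\<lambda>x. c j + d * x" borel borel "A j"] A by simp
    qed
    also have "ennreal (d ^ card J) * \<dots> = (\<Prod>j\<in>J. ennreal d * emeasure lborel ((\<lambda>x. c j + d * x) -` A j))"
      using d by (simp add: prod.distrib ennreal_power)
    also have "\<dots> = (\<Prod>j\<in>J. emeasure lborel (A j))" by (intro prod.cong refl) (simp add: one)
    finally show "emeasure (scale_measure (ennreal (d ^ card J)) (distr N N T)) (Pi\<^sub>E J A) = (\<Prod>i\<in>J. emeasure lborel (A i))" .
  qed
  then have "(\<integral>\<^sup>+y. f y \<partial>N) = (\<integral>\<^sup>+y. f y \<partial>scale_measure (ennreal (d ^ card J)) (distr N N T))" by (simp add: N_def)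
  also have "\<dots> = ennreal (d ^ card J) * (\<integral>\<^sup>+y. f y \<partial>distr N N T)"
    using f by (intro nn_integral_scale_measure) (simp add: N_def)
  also have "(\<integral>\<^sup>+y. f y \<partial>distr N N T) = (\<integral>\<^sup>+y. f (T y) \<partial>N)"
    using f T by (intro nn_integral_distr) (simp_all add: N_def)
  finally show ?thesis by (simp add: N_def T_def)
qed

text \<open>Fubini with the even coordinates outside: for fixed first points the second points are
  an affine image of the rescaled gaps, with Jacobian d for each of the s pairs.\<close>

lemma nn_integral_pair_shift:
  assumes d: "d > 0" and f: "f \<in> borel_measurable (PiM {..<2 * s} (\<lambda>_. lborel))"
  shows "(\<integral>\<^sup>+t. f t \<partial>PiM {..<2 * s} (\<lambda>_. lborel)) = ennreal (d ^ s) * (\<integral>\<^sup>+x. f (\<lambda>i\<in>{..<2 * s}. pair_shift d x i) \<partial>PiM {..<2 * s} (\<lambda>_. lborel))"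
proof -
  define I where "I = {i. i < 2 * s \<and> even i}"
  define J where "J = {i. i < 2 * s \<and> odd i}"
  have IJ: "I \<inter> J = {}" "finite I" "finite J" "I \<union> J = {..<2 * s}" by (auto simp: I_def J_def)
  have cJ: "card J = s"
  proof -
    have "J = (\<lambda>r. 2 * r + 1) ` {..<s}" by (auto simp: J_def elim!: oddE)
    then show ?thesis by (simp add: card_image inj_on_def)
  qed
  have f': "f \<in> borel_measurable (PiM (I \<union> J) (\<lambda>_. lborel))" using f by (simp add: IJ(4))
  define g where "g x = f (\<lambda>i\<in>I \<union> J. pair_shift d x i)" for x
  have g: "g \<in> borel_measurable (PiM (I \<union> J) (\<lambda>_. lborel))"
    unfolding g_def
  proof (rule measurable_compose[OF _ f'], rule measurable_restrict)
    fix i assume i: "i \<in> I \<union> J"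
    then have i1: "odd i \<Longrightarrow> i - 1 \<in> I \<union> J" by (auto simp: I_def J_def)
    have c: "(\<lambda>x. x k) \<in> borel_measurable (PiM (I \<union> J) (\<lambda>_. lborel))" if "k \<in> I \<union> J" for k
      using measurable_component_singleton[OF that, of "\<lambda>_. lborel"] by simp
    show "(\<lambda>x. pair_shift d x i) \<in> measurable (PiM (I \<union> J) (\<lambda>_. lborel)) lborel"
    proof (cases "odd i")
      case True
      have "(\<lambda>x. x (i - 1) + d * x i) \<in> borel_measurable (PiM (I \<union> J) (\<lambda>_. lborel))"
        by (intro borel_measurable_add borel_measurable_times borel_measurable_const c i i1 True)
      then show ?thesis using True by (simp add: pair_shift_def)
    next
      case False
      then show ?thesis using c[OF i] by (simp add: pair_shift_def)
    qed
  qed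
  have "(\<integral>\<^sup>+t. f t \<partial>PiM (I \<union> J) (\<lambda>_. lborel)) = (\<integral>\<^sup>+x. (\<integral>\<^sup>+y. f (merge I J (x, y)) \<partial>PiM J (\<lambda>_. lborel)) \<partial>PiM I (\<lambda>_. lborel))"
    by (rule lborel_fun.product_nn_integral_fold[OF IJ(1-3) f'])
  also have "\<dots> = (\<integral>\<^sup>+x. ennreal (d ^ s) * (\<integral>\<^sup>+y. g (merge I J (x, y)) \<partial>PiM J (\<lambda>_. lborel)) \<partial>PiM I (\<lambda>_. lborel))"
  proof (rule nn_integral_cong)
    fix x assume x: "x \<in> space (PiM I (\<lambda>_. lborel :: real measure))"
    have "(\<lambda>p. f (merge I J p)) \<in> borel_measurable (PiM I (\<lambda>_. lborel) \<Otimes>\<^sub>M PiM J (\<lambda>_. lborel))"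
      by (rule measurable_compose[OF measurable_merge f'])
    from measurable_Pair2[OF this x]
    have "(\<lambda>y. f (merge I J (x, y))) \<in> borel_measurable (PiM J (\<lambda>_. lborel))" .
    from nn_integral_PiM_affine[OF IJ(3) d this, of "\<lambda>j. x (j - 1)"]
    have "(\<integral>\<^sup>+y. f (merge I J (x, y)) \<partial>PiM J (\<lambda>_. lborel))
       = ennreal (d ^ s) * (\<integral>\<^sup>+y. f (merge I J (x, \<lambda>j\<in>J. x (j - 1) + d * y j)) \<partial>PiM J (\<lambda>_. lborel))" by (simp add: cJ)
    also have "(\<lambda>y. f (merge I J (x, \<lambda>j\<in>J. x (j - 1) + d * y j))) = (\<lambda>y. g (merge I J (x, y)))"
    proof
      fix y
      have "merge I J (x, \<lambda>j\<in>J. x (j - 1) + d * y j) = (\<lambda>i\<in>I \<union> J. pair_shift d (merge I J (x, y)) i)"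
      proof
        fix i
        show "merge I J (x, \<lambda>j\<in>J. x (j - 1) + d * y j) i = (\<lambda>i\<in>I \<union> J. pair_shift d (merge I J (x, y)) i) i"
        proof (cases "i \<in> J")
          case True
          then have "i \<notin> I" "i - 1 \<in> I" "odd i" using IJ(1) by (auto simp: I_def J_def)
          then show ?thesis using True by (simp add: pair_shift_def merge_def)
        next
          case False
          then show ?thesis by (cases "i \<in> I") (auto simp: pair_shift_def I_def merge_def)
        qed
      qed
      then show "f (merge I J (x, \<lambda>j\<in>J. x (j - 1) + d * y j)) = g (merge I J (x, y))" by (simp add: g_def)
    qed
    finally show "(\<integral>\<^sup>+y. f (merge I J (x, y)) \<partial>PiM J (\<lambda>_. lborel)) = ennreal (d ^ s) * (\<integral>\<^sup>+y. g (merge I J (x, y)) \<partial>PiM J (\<lambda>_. lborel))" .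
  qed
  also have "\<dots> = ennreal (d ^ s) * (\<integral>\<^sup>+x. (\<integral>\<^sup>+y. g (merge I J (x, y)) \<partial>PiM J (\<lambda>_. lborel)) \<partial>PiM I (\<lambda>_. lborel))"
  proof (rule nn_integral_cmult)
    interpret S: sigma_finite_measure "PiM J (\<lambda>_. lborel :: real measure)" by (rule lborel_fun.sigma_finite[OF IJ(3)])
    show "(\<lambda>x. \<integral>\<^sup>+y. g (merge I J (x, y)) \<partial>PiM J (\<lambda>_. lborel)) \<in> borel_measurable (PiM I (\<lambda>_. lborel))"
      using measurable_compose[OF measurable_merge g] by (intro S.borel_measurable_nn_integral) (simp add: split_def)
  qed
  also have "(\<integral>\<^sup>+x. (\<integral>\<^sup>+y. g (merge I J (x, y)) \<partial>PiM J (\<lambda>_. lborel)) \<partial>PiM I (\<lambda>_. lborel)) = (\<integral>\<^sup>+t. g t \<partial>PiM (I \<union> J) (\<lambda>_. lborel))"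
    by (rule lborel_fun.product_nn_integral_fold[symmetric, OF IJ(1-3) g])
  finally show ?thesis by (simp add: IJ(4) g_def)
qed

text \<open>With all other coordinates fixed, the exceptional values of \<open>x i\<close> form a
  single point.\<close>

lemma AE_PiM_lborel_distinct:
  fixes i j m :: nat
  assumes ij: "i < m" "j < m" "i \<noteq> j"
  shows "AE x in PiM {..<m} (\<lambda>_. lborel :: real measure). x i \<noteq> x j"
proof -
  define I where "I = {..<m} - {i}"
  have I: "finite I" "i \<notin> I" by (simp_all add: I_def)
  have I3: "insert i I = {..<m}" unfolding I_def using ij(1) by (intro insert_Diff) simp
  define S where "S = {x \<in> space (PiM {..<m} (\<lambda>_. lborel :: real measure)). x i = x j}"
  have c: "(\<lambda>x. x k) \<in> borel_measurable (PiM {..<m} (\<lambda>_. lborel :: real measure))" if "k < m" for k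
    using measurable_component_singleton[of k "{..<m}" "\<lambda>_. lborel"] that by simp
  have S: "S \<in> sets (PiM {..<m} (\<lambda>_. lborel))"
    unfolding S_def using c[OF ij(1)] c[OF ij(2)] by measurable
  have "emeasure (PiM {..<m} (\<lambda>_. lborel)) S = (\<integral>\<^sup>+x. indicator S x \<partial>PiM (insert i I) (\<lambda>_. lborel))"
    using S by (simp add: I3)
  also have "\<dots> = (\<integral>\<^sup>+x. (\<integral>\<^sup>+y. indicator S (x(i := y)) \<partial>lborel) \<partial>PiM I (\<lambda>_. lborel))"
    by (rule lborel_fun.product_nn_integral_insert[OF I(1,2)]) (use S in \<open>simp add: I3\<close>)
  also have "\<dots> = (\<integral>\<^sup>+x. 0 \<partial>PiM I (\<lambda>_. lborel :: real measure))"
  proof (rule nn_integral_cong)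
    fix x
    have "(\<integral>\<^sup>+y. indicator S (x(i := y)) \<partial>lborel) \<le> (\<integral>\<^sup>+y. indicator {x j} y \<partial>lborel)"
      by (rule nn_integral_mono) (use ij in \<open>auto simp: S_def split: split_indicator\<close>)
    then show "(\<integral>\<^sup>+y. indicator S (x(i := y)) \<partial>lborel) = 0" by simp
  qed
  finally have "emeasure (PiM {..<m} (\<lambda>_. lborel)) S = 0" by simp
  then show ?thesis using S by (intro AE_I[of _ _ S]) (auto simp: S_def)
qed

section \<open>Limit of the means of close pairs\<close>

text \<open>The strict inequality x < y counts each close pair once and excludes coincident points,
  for which the difference rows would be divided by zero. Both points must lie in the same
  interval.\<close>

definition pair_close :: "real \<Rightarrow> real \<Rightarrow> real \<Rightarrow> real \<Rightarrow> real \<Rightarrow> real" where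
  "pair_close d a b x y = (if x < y \<and> y \<le> x + d \<and> a \<le> x \<and> x < b \<and> a \<le> y \<and> y < b then 1 else 0)"

definition pairs_fn :: "nat \<Rightarrow> real \<Rightarrow> (nat \<Rightarrow> real) \<Rightarrow> (nat \<Rightarrow> real) \<Rightarrow> (nat \<Rightarrow> real) \<Rightarrow> real" where
  "pairs_fn s d a b t = (\<Prod>r<s. pair_close d (a r) (b r) (t (2 * r)) (t (2 * r + 1)))"

lemma pair_close_01: "pair_close d a b x y = 0 \<or> pair_close d a b x y = 1"
  by (simp add: pair_close_def)

lemma pairs_fn_01: "pairs_fn s d a b t = 0 \<or> pairs_fn s d a b t = 1"
proof (cases "\<exists>r<s. pair_close d (a r) (b r) (t (2 * r)) (t (2 * r + 1)) = 0")
  case True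
  then show ?thesis by (auto simp: pairs_fn_def)
next
  case False
  then have "\<forall>r<s. pair_close d (a r) (b r) (t (2 * r)) (t (2 * r + 1)) = 1" using pair_close_01 by blast
  then show ?thesis by (simp add: pairs_fn_def)
qed

lemma pairs_fn_nonneg: "pairs_fn s d a b t \<ge> 0" using pairs_fn_01[of s d a b t] by auto

lemma pairs_fn_nonzero:
  "pairs_fn s d a b t \<noteq> 0 \<longleftrightarrow> (\<forall>r<s. pair_close d (a r) (b r) (t (2 * r)) (t (2 * r + 1)) \<noteq> 0)"
  by (auto simp: pairs_fn_def)

lemma pairs_fn_cong:
  assumes "\<And>i. i < 2 * s \<Longrightarrow> t i = u i" "\<And>r. r < s \<Longrightarrow> a r = a' r \<and> b r = b' r"
  shows "pairs_fn s d a b t = pairs_fn s d a' b' u"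
  using assms unfolding pairs_fn_def by (intro prod.cong refl) simp

lemma pair_close_measurable:
  assumes [measurable]: "f \<in> borel_measurable M" "g \<in> borel_measurable M"
  shows "(\<lambda>x. pair_close d a b (f x) (g x)) \<in> borel_measurable M"
  unfolding pair_close_def by measurable

lemma pairs_fn_measurable: "2 * s \<le> m \<Longrightarrow> pairs_fn s d a b \<in> borel_measurable (torus_unif m)"
  unfolding pairs_fn_def[abs_def]
  by (intro borel_measurable_prod pair_close_measurable torus_component_measurable) auto

lemma sets_torus_unif_lborel: "sets (torus_unif m) = sets (PiM {..<m} (\<lambda>_. lborel))"
  unfolding torus_unif_def by (rule sets_PiM_cong) simp_all

lemma lborel_component_measurable:
  "k \<in> I \<Longrightarrow> (\<lambda>x. x k) \<in> borel_measurable (PiM I (\<lambda>_. lborel :: real measure))"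
  using measurable_component_singleton[of k I "\<lambda>_. lborel"] by simp

lemma pair_shift_measurable:
  "(\<lambda>x. \<lambda>i\<in>{..<2 * s}. pair_shift d x i) \<in> measurable (PiM {..<2 * s} (\<lambda>_. lborel)) (PiM {..<2 * s} (\<lambda>_. lborel))"
proof (rule measurable_restrict)
  fix i assume i: "i \<in> {..<2 * s}"
  then have i1: "i - 1 \<in> {..<2 * s}" by auto
  show "(\<lambda>x. pair_shift d x i) \<in> measurable (PiM {..<2 * s} (\<lambda>_. lborel)) lborel"
  proof (cases "odd i")
    case True
    have "(\<lambda>x. x (i - 1) + d * x i) \<in> borel_measurable (PiM {..<2 * s} (\<lambda>_. lborel))"
      by (intro borel_measurable_add borel_measurable_times borel_measurable_const lborel_component_measurable i i1)
    then show ?thesis using True by (simp add: pair_shift_def)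
  next
    case False
    then show ?thesis using lborel_component_measurable[OF i] by (simp add: pair_shift_def)
  qed
qed

definition pair_integrand :: "nat \<Rightarrow> real \<Rightarrow> nat \<Rightarrow> (nat \<Rightarrow> real) \<Rightarrow> (nat \<Rightarrow> real) \<Rightarrow> (nat \<Rightarrow> real) \<Rightarrow> real" where
  "pair_integrand n d s a b t = (1 / (2 * pi)) ^ (2 * s) * (pairs_fn s d a b t * Re (kernel_det n (2 * s) t))"

lemma pair_integrand_measurable: "pair_integrand n d s a b \<in> borel_measurable (PiM {..<2 * s} (\<lambda>_. lborel))"
proof -
  have "pair_integrand n d s a b \<in> borel_measurable (torus_unif (2 * s))"
    unfolding pair_integrand_def[abs_def]
    using pairs_fn_measurable[of s "2 * s" d a b] kernel_det_measurable[of "2 * s" "2 * s" n] by measurable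
  then show ?thesis by (simp cong: measurable_cong_sets add: measurable_cong_sets[OF sets_torus_unif_lborel refl])
qed

lemma weyl_pairs_integral:
  assumes n: "2 * s \<le> n" and d: "d > 0" and ab: "\<And>r. r < s \<Longrightarrow> 0 \<le> a r \<and> b r \<le> 2 * pi"
  shows "(\<integral>\<^sup>+t. ennreal (tuple_sum n (2 * s) (pairs_fn s d a b) t) \<partial>weyl n)
    = (\<integral>\<^sup>+x. ennreal (d ^ s * pair_integrand n d s a b (\<lambda>i\<in>{..<2 * s}. pair_shift d x i)) \<partial>PiM {..<2 * s} (\<lambda>_. lborel))"
proof -
  define w where "w t = (\<Prod>i<2 * s. ennreal (indicator {0..<2*pi} (t i) / (2*pi)))" for t :: "nat \<Rightarrow> real"
  have w: "w \<in> borel_measurable (PiM {..<2 * s} (\<lambda>_. lborel))"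
    unfolding w_def[abs_def]
  proof (rule borel_measurable_prod_ennreal)
    fix i assume "i \<in> {..<2 * s}"
    then have [measurable]: "(\<lambda>x. x i) \<in> borel_measurable (PiM {..<2 * s} (\<lambda>_. lborel :: real measure))"
      by (rule lborel_component_measurable)
    show "(\<lambda>t. ennreal (indicator {0..<2*pi} (t i) / (2*pi))) \<in> borel_measurable (PiM {..<2 * s} (\<lambda>_. lborel))" by measurable
  qed
  have "(\<integral>\<^sup>+t. ennreal (tuple_sum n (2 * s) (pairs_fn s d a b) t) \<partial>weyl n)
     = (\<integral>\<^sup>+t. ennreal (pairs_fn s d a b t) * ennreal (Re (kernel_det n (2 * s) t)) \<partial>torus_unif (2 * s))"
    by (intro weyl_tuple_sum pairs_fn_measurable pairs_fn_nonneg n order_refl)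
  also have "\<dots> = (\<integral>\<^sup>+t. w t * (ennreal (pairs_fn s d a b t) * ennreal (Re (kernel_det n (2 * s) t))) \<partial>PiM {..<2 * s} (\<lambda>_. lborel))"
  proof -
    have "(\<lambda>t. ennreal (pairs_fn s d a b t) * ennreal (Re (kernel_det n (2 * s) t))) \<in> borel_measurable (torus_unif (2 * s))"
      using pairs_fn_measurable[of s "2 * s" d a b] kernel_det_measurable[of "2 * s" "2 * s" n] by measurable
    then have "(\<lambda>t. ennreal (pairs_fn s d a b t) * ennreal (Re (kernel_det n (2 * s) t))) \<in> borel_measurable (PiM {..<2 * s} (\<lambda>_. lborel))"
      by (simp add: measurable_cong_sets[OF sets_torus_unif_lborel refl])
    then show ?thesis unfolding torus_unif_density w_def[symmetric] by (intro nn_integral_density w)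
  qed
  also have "\<dots> = (\<integral>\<^sup>+t. ennreal (pair_integrand n d s a b t) \<partial>PiM {..<2 * s} (\<lambda>_. lborel))"
  proof (rule nn_integral_cong)
    fix t :: "nat \<Rightarrow> real"
    show "w t * (ennreal (pairs_fn s d a b t) * ennreal (Re (kernel_det n (2 * s) t))) = ennreal (pair_integrand n d s a b t)"
    proof (cases "pairs_fn s d a b t = 0")
      case False
      \<comment> \<open>On the support of \<open>pairs_fn\<close> every coordinate lies in one of
        the intervals [a r, b r), hence in [0, 2 pi), where the density of
        \<open>circle_unif\<close> is constant.\<close>
      have "indicator {0..<2*pi} (t i) = (1::real)" if i: "i < 2 * s" for i
      proof -
        have r: "i div 2 < s" using i by auto
        then have "pair_close d (a (i div 2)) (b (i div 2)) (t (2 * (i div 2))) (t (2 * (i div 2) + 1)) \<noteq> 0"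
          using False by (simp add: pairs_fn_nonzero)
        moreover have "i = 2 * (i div 2) \<or> i = 2 * (i div 2) + 1" by linarith
        ultimately have "a (i div 2) \<le> t i \<and> t i < b (i div 2)" by (auto simp: pair_close_def split: if_splits)
        then show ?thesis using ab[OF r] by simp
      qed
      then have "w t = (\<Prod>i<2 * s. ennreal (1 / (2*pi)))" unfolding w_def by (intro prod.cong refl) simp
      also have "\<dots> = ennreal ((1 / (2 * pi)) ^ (2 * s))" by (simp only: prod_constant card_lessThan ennreal_power[symmetric]) (simp add: ennreal_power)
      finally show ?thesis unfolding pair_integrand_def using pairs_fn_nonneg[of s d a b t] kernel_det_nonneg[OF n, of t]
        by (simp add: ennreal_mult)
    qed (simp add: pair_integrand_def)
  qed
  also have "\<dots> = ennreal (d ^ s) * (\<integral>\<^sup>+x. ennreal (pair_integrand n d s a b (\<lambda>i\<in>{..<2 * s}. pair_shift d x i)) \<partial>PiM {..<2 * s} (\<lambda>_. lborel))"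
    by (intro nn_integral_pair_shift d measurable_compose[OF pair_integrand_measurable measurable_ennreal])
  also have "\<dots> = (\<integral>\<^sup>+x. ennreal (d ^ s) * ennreal (pair_integrand n d s a b (\<lambda>i\<in>{..<2 * s}. pair_shift d x i)) \<partial>PiM {..<2 * s} (\<lambda>_. lborel))"
    by (intro nn_integral_cmult[symmetric] measurable_compose[OF measurable_compose[OF pair_shift_measurable pair_integrand_measurable] measurable_ennreal])
  also have "\<dots> = (\<integral>\<^sup>+x. ennreal (d ^ s * pair_integrand n d s a b (\<lambda>i\<in>{..<2 * s}. pair_shift d x i)) \<partial>PiM {..<2 * s} (\<lambda>_. lborel))"
    using d by (intro nn_integral_cong) (simp add: ennreal_mult')
  finally show ?thesis .
qed

lemma pair_close_shift:
  assumes "d > 0"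
  shows "pair_close d a b x (x + d * v) = (if 0 < v \<and> v \<le> 1 \<and> a \<le> x \<and> x + d * v < b then 1 else 0)"
proof -
  have 1: "0 < d * v \<longleftrightarrow> 0 < v" using assms by (simp add: zero_less_mult_iff)
  have 2: "d * v \<le> d \<longleftrightarrow> v \<le> 1" using assms by simp
  have 3: "x < x + d * v \<and> x + d * v \<le> x + d \<and> a \<le> x \<and> x < b \<and> a \<le> x + d * v \<and> x + d * v < b
     \<longleftrightarrow> 0 < v \<and> v \<le> 1 \<and> a \<le> x \<and> x + d * v < b"
    unfolding 1[symmetric] 2[symmetric] by auto
  show ?thesis unfolding pair_close_def by (rule if_cong[OF 3 refl refl])
qed

lemma pairs_fn_shift:
  assumes "d > 0"
  shows "pairs_fn s d a b (\<lambda>i\<in>{..<2 * s}. pair_shift d x i)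
    = (\<Prod>r<s. if 0 < x (2*r+1) \<and> x (2*r+1) \<le> 1 \<and> a r \<le> x (2*r) \<and> x (2*r) + d * x (2*r+1) < b r then 1 else 0)"
  unfolding pairs_fn_def
proof (rule prod.cong[OF refl])
  fix r assume "r \<in> {..<s}"
  then have "2 * r < 2 * s" "2 * r + 1 < 2 * s" by auto
  then show "pair_close d (a r) (b r) ((\<lambda>i\<in>{..<2 * s}. pair_shift d x i) (2 * r)) ((\<lambda>i\<in>{..<2 * s}. pair_shift d x i) (2 * r + 1))
    = (if 0 < x (2*r+1) \<and> x (2*r+1) \<le> 1 \<and> a r \<le> x (2*r) \<and> x (2*r) + d * x (2*r+1) < b r then 1 else 0)"
    using pair_close_shift[OF assms, of "a r" "b r" "x (2*r)" "x (2*r+1)"] by (simp add: pair_shift_def)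
qed

text \<open>Each pair collects d from the substitution and n^4 d^2 v^2 from its rows, v being the
  rescaled gap. The power n^4 d^3 is constant in n in the application.\<close>

lemma pair_integrand_shift:
  assumes n: "n \<ge> 1" and d: "d > 0"
  shows "d ^ s * pair_integrand n d s a b (\<lambda>i\<in>{..<2 * s}. pair_shift d x i)
    = (real n ^ 4 * d ^ 3 / (2 * pi)\<^sup>2) ^ s * (pairs_fn s d a b (\<lambda>i\<in>{..<2 * s}. pair_shift d x i)
        * ((\<Prod>r<s. (x (2*r+1))\<^sup>2) * Re (det (mat (2 * s) (2 * s) (\<lambda>(i,j). pair_gram n s (pair_shift d x) i j)))))"
proof (cases "pairs_fn s d a b (\<lambda>i\<in>{..<2 * s}. pair_shift d x i) = 0")
  case True
  then show ?thesis by (simp only: pair_integrand_def mult_zero_left mult_zero_right)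
next
  case False
  have v: "0 < x (2*r+1)" if "r < s" for r
    using False that unfolding pairs_fn_shift[OF d] by (auto split: if_splits)
  have ne: "pair_shift d x i \<noteq> pair_shift d x (i - 1)" if "pair_odd s i" for i
  proof -
    have "odd i" "i < 2 * s" using that by (auto simp: pair_odd_def)
    then obtain r where r: "i = 2 * r + 1" by (elim oddE)
    then show ?thesis using v[of r] \<open>i < 2 * s\<close> d by (simp add: pair_shift_def)
  qed
  have "kernel_det n (2 * s) (\<lambda>i\<in>{..<2 * s}. pair_shift d x i) = kernel_det n (2 * s) (pair_shift d x)"
    by (rule kernel_det_cong) simp
  also have "\<dots> = of_real (\<Prod>i<2 * s. (pair_scale n s (pair_shift d x) i)\<^sup>2)
      * det (mat (2 * s) (2 * s) (\<lambda>(i,j). pair_gram n s (pair_shift d x) i j))"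
    by (rule kernel_det_pairs[OF n]) (rule ne)
  also have "(\<Prod>i<2 * s. (pair_scale n s (pair_shift d x) i)\<^sup>2) = (\<Prod>r<s. real n ^ 4 * d\<^sup>2 * (x (2*r+1))\<^sup>2)"
    unfolding prod_pair_scale by (intro prod.cong refl) (simp add: pair_shift_def power_mult_distrib)
  also have "\<dots> = (real n ^ 4 * d\<^sup>2) ^ s * (\<Prod>r<s. (x (2*r+1))\<^sup>2)" by (simp add: prod.distrib)
  finally have "kernel_det n (2 * s) (\<lambda>i\<in>{..<2 * s}. pair_shift d x i) = of_real ((real n ^ 4 * d\<^sup>2) ^ s * (\<Prod>r<s. (x (2*r+1))\<^sup>2))
     * det (mat (2 * s) (2 * s) (\<lambda>(i,j). pair_gram n s (pair_shift d x) i j))" .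
  then have k: "Re (kernel_det n (2 * s) (\<lambda>i\<in>{..<2 * s}. pair_shift d x i)) = (real n ^ 4 * d\<^sup>2) ^ s * (\<Prod>r<s. (x (2*r+1))\<^sup>2)
     * Re (det (mat (2 * s) (2 * s) (\<lambda>(i,j). pair_gram n s (pair_shift d x) i j)))"
    by (simp only: scaleR_conv_of_real[symmetric] scaleR_complex.sel)
  have c: "d ^ s * ((1 / (2 * pi)) ^ (2 * s) * (real n ^ 4 * d\<^sup>2) ^ s) = (real n ^ 4 * d ^ 3 / (2 * pi)\<^sup>2) ^ s"
    unfolding power_mult power_mult_distrib[symmetric] by (simp add: power2_eq_square power3_eq_cube mult_ac)
  show ?thesis unfolding pair_integrand_def k c[symmetric] by (simp only: mult_ac)
qed

text \<open>With the constant 1 for \<phi> this is the dominating function of the pair integrals,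
  with v^2 it is their limit.\<close>

definition pair_box :: "(real \<Rightarrow> real) \<Rightarrow> nat \<Rightarrow> (nat \<Rightarrow> real) \<Rightarrow> (nat \<Rightarrow> real) \<Rightarrow> (nat \<Rightarrow> real) \<Rightarrow> real" where
  "pair_box \<phi> s a b x = (\<Prod>r<s. indicator {a r..<b r} (x (2*r)) * (\<phi> (x (2*r+1)) * indicator {0<..1} (x (2*r+1))))"

lemma pair_box_measurable:
  assumes [measurable]: "\<phi> \<in> borel_measurable borel"
  shows "pair_box \<phi> s a b \<in> borel_measurable (PiM {..<2 * s} (\<lambda>_. lborel))"
  unfolding pair_box_def[abs_def]
proof (rule borel_measurable_prod)
  fix r assume "r \<in> {..<s}"
  then have r: "2 * r \<in> {..<2 * s}" "2 * r + 1 \<in> {..<2 * s}" by auto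
  note [measurable] = lborel_component_measurable[OF r(1)] lborel_component_measurable[OF r(2)]
  show "(\<lambda>x. indicator {a r..<b r} (x (2*r)) * (\<phi> (x (2*r+1)) * indicator {0<..1} (x (2*r+1)))) \<in> borel_measurable (PiM {..<2 * s} (\<lambda>_. lborel))"
    by measurable
qed

lemma nn_integral_pair_box:
  assumes \<phi>: "\<phi> \<in> borel_measurable borel" "\<And>v. \<phi> v \<ge> 0" "(\<integral>\<^sup>+v. ennreal (\<phi> v * indicator {0<..1} v) \<partial>lborel) = ennreal c" "c \<ge> 0"
    and ab: "\<And>r. r < s \<Longrightarrow> a r \<le> b r"
  shows "(\<integral>\<^sup>+x. ennreal (pair_box \<phi> s a b x) \<partial>PiM {..<2 * s} (\<lambda>_. lborel)) = ennreal (\<Prod>r<s. (b r - a r) * c)"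
proof -
  define u where "u i y = ennreal (if even i then indicator {a (i div 2)..<b (i div 2)} y else \<phi> y * indicator {0<..1} y)" for i :: nat and y :: real
  have [measurable]: "\<phi> \<in> borel_measurable borel" by (rule \<phi>(1))
  have u [measurable]: "u i \<in> borel_measurable borel" for i
    unfolding u_def[abs_def] by (cases "even i") simp_all
  have "ennreal (pair_box \<phi> s a b x) = (\<Prod>i<2 * s. u i (x i))" for x
    unfolding pair_box_def prod_pairs u_def using \<phi>(2)
    by (subst prod_ennreal[symmetric]) (auto intro!: prod.cong mult_nonneg_nonneg simp: ennreal_mult')
  then have "(\<integral>\<^sup>+x. ennreal (pair_box \<phi> s a b x) \<partial>PiM {..<2 * s} (\<lambda>_. lborel)) = (\<integral>\<^sup>+x. (\<Prod>i<2 * s. u i (x i)) \<partial>PiM {..<2 * s} (\<lambda>_. lborel))"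
    by (simp only:)
  also have "\<dots> = (\<Prod>i<2 * s. \<integral>\<^sup>+y. u i y \<partial>lborel)"
    by (rule lborel_fun.product_nn_integral_prod) simp_all
  also have "\<dots> = (\<Prod>r<s. ennreal ((b r - a r) * c))"
    unfolding prod_pairs
  proof (rule prod.cong[OF refl])
    fix r assume "r \<in> {..<s}"
    then have r: "a r \<le> b r" using ab by simp
    have "(\<integral>\<^sup>+y. u (2 * r) y \<partial>lborel) = (\<integral>\<^sup>+y. indicator {a r..<b r} y \<partial>lborel)"
      by (rule nn_integral_cong) (simp add: u_def indicator_def)
    also have "\<dots> = ennreal (b r - a r)" using r by simp
    finally have 1: "(\<integral>\<^sup>+y. u (2 * r) y \<partial>lborel) = ennreal (b r - a r)" .
    have 2: "(\<integral>\<^sup>+y. u (2 * r + 1) y \<partial>lborel) = ennreal c"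
      unfolding \<phi>(3)[symmetric] by (simp add: u_def)
    show "(\<integral>\<^sup>+y. u (2 * r) y \<partial>lborel) * (\<integral>\<^sup>+y. u (2 * r + 1) y \<partial>lborel) = ennreal ((b r - a r) * c)"
      unfolding 1 2 using r \<phi>(4) by (simp add: ennreal_mult)
  qed
  also have "\<dots> = ennreal (\<Prod>r<s. (b r - a r) * c)" using ab \<phi>(4) by (intro prod_ennreal) (auto intro!: mult_nonneg_nonneg)
  finally show ?thesis .
qed

lemma nn_integral_sq_unit: "(\<integral>\<^sup>+v. ennreal (v\<^sup>2 * indicator {0<..1} v) \<partial>lborel) = ennreal (1 / 3)"
proof -
  have "(\<integral>\<^sup>+v. ennreal (v\<^sup>2 * indicator {0<..1} v) \<partial>lborel) = (\<integral>\<^sup>+v. ennreal (v\<^sup>2) * indicator {0..1} v \<partial>lborel)"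
    by (rule nn_integral_cong) (auto simp: indicator_def)
  also have "\<dots> = ennreal (1 ^ 3 / 3 - 0 ^ 3 / 3)"
    by (rule nn_integral_FTC_Icc) (auto intro!: derivative_eq_intros)
  finally show ?thesis by simp
qed

text \<open>Dominated convergence in the rescaled coordinates. A pair contributes K / (2 pi)^2 from
  densities and scaling, 1/12 from the limit determinant, 1/3 from the integral of v^2 over the unit
  interval and b - a from its position, in all K (b - a) / (144 pi^2).\<close>

lemma weyl_pairs_tendsto:
  fixes d :: "nat \<Rightarrow> real"
  assumes d: "\<And>n. n \<ge> 1 \<Longrightarrow> d n > 0" and K: "\<And>n. n \<ge> 1 \<Longrightarrow> real n ^ 4 * d n ^ 3 = K" and nd: "(\<lambda>n. real n * d n) \<longlonglongrightarrow> 0"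
    and ab: "\<And>r. r < s \<Longrightarrow> 0 \<le> a r \<and> a r \<le> b r \<and> b r \<le> 2 * pi"
  shows "(\<lambda>n. \<integral>\<^sup>+t. ennreal (tuple_sum n (2 * s) (pairs_fn s (d n) a b) t) \<partial>weyl n) \<longlonglongrightarrow> ennreal (\<Prod>r<s. K * (b r - a r) / (144 * pi\<^sup>2))"
proof -
  define P where "P = PiM {..<2 * s} (\<lambda>_. lborel :: real measure)"
  define C where "C = (K / (2 * pi)\<^sup>2) ^ s"
  have K0: "K > 0" using K[of 1] zero_less_power[OF d[of 1], of 3] by simp
  have C0: "C \<ge> 0" unfolding C_def using K0 by simp
  define \<Phi> where "\<Phi> e x = (\<lambda>i\<in>{..<2 * s}. pair_shift e x i)" for e and x :: "nat \<Rightarrow> real"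
  define p where "p n x = pairs_fn s (d n) a b (\<Phi> (d n) x)" for n and x :: "nat \<Rightarrow> real"
  define D where "D n x = Re (det (mat (2 * s) (2 * s) (\<lambda>(i,j). pair_gram n s (pair_shift (d n) x) i j)))" for n and x :: "nat \<Rightarrow> real"
  define V where "V x = (\<Prod>r<s. (x (2*r+1))\<^sup>2)" for x :: "nat \<Rightarrow> real"
  define u where "u n x = d n ^ s * pair_integrand n (d n) s a b (\<Phi> (d n) x)" for n x
  have u_eq: "u n x = C * (p n x * (V x * D n x))" if "n \<ge> 1" for n x
    unfolding u_def \<Phi>_def pair_integrand_shift[OF that d[OF that]] K[OF that] C_def p_def V_def D_def by (rule refl)
  have p_eq: "p n x = (\<Prod>r<s. if 0 < x (2*r+1) \<and> x (2*r+1) \<le> 1 \<and> a r \<le> x (2*r) \<and> x (2*r) + d n * x (2*r+1) < b r then 1 else 0)" if "n \<ge> 1" for n x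
    unfolding p_def \<Phi>_def by (rule pairs_fn_shift[OF d[OF that]])
  have p01: "p n x = 0 \<or> p n x = 1" for n x unfolding p_def by (rule pairs_fn_01)
  have p_nz: "\<forall>r<s. 0 < x (2*r+1) \<and> x (2*r+1) \<le> 1 \<and> a r \<le> x (2*r) \<and> x (2*r) + d n * x (2*r+1) < b r"
    if "n \<ge> 1" "p n x \<noteq> 0" for n x
    using that(2) unfolding p_eq[OF that(1)] by (auto split: if_splits)
  have um: "(\<lambda>x. ennreal (u n x)) \<in> borel_measurable P" for n
    using measurable_compose[OF pair_shift_measurable pair_integrand_measurable, of n "d n" s a b "d n"]
    unfolding u_def \<Phi>_def P_def by measurable
  have D_bound: "\<bar>D n x\<bar> \<le> fact (2 * s)" if n: "n \<ge> 1" and pn: "p n x \<noteq> 0" for n x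
  proof -
    have ne: "pair_shift (d n) x i \<noteq> pair_shift (d n) x (i - 1)" if "pair_odd s i" for i
    proof -
      have "odd i" "i < 2 * s" using that by (auto simp: pair_odd_def)
      then obtain r where r: "i = 2 * r + 1" by (elim oddE)
      then show ?thesis using p_nz[OF n pn, rule_format, of r] \<open>i < 2 * s\<close> d[OF n] by (simp add: pair_shift_def)
    qed
    have "\<bar>D n x\<bar> \<le> cmod (det (mat (2 * s) (2 * s) (\<lambda>(i,j). pair_gram n s (pair_shift (d n) x) i j)))"
      unfolding D_def by (rule abs_Re_le_cmod)
    also have "\<dots> \<le> fact (2 * s)" by (rule norm_det_le_fact) (intro norm_pair_gram n ne)
    finally show ?thesis .
  qed
  \<comment> \<open>Gram entries of modulus at most 1 bound the determinant by (2 s)!, and the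
    rescaled gaps stay in (0, 1], so a multiple of the indicator of a fixed box dominates.\<close>
  define w where "w x = C * fact (2 * s) * pair_box (\<lambda>_. 1) s (\<lambda>_. 0) (\<lambda>_. 2 * pi) x" for x
  define l where "l x = C * (1 / 12) ^ s * pair_box (\<lambda>v. v\<^sup>2) s a b x" for x
  have box_nonneg: "pair_box \<phi> s a' b' x \<ge> 0" if "\<And>v. \<phi> v \<ge> 0" for \<phi> a' b' x
    unfolding pair_box_def by (intro prod_nonneg ballI mult_nonneg_nonneg that) auto
  have bound: "u n x \<le> w x" if n: "n \<ge> 1" for n x
  proof (cases "p n x = 0")
    case True
    then show ?thesis using C0 box_nonneg[of "\<lambda>_. 1"] by (simp add: u_eq[OF n] w_def)
  next
    case False
    note nz = p_nz[OF n this]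
    have V: "0 \<le> V x" "V x \<le> 1" unfolding V_def using nz by (auto intro!: prod_nonneg prod_le_1 power_le_one simp: less_imp_le)
    have "pair_box (\<lambda>_. 1) s (\<lambda>_. 0) (\<lambda>_. 2 * pi) x = 1"
      unfolding pair_box_def
    proof (rule prod.neutral, rule ballI)
      fix r assume "r \<in> {..<s}"
      then have r: "r < s" by simp
      have "0 < d n * x (2*r+1)" using nz r d[OF n] by simp
      then have "0 \<le> x (2*r)" "x (2*r) < 2 * pi" using nz r ab[OF r] by fastforce+
      then show "indicator {0..<2 * pi} (x (2*r)) * (1 * indicator {0<..1} (x (2*r+1))) = (1::real)" using nz r by simp
    qed
    moreover have "V x * D n x \<le> 1 * fact (2 * s)"
      using D_bound[OF n False] V order_trans[OF mult_left_mono[of "D n x" "fact (2 * s)" "V x"] mult_right_mono[of "V x" 1 "fact (2 * s)"]] by simp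
    ultimately show ?thesis using False p01[of n x] C0 by (simp add: u_eq[OF n] w_def mult_left_mono)
  qed
  have lim: "(\<lambda>n. u n x) \<longlonglongrightarrow> l x" if ne: "\<And>i j. i < 2 * s \<Longrightarrow> j < 2 * s \<Longrightarrow> i \<noteq> j \<Longrightarrow> x i \<noteq> x j" for x
  proof (cases "\<forall>r<s. a r \<le> x (2*r) \<and> x (2*r) < b r \<and> 0 < x (2*r+1) \<and> x (2*r+1) \<le> 1")
    case True
    have d0: "d \<longlonglongrightarrow> 0"
    proof (rule Lim_null_comparison[OF _ nd])
      show "\<forall>\<^sub>F n in sequentially. norm (d n) \<le> real n * d n"
        using eventually_ge_at_top[of 1]
      proof eventually_elim
        case (elim n)
        then show ?case using d[OF elim] mult_right_mono[of 1 "real n" "d n"] by simp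
      qed
    qed
    have "\<forall>\<^sub>F n in sequentially. \<forall>r\<in>{..<s}. x (2*r) + d n * x (2*r+1) < b r"
    proof (rule eventually_ball_finite, simp, rule ballI)
      fix r assume "r \<in> {..<s}"
      have "(\<lambda>n. x (2*r) + d n * x (2*r+1)) \<longlonglongrightarrow> x (2*r) + 0 * x (2*r+1)"
        by (intro tendsto_intros d0)
      then show "\<forall>\<^sub>F n in sequentially. x (2*r) + d n * x (2*r+1) < b r"
        by (rule order_tendstoD(2)) (use True \<open>r \<in> {..<s}\<close> in simp)
    qed
    then have ev: "\<forall>\<^sub>F n in sequentially. C * (V x * D n x) = u n x"
      using eventually_ge_at_top[of 1]
    proof eventually_elim
      case (elim n)
      have "p n x = 1" unfolding p_eq[OF elim(2)] using elim(1) True by (intro prod.neutral) auto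
      then show ?case by (simp add: u_eq[OF elim(2)])
    qed
    have "(\<lambda>n. det (mat (2 * s) (2 * s) (\<lambda>(i,j). pair_gram n s (pair_shift (d n) x) i j))) \<longlonglongrightarrow> det (mat (2 * s) (2 * s) (\<lambda>(i,j). limit_gram i j))"
    proof (rule det_tendsto, rule pair_gram_tendsto)
      fix k assume "k < 2 * s" "even k"
      then obtain r where "k = 2 * r" "r < s" by (elim evenE) auto
      then show "0 \<le> x k \<and> x k < 2 * pi" using True ab[of r] by fastforce
    next
      fix k assume "k < 2 * s" "odd k"
      then obtain r where "k = 2 * r + 1" "r < s" by (elim oddE) auto
      then show "0 < x k \<and> x k \<le> 1" using True by simp
    qed (use ne d nd in auto)
    then have "(\<lambda>n. D n x) \<longlonglongrightarrow> Re ((1 / 12) ^ s)" unfolding D_def det_limit_gram by (rule tendsto_Re)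
    also have "Re ((1 / 12) ^ s) = (1 / 12) ^ s"
    proof -
      have "(1 / 12 :: complex) ^ s = of_real ((1 / 12) ^ s)" by simp
      then show ?thesis by (simp only: Re_complex_of_real)
    qed
    finally have D: "(\<lambda>n. D n x) \<longlonglongrightarrow> (1 / 12) ^ s" .
    have "pair_box (\<lambda>v. v\<^sup>2) s a b x = V x"
      unfolding pair_box_def V_def using True by (intro prod.cong refl) simp
    then have "C * (V x * (1 / 12) ^ s) = l x" by (simp add: l_def)
    moreover have "(\<lambda>n. C * (V x * D n x)) \<longlonglongrightarrow> C * (V x * (1 / 12) ^ s)" by (intro tendsto_mult tendsto_const D)
    ultimately show ?thesis using ev by (simp add: filterlim_cong[OF refl refl ev])
  next
    case False
    then obtain r where r: "r < s" "\<not> (a r \<le> x (2*r) \<and> x (2*r) < b r \<and> 0 < x (2*r+1) \<and> x (2*r+1) \<le> 1)" by blast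
    then have "pair_box (\<lambda>v. v\<^sup>2) s a b x = 0"
      unfolding pair_box_def by (intro prod_zero bexI[of _ r]) (auto simp: indicator_def)
    then have l0: "l x = 0" by (simp add: l_def)
    have pz: "p n x = 0" if n: "n \<ge> 1" for n
    proof (rule ccontr)
      assume "p n x \<noteq> 0"
      note nz = p_nz[OF n this]
      have "0 < d n * x (2*r+1)" using nz r(1) d[OF n] by simp
      moreover have "0 < x (2*r+1) \<and> x (2*r+1) \<le> 1 \<and> a r \<le> x (2*r) \<and> x (2*r) + d n * x (2*r+1) < b r" using nz r(1) by blast
      ultimately show False using r(2) by linarith
    qed
    have "\<forall>\<^sub>F n in sequentially. 0 = u n x"
      using eventually_ge_at_top[of 1] by eventually_elim (simp add: u_eq pz)
    then show ?thesis unfolding l0 by (rule Lim_transform_eventually[OF tendsto_const])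
  qed
  \<comment> \<open>Pointwise convergence requires different base points for different pairs, which
    holds almost everywhere.\<close>
  have AE: "AE x in P. \<forall>i\<in>{..<2 * s}. \<forall>j\<in>{..<2 * s}. i \<noteq> j \<longrightarrow> x i \<noteq> x j"
  proof (intro AE_finite_allI)
    fix i j :: nat assume ij: "i \<in> {..<2 * s}" "j \<in> {..<2 * s}"
    show "AE x in P. i \<noteq> j \<longrightarrow> x i \<noteq> x j"
    proof (cases "i = j")
      case False
      then have "AE x in P. x i \<noteq> x j" unfolding P_def using ij by (intro AE_PiM_lborel_distinct) auto
      then show ?thesis by (rule eventually_mono) simp
    qed simp
  qed simp_all
  have one: "(\<integral>\<^sup>+v. ennreal (1 * indicator {0<..1::real} v) \<partial>lborel) = ennreal 1"
  proof -
    have "(\<integral>\<^sup>+v. ennreal (1 * indicator {0<..1::real} v) \<partial>lborel) = (\<integral>\<^sup>+v. indicator {0<..1::real} v \<partial>lborel)"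
      by (rule nn_integral_cong) (simp add: indicator_def)
    then show ?thesis by simp
  qed
  have cm: "(\<integral>\<^sup>+x. ennreal (c * pair_box \<phi> s a' b' x) \<partial>P) = ennreal c * (\<integral>\<^sup>+x. ennreal (pair_box \<phi> s a' b' x) \<partial>P)"
    if "c \<ge> 0" "\<phi> \<in> borel_measurable borel" for c \<phi> a' b'
    using that pair_box_measurable[OF that(2), of s a' b'] unfolding P_def
    by (subst nn_integral_cmult[symmetric]) (auto simp: ennreal_mult')
  \<comment> \<open>The sequence is shifted by one because \<open>d\<close> is controlled only from
    n = 1 on.\<close>
  have "(\<lambda>n. \<integral>\<^sup>+x. ennreal (u (Suc n) x) \<partial>P) \<longlonglongrightarrow> (\<integral>\<^sup>+x. ennreal (l x) \<partial>P)"
  proof (rule nn_integral_dominated_convergence[where w = "\<lambda>x. ennreal (w x)"])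
    show "(\<lambda>x. ennreal (l x)) \<in> borel_measurable P" "(\<lambda>x. ennreal (w x)) \<in> borel_measurable P"
      unfolding l_def w_def P_def using pair_box_measurable[of "\<lambda>v. v\<^sup>2" s a b] pair_box_measurable[of "\<lambda>v. 1" s "\<lambda>_. 0" "\<lambda>_. 2 * pi"]
      by simp_all
    show "(\<integral>\<^sup>+x. ennreal (w x) \<partial>P) < \<infinity>"
      unfolding w_def using nn_integral_pair_box[OF _ _ one, of s "\<lambda>_. 0" "\<lambda>_. 2 * pi"] C0
      by (subst cm) (auto simp: P_def ennreal_mult[symmetric])
    show "AE x in P. (\<lambda>n. ennreal (u (Suc n) x)) \<longlonglongrightarrow> ennreal (l x)"
      using AE
    proof (rule eventually_mono)
      fix x :: "nat \<Rightarrow> real" assume "\<forall>i\<in>{..<2 * s}. \<forall>j\<in>{..<2 * s}. i \<noteq> j \<longrightarrow> x i \<noteq> x j"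
      then have "(\<lambda>n. u n x) \<longlonglongrightarrow> l x" by (intro lim) auto
      then show "(\<lambda>n. ennreal (u (Suc n) x)) \<longlonglongrightarrow> ennreal (l x)" by (intro tendsto_ennrealI LIMSEQ_Suc)
    qed
  qed (use um bound in \<open>auto intro!: AE_I2 ennreal_leI\<close>)
  then have "(\<lambda>n. \<integral>\<^sup>+x. ennreal (u n x) \<partial>P) \<longlonglongrightarrow> (\<integral>\<^sup>+x. ennreal (l x) \<partial>P)" by (rule LIMSEQ_imp_Suc)
  moreover have "\<forall>\<^sub>F n in sequentially. (\<integral>\<^sup>+x. ennreal (u n x) \<partial>P) = (\<integral>\<^sup>+t. ennreal (tuple_sum n (2 * s) (pairs_fn s (d n) a b) t) \<partial>weyl n)"
    using eventually_ge_at_top[of 1] eventually_ge_at_top[of "2 * s"]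
  proof eventually_elim
    case (elim n)
    show ?case unfolding u_def \<Phi>_def P_def
      by (rule weyl_pairs_integral[symmetric]) (use elim d ab in auto)
  qed
  ultimately have "(\<lambda>n. \<integral>\<^sup>+t. ennreal (tuple_sum n (2 * s) (pairs_fn s (d n) a b) t) \<partial>weyl n) \<longlonglongrightarrow> (\<integral>\<^sup>+x. ennreal (l x) \<partial>P)"
    by (rule Lim_transform_eventually)
  also have "(\<integral>\<^sup>+x. ennreal (l x) \<partial>P) = ennreal (C * (1 / 12) ^ s) * ennreal (\<Prod>r<s. (b r - a r) * (1 / 3))"
  proof -
    have "(\<integral>\<^sup>+x. ennreal (pair_box (\<lambda>v. v\<^sup>2) s a b x) \<partial>P) = ennreal (\<Prod>r<s. (b r - a r) * (1 / 3))"
      unfolding P_def by (rule nn_integral_pair_box[OF _ _ nn_integral_sq_unit]) (use ab in auto)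
    then show ?thesis unfolding l_def using C0 by (subst cm) auto
  qed
  also have "\<dots> = ennreal (C * (1 / 12) ^ s * (\<Prod>r<s. (b r - a r) * (1 / 3)))"
    using C0 ab by (intro ennreal_mult[symmetric] prod_nonneg) auto
  also have "C * (1 / 12) ^ s * (\<Prod>r<s. (b r - a r) * (1 / 3)) = (\<Prod>r<s. K * (b r - a r) / (144 * pi\<^sup>2))"
  proof -
    have "C * (1 / 12) ^ s = (\<Prod>r<s. K / (2 * pi)\<^sup>2 * (1 / 12))"
      by (simp only: C_def power_mult_distrib[symmetric] prod_constant card_lessThan)
    then have "C * (1 / 12) ^ s * (\<Prod>r<s. (b r - a r) * (1 / 3)) = (\<Prod>r<s. K / (2 * pi)\<^sup>2 * (1 / 12) * ((b r - a r) * (1 / 3)))"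
      by (simp only: prod.distrib)
    then show ?thesis by (simp add: power_mult_distrib mult_ac)
  qed
  finally show ?thesis .
qed

section \<open>Close triples are negligible\<close>

text \<open>The extra point, coordinate 2 s, accompanies the last pair, whose first point is
  coordinate 2 s - 2. The distance 2 d allows for a point within d of the second point of that
  pair.\<close>

definition triple_fn :: "nat \<Rightarrow> real \<Rightarrow> (nat \<Rightarrow> real) \<Rightarrow> (nat \<Rightarrow> real) \<Rightarrow> (nat \<Rightarrow> real) \<Rightarrow> real" where
  "triple_fn s d a b t = pairs_fn s d a b t
     * (if \<bar>t (2 * s) - t (2 * s - 2)\<bar> \<le> 2 * d \<and> a (s - 1) \<le> t (2 * s) \<and> t (2 * s) < b (s - 1) then 1 else 0)"

lemma triple_fn_01: "triple_fn s d a b t = 0 \<or> triple_fn s d a b t = 1"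
  using pairs_fn_01[of s d a b t] by (auto simp: triple_fn_def)

lemma triple_fn_nonneg: "triple_fn s d a b t \<ge> 0" using triple_fn_01[of s d a b t] by auto

lemma triple_fn_measurable: "triple_fn s d a b \<in> borel_measurable (torus_unif (2 * s + 1))"
proof -
  have [measurable]: "pairs_fn s d a b \<in> borel_measurable (torus_unif (2 * s + 1))" by (rule pairs_fn_measurable) simp
  have [measurable]: "(\<lambda>t. t (2 * s)) \<in> borel_measurable (torus_unif (2 * s + 1))"
    "(\<lambda>t. t (2 * s - 2)) \<in> borel_measurable (torus_unif (2 * s + 1))" by (auto intro!: torus_component_measurable)
  show ?thesis unfolding triple_fn_def[abs_def] by measurable
qed

lemma emeasure_circle_unif_le: "A \<in> sets borel \<Longrightarrow> emeasure circle_unif A \<le> emeasure lborel A"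
proof -
  assume A: "A \<in> sets borel"
  have 1: "ennreal (indicator {0..<2*pi} x / (2*pi)) \<le> 1" for x :: real
    using pi_gt3 by (auto simp: indicator_def)
  have "emeasure circle_unif A = (\<integral>\<^sup>+x. ennreal (indicator {0..<2*pi} x / (2*pi)) * indicator A x \<partial>lborel)"
    unfolding circle_unif_def using A by (intro emeasure_density) auto
  also have "\<dots> \<le> (\<integral>\<^sup>+x. 1 * indicator A x \<partial>lborel)" by (intro nn_integral_mono mult_right_mono 1) simp
  finally show ?thesis using A by simp
qed

lemma close_indicator_measurable:
  fixes f g :: "'a \<Rightarrow> real"
  assumes [measurable]: "f \<in> borel_measurable M" "g \<in> borel_measurable M"
  shows "(\<lambda>x. indicator {f x - e..f x + e} (g x) :: ennreal) \<in> borel_measurable M"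
proof -
  have "(\<lambda>x. if f x - e \<le> g x \<and> g x \<le> f x + e then 1 else 0 :: ennreal) \<in> borel_measurable M" by measurable
  then show ?thesis by (simp add: indicator_def)
qed

text \<open>For fixed coordinates in I those in J are independent, and each is confined to a window
  of length 2 e, of probability at most 2 e.\<close>

lemma nn_integral_torus_close:
  fixes \<beta> :: "nat \<Rightarrow> nat"
  assumes IJ: "I \<inter> J = {}" "finite I" "finite J" and \<beta>: "\<And>j. j \<in> J \<Longrightarrow> \<beta> j \<in> I" and e: "e \<ge> 0"
  shows "(\<integral>\<^sup>+t. (\<Prod>j\<in>J. indicator {t (\<beta> j) - e..t (\<beta> j) + e} (t j)) \<partial>PiM (I \<union> J) (\<lambda>_. circle_unif)) \<le> ennreal ((2 * e) ^ card J)"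
proof -
  interpret P: prob_space "PiM I (\<lambda>_. circle_unif)" by (intro prob_space_PiM prob_space_circle_unif)
  define f where "f t = (\<Prod>j\<in>J. indicator {t (\<beta> j) - e..t (\<beta> j) + e} (t j) :: ennreal)" for t :: "nat \<Rightarrow> real"
  have c: "(\<lambda>t. t k) \<in> borel_measurable (PiM (I \<union> J) (\<lambda>_. circle_unif))" if "k \<in> I \<union> J" for k
    using measurable_component_singleton[OF that, of "\<lambda>_. circle_unif"] by (simp cong: measurable_cong_sets add: measurable_cong_sets[OF refl sets_circle_unif])
  have f: "f \<in> borel_measurable (PiM (I \<union> J) (\<lambda>_. circle_unif))"
    unfolding f_def[abs_def]
  proof (rule borel_measurable_prod_ennreal)
    fix j assume j: "j \<in> J"
    show "(\<lambda>t. indicator {t (\<beta> j) - e..t (\<beta> j) + e} (t j) :: ennreal) \<in> borel_measurable (PiM (I \<union> J) (\<lambda>_. circle_unif))"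
      by (intro close_indicator_measurable c) (use j \<beta>[OF j] in auto)
  qed
  have "(\<integral>\<^sup>+t. f t \<partial>PiM (I \<union> J) (\<lambda>_. circle_unif)) = (\<integral>\<^sup>+x. (\<integral>\<^sup>+y. f (merge I J (x, y)) \<partial>PiM J (\<lambda>_. circle_unif)) \<partial>PiM I (\<lambda>_. circle_unif))"
    by (rule torus.product_nn_integral_fold[OF IJ f])
  also have "\<dots> \<le> (\<integral>\<^sup>+x. ennreal ((2 * e) ^ card J) \<partial>PiM I (\<lambda>_. circle_unif))"
  proof (rule nn_integral_mono)
    fix x :: "nat \<Rightarrow> real"
    have "(\<integral>\<^sup>+y. f (merge I J (x, y)) \<partial>PiM J (\<lambda>_. circle_unif))
       = (\<integral>\<^sup>+y. (\<Prod>j\<in>J. indicator {x (\<beta> j) - e..x (\<beta> j) + e} (y j)) \<partial>PiM J (\<lambda>_. circle_unif))"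
    proof (rule nn_integral_cong)
      fix y :: "nat \<Rightarrow> real"
      have "merge I J (x, y) j = y j" "merge I J (x, y) (\<beta> j) = x (\<beta> j)" if "j \<in> J" for j
        using that \<beta>[OF that] IJ(1) by (auto simp: merge_def)
      then show "f (merge I J (x, y)) = (\<Prod>j\<in>J. indicator {x (\<beta> j) - e..x (\<beta> j) + e} (y j))"
        unfolding f_def by (intro prod.cong refl) simp
    qed
    also have "\<dots> = (\<Prod>j\<in>J. \<integral>\<^sup>+y. indicator {x (\<beta> j) - e..x (\<beta> j) + e} y \<partial>circle_unif)"
      by (rule torus.product_nn_integral_prod[OF IJ(3)], rule borel_measurable_indicator) simp
    also have "\<dots> \<le> (\<Prod>j\<in>J. ennreal (2 * e))"
    proof -
      have le: "(\<integral>\<^sup>+y. indicator {x (\<beta> j) - e..x (\<beta> j) + e} y \<partial>circle_unif) \<le> ennreal (2 * e)" for j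
      proof -
        have "(\<integral>\<^sup>+y. indicator {x (\<beta> j) - e..x (\<beta> j) + e} y \<partial>circle_unif) = emeasure circle_unif {x (\<beta> j) - e..x (\<beta> j) + e}" by simp
        also have "\<dots> \<le> emeasure lborel {x (\<beta> j) - e..x (\<beta> j) + e}" by (rule emeasure_circle_unif_le) simp
        also have "\<dots> = ennreal (2 * e)" using e by simp
        finally show ?thesis .
      qed
      show ?thesis by (intro prod_mono_ennreal le)
    qed
    also have "\<dots> = ennreal ((2 * e) ^ card J)" using e by (simp add: ennreal_power)
    finally show "(\<integral>\<^sup>+y. f (merge I J (x, y)) \<partial>PiM J (\<lambda>_. circle_unif)) \<le> ennreal ((2 * e) ^ card J)" .
  qed
  also have "\<dots> = ennreal ((2 * e) ^ card J)" by (simp add: P.emeasure_space_1)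
  finally show ?thesis by (simp add: f_def)
qed

text \<open>The determinant is at most (2 s + 1)! times n^4 d^2 for each pair and n for the extra
  point. The s second points and the extra point each lie in a window of length 4 d around a first
  point.\<close>

lemma weyl_triple_bound:
  assumes s: "s \<ge> 1" and n: "2 * s + 1 \<le> n" and d: "d > 0"
  shows "(\<integral>\<^sup>+t. ennreal (tuple_sum n (2 * s + 1) (triple_fn s d a b) t) \<partial>weyl n)
     \<le> ennreal (fact (2 * s + 1) * (real n * (real n ^ 4 * d\<^sup>2) ^ s) * (2 * (2 * d)) ^ (s + 1))"
proof -
  define I where "I = {i. i < 2 * s \<and> even i}"
  define J where "J = insert (2 * s) {j. j < 2 * s \<and> odd j}"
  \<comment> \<open>The first point of the pair to which j belongs: j - 1 for odd j, and 2 s - 2 for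
    the extra point j = 2 s.\<close>
  define \<beta> where "\<beta> j = 2 * ((j - 1) div 2)" for j :: nat
  define C where "C = fact (2 * s + 1) * (real n * (real n ^ 4 * d\<^sup>2) ^ s)"
  define f where "f t = (\<Prod>j\<in>J. indicator {t (\<beta> j) - 2 * d..t (\<beta> j) + 2 * d} (t j) :: ennreal)" for t :: "nat \<Rightarrow> real"
  have C0: "C \<ge> 0" by (simp add: C_def)
  have IJ: "I \<inter> J = {}" "finite I" "finite J" by (auto simp: I_def J_def)
  have IJu: "I \<union> J = {..<2 * s + 1}" by (auto simp: I_def J_def)
  have odds: "{j. j < 2 * s \<and> odd j} = (\<lambda>r. 2 * r + 1) ` {..<s}" by (auto elim!: oddE)
  have "card {j. j < 2 * s \<and> odd j} = s" unfolding odds by (simp add: card_image inj_on_def)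
  then have cJ: "card J = s + 1" unfolding J_def by (subst card_insert_disjoint) simp_all
  have \<beta>I: "\<beta> j \<in> I" if "j \<in> J" for j
    using that s unfolding odds J_def I_def \<beta>_def by auto
  have "(\<integral>\<^sup>+t. ennreal (tuple_sum n (2 * s + 1) (triple_fn s d a b) t) \<partial>weyl n)
     = (\<integral>\<^sup>+t. ennreal (triple_fn s d a b t) * ennreal (Re (kernel_det n (2 * s + 1) t)) \<partial>torus_unif (2 * s + 1))"
    by (intro weyl_tuple_sum triple_fn_measurable triple_fn_nonneg n)
  also have "\<dots> \<le> (\<integral>\<^sup>+t. ennreal C * f t \<partial>torus_unif (2 * s + 1))"
  proof (rule nn_integral_mono)
    fix t :: "nat \<Rightarrow> real"
    show "ennreal (triple_fn s d a b t) * ennreal (Re (kernel_det n (2 * s + 1) t)) \<le> ennreal C * f t"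
    proof (cases "triple_fn s d a b t = 0")
      case False
      then have t1: "triple_fn s d a b t = 1" using triple_fn_01 by blast
      have w: "\<bar>t (2 * s) - t (2 * s - 2)\<bar> \<le> 2 * d" using False by (auto simp: triple_fn_def split: if_splits)
      have p: "t (2 * r) < t (2 * r + 1) \<and> t (2 * r + 1) \<le> t (2 * r) + d" if "r < s" for r
      proof -
        have "pairs_fn s d a b t \<noteq> 0" using False by (auto simp: triple_fn_def)
        then have "pair_close d (a r) (b r) (t (2 * r)) (t (2 * r + 1)) \<noteq> 0" using that unfolding pairs_fn_nonzero by blast
        then show ?thesis by (auto simp: pair_close_def split: if_splits)
      qed
      have ne: "t i \<noteq> t (i - 1)" if "pair_odd s i" for i
      proof -
        have "odd i" "i < 2 * s" using that by (auto simp: pair_odd_def)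
        then obtain r where r: "i = 2 * r + 1" "r < s" by (elim oddE) auto
        then show ?thesis using p[of r] by simp
      qed
      have "Re (kernel_det n (2 * s + 1) t) \<le> fact (2 * s + 1) * (\<Prod>i<2 * s + 1. (pair_scale n s t i)\<^sup>2)"
        using n by (intro kernel_det_pair_bound ne) auto
      also have "(\<Prod>i<2 * s + 1. (pair_scale n s t i)\<^sup>2) = real n * (\<Prod>r<s. real n ^ 4 * (t (2*r+1) - t (2*r))\<^sup>2)"
        using prod_pair_scale_Suc[of n s t] by simp
      also have "fact (2 * s + 1) * \<dots> \<le> fact (2 * s + 1) * (real n * (\<Prod>r<s. real n ^ 4 * d\<^sup>2))"
      proof (intro mult_left_mono prod_mono conjI)
        fix r assume "r \<in> {..<s}"
        then show "(t (2*r+1) - t (2*r))\<^sup>2 \<le> d\<^sup>2" using p[of r] by (intro power_mono) auto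
      qed auto
      also have "\<dots> = C" by (simp add: C_def)
      finally have "ennreal (Re (kernel_det n (2 * s + 1) t)) \<le> ennreal C" by (rule ennreal_leI)
      moreover have "f t = 1" unfolding f_def
      proof (rule prod.neutral, rule ballI)
        fix j assume "j \<in> J"
        then consider "j = 2 * s" | r where "r < s" "j = 2 * r + 1" unfolding J_def odds by auto
        then show "indicator {t (\<beta> j) - 2 * d..t (\<beta> j) + 2 * d} (t j) = (1 :: ennreal)"
        proof cases
          case 1
          have "(2 * s - 1) div 2 = s - 1" using s by linarith
          then have "\<beta> j = 2 * s - 2" by (simp add: \<beta>_def 1 right_diff_distrib')
          then show ?thesis using w 1 by (auto simp: indicator_def abs_le_iff)
        next
          case 2
          then show ?thesis using p[of r] d by (auto simp: indicator_def \<beta>_def)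
        qed
      qed
      ultimately show ?thesis by (simp add: t1)
    qed simp
  qed
  also have "\<dots> \<le> ennreal C * ennreal ((2 * (2 * d)) ^ (s + 1))"
  proof -
    have fm: "f \<in> borel_measurable (torus_unif (2 * s + 1))"
      unfolding f_def[abs_def]
    proof (rule borel_measurable_prod_ennreal)
      fix j assume j: "j \<in> J"
      have "j < 2 * s + 1" "\<beta> j < 2 * s + 1" using j \<beta>I[OF j] IJu by blast+
      then show "(\<lambda>t. indicator {t (\<beta> j) - 2 * d..t (\<beta> j) + 2 * d} (t j) :: ennreal) \<in> borel_measurable (torus_unif (2 * s + 1))"
        by (intro close_indicator_measurable torus_component_measurable)
    qed
    have "(\<integral>\<^sup>+t. f t \<partial>torus_unif (2 * s + 1)) \<le> ennreal ((2 * (2 * d)) ^ card J)"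
      unfolding f_def torus_unif_def IJu[symmetric] using IJ \<beta>I d by (intro nn_integral_torus_close) auto
    then show ?thesis unfolding nn_integral_cmult[OF fm] cJ by (rule mult_left_mono) simp
  qed
  also have "\<dots> = ennreal (C * (2 * (2 * d)) ^ (s + 1))" using C0 d by (intro ennreal_mult[symmetric]) auto
  finally show ?thesis by (simp only: C_def)
qed

text \<open>Since n^4 d^3 is the constant K, the bound is a constant times n d: the extra point
  gains a factor n and pays a factor of order d.\<close>

lemma weyl_triple_tendsto:
  fixes d :: "nat \<Rightarrow> real"
  assumes d: "\<And>n. n \<ge> 1 \<Longrightarrow> d n > 0" and K: "\<And>n. n \<ge> 1 \<Longrightarrow> real n ^ 4 * d n ^ 3 = K" and nd: "(\<lambda>n. real n * d n) \<longlonglongrightarrow> 0" and s: "s \<ge> 1"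
  shows "(\<lambda>n. \<integral>\<^sup>+t. ennreal (tuple_sum n (2 * s + 1) (triple_fn s (d n) a b) t) \<partial>weyl n) \<longlonglongrightarrow> 0"
proof -
  define c where "c = fact (2 * s + 1) * 4 ^ (s + 1) * K ^ s"
  have "(\<lambda>n. ennreal (c * (real n * d n))) \<longlonglongrightarrow> ennreal (c * 0)" by (intro tendsto_ennrealI tendsto_mult tendsto_const nd)
  then have lim: "(\<lambda>n. ennreal (c * (real n * d n))) \<longlonglongrightarrow> 0" by simp
  show ?thesis
  proof (rule tendsto_sandwich[OF _ _ tendsto_const lim])
    show "\<forall>\<^sub>F n in sequentially. (\<integral>\<^sup>+t. ennreal (tuple_sum n (2 * s + 1) (triple_fn s (d n) a b) t) \<partial>weyl n) \<le> ennreal (c * (real n * d n))"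
      using eventually_ge_at_top[of "2 * s + 1"]
    proof eventually_elim
      case (elim n)
      then have n1: "n \<ge> 1" by simp
      have "(real n ^ 4 * (d n)\<^sup>2) ^ s * d n ^ s = K ^ s"
        unfolding power_mult_distrib[symmetric] K[OF n1, symmetric] by (simp add: power2_eq_square power3_eq_cube mult_ac)
      then have "c * (real n * d n) = fact (2 * s + 1) * 4 ^ (s + 1) * ((real n ^ 4 * (d n)\<^sup>2) ^ s * d n ^ s) * (real n * d n)"
        by (simp only: c_def)
      also have "\<dots> = fact (2 * s + 1) * (real n * (real n ^ 4 * (d n)\<^sup>2) ^ s) * (4 * d n) ^ (s + 1)"
        by (simp only: power_mult_distrib power_add power_one_right mult_ac)
      also have "4 * d n = 2 * (2 * d n)" by simp
      finally show ?case using weyl_triple_bound[OF s elim d[OF n1], of a b] by (simp only:)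
    qed
  qed simp
qed

section \<open>The number of close pairs in blocks of the circle\<close>

text \<open>Injective tuples as lists, so that products of tuple sums become sums over
  concatenations.\<close>

definition distinct_lists :: "nat \<Rightarrow> nat \<Rightarrow> nat list set" where
  "distinct_lists m n = {xs. length xs = m \<and> distinct xs \<and> set xs \<subseteq> {..<n}}"

lemma finite_distinct_lists [simp]: "finite (distinct_lists m n)"
  by (rule finite_subset[OF _ finite_lists_length_eq[of "{..<n}" m]]) (auto simp: distinct_lists_def)

lemma tuple_sum_lists: "tuple_sum n m h t = (\<Sum>xs\<in>distinct_lists m n. h (\<lambda>i\<in>{..<m}. t (xs ! i)))"
  unfolding tuple_sum_def
proof (rule sum.reindex_bij_witness[where i = "\<lambda>xs. \<lambda>i\<in>{..<m}. xs ! i" and j = "\<lambda>f. map f [0..<m]"])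
  fix f assume f: "f \<in> inj_tuples m n"
  show "(\<lambda>i\<in>{..<m}. map f [0..<m] ! i) = f"
    using f by (auto simp: inj_tuples_def PiE_def extensional_def restrict_def)
  show "map f [0..<m] \<in> distinct_lists m n"
    using f by (auto simp: inj_tuples_def distinct_lists_def distinct_map atLeast0LessThan)
  have "(\<lambda>i\<in>{..<m}. t (map f [0..<m] ! i)) = (\<lambda>i\<in>{..<m}. t (f i))" by auto
  then show "h (\<lambda>i\<in>{..<m}. t (map f [0..<m] ! i)) = h (\<lambda>i\<in>{..<m}. t (f i))" by simp
next
  fix xs assume xs: "xs \<in> distinct_lists m n"
  show "map (\<lambda>i\<in>{..<m}. xs ! i) [0..<m] = xs"
    using xs by (intro nth_equalityI) (auto simp: distinct_lists_def)
  have "inj_on (\<lambda>i\<in>{..<m}. xs ! i) {..<m}"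
    using xs by (auto simp: inj_on_def distinct_lists_def nth_eq_iff_index_eq)
  moreover have "xs ! i < n" if "i < m" for i
  proof -
    have "xs ! i \<in> set xs" "set xs \<subseteq> {..<n}" using xs that by (auto simp: distinct_lists_def)
    then show ?thesis by blast
  qed
  ultimately show "(\<lambda>i\<in>{..<m}. xs ! i) \<in> inj_tuples m n" by (auto simp: inj_tuples_def)
qed

text \<open>A product of two sums runs over pairs of tuples. If tuples with nonzero terms never
  share an index, these pairs are the splittings of longer injective tuples.\<close>

lemma tuple_sum_mult:
  assumes sep: "\<And>xs ys. xs \<in> distinct_lists m n \<Longrightarrow> ys \<in> distinct_lists k n \<Longrightarrow> h (\<lambda>i\<in>{..<m}. t (xs ! i)) \<noteq> 0
      \<Longrightarrow> g (\<lambda>i\<in>{..<k}. t (ys ! i)) \<noteq> 0 \<Longrightarrow> set xs \<inter> set ys = {}"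
    and split: "\<And>u. p (\<lambda>i\<in>{..<m+k}. u i) = h (\<lambda>i\<in>{..<m}. u i) * g (\<lambda>i\<in>{..<k}. u (m + i))"
  shows "tuple_sum n m h t * tuple_sum n k g t = tuple_sum n (m + k) p t"
proof -
  define H where "H z = h (\<lambda>i\<in>{..<m}. t (fst z ! i)) * g (\<lambda>i\<in>{..<k}. t (snd z ! i))" for z :: "nat list \<times> nat list"
  define A where "A = distinct_lists m n \<times> distinct_lists k n"
  have "tuple_sum n m h t * tuple_sum n k g t = (\<Sum>z\<in>A. H z)"
    by (simp add: tuple_sum_lists sum_product sum.cartesian_product A_def H_def split_def)
  also have "\<dots> = (\<Sum>z | z \<in> A \<and> set (fst z) \<inter> set (snd z) = {}. H z)"
  proof (rule sum.mono_neutral_right)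
    show "finite A" by (simp add: A_def)
    show "\<forall>z\<in>A - {z \<in> A. set (fst z) \<inter> set (snd z) = {}}. H z = 0"
    proof (rule ballI, rule ccontr)
      fix z assume z: "z \<in> A - {z \<in> A. set (fst z) \<inter> set (snd z) = {}}" and "H z \<noteq> 0"
      then have "h (\<lambda>i\<in>{..<m}. t (fst z ! i)) \<noteq> 0" "g (\<lambda>i\<in>{..<k}. t (snd z ! i)) \<noteq> 0" by (auto simp: H_def)
      from sep[OF _ _ this] z show False by (auto simp: A_def)
    qed
  qed auto
  also have "\<dots> = tuple_sum n (m + k) p t"
    unfolding tuple_sum_lists
  proof (rule sum.reindex_bij_witness[where i = "\<lambda>zs. (take m zs, drop m zs)" and j = "\<lambda>z. fst z @ snd z"])
    fix z assume z: "z \<in> {z \<in> A. set (fst z) \<inter> set (snd z) = {}}"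
    then have len: "length (fst z) = m" "length (snd z) = k" by (auto simp: A_def distinct_lists_def)
    then show "(take m (fst z @ snd z), drop m (fst z @ snd z)) = z" by simp
    show "fst z @ snd z \<in> distinct_lists (m + k) n" using z by (auto simp: A_def distinct_lists_def)
    have 1: "(\<lambda>i\<in>{..<m}. t ((fst z @ snd z) ! i)) = (\<lambda>i\<in>{..<m}. t (fst z ! i))"
      using len by (auto simp: nth_append fun_eq_iff)
    have 2: "(\<lambda>i\<in>{..<k}. t ((fst z @ snd z) ! (m + i))) = (\<lambda>i\<in>{..<k}. t (snd z ! i))"
      using len by (auto simp: nth_append fun_eq_iff)
    show "p (\<lambda>i\<in>{..<m + k}. t ((fst z @ snd z) ! i)) = H z" unfolding split 1 2 H_def by (rule refl)
  next
    fix zs assume zs: "zs \<in> distinct_lists (m + k) n"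
    then have d: "distinct (take m zs @ drop m zs)" by (simp add: distinct_lists_def)
    show "fst (take m zs, drop m zs) @ snd (take m zs, drop m zs) = zs" by simp
    have "set (take m zs) \<subseteq> {..<n}" "set (drop m zs) \<subseteq> {..<n}"
      using zs set_take_subset[of m zs] set_drop_subset[of m zs] unfolding distinct_lists_def by blast+
    then show "(take m zs, drop m zs) \<in> {z \<in> A. set (fst z) \<inter> set (snd z) = {}}"
      using zs d unfolding distinct_append by (auto simp: A_def distinct_lists_def)
  qed
  finally show ?thesis .
qed

lemma pairs_fn_add:
  "pairs_fn (s + s') d a b u = pairs_fn s d a b u * pairs_fn s' d (\<lambda>r. a (s + r)) (\<lambda>r. b (s + r)) (\<lambda>i. u (2 * s + i))"
proof (induction s')
  case (Suc s')
  have "pairs_fn (s + Suc s') d a b u = pairs_fn (s + s') d a b u * pair_close d (a (s + s')) (b (s + s')) (u (2 * (s + s'))) (u (2 * (s + s') + 1))"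
    by (simp add: pairs_fn_def)
  then show ?case unfolding Suc by (simp add: pairs_fn_def mult_ac add_mult_distrib2)
qed (simp add: pairs_fn_def)

lemma pairs_fn_support:
  assumes "pairs_fn s d a b u \<noteq> 0" "i < 2 * s"
  shows "a (i div 2) \<le> u i \<and> u i < b (i div 2)"
proof -
  have "i div 2 < s" using assms(2) by auto
  then have "pair_close d (a (i div 2)) (b (i div 2)) (u (2 * (i div 2))) (u (2 * (i div 2) + 1)) \<noteq> 0"
    using assms(1) unfolding pairs_fn_nonzero by blast
  moreover have "i = 2 * (i div 2) \<or> i = 2 * (i div 2) + 1" by linarith
  ultimately show ?thesis by (auto simp: pair_close_def split: if_splits)
qed

text \<open>\<open>c r\<close> is the block of the r-th pair. A block may occur twice: two disjoint
  pairs in one block enter the bound for a squared count.\<close>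

definition block_pairs :: "nat \<Rightarrow> nat \<Rightarrow> real \<Rightarrow> nat \<Rightarrow> (nat \<Rightarrow> nat) \<Rightarrow> (nat \<Rightarrow> real) \<Rightarrow> real" where
  "block_pairs B n d s c = tuple_sum n (2 * s) (pairs_fn s d (\<lambda>r. 2 * pi * c r / B) (\<lambda>r. 2 * pi * Suc (c r) / B))"

definition block_triples :: "nat \<Rightarrow> nat \<Rightarrow> real \<Rightarrow> nat \<Rightarrow> (nat \<Rightarrow> nat) \<Rightarrow> (nat \<Rightarrow> real) \<Rightarrow> real" where
  "block_triples B n d s c = tuple_sum n (2 * s + 1) (triple_fn s d (\<lambda>r. 2 * pi * c r / B) (\<lambda>r. 2 * pi * Suc (c r) / B))"

lemma block_disjoint:
  fixes B :: nat
  assumes B: "B \<ge> 1" and "2 * pi * real i / B \<le> x" "x < 2 * pi * real (Suc i) / B" "2 * pi * real j / B \<le> x" "x < 2 * pi * real (Suc j) / B"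
  shows "i = j"
proof -
  define y where "y = x * B / (2 * pi)"
  have "real i \<le> y" "y < real (Suc i)" "real j \<le> y" "y < real (Suc j)"
    unfolding y_def using assms by (simp_all add: field_simps)
  then show ?thesis by linarith
qed

text \<open>The half-open blocks are disjoint, so tuples supported in different blocks have no index
  in common.\<close>

lemma block_pairs_append:
  assumes B: "B \<ge> 1" and c: "\<And>r r'. r < s \<Longrightarrow> r' < s' \<Longrightarrow> c r \<noteq> c (s + r')"
  shows "block_pairs B n d (s + s') c t = block_pairs B n d s c t * block_pairs B n d s' (\<lambda>r. c (s + r)) t"
  unfolding block_pairs_def distrib_left
proof (rule tuple_sum_mult[symmetric])
  fix xs ys
  assume xs: "xs \<in> distinct_lists (2 * s) n" and ys: "ys \<in> distinct_lists (2 * s') n"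
    and x: "pairs_fn s d (\<lambda>r. 2 * pi * c r / B) (\<lambda>r. 2 * pi * Suc (c r) / B) (\<lambda>i\<in>{..<2 * s}. t (xs ! i)) \<noteq> 0"
    and y: "pairs_fn s' d (\<lambda>r. 2 * pi * c (s + r) / B) (\<lambda>r. 2 * pi * Suc (c (s + r)) / B) (\<lambda>i\<in>{..<2 * s'}. t (ys ! i)) \<noteq> 0"
  show "set xs \<inter> set ys = {}"
  proof (rule ccontr)
    assume "set xs \<inter> set ys \<noteq> {}"
    then obtain i j where ij: "i < 2 * s" "j < 2 * s'" "xs ! i = ys ! j"
      using xs ys by (fastforce simp: distinct_lists_def in_set_conv_nth)
    have "c (i div 2) = c (s + j div 2)"
      by (rule block_disjoint[OF B, where x = "t (xs ! i)"]) (use pairs_fn_support[OF x ij(1)] pairs_fn_support[OF y ij(2)] ij in auto)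
    then show False using c[of "i div 2" "j div 2"] ij by auto
  qed
next
  fix u :: "nat \<Rightarrow> real"
  show "pairs_fn (s + s') d (\<lambda>r. 2 * pi * c r / B) (\<lambda>r. 2 * pi * Suc (c r) / B) (\<lambda>i\<in>{..<2 * s + 2 * s'}. u i)
    = pairs_fn s d (\<lambda>r. 2 * pi * c r / B) (\<lambda>r. 2 * pi * Suc (c r) / B) (\<lambda>i\<in>{..<2 * s}. u i)
      * pairs_fn s' d (\<lambda>r. 2 * pi * c (s + r) / B) (\<lambda>r. 2 * pi * Suc (c (s + r)) / B) (\<lambda>i\<in>{..<2 * s'}. u (2 * s + i))"
    unfolding pairs_fn_add by (intro arg_cong2[where f = times] pairs_fn_cong) auto
qed

lemma triple_fn_shift:
  "triple_fn (Suc s) d a b (\<lambda>i\<in>{..<2 * s + 3}. u i)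
    = pairs_fn s d a b (\<lambda>i\<in>{..<2 * s}. u i) * triple_fn 1 d (\<lambda>r. a (s + r)) (\<lambda>r. b (s + r)) (\<lambda>i\<in>{..<3}. u (2 * s + i))"
proof -
  have "pairs_fn (Suc s) d a b (\<lambda>i\<in>{..<2 * s + 3}. u i) = pairs_fn (s + 1) d a b u"
    by (simp, rule pairs_fn_cong) auto
  also have "\<dots> = pairs_fn s d a b (\<lambda>i\<in>{..<2 * s}. u i) * pairs_fn 1 d (\<lambda>r. a (s + r)) (\<lambda>r. b (s + r)) (\<lambda>i\<in>{..<3}. u (2 * s + i))"
    unfolding pairs_fn_add by (intro arg_cong2[where f = times] pairs_fn_cong) auto
  finally show ?thesis by (simp add: triple_fn_def)
qed

lemma block_triples_append:
  assumes B: "B \<ge> 1" and c: "\<And>r. r < s \<Longrightarrow> c r \<noteq> c s"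
  shows "block_triples B n d (Suc s) c t = block_pairs B n d s c t * block_triples B n d 1 (\<lambda>r. c (s + r)) t"
proof -
  have e: "2 * Suc s + 1 = 2 * s + 3" "2 * 1 + 1 = (3::nat)" by simp_all
  show ?thesis
    unfolding block_pairs_def block_triples_def e
  proof (rule tuple_sum_mult[symmetric])
    fix xs ys
    assume xs: "xs \<in> distinct_lists (2 * s) n" and ys: "ys \<in> distinct_lists 3 n"
      and x: "pairs_fn s d (\<lambda>r. 2 * pi * c r / B) (\<lambda>r. 2 * pi * Suc (c r) / B) (\<lambda>i\<in>{..<2 * s}. t (xs ! i)) \<noteq> 0"
      and y: "triple_fn 1 d (\<lambda>r. 2 * pi * c (s + r) / B) (\<lambda>r. 2 * pi * Suc (c (s + r)) / B) (\<lambda>i\<in>{..<3}. t (ys ! i)) \<noteq> 0"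
    show "set xs \<inter> set ys = {}"
    proof (rule ccontr)
      assume "set xs \<inter> set ys \<noteq> {}"
      then obtain i j where ij: "i < 2 * s" "j < 3" "xs ! i = ys ! j"
        using xs ys by (fastforce simp: distinct_lists_def in_set_conv_nth)
      have y1: "pairs_fn 1 d (\<lambda>r. 2 * pi * c (s + r) / B) (\<lambda>r. 2 * pi * Suc (c (s + r)) / B) (\<lambda>i\<in>{..<3}. t (ys ! i)) \<noteq> 0"
        using y by (auto simp: triple_fn_def)
      have "2 * pi * real (c s) / B \<le> t (ys ! j) \<and> t (ys ! j) < 2 * pi * real (Suc (c s)) / B"
      proof (cases "j < 2")
        case True
        then show ?thesis using pairs_fn_support[OF y1, of j] by simp
      next
        case False
        then have "j = 2" using ij by simp
        then show ?thesis using y by (auto simp: triple_fn_def split: if_splits)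
      qed
      then have "c (i div 2) = c s"
        by (intro block_disjoint[OF B, where x = "t (xs ! i)"]) (use pairs_fn_support[OF x ij(1)] ij in auto)
      then show False using c[of "i div 2"] ij by auto
    qed
  qed (rule triple_fn_shift)
qed

lemma block_pairs_0: "block_pairs B n d 0 c t = 1"
proof -
  have "distinct_lists 0 n = {[]}" by (auto simp: distinct_lists_def)
  then show ?thesis by (simp add: block_pairs_def tuple_sum_lists pairs_fn_def)
qed

lemma block_pairs_cong: "(\<And>r. r < s \<Longrightarrow> c r = c' r) \<Longrightarrow> block_pairs B n d s c t = block_pairs B n d s c' t"
  unfolding block_pairs_def tuple_sum_lists by (intro sum.cong refl pairs_fn_cong) auto

lemma block_pairs_prod:
  assumes B: "B \<ge> 1" and c: "inj_on c {..<s}"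
  shows "block_pairs B n d s c t = (\<Prod>r<s. block_pairs B n d 1 (\<lambda>_. c r) t)"
  using c
proof (induction s)
  case (Suc s)
  have "block_pairs B n d (s + 1) c t = block_pairs B n d s c t * block_pairs B n d 1 (\<lambda>r. c (s + r)) t"
  proof (rule block_pairs_append[OF B])
    fix r r' :: nat assume "r < s" "r' < 1"
    then show "c r \<noteq> c (s + r')" using inj_onD[OF Suc.prems, of r s] by auto
  qed
  moreover have "block_pairs B n d 1 (\<lambda>r. c (s + r)) t = block_pairs B n d 1 (\<lambda>_. c s) t" by (rule block_pairs_cong) simp
  moreover have "inj_on c {..<s}" using Suc.prems by (rule inj_on_subset) auto
  ultimately show ?case using Suc.IH by simp
qed (simp add: block_pairs_0)

lemma tuple_sum_card:
  assumes "\<And>u. h u = 0 \<or> h u = 1"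
  shows "tuple_sum n m h t = real (card {xs \<in> distinct_lists m n. h (\<lambda>i\<in>{..<m}. t (xs ! i)) \<noteq> 0})"
proof -
  have "tuple_sum n m h t = (\<Sum>xs\<in>{xs \<in> distinct_lists m n. h (\<lambda>i\<in>{..<m}. t (xs ! i)) \<noteq> 0}. h (\<lambda>i\<in>{..<m}. t (xs ! i)))"
    unfolding tuple_sum_lists by (rule sum.mono_neutral_right) auto
  also have "\<dots> = (\<Sum>xs\<in>{xs \<in> distinct_lists m n. h (\<lambda>i\<in>{..<m}. t (xs ! i)) \<noteq> 0}. 1)"
    using assms by (intro sum.cong refl) blast
  finally show ?thesis by simp
qed

lemma pairs_fn_1: "pairs_fn 1 d a b u = pair_close d (a 0) (b 0) (u 0) (u 1)"
  by (simp add: pairs_fn_def)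

lemma pairs_fn_2: "pairs_fn 2 d a b u = pair_close d (a 0) (b 0) (u 0) (u 1) * pair_close d (a 1) (b 1) (u 2) (u 3)"
proof -
  have "{..<2::nat} = {0, 1}" by auto
  then show ?thesis by (simp add: pairs_fn_def)
qed

section \<open>Second moment of the number of close pairs in a block\<close>

definition close_pairs :: "real \<Rightarrow> real \<Rightarrow> real \<Rightarrow> nat \<Rightarrow> (nat \<Rightarrow> real) \<Rightarrow> (nat \<times> nat) set" where
  "close_pairs d a b n t = {p. fst p < n \<and> snd p < n \<and> pair_close d a b (t (fst p)) (t (snd p)) \<noteq> 0}"

lemma finite_close_pairs [simp]: "finite (close_pairs d a b n t)"
  by (rule finite_subset[of _ "{..<n} \<times> {..<n}"]) (auto simp: close_pairs_def)

lemma tuple_sum_close_pairs: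
  "tuple_sum n 2 (pairs_fn 1 d (\<lambda>_. a) (\<lambda>_. b)) t = real (card (close_pairs d a b n t))"
proof -
  have "{xs \<in> distinct_lists 2 n. pairs_fn 1 d (\<lambda>_. a) (\<lambda>_. b) (\<lambda>i\<in>{..<2}. t (xs ! i)) \<noteq> 0} = (\<lambda>p. [fst p, snd p]) ` close_pairs d a b n t"
  proof (intro subset_antisym subsetI)
    fix xs assume xs: "xs \<in> {xs \<in> distinct_lists 2 n. pairs_fn 1 d (\<lambda>_. a) (\<lambda>_. b) (\<lambda>i\<in>{..<2}. t (xs ! i)) \<noteq> 0}"
    then have "length xs = 2" by (simp add: distinct_lists_def)
    then obtain i j where "xs = [i, j]" by (auto simp: numeral_2_eq_2 length_Suc_conv)
    then show "xs \<in> (\<lambda>p. [fst p, snd p]) ` close_pairs d a b n t"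
      using xs unfolding pairs_fn_1 by (intro image_eqI[of _ _ "(i, j)"]) (auto simp: close_pairs_def distinct_lists_def)
  next
    fix xs assume "xs \<in> (\<lambda>p. [fst p, snd p]) ` close_pairs d a b n t"
    then obtain i j where ij: "xs = [i, j]" "(i, j) \<in> close_pairs d a b n t" by auto
    then have "i \<noteq> j" by (auto simp: close_pairs_def pair_close_def)
    then show "xs \<in> {xs \<in> distinct_lists 2 n. pairs_fn 1 d (\<lambda>_. a) (\<lambda>_. b) (\<lambda>i\<in>{..<2}. t (xs ! i)) \<noteq> 0}"
      using ij unfolding pairs_fn_1 by (auto simp: close_pairs_def distinct_lists_def)
  qed
  then show ?thesis
    using tuple_sum_card[of "pairs_fn 1 d (\<lambda>_. a) (\<lambda>_. b)", OF pairs_fn_01]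
    by (simp add: card_image inj_on_def prod_eq_iff)
qed

text \<open>The left side counts ordered pairs of different close pairs. Disjoint ones are
  four-tuples of distinct indices; those with a common point yield a close pair with a third point,
  and the common point can sit in four positions.\<close>

lemma close_pairs_square:
  "(real (card (close_pairs d a b n t)))\<^sup>2 - real (card (close_pairs d a b n t))
    \<le> tuple_sum n 4 (pairs_fn 2 d (\<lambda>_. a) (\<lambda>_. b)) t + 4 * tuple_sum n 3 (triple_fn 1 d (\<lambda>_. a) (\<lambda>_. b)) t"
proof -
  define E where "E = close_pairs d a b n t"
  define D where "D = {z \<in> E \<times> E. {fst (fst z), snd (fst z)} \<inter> {fst (snd z), snd (snd z)} = {}}"
  define W where "W = {z. (fst z, fst (snd z)) \<in> E \<and> snd (snd z) < n \<and> snd (snd z) \<noteq> fst z \<and> snd (snd z) \<noteq> fst (snd z)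
    \<and> \<bar>t (snd (snd z)) - t (fst z)\<bar> \<le> 2 * d \<and> a \<le> t (snd (snd z)) \<and> t (snd (snd z)) < b}"
  have finE: "finite E" by (simp add: E_def)
  have finD: "finite D" using finE by (auto simp: D_def)
  have finW: "finite W"
    by (rule finite_subset[of _ "{..<n} \<times> {..<n} \<times> {..<n}"]) (auto simp: W_def E_def close_pairs_def)
  have E: "i < n \<and> j < n \<and> i \<noteq> j \<and> t i < t j \<and> t j \<le> t i + d \<and> a \<le> t i \<and> t i < b \<and> a \<le> t j \<and> t j < b" if "(i, j) \<in> E" for i j
    using that by (auto simp: E_def close_pairs_def pair_close_def split: if_splits)
  have D_le: "real (card D) \<le> tuple_sum n 4 (pairs_fn 2 d (\<lambda>_. a) (\<lambda>_. b)) t"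
  proof -
    define \<phi> where "\<phi> z = [fst (fst z), snd (fst z), fst (snd z), snd (snd z)]" for z :: "(nat \<times> nat) \<times> (nat \<times> nat)"
    have "\<phi> ` D \<subseteq> {xs \<in> distinct_lists 4 n. pairs_fn 2 d (\<lambda>_. a) (\<lambda>_. b) (\<lambda>i\<in>{..<4}. t (xs ! i)) \<noteq> 0}"
    proof (rule image_subsetI)
      fix z assume z: "z \<in> D"
      obtain i j k l where zz: "z = ((i, j), (k, l))" by (cases z) auto
      have ij: "(i, j) \<in> E" "(k, l) \<in> E" "i \<noteq> k" "i \<noteq> l" "j \<noteq> k" "j \<noteq> l" using z unfolding zz D_def by auto
      then have "pair_close d a b (t i) (t j) \<noteq> 0" "pair_close d a b (t k) (t l) \<noteq> 0" by (auto simp: E_def close_pairs_def)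
      then show "\<phi> z \<in> {xs \<in> distinct_lists 4 n. pairs_fn 2 d (\<lambda>_. a) (\<lambda>_. b) (\<lambda>i\<in>{..<4}. t (xs ! i)) \<noteq> 0}"
        using E[OF ij(1)] E[OF ij(2)] ij unfolding zz \<phi>_def pairs_fn_2 by (auto simp: distinct_lists_def)
    qed
    then have "card (\<phi> ` D) \<le> card {xs \<in> distinct_lists 4 n. pairs_fn 2 d (\<lambda>_. a) (\<lambda>_. b) (\<lambda>i\<in>{..<4}. t (xs ! i)) \<noteq> 0}"
      by (intro card_mono) auto
    moreover have "inj_on \<phi> D" by (auto simp: inj_on_def \<phi>_def prod_eq_iff)
    ultimately show ?thesis
      using tuple_sum_card[of "pairs_fn 2 d (\<lambda>_. a) (\<lambda>_. b)", OF pairs_fn_01] by (simp add: card_image)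
  qed
  have W_le: "real (card W) \<le> tuple_sum n 3 (triple_fn 1 d (\<lambda>_. a) (\<lambda>_. b)) t"
  proof -
    define \<phi> where "\<phi> z = [fst z, fst (snd z), snd (snd z)]" for z :: "nat \<times> nat \<times> nat"
    have "\<phi> ` W \<subseteq> {xs \<in> distinct_lists 3 n. triple_fn 1 d (\<lambda>_. a) (\<lambda>_. b) (\<lambda>i\<in>{..<3}. t (xs ! i)) \<noteq> 0}"
    proof (rule image_subsetI)
      fix z assume z: "z \<in> W"
      obtain i j w where zz: "z = (i, j, w)" by (cases z) auto
      have ij: "(i, j) \<in> E" using z unfolding zz W_def by auto
      then have "pair_close d a b (t i) (t j) \<noteq> 0" by (auto simp: E_def close_pairs_def)
      then show "\<phi> z \<in> {xs \<in> distinct_lists 3 n. triple_fn 1 d (\<lambda>_. a) (\<lambda>_. b) (\<lambda>i\<in>{..<3}. t (xs ! i)) \<noteq> 0}"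
        using E[OF ij] z unfolding zz \<phi>_def triple_fn_def pairs_fn_1 W_def by (auto simp: distinct_lists_def)
    qed
    then have "card (\<phi> ` W) \<le> card {xs \<in> distinct_lists 3 n. triple_fn 1 d (\<lambda>_. a) (\<lambda>_. b) (\<lambda>i\<in>{..<3}. t (xs ! i)) \<noteq> 0}"
      by (intro card_mono) auto
    moreover have "inj_on \<phi> W" by (auto simp: inj_on_def \<phi>_def prod_eq_iff)
    ultimately show ?thesis
      using tuple_sum_card[of "triple_fn 1 d (\<lambda>_. a) (\<lambda>_. b)", OF triple_fn_01] by (simp add: card_image)
  qed
  \<comment> \<open>The four positions of the common point. The width 2 d in \<open>W\<close> is
    used when the pairs are chained, the second point of one being the first of the other.\<close>
  define f1 f2 f3 f4 :: "nat \<times> nat \<times> nat \<Rightarrow> (nat \<times> nat) \<times> (nat \<times> nat)" where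
    "f1 = (\<lambda>(i,j,w). ((i,j),(i,w)))" and "f2 = (\<lambda>(i,j,w). ((i,j),(w,i)))" and
    "f3 = (\<lambda>(i,j,w). ((i,j),(j,w)))" and "f4 = (\<lambda>(i,j,w). ((i,j),(w,j)))"
  have "E \<times> E \<subseteq> (\<lambda>e. (e, e)) ` E \<union> D \<union> f1 ` W \<union> f2 ` W \<union> f3 ` W \<union> f4 ` W"
  proof
    fix z assume "z \<in> E \<times> E"
    then obtain i j k l where z: "z = ((i, j), (k, l))" and ij: "(i, j) \<in> E" and kl: "(k, l) \<in> E" by auto
    note e = E[OF ij] E[OF kl]
    show "z \<in> (\<lambda>e. (e, e)) ` E \<union> D \<union> f1 ` W \<union> f2 ` W \<union> f3 ` W \<union> f4 ` W"
    proof (cases "z \<in> D \<or> (i, j) = (k, l)")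
      case True
      then show ?thesis using z ij by auto
    next
      case False
      then have c: "i = k \<or> i = l \<or> j = k \<or> j = l" and ne: "i \<noteq> k \<or> j \<noteq> l" using z ij kl by (auto simp: D_def)
      have W: "(i, j, w) \<in> W" if "w = k \<or> w = l" "w \<noteq> i" "w \<noteq> j" "\<bar>t w - t i\<bar> \<le> 2 * d" for w
        using that e ij unfolding W_def by auto
      consider "i = k" | "i = l" | "j = k" | "j = l" using c by blast
      then show ?thesis
      proof cases
        case 1
        then have "(i, j, l) \<in> W" using e ne by (intro W) auto
        then have "f1 (i, j, l) \<in> f1 ` W" by (rule imageI)
        then show ?thesis using 1 z by (simp add: f1_def)
      next
        case 2
        then have "(i, j, k) \<in> W" using e by (intro W) auto
        then have "f2 (i, j, k) \<in> f2 ` W" by (rule imageI)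
        then show ?thesis using 2 z by (simp add: f2_def)
      next
        case 3
        then have "(i, j, l) \<in> W" using e by (intro W) auto
        then have "f3 (i, j, l) \<in> f3 ` W" by (rule imageI)
        then show ?thesis using 3 z by (simp add: f3_def)
      next
        case 4
        then have "(i, j, k) \<in> W" using e ne by (intro W) auto
        then have "f4 (i, j, k) \<in> f4 ` W" by (rule imageI)
        then show ?thesis using 4 z by (simp add: f4_def)
      qed
    qed
  qed
  then have "card (E \<times> E) \<le> card ((\<lambda>e. (e, e)) ` E \<union> D \<union> f1 ` W \<union> f2 ` W \<union> f3 ` W \<union> f4 ` W)"
    by (rule card_mono[rotated]) (use finE finD finW in auto)
  also have "\<dots> \<le> card ((\<lambda>e. (e, e)) ` E) + card D + card (f1 ` W) + card (f2 ` W) + card (f3 ` W) + card (f4 ` W)"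
    by (intro order_trans[OF card_Un_le] add_right_mono order_refl)
  also have "\<dots> \<le> card E + card D + card W + card W + card W + card W"
    by (intro add_mono card_image_le finE finW order_refl)
  finally have "card E * card E \<le> card E + card D + 4 * card W" by (simp add: card_cartesian_product)
  then have "real (card E * card E) \<le> real (card E + card D + 4 * card W)" by (rule of_nat_mono)
  then have "real (card E) * real (card E) \<le> real (card E) + real (card D) + 4 * real (card W)" by simp
  then show ?thesis using D_le W_le unfolding E_def[symmetric] power2_eq_square by linarith
qed

lemma tuple_sum_measurable:
  assumes h: "h \<in> borel_measurable (torus_unif m)"
  shows "tuple_sum n m h \<in> borel_measurable (weyl n)"
  unfolding tuple_sum_def[abs_def]
proof (rule borel_measurable_sum)
  fix f assume f: "f \<in> inj_tuples m n"
  have "(\<lambda>t. \<lambda>i\<in>{..<m}. t (f i)) \<in> measurable (torus_unif n) (torus_unif m)"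
    unfolding torus_unif_def using f by (intro measurable_restrict measurable_component_singleton) (auto simp: inj_tuples_def)
  from measurable_compose[OF this h] show "(\<lambda>t. h (\<lambda>i\<in>{..<m}. t (f i))) \<in> borel_measurable (weyl n)" by (simp add: weyl_def)
qed

lemma tuple_sum_01_bounds:
  assumes "\<And>u. h u = 0 \<or> h u = 1"
  shows "0 \<le> tuple_sum n m h t" "tuple_sum n m h t \<le> real (card (distinct_lists m n))"
  unfolding tuple_sum_card[OF assms] by (auto intro!: card_mono)

lemma weyl_tuple_sum_integrable:
  assumes h: "h \<in> borel_measurable (torus_unif m)" and h01: "\<And>u. h u = 0 \<or> h u = 1"
  shows "integrable (weyl n) (tuple_sum n m h)"
proof -
  interpret prob_space "weyl n" by (rule prob_space_weyl)
  show ?thesis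
    by (rule integrable_const_bound[where B = "real (card (distinct_lists m n))"])
       (use tuple_sum_01_bounds[of h n m] h01 tuple_sum_measurable[OF h] in auto)
qed

lemma weyl_tuple_sum_tendsto:
  assumes h: "\<And>n. h n \<in> borel_measurable (torus_unif m)" and h01: "\<And>n u. h n u = 0 \<or> h n u = 1"
    and lim: "(\<lambda>n. \<integral>\<^sup>+t. ennreal (tuple_sum n m (h n) t) \<partial>weyl n) \<longlonglongrightarrow> ennreal c" and c: "c \<ge> 0"
  shows "(\<lambda>n. \<integral>t. tuple_sum n m (h n) t \<partial>weyl n) \<longlonglongrightarrow> c"
proof -
  have "(\<integral>t. tuple_sum n m (h n) t \<partial>weyl n) = enn2real (\<integral>\<^sup>+t. ennreal (tuple_sum n m (h n) t) \<partial>weyl n)" for n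
    by (rule integral_eq_nn_integral[OF tuple_sum_measurable[OF h]]) (use tuple_sum_01_bounds(1)[OF h01] in auto)
  then show ?thesis using tendsto_enn2real[OF lim c] by simp
qed

lemma block_pairs_integrable: "integrable (weyl n) (block_pairs B n d s c)"
  unfolding block_pairs_def by (intro weyl_tuple_sum_integrable pairs_fn_measurable pairs_fn_01 order_refl)

lemma block_triples_integrable: "integrable (weyl n) (block_triples B n d s c)"
  unfolding block_triples_def by (intro weyl_tuple_sum_integrable triple_fn_measurable triple_fn_01)

abbreviation block_count :: "nat \<Rightarrow> nat \<Rightarrow> real \<Rightarrow> nat \<Rightarrow> (nat \<Rightarrow> real) \<Rightarrow> real" where
  "block_count B n d b \<equiv> block_pairs B n d 1 (\<lambda>_. b)"

lemma block_count_card: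
  "block_count B n d b t = real (card (close_pairs d (2 * pi * b / B) (2 * pi * Suc b / B) n t))"
  using tuple_sum_close_pairs[of n d "2 * pi * b / B" "2 * pi * Suc b / B" t] by (simp add: block_pairs_def)

lemma block_count_nonneg: "0 \<le> block_count B n d b t"
  unfolding block_count_card by simp

text \<open>The count is a natural number k. For k = 0 the approximation is exact, for k \<ge> 1 the
  error is k - 1, at most k (k - 1).\<close>

lemma block_count_square_diff: "0 \<le> (block_count B n d b t)\<^sup>2 - block_count B n d b t"
  and block_count_empty_diff: "\<bar>(if block_count B n d b t = 0 then 1 else 0) - (1 - block_count B n d b t)\<bar> \<le> (block_count B n d b t)\<^sup>2 - block_count B n d b t"
proof -
  obtain k :: nat where k: "block_count B n d b t = real k" unfolding block_count_card by blast
  have "k = 0 \<or> 1 \<le> real k" by (cases k) auto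
  then consider "k = 0" | "1 \<le> real k" by blast
  then have "0 \<le> (real k)\<^sup>2 - real k \<and> \<bar>(if real k = 0 then 1 else 0) - (1 - real k)\<bar> \<le> (real k)\<^sup>2 - real k"
  proof cases
    case 2
    have "0 \<le> (real k - 1) * (real k - 1)" by simp
    moreover have "0 \<le> real k * (real k - 1)" using 2 by simp
    ultimately show ?thesis using 2 by (auto simp: power2_eq_square algebra_simps)
  qed simp
  then show "0 \<le> (block_count B n d b t)\<^sup>2 - block_count B n d b t"
    "\<bar>(if block_count B n d b t = 0 then 1 else 0) - (1 - block_count B n d b t)\<bar> \<le> (block_count B n d b t)\<^sup>2 - block_count B n d b t"
    unfolding k by auto
qed

lemma block_count_prod:
  assumes B: "B \<ge> 1" and c: "bij_betw c {..<s} S"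
  shows "(\<Prod>b\<in>S. block_count B n d b t) = block_pairs B n d s c t"
  unfolding block_pairs_prod[OF B bij_betw_imp_inj_on[OF c]] by (rule prod.reindex_bij_betw[OF c, symmetric])

text \<open>\<open>c'\<close> lists the blocks of S and continues with b forever. Read with s + 2
  pairs it puts two disjoint pairs into b, read as a triple with s + 1 pairs it puts one pair and a
  third point there.\<close>

lemma block_count_square_prod:
  assumes B: "B \<ge> 1" and c: "bij_betw c {..<s} S" and b: "b \<notin> S"
  defines "c' \<equiv> (\<lambda>r. if r < s then c r else b)"
  shows "((block_count B n d b t)\<^sup>2 - block_count B n d b t) * (\<Prod>b\<in>S. block_count B n d b t)
    \<le> block_pairs B n d (s + 2) c' t + 4 * block_triples B n d (Suc s) c' t"
proof -
  have cb: "c r \<noteq> b" if "r < s" for r using bij_betwE[OF c] b that by auto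
  have ps: "block_pairs B n d s c' t = (\<Prod>b\<in>S. block_count B n d b t)"
    unfolding block_count_prod[OF B c] by (rule block_pairs_cong) (simp add: c'_def)
  have "block_pairs B n d (s + 2) c' t = block_pairs B n d s c' t * block_pairs B n d 2 (\<lambda>r. c' (s + r)) t"
    by (rule block_pairs_append[OF B]) (use cb in \<open>auto simp: c'_def\<close>)
  also have "(\<lambda>r. c' (s + r)) = (\<lambda>_. b)" by (simp add: c'_def)
  finally have 1: "block_pairs B n d (s + 2) c' t = (\<Prod>b\<in>S. block_count B n d b t) * block_pairs B n d 2 (\<lambda>_. b) t" unfolding ps .
  have "block_triples B n d (Suc s) c' t = block_pairs B n d s c' t * block_triples B n d 1 (\<lambda>r. c' (s + r)) t"
    by (rule block_triples_append[OF B]) (use cb in \<open>auto simp: c'_def\<close>)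
  also have "(\<lambda>r. c' (s + r)) = (\<lambda>_. b)" by (simp add: c'_def)
  finally have 2: "block_triples B n d (Suc s) c' t = (\<Prod>b\<in>S. block_count B n d b t) * block_triples B n d 1 (\<lambda>_. b) t" unfolding ps .
  have "(block_count B n d b t)\<^sup>2 - block_count B n d b t \<le> block_pairs B n d 2 (\<lambda>_. b) t + 4 * block_triples B n d 1 (\<lambda>_. b) t"
    using close_pairs_square[of d "2 * pi * b / B" "2 * pi * Suc b / B" n t]
    unfolding block_count_card by (simp add: block_pairs_def block_triples_def numeral_3_eq_3)
  then have "((block_count B n d b t)\<^sup>2 - block_count B n d b t) * (\<Prod>b\<in>S. block_count B n d b t)
     \<le> (block_pairs B n d 2 (\<lambda>_. b) t + 4 * block_triples B n d 1 (\<lambda>_. b) t) * (\<Prod>b\<in>S. block_count B n d b t)"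
    by (intro mult_right_mono prod_nonneg block_count_nonneg) auto
  also have "\<dots> = block_pairs B n d (s + 2) c' t + 4 * block_triples B n d (Suc s) c' t"
    unfolding 1 2 by (simp add: algebra_simps)
  finally show ?thesis .
qed

section \<open>From empty blocks to the gap event\<close>

text \<open>Factors are exchanged one at a time; the other factors in each step are bounded by
  w.\<close>

lemma prod_diff_bound:
  fixes x y w e :: "'a \<Rightarrow> real"
  assumes "finite A" "\<And>i. i \<in> A \<Longrightarrow> \<bar>x i\<bar> \<le> w i" "\<And>i. i \<in> A \<Longrightarrow> \<bar>y i\<bar> \<le> w i" "\<And>i. i \<in> A \<Longrightarrow> \<bar>x i - y i\<bar> \<le> e i"
  shows "\<bar>prod x A - prod y A\<bar> \<le> (\<Sum>i\<in>A. e i * prod w (A - {i}))"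
  using assms
proof (induction A rule: finite_induct)
  case (insert a A)
  have w0: "w i \<ge> 0" if "i \<in> insert a A" for i using insert.prems(1)[OF that] by linarith
  have py: "\<bar>prod y A\<bar> \<le> prod w A"
    unfolding abs_prod by (intro prod_mono conjI abs_ge_zero insert.prems) simp
  have IH: "\<bar>prod x A - prod y A\<bar> \<le> (\<Sum>i\<in>A. e i * prod w (A - {i}))" by (intro insert.IH insert.prems) auto
  have "prod x (insert a A) - prod y (insert a A) = x a * (prod x A - prod y A) + (x a - y a) * prod y A"
    using insert.hyps by (simp add: algebra_simps)
  also have "\<bar>\<dots>\<bar> \<le> \<bar>x a\<bar> * \<bar>prod x A - prod y A\<bar> + \<bar>x a - y a\<bar> * \<bar>prod y A\<bar>"
    by (rule order_trans[OF abs_triangle_ineq]) (simp add: abs_mult)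
  also have "\<dots> \<le> w a * (\<Sum>i\<in>A. e i * prod w (A - {i})) + e a * prod w A"
    by (intro add_mono mult_mono insert.prems IH py w0) (use insert.prems(3)[of a] in auto)
  also have "w a * (\<Sum>i\<in>A. e i * prod w (A - {i})) = (\<Sum>i\<in>A. e i * prod w (insert a A - {i}))"
    unfolding sum_distrib_left
  proof (rule sum.cong[OF refl])
    fix i assume "i \<in> A"
    then have "insert a A - {i} = insert a (A - {i})" using insert.hyps by auto
    then show "w a * (e i * prod w (A - {i})) = e i * prod w (insert a A - {i})" using insert.hyps by simp
  qed
  also have "insert a A - {a} = A" using insert.hyps by auto
  then have "(\<Sum>i\<in>A. e i * prod w (insert a A - {i})) + e a * prod w A = (\<Sum>i\<in>insert a A. e i * prod w (insert a A - {i}))"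
    using insert.hyps by simp
  finally show ?case .
qed simp

text \<open>The density vanishes wherever two angles coincide.\<close>

lemma weyl_AE_distinct: "AE t in weyl n. \<forall>i<n. \<forall>j<n. i \<noteq> j \<longrightarrow> t i \<noteq> t j"
proof -
  have "(\<lambda>t. ennreal ((cmod (vdm n (circle_pts t)))\<^sup>2 / fact n)) \<in> borel_measurable (torus_unif n)" by measurable
  moreover have "vdm n (circle_pts t) = 0" if "i < n" "j < n" "i \<noteq> j" "t i = t j" for t i j
    by (rule vdm_repeat[of i n j]) (use that in \<open>auto simp: circle_pts_def\<close>)
  ultimately show ?thesis unfolding weyl_def by (subst AE_density) (auto intro!: AE_I2)
qed

text \<open>Distances are not cyclic, so [0, 2 pi) taken as a single block contains every pair; for
  distinct angles each violating pair can be ordered strictly.\<close>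

lemma gap_exceeds_no_close_pairs:
  assumes "\<forall>i<n. 0 \<le> t i \<and> t i < 2 * pi" "\<forall>i<n. \<forall>j<n. i \<noteq> j \<longrightarrow> t i \<noteq> t j"
  shows "gap_exceeds n d t \<longleftrightarrow> block_count 1 n d 0 t = 0"
proof -
  have "gap_exceeds n d t \<longleftrightarrow> close_pairs d 0 (2 * pi) n t = {}"
  proof
    assume g: "gap_exceeds n d t"
    show "close_pairs d 0 (2 * pi) n t = {}"
    proof (rule ccontr)
      assume "close_pairs d 0 (2 * pi) n t \<noteq> {}"
      then obtain i j where "(i, j) \<in> close_pairs d 0 (2 * pi) n t" by auto
      then have "i < n" "j < n" "t i < t j" "t j \<le> t i + d" by (auto simp: close_pairs_def pair_close_def split: if_splits)
      then show False using g unfolding gap_exceeds_def by fastforce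
    qed
  next
    assume e: "close_pairs d 0 (2 * pi) n t = {}"
    have "\<bar>t i - t j\<bar> > d" if ij: "i < n" "j < n" "i \<noteq> j" for i j
    proof (rule ccontr)
      assume "\<not> \<bar>t i - t j\<bar> > d"
      then have "(i, j) \<in> close_pairs d 0 (2 * pi) n t \<or> (j, i) \<in> close_pairs d 0 (2 * pi) n t"
        using assms ij by (cases "t i < t j") (auto simp: close_pairs_def pair_close_def)
      then show False using e by auto
    qed
    then show "gap_exceeds n d t" by (simp add: gap_exceeds_def)
  qed
  also have "\<dots> \<longleftrightarrow> block_count 1 n d 0 t = 0" unfolding block_count_card by simp
  finally show ?thesis .
qed

text \<open>Close pairs within blocks are close pairs of the whole circle, and no pair lies in two
  blocks. The deficit is the number of pairs that straddle blocks.\<close>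

lemma block_count_sum_le:
  assumes B: "B \<ge> 1"
  shows "(\<Sum>b<B. block_count B n d b t) \<le> block_count 1 n d 0 t"
proof -
  define C where "C b = close_pairs d (2 * pi * real b / B) (2 * pi * Suc b / B) n t" for b
  have "(\<Sum>b<B. card (C b)) = card (\<Union>b\<in>{..<B}. C b)"
  proof (rule card_UN_disjoint[symmetric])
    show "\<forall>i\<in>{..<B}. \<forall>j\<in>{..<B}. i \<noteq> j \<longrightarrow> C i \<inter> C j = {}"
    proof (intro ballI impI, rule ccontr)
      fix i j assume "i \<noteq> j" "C i \<inter> C j \<noteq> {}"
      then obtain p where "p \<in> C i" "p \<in> C j" by blast
      then have "i = j" by (intro block_disjoint[OF B, where x = "t (fst p)"]) (auto simp: C_def close_pairs_def pair_close_def split: if_splits)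
      then show False using \<open>i \<noteq> j\<close> by simp
    qed
  qed (auto simp: C_def)
  also have "\<dots> \<le> card (close_pairs d 0 (2 * pi) n t)"
  proof (rule card_mono)
    show "(\<Union>b\<in>{..<B}. C b) \<subseteq> close_pairs d 0 (2 * pi) n t"
    proof
      fix p assume "p \<in> (\<Union>b\<in>{..<B}. C b)"
      then obtain b where b: "b < B" "p \<in> C b" by auto
      have *: "fst p < n" "snd p < n" "t (fst p) < t (snd p)" "t (snd p) \<le> t (fst p) + d"
        "2 * pi * real b / B \<le> t (fst p)" "t (snd p) < 2 * pi * real (Suc b) / B"
        using b(2) by (auto simp: C_def close_pairs_def pair_close_def split: if_splits)
      have "2 * pi * real (Suc b) / B \<le> 2 * pi" using b(1) by (auto simp: divide_le_eq)
      moreover have "0 \<le> 2 * pi * real b / B" by simp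
      ultimately have "0 \<le> t (fst p)" "t (snd p) < 2 * pi" using * by linarith+
      then show "p \<in> close_pairs d 0 (2 * pi) n t" using * by (simp add: close_pairs_def pair_close_def)
    qed
  qed simp
  finally show ?thesis unfolding block_count_card C_def by (simp flip: of_nat_sum)
qed

lemma sum_Pow_power: "finite A \<Longrightarrow> (\<Sum>X\<in>Pow A. x ^ card X) = (1 + x) ^ card A" for x :: "'a::comm_ring_1"
  using prod_add[of A "\<lambda>_. x" "\<lambda>_. 1"] by (simp add: add.commute)

lemma gap_exceeds_sets: "{t \<in> space (weyl n). gap_exceeds n \<delta> t} \<in> sets (weyl n)"
proof -
  have "{t \<in> space (weyl n). gap_exceeds n \<delta> t} = {t \<in> space (weyl n). \<forall>i\<in>{..<n}. \<forall>j\<in>{..<n}. i \<noteq> j \<longrightarrow> \<delta> < \<bar>t i - t j\<bar>}"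
    by (auto simp: gap_exceeds_def)
  also have "\<dots> \<in> sets (weyl n)"
  proof (intro sets.sets_Collect_finite_All)
    fix i j assume "i \<in> {..<n}" "j \<in> {..<n}"
    then have [measurable]: "(\<lambda>t. t i) \<in> borel_measurable (weyl n)" "(\<lambda>t. t j) \<in> borel_measurable (weyl n)"
      by (auto simp: weyl_def)
    show "{t \<in> space (weyl n). i \<noteq> j \<longrightarrow> \<delta> < \<bar>t i - t j\<bar>} \<in> sets (weyl n)" by measurable
  qed auto
  finally show ?thesis .
qed

section \<open>Limit of the gap probability\<close>

text \<open>The critical scale: d is of order n powr (-4/3), at which the mean number of close pairs
  stays bounded, while n d, the gap in units of the mean spacing, tends to 0.\<close>

locale gap_scale =
  fixes d :: "nat \<Rightarrow> real" and K :: real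
  assumes d_pos: "n \<ge> 1 \<Longrightarrow> d n > 0"
    and d_scale: "n \<ge> 1 \<Longrightarrow> real n ^ 4 * d n ^ 3 = K"
    and d_small: "(\<lambda>n. real n * d n) \<longlonglongrightarrow> 0"
begin

text \<open>The limiting mean number of close pairs on the whole circle: K (b - a) / (144 pi^2) with
  b - a = 2 pi.\<close>

definition intensity :: real where "intensity = K / (72 * pi)"

lemma intensity_nonneg: "intensity \<ge> 0"
  using d_scale[of 1] d_pos[of 1] by (auto simp: intensity_def)

lemma block_pairs_mean:
  assumes B: "B \<ge> 1" and c: "\<And>r. r < s \<Longrightarrow> c r < B"
  shows "(\<lambda>n. \<integral>t. block_pairs B n (d n) s c t \<partial>weyl n) \<longlonglongrightarrow> (intensity / B) ^ s"
  unfolding block_pairs_def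
proof (rule weyl_tuple_sum_tendsto)
  have len: "2 * pi * real (Suc i) / B - 2 * pi * real i / B = 2 * pi / B" for i
    by (simp add: diff_divide_distrib[symmetric] right_diff_distrib[symmetric])
  have "(\<lambda>n. \<integral>\<^sup>+t. ennreal (tuple_sum n (2 * s) (pairs_fn s (d n) (\<lambda>r. 2 * pi * c r / B) (\<lambda>r. 2 * pi * Suc (c r) / B)) t) \<partial>weyl n)
    \<longlonglongrightarrow> ennreal (\<Prod>r<s. K * (2 * pi * Suc (c r) / B - 2 * pi * c r / B) / (144 * pi\<^sup>2))"
  proof (rule weyl_pairs_tendsto[OF d_pos d_scale d_small])
    fix r assume "r < s"
    then have "real (Suc (c r)) \<le> real B" using c[of r] by simp
    then have "2 * pi * real (Suc (c r)) / B \<le> 2 * pi" using B by (simp add: divide_le_eq)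
    moreover have "2 * pi * real (c r) / B \<le> 2 * pi * real (Suc (c r)) / B" by (intro divide_right_mono mult_left_mono) auto
    ultimately show "0 \<le> 2 * pi * c r / B \<and> 2 * pi * c r / B \<le> 2 * pi * Suc (c r) / B \<and> 2 * pi * Suc (c r) / B \<le> 2 * pi" by simp
  qed
  also have "(\<Prod>r<s. K * (2 * pi * Suc (c r) / B - 2 * pi * c r / B) / (144 * pi\<^sup>2)) = (intensity / B) ^ s"
    unfolding len by (simp add: intensity_def power2_eq_square mult.assoc)
  finally show "(\<lambda>n. \<integral>\<^sup>+t. ennreal (tuple_sum n (2 * s) (pairs_fn s (d n) (\<lambda>r. 2 * pi * c r / B) (\<lambda>r. 2 * pi * Suc (c r) / B)) t) \<partial>weyl n)
    \<longlonglongrightarrow> ennreal ((intensity / B) ^ s)" .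
qed (use intensity_nonneg in \<open>auto intro!: pairs_fn_measurable pairs_fn_01\<close>)

lemma block_triples_mean:
  assumes s: "s \<ge> 1"
  shows "(\<lambda>n. \<integral>t. block_triples B n (d n) s c t \<partial>weyl n) \<longlonglongrightarrow> 0"
  unfolding block_triples_def
proof (rule weyl_tuple_sum_tendsto)
  show "(\<lambda>n. \<integral>\<^sup>+t. ennreal (tuple_sum n (2 * s + 1) (triple_fn s (d n) (\<lambda>r. 2 * pi * c r / B) (\<lambda>r. 2 * pi * Suc (c r) / B)) t) \<partial>weyl n)
    \<longlonglongrightarrow> ennreal 0"
    using weyl_triple_tendsto[OF d_pos d_scale d_small s] by simp
qed (rule triple_fn_measurable triple_fn_01 order_refl)+

lemma block_count_prod_mean:
  assumes B: "B \<ge> 1" and S: "S \<subseteq> {..<B}"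
  shows "(\<lambda>n. \<integral>t. (\<Prod>b\<in>S. block_count B n (d n) b t) \<partial>weyl n) \<longlonglongrightarrow> (intensity / B) ^ card S"
    and "integrable (weyl n) (\<lambda>t. \<Prod>b\<in>S. block_count B n (d n) b t)"
proof -
  have "finite S" using S by (rule finite_subset) simp
  then obtain c where c: "bij_betw c {..<card S} S" using ex_bij_betw_nat_finite[of S] by (auto simp: atLeast0LessThan)
  have cB: "c r < B" if "r < card S" for r using bij_betwE[OF c] S that by auto
  show "(\<lambda>n. \<integral>t. (\<Prod>b\<in>S. block_count B n (d n) b t) \<partial>weyl n) \<longlonglongrightarrow> (intensity / B) ^ card S"
    unfolding block_count_prod[OF B c] using B cB by (rule block_pairs_mean)
  show "integrable (weyl n) (\<lambda>t. \<Prod>b\<in>S. block_count B n (d n) b t)"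
    unfolding block_count_prod[OF B c] by (rule block_pairs_integrable)
qed

text \<open>The bound g has one pair in each block of S and two disjoint pairs in b; its triple term
  has mean tending to 0. The exponent is therefore the number of pairs.\<close>

lemma block_count_square_prod_mean:
  assumes B: "B \<ge> 1" and S: "S \<subseteq> {..<B}" and b: "b < B" "b \<notin> S"
  obtains g where "\<And>n t. ((block_count B n (d n) b t)\<^sup>2 - block_count B n (d n) b t) * (\<Prod>b\<in>S. block_count B n (d n) b t) \<le> g n t"
    "\<And>n. integrable (weyl n) (g n)" "(\<lambda>n. \<integral>t. g n t \<partial>weyl n) \<longlonglongrightarrow> (intensity / B) ^ (card S + 2)"
proof -
  have "finite S" using S by (rule finite_subset) simp
  then obtain c where c: "bij_betw c {..<card S} S" using ex_bij_betw_nat_finite[of S] by (auto simp: atLeast0LessThan)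
  have cB: "c r < B" if "r < card S" for r using bij_betwE[OF c] S that by auto
  define s where "s = card S"
  define c' where "c' r = (if r < s then c r else b)" for r
  define g where "g n t = block_pairs B n (d n) (s + 2) c' t + 4 * block_triples B n (d n) (Suc s) c' t" for n t
  show ?thesis
  proof (rule that[of g])
    show "((block_count B n (d n) b t)\<^sup>2 - block_count B n (d n) b t) * (\<Prod>b\<in>S. block_count B n (d n) b t) \<le> g n t" for n t
      using block_count_square_prod[OF B c b(2)] unfolding g_def c'_def[abs_def] s_def .
    have i: "integrable (weyl n) (\<lambda>t. 4 * block_triples B n (d n) (Suc s) c' t)" for n
      by (intro integrable_mult_right block_triples_integrable)
    show "integrable (weyl n) (g n)" for n
      unfolding g_def[abs_def] by (intro Bochner_Integration.integrable_add block_pairs_integrable i)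
    have "(\<integral>t. g n t \<partial>weyl n) = (\<integral>t. block_pairs B n (d n) (s + 2) c' t \<partial>weyl n) + 4 * (\<integral>t. block_triples B n (d n) (Suc s) c' t \<partial>weyl n)" for n
      unfolding g_def by (simp add: Bochner_Integration.integral_add[OF block_pairs_integrable i])
    moreover have "(\<lambda>n. (\<integral>t. block_pairs B n (d n) (s + 2) c' t \<partial>weyl n) + 4 * (\<integral>t. block_triples B n (d n) (Suc s) c' t \<partial>weyl n))
       \<longlonglongrightarrow> (intensity / B) ^ (s + 2) + 4 * 0"
    proof (intro tendsto_add tendsto_mult tendsto_const block_triples_mean)
      show "(\<lambda>n. \<integral>t. block_pairs B n (d n) (s + 2) c' t \<partial>weyl n) \<longlonglongrightarrow> (intensity / B) ^ (s + 2)"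
        by (rule block_pairs_mean[OF B]) (use cB b(1) in \<open>auto simp: c'_def s_def\<close>)
    qed simp
    ultimately show "(\<lambda>n. \<integral>t. g n t \<partial>weyl n) \<longlonglongrightarrow> (intensity / B) ^ (card S + 2)" by (simp add: s_def)
  qed
qed

definition blocks_empty :: "nat \<Rightarrow> nat \<Rightarrow> (nat \<Rightarrow> real) \<Rightarrow> real" where
  "blocks_empty B n t = (\<Prod>b<B. if block_count B n (d n) b t = 0 then 1 else 0)"

lemma block_count_measurable: "block_count B n (d n) b \<in> borel_measurable (weyl n)"
  by (rule borel_measurable_integrable[OF block_pairs_integrable])

lemma blocks_empty_integrable: "integrable (weyl n) (blocks_empty B n)"
proof -
  interpret prob_space "weyl n" by (rule prob_space_weyl)
  have "\<bar>blocks_empty B n t\<bar> \<le> 1" for t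
    unfolding blocks_empty_def abs_prod by (intro prod_le_1) auto
  moreover have "blocks_empty B n \<in> borel_measurable (weyl n)"
    unfolding blocks_empty_def[abs_def]
  proof (rule borel_measurable_prod)
    fix b
    have [measurable]: "block_count B n (d n) b \<in> borel_measurable (weyl n)" by (rule block_count_measurable)
    show "(\<lambda>t. if block_count B n (d n) b t = 0 then 1 else 0) \<in> borel_measurable (weyl n)" by measurable
  qed
  ultimately show ?thesis by (intro integrable_const_bound[where B = 1]) auto
qed

text \<open>Expand over the subsets X of blocks. The mean of each product of counts tends to a power
  with exponent the size of X, and the binomial theorem sums the limits.\<close>

lemma one_minus_count_prod:
  assumes B: "B \<ge> 1"
  shows "(\<lambda>n. \<integral>t. (\<Prod>b<B. 1 - block_count B n (d n) b t) \<partial>weyl n) \<longlonglongrightarrow> (1 - intensity / B) ^ B"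
    and "integrable (weyl n) (\<lambda>t. \<Prod>b<B. 1 - block_count B n (d n) b t)"
proof -
  have e: "(\<Prod>b<B. 1 - block_count B n (d n) b t) = (\<Sum>X\<in>Pow {..<B}. (-1) ^ card X * (\<Prod>b\<in>X. block_count B n (d n) b t))" for n t
  proof -
    have "(\<Prod>b<B. - block_count B n (d n) b t + 1) = (\<Sum>X\<in>Pow {..<B}. (\<Prod>b\<in>X. - block_count B n (d n) b t) * (\<Prod>b\<in>{..<B} - X. 1))"
      by (rule prod_add) simp
    then show ?thesis by (simp add: prod_uminus)
  qed
  have i: "integrable (weyl n) (\<lambda>t. (-1) ^ card X * (\<Prod>b\<in>X. block_count B n (d n) b t))" if "X \<in> Pow {..<B}" for n X
    using that by (intro integrable_mult_right block_count_prod_mean(2)[OF B]) auto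
  show "integrable (weyl n) (\<lambda>t. \<Prod>b<B. 1 - block_count B n (d n) b t)"
    unfolding e by (intro Bochner_Integration.integrable_sum i)
  have "(\<integral>t. (\<Prod>b<B. 1 - block_count B n (d n) b t) \<partial>weyl n) = (\<Sum>X\<in>Pow {..<B}. (-1) ^ card X * (\<integral>t. (\<Prod>b\<in>X. block_count B n (d n) b t) \<partial>weyl n))" for n
    unfolding e by (subst Bochner_Integration.integral_sum[OF i]) auto
  moreover have "(\<lambda>n. \<Sum>X\<in>Pow {..<B}. (-1) ^ card X * (\<integral>t. (\<Prod>b\<in>X. block_count B n (d n) b t) \<partial>weyl n))
     \<longlonglongrightarrow> (\<Sum>X\<in>Pow {..<B}. (-1) ^ card X * (intensity / B) ^ card X)"
    by (intro tendsto_sum tendsto_mult tendsto_const block_count_prod_mean(1)[OF B]) auto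
  moreover have "(\<Sum>X\<in>Pow {..<B}. (-1) ^ card X * (intensity / B) ^ card X) = (1 - intensity / B) ^ B"
    using sum_Pow_power[of "{..<B}" "- intensity / B"] by (simp add: power_mult_distrib[symmetric])
  ultimately show "(\<lambda>n. \<integral>t. (\<Prod>b<B. 1 - block_count B n (d n) b t) \<partial>weyl n) \<longlonglongrightarrow> (1 - intensity / B) ^ B" by simp
qed

text \<open>Each indicator of an empty block is exchanged for 1 - N at cost N^2 - N, the other
  factors being at most N + 1. Expanding these over subsets X gives means with limits of exponent
  |X| + 2, and the sum over X and over the B blocks is of order 1 / B.\<close>

lemma blocks_empty_approx:
  assumes B: "B \<ge> 1"
  obtains E where "E \<longlonglongrightarrow> B * ((intensity / B)\<^sup>2 * (1 + intensity / B) ^ (B - 1))"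
    "\<And>n. \<bar>(\<integral>t. blocks_empty B n t \<partial>weyl n) - (\<integral>t. (\<Prod>b<B. 1 - block_count B n (d n) b t) \<partial>weyl n)\<bar> \<le> E n"
proof -
  define N where "N n b t = block_count B n (d n) b t" for n b t
  have "\<forall>p\<in>(SIGMA b:{..<B}. Pow ({..<B} - {b})). \<exists>g. (\<forall>n t. ((N n (fst p) t)\<^sup>2 - N n (fst p) t) * (\<Prod>b\<in>snd p. N n b t) \<le> g n t)
     \<and> (\<forall>n. integrable (weyl n) (g n)) \<and> (\<lambda>n. \<integral>t. g n t \<partial>weyl n) \<longlonglongrightarrow> (intensity / B) ^ (card (snd p) + 2)"
  proof
    fix p assume "p \<in> (SIGMA b:{..<B}. Pow ({..<B} - {b}))"
    then have p: "snd p \<subseteq> {..<B}" "fst p < B" "fst p \<notin> snd p" by auto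
    show "\<exists>g. (\<forall>n t. ((N n (fst p) t)\<^sup>2 - N n (fst p) t) * (\<Prod>b\<in>snd p. N n b t) \<le> g n t)
     \<and> (\<forall>n. integrable (weyl n) (g n)) \<and> (\<lambda>n. \<integral>t. g n t \<partial>weyl n) \<longlonglongrightarrow> (intensity / B) ^ (card (snd p) + 2)"
    proof (rule block_count_square_prod_mean[OF B p])
      fix g assume "\<And>n t. ((block_count B n (d n) (fst p) t)\<^sup>2 - block_count B n (d n) (fst p) t) * (\<Prod>b\<in>snd p. block_count B n (d n) b t) \<le> g n t"
        and "\<And>n. integrable (weyl n) (g n)" and "(\<lambda>n. \<integral>t. g n t \<partial>weyl n) \<longlonglongrightarrow> (intensity / B) ^ (card (snd p) + 2)"
      then show ?thesis unfolding N_def by (intro exI[of _ g] conjI allI)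
    qed
  qed
  then obtain G where G: "\<forall>p\<in>(SIGMA b:{..<B}. Pow ({..<B} - {b})). (\<forall>n t. ((N n (fst p) t)\<^sup>2 - N n (fst p) t) * (\<Prod>b\<in>snd p. N n b t) \<le> G p n t)
     \<and> (\<forall>n. integrable (weyl n) (G p n)) \<and> (\<lambda>n. \<integral>t. G p n t \<partial>weyl n) \<longlonglongrightarrow> (intensity / B) ^ (card (snd p) + 2)"
    unfolding bchoice_iff by blast
  define g where "g n t = (\<Sum>b<B. \<Sum>X\<in>Pow ({..<B} - {b}). G (b, X) n t)" for n t
  have GbX: "(\<forall>n t. ((N n b t)\<^sup>2 - N n b t) * (\<Prod>b\<in>X. N n b t) \<le> G (b, X) n t)
     \<and> (\<forall>n. integrable (weyl n) (G (b, X) n)) \<and> (\<lambda>n. \<integral>t. G (b, X) n t \<partial>weyl n) \<longlonglongrightarrow> (intensity / B) ^ (card X + 2)"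
    if "b \<in> {..<B}" "X \<in> Pow ({..<B} - {b})" for b X
  proof -
    have "(b, X) \<in> (SIGMA b:{..<B}. Pow ({..<B} - {b}))" using that by simp
    from bspec[OF G this] show ?thesis unfolding fst_conv snd_conv .
  qed
  then have Gi: "integrable (weyl n) (G (b, X) n)" if "b \<in> {..<B}" "X \<in> Pow ({..<B} - {b})" for b X n
    using that by blast
  have gi: "integrable (weyl n) (g n)" for n
    unfolding g_def[abs_def] by (intro Bochner_Integration.integrable_sum Gi)
  have le: "\<bar>blocks_empty B n t - (\<Prod>b<B. 1 - N n b t)\<bar> \<le> g n t" for n t
  proof -
    have "\<bar>blocks_empty B n t - (\<Prod>b<B. 1 - N n b t)\<bar> \<le> (\<Sum>b<B. ((N n b t)\<^sup>2 - N n b t) * (\<Prod>j\<in>{..<B} - {b}. N n j t + 1))"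
      unfolding blocks_empty_def N_def
    proof (rule prod_diff_bound)
      fix b
      show "\<bar>if block_count B n (d n) b t = 0 then 1 else 0 :: real\<bar> \<le> block_count B n (d n) b t + 1"
        using block_count_nonneg[of B n "d n" b t] by auto
      show "\<bar>1 - block_count B n (d n) b t\<bar> \<le> block_count B n (d n) b t + 1"
        using block_count_nonneg[of B n "d n" b t] by auto
    qed (rule finite_lessThan, rule block_count_empty_diff)
    also have "\<dots> \<le> g n t"
      unfolding g_def
    proof (rule sum_mono)
      fix b assume b: "b \<in> {..<B}"
      have "((N n b t)\<^sup>2 - N n b t) * (\<Prod>j\<in>{..<B} - {b}. N n j t + 1) = (\<Sum>X\<in>Pow ({..<B} - {b}). ((N n b t)\<^sup>2 - N n b t) * (\<Prod>j\<in>X. N n j t))"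
        by (subst prod_add) (simp_all add: sum_distrib_left)
      also have "\<dots> \<le> (\<Sum>X\<in>Pow ({..<B} - {b}). G (b, X) n t)"
        by (rule sum_mono) (use GbX[OF b] in blast)
      finally show "((N n b t)\<^sup>2 - N n b t) * (\<Prod>j\<in>{..<B} - {b}. N n j t + 1) \<le> (\<Sum>X\<in>Pow ({..<B} - {b}). G (b, X) n t)" .
    qed
    finally show ?thesis .
  qed
  show ?thesis
  proof (rule that[of "\<lambda>n. \<integral>t. g n t \<partial>weyl n"])
    have "(\<integral>t. g n t \<partial>weyl n) = (\<Sum>b<B. \<Sum>X\<in>Pow ({..<B} - {b}). \<integral>t. G (b, X) n t \<partial>weyl n)" for n
    proof -
      have "(\<integral>t. g n t \<partial>weyl n) = (\<Sum>b<B. \<integral>t. (\<Sum>X\<in>Pow ({..<B} - {b}). G (b, X) n t) \<partial>weyl n)"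
        unfolding g_def by (intro Bochner_Integration.integral_sum Bochner_Integration.integrable_sum Gi)
      also have "\<dots> = (\<Sum>b<B. \<Sum>X\<in>Pow ({..<B} - {b}). \<integral>t. G (b, X) n t \<partial>weyl n)"
        by (intro sum.cong refl Bochner_Integration.integral_sum Gi)
      finally show ?thesis .
    qed
    moreover have "(\<lambda>n. \<Sum>b<B. \<Sum>X\<in>Pow ({..<B} - {b}). \<integral>t. G (b, X) n t \<partial>weyl n) \<longlonglongrightarrow> (\<Sum>b<B. \<Sum>X\<in>Pow ({..<B} - {b}). (intensity / B) ^ (card X + 2))"
      by (intro tendsto_sum) (use GbX in blast)
    moreover have "(\<Sum>b<B. \<Sum>X\<in>Pow ({..<B} - {b}). (intensity / B) ^ (card X + 2)) = B * ((intensity / B)\<^sup>2 * (1 + intensity / B) ^ (B - 1))"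
    proof -
      have "(\<Sum>X\<in>Pow ({..<B} - {b}). (intensity / B) ^ (card X + 2)) = (intensity / B)\<^sup>2 * (1 + intensity / B) ^ (B - 1)" if "b \<in> {..<B}" for b
      proof -
        have "(\<Sum>X\<in>Pow ({..<B} - {b}). (intensity / B) ^ (card X + 2)) = (\<Sum>X\<in>Pow ({..<B} - {b}). (intensity / B) ^ card X) * (intensity / B)\<^sup>2"
          by (simp only: power_add sum_distrib_right)
        also have "\<dots> = (1 + intensity / B) ^ card ({..<B} - {b}) * (intensity / B)\<^sup>2"
          by (subst sum_Pow_power) simp_all
        also have "card ({..<B} - {b}) = B - 1" using that by (simp add: card_Diff_singleton)
        finally show ?thesis by (simp only: mult.commute)
      qed
      then show ?thesis by simp
    qed
    ultimately show "(\<lambda>n. \<integral>t. g n t \<partial>weyl n) \<longlonglongrightarrow> B * ((intensity / B)\<^sup>2 * (1 + intensity / B) ^ (B - 1))" by simp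
    fix n
    have i: "integrable (weyl n) (\<lambda>t. \<Prod>b<B. 1 - N n b t)" unfolding N_def by (rule one_minus_count_prod(2)[OF B])
    have "\<bar>(\<integral>t. blocks_empty B n t \<partial>weyl n) - (\<integral>t. (\<Prod>b<B. 1 - N n b t) \<partial>weyl n)\<bar>
      = \<bar>\<integral>t. blocks_empty B n t - (\<Prod>b<B. 1 - N n b t) \<partial>weyl n\<bar>"
      by (subst Bochner_Integration.integral_diff[OF blocks_empty_integrable i]) simp
    also have "\<dots> \<le> (\<integral>t. \<bar>blocks_empty B n t - (\<Prod>b<B. 1 - N n b t)\<bar> \<partial>weyl n)" by (rule integral_abs_bound)
    also have "\<dots> \<le> (\<integral>t. g n t \<partial>weyl n)"
      by (intro integral_mono integrable_abs Bochner_Integration.integrable_diff blocks_empty_integrable i gi le)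
    finally show "\<bar>(\<integral>t. blocks_empty B n t \<partial>weyl n) - (\<integral>t. (\<Prod>b<B. 1 - block_count B n (d n) b t) \<partial>weyl n)\<bar> \<le> (\<integral>t. g n t \<partial>weyl n)"
      by (simp add: N_def)
  qed
qed

definition gap_prob :: "nat \<Rightarrow> real" where
  "gap_prob n = measure (weyl n) {t \<in> space (weyl n). gap_exceeds n (d n) t}"

text \<open>A gap is missed by the blocks only if a close pair straddles two of them; in the mean
  there are \<open>intensity - B \<cdot> (intensity / B) = 0\<close> such pairs in the limit.\<close>

lemma gap_prob_blocks:
  assumes B: "B \<ge> 1"
  shows "(\<lambda>n. gap_prob n - (\<integral>t. blocks_empty B n t \<partial>weyl n)) \<longlonglongrightarrow> 0"
proof -
  define T where "T n t = block_count 1 n (d n) 0 t" for n t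
  define S where "S n t = (\<Sum>b<B. block_count B n (d n) b t)" for n t
  define p where "p n t = (if T n t = 0 then 1 else 0 :: real)" for n t
  have Tm: "T n \<in> borel_measurable (weyl n)" for n unfolding T_def[abs_def] by (rule block_count_measurable)
  have pm: "p n \<in> borel_measurable (weyl n)" for n
  proof -
    note [measurable] = Tm[of n]
    show ?thesis unfolding p_def[abs_def] by measurable
  qed
  have pi: "integrable (weyl n) (p n)" for n
  proof -
    interpret prob_space "weyl n" by (rule prob_space_weyl)
    show ?thesis by (rule integrable_const_bound[where B = 1]) (auto simp: p_def[abs_def] intro: pm[unfolded p_def[abs_def]])
  qed
  have gp: "gap_prob n = (\<integral>t. p n t \<partial>weyl n)" for n
  proof -
    interpret prob_space "weyl n" by (rule prob_space_weyl)
    note [measurable] = Tm[of n]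
    have "gap_prob n = measure (weyl n) {t \<in> space (weyl n). T n t = 0}"
    proof -
      have "AE t in weyl n. gap_exceeds n (d n) t \<longleftrightarrow> T n t = 0"
        using weyl_AE_range weyl_AE_distinct unfolding T_def by eventually_elim (rule gap_exceeds_no_close_pairs)
      then show ?thesis unfolding gap_prob_def
        by (intro measure_eq_AE) (auto elim!: eventually_mono intro: gap_exceeds_sets)
    qed
    also have "\<dots> = (\<integral>t. indicator {t \<in> space (weyl n). T n t = 0} t \<partial>weyl n)" by simp
    also have "\<dots> = (\<integral>t. p n t \<partial>weyl n)" by (intro Bochner_Integration.integral_cong) (auto simp: p_def indicator_def)
    finally show ?thesis .
  qed
  have Si: "integrable (weyl n) (S n)" for n
    unfolding S_def[abs_def] by (intro Bochner_Integration.integrable_sum block_pairs_integrable)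
  have Ti: "integrable (weyl n) (T n)" for n unfolding T_def[abs_def] by (rule block_pairs_integrable)
  have le: "\<bar>p n t - blocks_empty B n t\<bar> \<le> T n t - S n t" for n t
  proof -
    have ST: "S n t \<le> T n t" unfolding S_def T_def by (rule block_count_sum_le[OF B])
    have S0: "S n t = 0 \<longleftrightarrow> (\<forall>b<B. block_count B n (d n) b t = 0)"
    proof -
      have "S n t = 0 \<longleftrightarrow> (\<forall>b\<in>{..<B}. block_count B n (d n) b t = 0)"
        unfolding S_def by (rule sum_nonneg_eq_0_iff) (rule finite_lessThan, rule block_count_nonneg)
      then show ?thesis by (simp only: lessThan_iff Ball_def)
    qed
    have be: "blocks_empty B n t = (if S n t = 0 then 1 else 0)"
    proof (cases "S n t = 0")
      case True
      then show ?thesis unfolding S0 by (simp add: blocks_empty_def)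
    next
      case False
      then obtain b where "b < B" "block_count B n (d n) b t \<noteq> 0" unfolding S0 by blast
      then have "blocks_empty B n t = 0" unfolding blocks_empty_def by (intro prod_zero bexI[of _ b]) auto
      then show ?thesis using False by simp
    qed
    obtain k :: nat where k: "T n t = real k" unfolding T_def block_count_card by blast
    have S1: "0 \<le> S n t" unfolding S_def by (intro sum_nonneg block_count_nonneg)
    show ?thesis
    proof (cases "k = 0")
      case True
      then show ?thesis using ST S1 k by (simp add: be p_def)
    next
      case False
      then have "T n t \<ge> 1" unfolding k by simp
      then show ?thesis using ST by (auto simp: be p_def)
    qed
  qed
  have "(\<lambda>n. (\<integral>t. T n t \<partial>weyl n) - (\<integral>t. S n t \<partial>weyl n)) \<longlonglongrightarrow> (intensity / real 1) ^ 1 - (\<Sum>b<B. (intensity / B) ^ 1)"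
  proof (rule tendsto_diff)
    show "(\<lambda>n. \<integral>t. T n t \<partial>weyl n) \<longlonglongrightarrow> (intensity / real 1) ^ 1" unfolding T_def by (rule block_pairs_mean) auto
    have "(\<integral>t. S n t \<partial>weyl n) = (\<Sum>b<B. \<integral>t. block_count B n (d n) b t \<partial>weyl n)" for n
      unfolding S_def by (intro Bochner_Integration.integral_sum block_pairs_integrable)
    moreover have "(\<lambda>n. \<Sum>b<B. \<integral>t. block_count B n (d n) b t \<partial>weyl n) \<longlonglongrightarrow> (\<Sum>b<B. (intensity / B) ^ 1)"
      by (intro tendsto_sum block_pairs_mean B) auto
    ultimately show "(\<lambda>n. \<integral>t. S n t \<partial>weyl n) \<longlonglongrightarrow> (\<Sum>b<B. (intensity / B) ^ 1)" by simp
  qed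
  then have lim: "(\<lambda>n. (\<integral>t. T n t \<partial>weyl n) - (\<integral>t. S n t \<partial>weyl n)) \<longlonglongrightarrow> 0" using B by simp
  show ?thesis
  proof (rule Lim_null_comparison[OF _ lim], rule always_eventually, rule allI)
    fix n
    have "\<bar>gap_prob n - (\<integral>t. blocks_empty B n t \<partial>weyl n)\<bar> = \<bar>\<integral>t. p n t - blocks_empty B n t \<partial>weyl n\<bar>"
      unfolding gp by (subst Bochner_Integration.integral_diff[OF pi blocks_empty_integrable]) simp
    also have "\<dots> \<le> (\<integral>t. \<bar>p n t - blocks_empty B n t\<bar> \<partial>weyl n)" by (rule integral_abs_bound)
    also have "\<dots> \<le> (\<integral>t. T n t - S n t \<partial>weyl n)"
      by (intro integral_mono integrable_abs Bochner_Integration.integrable_diff blocks_empty_integrable pi Ti Si le)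
    also have "\<dots> = (\<integral>t. T n t \<partial>weyl n) - (\<integral>t. S n t \<partial>weyl n)" by (rule Bochner_Integration.integral_diff[OF Ti Si])
    finally show "norm (gap_prob n - (\<integral>t. blocks_empty B n t \<partial>weyl n)) \<le> (\<integral>t. T n t \<partial>weyl n) - (\<integral>t. S n t \<partial>weyl n)" by simp
  qed
qed

text \<open>B is fixed first, so large that the block error, at most the squared intensity times exp
  intensity / B, and the distance of (1 - intensity / B)^B from its limit are small; only then does
  n grow. The four quarters of \<epsilon> are these two and the two limits in n.\<close>

lemma gap_prob_tendsto: "gap_prob \<longlonglongrightarrow> exp (- intensity)"
proof (rule LIMSEQ_I)
  fix \<epsilon> :: real assume \<epsilon>: "\<epsilon> > 0"
  have "(\<lambda>B. intensity\<^sup>2 * exp intensity / real B) \<longlonglongrightarrow> 0" by (rule lim_const_over_n)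
  then have e1: "\<forall>\<^sub>F B in sequentially. intensity\<^sup>2 * exp intensity / real B < \<epsilon> / 4" by (rule order_tendstoD(2)) (use \<epsilon> in simp)
  have "(\<lambda>B. (1 + (- intensity) / real B) ^ B) \<longlonglongrightarrow> exp (- intensity)" by (rule tendsto_exp_limit_sequentially)
  then have e2: "\<forall>\<^sub>F B in sequentially. dist ((1 + (- intensity) / real B) ^ B) (exp (- intensity)) < \<epsilon> / 4" by (rule tendstoD) (use \<epsilon> in simp)
  have "\<forall>\<^sub>F B in sequentially. intensity\<^sup>2 * exp intensity / real B < \<epsilon> / 4
     \<and> dist ((1 + (- intensity) / real B) ^ B) (exp (- intensity)) < \<epsilon> / 4 \<and> B \<ge> 1"
    using e1 e2 eventually_ge_at_top[of 1] by eventually_elim simp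
  then obtain B :: nat where B: "intensity\<^sup>2 * exp intensity / real B < \<epsilon> / 4"
      "dist ((1 + (- intensity) / real B) ^ B) (exp (- intensity)) < \<epsilon> / 4" "B \<ge> 1"
    by (auto dest: eventually_happens)
  obtain E where E: "E \<longlonglongrightarrow> B * ((intensity / B)\<^sup>2 * (1 + intensity / B) ^ (B - 1))"
    "\<And>n. \<bar>(\<integral>t. blocks_empty B n t \<partial>weyl n) - (\<integral>t. (\<Prod>b<B. 1 - block_count B n (d n) b t) \<partial>weyl n)\<bar> \<le> E n"
    using blocks_empty_approx[OF B(3)] by blast
  have "B * ((intensity / B)\<^sup>2 * (1 + intensity / B) ^ (B - 1)) = intensity\<^sup>2 / B * (1 + intensity / B) ^ (B - 1)"
    using B(3) by (simp add: power2_eq_square)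
  also have "\<dots> \<le> intensity\<^sup>2 / B * exp intensity"
  proof (rule mult_left_mono)
    have "(1 + intensity / B) ^ (B - 1) \<le> (1 + intensity / B) ^ B" using intensity_nonneg by (intro power_increasing) auto
    also have "\<dots> \<le> exp (intensity / B) ^ B" using intensity_nonneg by (intro power_mono exp_ge_add_one_self) auto
    also have "\<dots> = exp intensity" using B(3) by (simp add: exp_of_nat_mult[symmetric])
    finally show "(1 + intensity / B) ^ (B - 1) \<le> exp intensity" .
  qed simp
  also have "\<dots> < \<epsilon> / 4" using B(1) by simp
  finally have f1: "\<forall>\<^sub>F n in sequentially. E n < \<epsilon> / 4" by (rule order_tendstoD(2)[OF E(1)])
  have f2: "\<forall>\<^sub>F n in sequentially. dist (\<integral>t. (\<Prod>b<B. 1 - block_count B n (d n) b t) \<partial>weyl n) ((1 - intensity / B) ^ B) < \<epsilon> / 4"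
    by (rule tendstoD[OF one_minus_count_prod(1)[OF B(3)]]) (use \<epsilon> in simp)
  have f3: "\<forall>\<^sub>F n in sequentially. dist (gap_prob n - (\<integral>t. blocks_empty B n t \<partial>weyl n)) 0 < \<epsilon> / 4"
    by (rule tendstoD[OF gap_prob_blocks[OF B(3)]]) (use \<epsilon> in simp)
  have "\<forall>\<^sub>F n in sequentially. norm (gap_prob n - exp (- intensity)) < \<epsilon>"
    using f1 f2 f3
  proof eventually_elim
    case (elim n)
    have "\<bar>(1 - intensity / B) ^ B - exp (- intensity)\<bar> < \<epsilon> / 4" using B(2) by (simp add: dist_real_def)
    then show ?case using elim E(2)[of n] unfolding dist_real_def real_norm_def diff_0_right by linarith
  qed
  then show "\<exists>no. \<forall>n\<ge>no. norm (gap_prob n - exp (- intensity)) < \<epsilon>" by (simp add: eventually_sequentially)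
qed

end

theorem mainTheorem2:
  fixes \<mu> :: "nat \<Rightarrow> complex mat measure" and \<beta> :: real
  assumes CUE: "\<And>n. n \<ge> 1 \<Longrightarrow>
      normalized_haar_measure (unitary_group n) (unitary_topology n) (\<mu> n)"
    and "\<beta> > 0"
  shows "(\<lambda>n. measure (\<mu> n)
            {A \<in> space (\<mu> n).
               closest_spacing A * (real n ^ 4 / (72 * pi)) powr (1 / 3) > \<beta>})
         \<longlonglongrightarrow> exp (- (\<beta> ^ 3))"
proof -
  define c where "c n = (real n ^ 4 / (72 * pi)) powr (1 / 3)" for n
  \<comment> \<open>The threshold for the unscaled spacing.\<close>
  define d where "d n = \<beta> / c n" for n
  have c: "c n > 0" "c n ^ 3 = real n ^ 4 / (72 * pi)" if "n \<ge> 1" for n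
  proof -
    have pos: "real n ^ 4 / (72 * pi) > 0" using that by simp
    show "c n > 0" using that by (simp add: c_def)
    have "c n ^ 3 = c n powr 3" using \<open>c n > 0\<close> by (simp add: powr_numeral)
    also have "\<dots> = real n ^ 4 / (72 * pi)" unfolding c_def powr_powr using pos by simp
    finally show "c n ^ 3 = real n ^ 4 / (72 * pi)" .
  qed
  have d_pos: "d n > 0" if "n \<ge> 1" for n using c(1)[OF that] \<open>\<beta> > 0\<close> by (simp add: d_def)
  have d_scale: "real n ^ 4 * d n ^ 3 = 72 * pi * \<beta> ^ 3" if "n \<ge> 1" for n
    unfolding d_def power_divide c(2)[OF that] using that by simp
  have d_small: "(\<lambda>n. real n * d n) \<longlonglongrightarrow> 0"
  proof -
    \<comment> \<open>The cube of n d n is (n^4 d^3) / n = 72 pi \<beta>^3 / n.\<close>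
    have "(\<lambda>n. root 3 (72 * pi * \<beta> ^ 3 / real n)) \<longlonglongrightarrow> root 3 0"
      by (intro tendsto_real_root lim_const_over_n)
    moreover have "\<forall>\<^sub>F n in sequentially. root 3 (72 * pi * \<beta> ^ 3 / real n) = real n * d n"
      using eventually_ge_at_top[of 1]
    proof eventually_elim
      case (elim n)
      have "72 * pi * \<beta> ^ 3 / real n = (real n * d n) ^ 3"
        unfolding d_scale[OF elim, symmetric] using elim by (simp add: power_mult_distrib power4_eq_xxxx power3_eq_cube)
      moreover have "root 3 ((real n * d n) ^ 3) = real n * d n" by (rule odd_real_root_power_cancel) simp
      ultimately show ?case by (simp only:)
    qed
    ultimately have "(\<lambda>n. real n * d n) \<longlonglongrightarrow> root 3 0" by (rule Lim_transform_eventually)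
    then show ?thesis by simp
  qed
  interpret gap_scale d "72 * pi * \<beta> ^ 3"
    by unfold_locales (fact d_pos, fact d_scale, fact d_small)
  have "intensity = \<beta> ^ 3" by (simp add: intensity_def)
  then have "gap_prob \<longlonglongrightarrow> exp (- (\<beta> ^ 3))" using gap_prob_tendsto by simp
  moreover have "\<forall>\<^sub>F n in sequentially. gap_prob n = measure (\<mu> n)
      {A \<in> space (\<mu> n). closest_spacing A * (real n ^ 4 / (72 * pi)) powr (1 / 3) > \<beta>}"
    \<comment> \<open>\<open>closest_spacing\<close> has a meaning only from order 2 on; the
      finitely many smaller orders do not affect the limit.\<close>
    using eventually_ge_at_top[of 2]
  proof eventually_elim
    case (elim n)
    have n1: "n \<ge> 1" using elim by simp
    have H: "haar_unitary n (\<mu> n)" unfolding haar_unitary_def by (rule CUE[OF n1])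
    have "closest_spacing A * c n > \<beta> \<longleftrightarrow> gap_exceeds n (d n) (\<lambda>i. eigenangles A ! i)" if "A \<in> space (\<mu> n)" for A
    proof -
      have "unitary_mat n A" using that haar_space[OF H] by simp
      from closest_spacing_gap[OF this elim, of "d n"] show ?thesis
        using c(1)[OF n1] by (simp add: d_def pos_divide_less_eq)
    qed
    then have "{A \<in> space (\<mu> n). closest_spacing A * c n > \<beta>} = {A \<in> space (\<mu> n). gap_exceeds n (d n) (\<lambda>i. eigenangles A ! i)}" by blast
    then show ?case
      unfolding c_def[symmetric] gap_prob_def using haar_weyl_gap(1)[OF H, of "d n"] d_pos[OF n1] by simp
  qed
  ultimately show ?thesis by (rule Lim_transform_eventually)
qed

end
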